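(* Let $G$ be a finitely generated inaccessible group. Then $G$ contains an infinite locally finite subgroup.
   Context: For a $G$–tree $T$, an edge $e$ is compressible if $G_e=G_{\iota e}$ and the endpoints $\iota e,\tau e$ lie in different $G$–orbits; $T$ is reduced if it has no compressible edges. A finitely generated group $G$ is inaccessible if there is a sequence $T_1,T_2,\dots$ of reduced simplicial $G$–trees, each with finitely many orbits of edges and all edge stabilizers finite, such that for each $n$ there is a surjective $G$–map $T_n\to T_{n-1}$ obtained by contracting finitely many $G$–orbits of edges, and the number of $G$–orbits of vertices of $T_n$ tends to infinity. A group is locally finite if every finitely generated subgroup is finite. *)

theory Defs
  imports "HOL-Algebra.Group_Action" "HOL-Algebra.Generated_Groups"
begin

record ('v, 'e) sgraph =
  gverts :: "'v set"
  garcs  :: "'e set"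
  gsrc   :: "'e \<Rightarrow> 'v"
  gtgt   :: "'e \<Rightarrow> 'v"
  gbar   :: "'e \<Rightarrow> 'e"

definition serre_graph :: "('v, 'e) sgraph \<Rightarrow> bool" where
  "serre_graph T \<longleftrightarrow>
     (\<forall>e \<in> garcs T. gsrc T e \<in> gverts T \<and> gtgt T e \<in> gverts T \<and>
        gbar T e \<in> garcs T \<and> gbar T e \<noteq> e \<and> gbar T (gbar T e) = e \<and>
        gsrc T (gbar T e) = gtgt T e)"

fun gpath :: "('v, 'e) sgraph \<Rightarrow> 'v \<Rightarrow> 'e list \<Rightarrow> 'v \<Rightarrow> bool" where
  "gpath T u [] v = (u = v \<and> u \<in> gverts T)"
| "gpath T u (e # es) v = (e \<in> garcs T \<and> gsrc T e = u \<and> gpath T (gtgt T e) es v)"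

fun reduced_path :: "('v, 'e) sgraph \<Rightarrow> 'e list \<Rightarrow> bool" where
  "reduced_path T (e1 # e2 # es) = (e2 \<noteq> gbar T e1 \<and> reduced_path T (e2 # es))"
| "reduced_path T _ = True"

definition is_tree :: "('v, 'e) sgraph \<Rightarrow> bool" where
  "is_tree T \<longleftrightarrow> serre_graph T \<and> gverts T \<noteq> {} \<and>
     (\<forall>u \<in> gverts T. \<forall>v \<in> gverts T. \<exists>!es. gpath T u es v \<and> reduced_path T es)"

definition G_tree ::
  "('g, 'm) monoid_scheme \<Rightarrow> ('v, 'e) sgraph \<Rightarrow> ('g \<Rightarrow> 'v \<Rightarrow> 'v) \<Rightarrow> ('g \<Rightarrow> 'e \<Rightarrow> 'e) \<Rightarrow> bool"
  where
  "G_tree G T av ae \<longleftrightarrow> is_tree T \<and>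
     group_action G (gverts T) av \<and> group_action G (garcs T) ae \<and>
     (\<forall>g \<in> carrier G. \<forall>e \<in> garcs T.
        gsrc T (ae g e) = av g (gsrc T e) \<and> gtgt T (ae g e) = av g (gtgt T e) \<and>
        gbar T (ae g e) = ae g (gbar T e) \<and> ae g e \<noteq> gbar T e)"

definition compressible ::
  "('g, 'm) monoid_scheme \<Rightarrow> ('v, 'e) sgraph \<Rightarrow> ('g \<Rightarrow> 'v \<Rightarrow> 'v) \<Rightarrow> ('g \<Rightarrow> 'e \<Rightarrow> 'e) \<Rightarrow> 'e \<Rightarrow> bool"
  where
  "compressible G T av ae e \<longleftrightarrow>
     stabilizer G ae e = stabilizer G av (gsrc T e) \<and>
     orbit G av (gsrc T e) \<noteq> orbit G av (gtgt T e)"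

definition reduced_tree ::
  "('g, 'm) monoid_scheme \<Rightarrow> ('v, 'e) sgraph \<Rightarrow> ('g \<Rightarrow> 'v \<Rightarrow> 'v) \<Rightarrow> ('g \<Rightarrow> 'e \<Rightarrow> 'e) \<Rightarrow> bool"
  where
  "reduced_tree G T av ae \<longleftrightarrow> (\<forall>e \<in> garcs T. \<not> compressible G T av ae e)"

definition C_connected :: "('v, 'e) sgraph \<Rightarrow> 'e set \<Rightarrow> 'v \<Rightarrow> 'v \<Rightarrow> bool" where
  "C_connected T C u v \<longleftrightarrow> (\<exists>es. gpath T u es v \<and> set es \<subseteq> C)"

definition contraction_map ::
  "('g, 'm) monoid_scheme \<Rightarrow> ('v, 'e) sgraph \<Rightarrow> ('g \<Rightarrow> 'v \<Rightarrow> 'v) \<Rightarrow> ('g \<Rightarrow> 'e \<Rightarrow> 'e) \<Rightarrow>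
   ('w, 'f) sgraph \<Rightarrow> ('g \<Rightarrow> 'w \<Rightarrow> 'w) \<Rightarrow> ('g \<Rightarrow> 'f \<Rightarrow> 'f) \<Rightarrow>
   ('v \<Rightarrow> 'w) \<Rightarrow> ('e \<Rightarrow> 'f) \<Rightarrow> 'e set \<Rightarrow> bool"
  where
  "contraction_map G T av ae T' av' ae' f fe C \<longleftrightarrow>
     C \<subseteq> garcs T \<and> (\<forall>e \<in> C. gbar T e \<in> C) \<and>
     (\<forall>g \<in> carrier G. \<forall>e \<in> C. ae g e \<in> C) \<and>
     finite (orbits G C ae) \<and>
     f ` gverts T = gverts T' \<and>
     (\<forall>g \<in> carrier G. \<forall>v \<in> gverts T. f (av g v) = av' g (f v)) \<and>
     (\<forall>u \<in> gverts T. \<forall>v \<in> gverts T. f u = f v \<longleftrightarrow> C_connected T C u v) \<and>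
     bij_betw fe (garcs T - C) (garcs T') \<and>
     (\<forall>e \<in> garcs T - C. gsrc T' (fe e) = f (gsrc T e) \<and> gtgt T' (fe e) = f (gtgt T e) \<and>
        gbar T' (fe e) = fe (gbar T e)) \<and>
     (\<forall>g \<in> carrier G. \<forall>e \<in> garcs T - C. fe (ae g e) = ae' g (fe e))"

definition inaccessible_sequence ::
  "('g, 'm) monoid_scheme \<Rightarrow> (nat \<Rightarrow> ('v, 'e) sgraph) \<Rightarrow> (nat \<Rightarrow> 'g \<Rightarrow> 'v \<Rightarrow> 'v) \<Rightarrow>
   (nat \<Rightarrow> 'g \<Rightarrow> 'e \<Rightarrow> 'e) \<Rightarrow> bool"
  where
  "inaccessible_sequence G T av ae \<longleftrightarrow>
     (\<forall>n. G_tree G (T n) (av n) (ae n) \<and> reduced_tree G (T n) (av n) (ae n) \<and>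
          finite (orbits G (garcs (T n)) (ae n)) \<and>
          (\<forall>e \<in> garcs (T n). finite (stabilizer G (ae n) e))) \<and>
     (\<forall>n. \<exists>f fe C. contraction_map G (T (Suc n)) (av (Suc n)) (ae (Suc n))
                                     (T n) (av n) (ae n) f fe C) \<and>
     filterlim (\<lambda>n. card (orbits G (gverts (T n)) (av n))) at_top sequentially"

definition finitely_generated_group :: "('g, 'm) monoid_scheme \<Rightarrow> bool" where
  "finitely_generated_group G \<longleftrightarrow>
     (\<exists>S. finite S \<and> S \<subseteq> carrier G \<and> generate G S = carrier G)"

definition locally_finite_subgroup :: "'g set \<Rightarrow> ('g, 'm) monoid_scheme \<Rightarrow> bool" where
  "locally_finite_subgroup H G \<longleftrightarrow> subgroup H G \<and>
     (\<forall>S. finite S \<and> S \<subseteq> H \<longrightarrow> finite (generate G S))"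

end

theory Submission
  imports Defs "HOL-Library.Multiset" "HOL-Library.Countable_Set"
begin

text \<open>
  If every increasing chain of finite subgroups is finite, then multisets of conjugacy classes of finite
  subgroups, with larger subgroups counted as smaller, are well-founded. Over the limit of the
  sequence of trees consider \<open>G\<close>-graphs with an equivariant parent map sending each vertex to itself
  or a neighbour, and choose one whose multiset of stabilisers of edges \<open>x y\<close> with \<open>p x \<noteq> y\<close> and
  \<open>p y \<noteq> x\<close> is minimal. Folding does not increase this multiset, so its size \<open>\<mu>\<close> survives subdividing
  the graph (at finitely many points per edge, by a Kneser type argument) and folding it until it crosses
  each edge of the \<open>n\<close>-th tree once. Reducedness then gives at most \<open>2 \<mu> + 1\<close> orbits of vertices, for all \<open>n\<close>.
\<close>

text \<open>A bound valid for all \<open>n\<close> calls for one object over the whole sequence: the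
  minimal multiset is chosen once, over the limit, and each level then gets a graph with that same
  multiset, since subdividing and folding never enlarge it and minimality forbids shrinking.
  Vertices may have infinite stabilisers, but every edge involves two distinct limit points, and
  these are fixed by finitely many elements only; hence the labels are stabilisers of edges. Finite
  generation provides a connected graph with finitely many orbits of edges to begin with. The parent
  map plays the part of compressible edges: an edge from a vertex to its parent costs nothing.
  Identifying two vertices with different parents gives up at least one parent edge, which may turn
  into a flag. The fold has to pay for it with a flag that it destroys and whose stabiliser is not
  larger; one old flag may pay for two new ones only if both labels drop strictly. In the final
  count, \<open>2 \<mu> + 1\<close> splits into \<mu> for the vertex classes at which a flag starts
  and \<mu> + 1 for classes of vertices with a common ancestor, since the flags connect these
  classes like the edges of a connected graph.\<close>

section \<open>Half-trees\<close>

text \<open>A vertex is encoded by the set of arcs pointing towards it.\<close>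

definition tow :: "('v, 'e) sgraph \<Rightarrow> 'v \<Rightarrow> 'e set" where
  "tow T v = {e \<in> garcs T. \<exists>es. gpath T (gsrc T e) (e # es) v \<and> reduced_path T (e # es)}"

lemma serreD:
  assumes "serre_graph T" "e \<in> garcs T"
  shows "gsrc T e \<in> gverts T" "gtgt T e \<in> gverts T" "gbar T e \<in> garcs T" "gbar T e \<noteq> e"
    "gbar T (gbar T e) = e" "gsrc T (gbar T e) = gtgt T e" "gtgt T (gbar T e) = gsrc T e"
proof -
  note a = assms(1)[unfolded serre_graph_def, rule_format, OF assms(2)]
  show "gsrc T e \<in> gverts T" "gtgt T e \<in> gverts T" "gbar T e \<in> garcs T" "gbar T e \<noteq> e"
    "gbar T (gbar T e) = e" "gsrc T (gbar T e) = gtgt T e" using a by auto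
  have "gsrc T (gbar T (gbar T e)) = gtgt T (gbar T e)"
    using assms(1) a unfolding serre_graph_def by blast
  then show "gtgt T (gbar T e) = gsrc T e" using a by simp
qed

lemma gpath_append:
  assumes "serre_graph T"
  shows "gpath T u (xs @ ys) w \<longleftrightarrow> (\<exists>v. gpath T u xs v \<and> gpath T v ys w)"
proof (induction xs arbitrary: u)
  case Nil
  have "u \<in> gverts T" if "gpath T u ys w"
    using that serreD[OF assms] by (cases ys) auto
  then show ?case by auto
next
  case (Cons a xs)
  then show ?case by auto
qed

lemma gpath_verts:
  assumes "serre_graph T" "gpath T u es v"
  shows "u \<in> gverts T" "v \<in> gverts T" "set es \<subseteq> garcs T"
proof -
  have "u \<in> gverts T \<and> v \<in> gverts T \<and> set es \<subseteq> garcs T" using assms(2)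
  proof (induction es arbitrary: u)
    case (Cons a es)
    then show ?case using serreD[OF assms(1)] by fastforce
  qed auto
  then show "u \<in> gverts T" "v \<in> gverts T" "set es \<subseteq> garcs T" by auto
qed

lemma reduced_path_Cons:
  "reduced_path T (e # es) \<longleftrightarrow> (es = [] \<or> hd es \<noteq> gbar T e \<and> reduced_path T es)"
  by (cases es) auto

lemma reduced_path_append:
  "reduced_path T (xs @ e # ys) \<longleftrightarrow> reduced_path T (xs @ [e]) \<and> reduced_path T (e # ys)"
proof (induction xs)
  case (Cons a xs)
  then show ?case
    by (cases xs) (auto simp: reduced_path_Cons)
qed auto

lemma reduced_path_suffix: "reduced_path T (xs @ ys) \<Longrightarrow> reduced_path T ys"
  by (induction xs) (auto simp: reduced_path_Cons)

definition grev :: "('v, 'e) sgraph \<Rightarrow> 'e list \<Rightarrow> 'e list" where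
  "grev T es = rev (map (gbar T) es)"

lemma grev_simps [simp]:
  "grev T [] = []" "grev T (e # es) = grev T es @ [gbar T e]"
  by (auto simp: grev_def)

lemma gpath_grev:
  assumes "serre_graph T" "gpath T u es v"
  shows "gpath T v (grev T es) u"
  using assms(2)
proof (induction es arbitrary: u)
  case (Cons a es)
  then show ?case using serreD[OF assms(1)] by (auto simp: gpath_append[OF assms(1)])
qed auto

lemma reduced_grev:
  assumes "serre_graph T" "set es \<subseteq> garcs T" "reduced_path T es"
  shows "reduced_path T (grev T es)"
  using assms(2,3)
proof (induction es)
  case (Cons a es)
  show ?case
  proof (cases es)
    case (Cons b bs)
    have r: "reduced_path T (grev T es)" using Cons.IH Cons.prems by (auto simp: reduced_path_Cons)
    have e: "grev T (a # es) = grev T bs @ gbar T b # [gbar T a]" using Cons by simp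
    have "gbar T (gbar T b) \<noteq> gbar T a"
      using Cons.prems Cons serreD[OF assms(1)] by auto
    then show ?thesis unfolding e reduced_path_append[of T "grev T bs" "gbar T b" "[gbar T a]"] using r Cons by auto
  qed auto
qed auto

locale gtree =
  fixes T :: "('v, 'e) sgraph"
  assumes tree: "is_tree T"
begin

lemma sg: "serre_graph T" using tree by (simp add: is_tree_def)

lemmas sgD = serreD[OF sg]
lemmas path_app = gpath_append[OF sg]

lemma path_unique:
  assumes "gpath T u es v" "reduced_path T es" "gpath T u fs v" "reduced_path T fs"
  shows "es = fs"
  using assms tree gpath_verts[OF sg assms(1)] unfolding is_tree_def by blast

lemma path_exists:
  assumes "u \<in> gverts T" "v \<in> gverts T"
  obtains es where "gpath T u es v" "reduced_path T es"
  using assms tree unfolding is_tree_def by blast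

lemma tow_sub: "tow T v \<subseteq> garcs T" by (auto simp: tow_def)

lemma tow_tgt: "e \<in> garcs T \<Longrightarrow> e \<in> tow T (gtgt T e)"
  using sgD[of e] by (auto simp: tow_def intro!: exI[of _ "[]"])

text \<open>The reduced path from the source of \<open>e\<close> to \<open>v\<close> either begins
  with \<open>e\<close>, or stays reduced when \<open>gbar T e\<close> is put in front of it.
  Uniqueness of reduced paths excludes both at once.\<close>

lemma tow_bar:
  assumes "e \<in> garcs T" "v \<in> gverts T"
  shows "gbar T e \<in> tow T v \<longleftrightarrow> e \<notin> tow T v"
proof
  assume "e \<notin> tow T v"
  obtain es where es: "gpath T (gsrc T e) es v" "reduced_path T es"
    using path_exists sgD(1)[OF assms(1)] assms(2) by blast
  have "es = [] \<or> hd es \<noteq> e"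
    using \<open>e \<notin> tow T v\<close> assms es by (cases es) (auto simp: tow_def)
  then have "reduced_path T (gbar T e # es)" using es sgD[OF assms(1)] by (auto simp: reduced_path_Cons)
  moreover have "gpath T (gsrc T (gbar T e)) (gbar T e # es) v" using es sgD[OF assms(1)] by auto
  ultimately show "gbar T e \<in> tow T v" using sgD[OF assms(1)] unfolding tow_def by blast
next
  assume "gbar T e \<in> tow T v"
  then obtain fs where fs: "gpath T (gtgt T e) (gbar T e # fs) v" "reduced_path T (gbar T e # fs)"
    using sgD[OF assms(1)] by (auto simp: tow_def)
  show "e \<notin> tow T v"
  proof
    assume "e \<in> tow T v"
    then obtain es where es: "gpath T (gsrc T e) (e # es) v" "reduced_path T (e # es)"
      by (auto simp: tow_def)
    then have "gpath T (gtgt T e) es v" "reduced_path T es" by (auto simp: reduced_path_Cons split: list.splits)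
    then have "es = gbar T e # fs" using path_unique fs by blast
    then show False using es by (simp add: reduced_path_Cons)
  qed
qed

text \<open>A reduced path from \<open>f\<close> to the head of \<open>e\<close> can be shortened by
  \<open>e\<close> if it ends with \<open>e\<close>, and otherwise extended by
  \<open>gbar T e\<close>. Both results are reduced and end at the source of
  \<open>e\<close>.\<close>

lemma tow_adj_half:
  assumes "e \<in> garcs T" "f \<in> garcs T" "f \<noteq> e" "f \<in> tow T (gtgt T e)"
  shows "f \<in> tow T (gsrc T e)"
proof -
  obtain fs where fs: "gpath T (gsrc T f) (f # fs) (gtgt T e)" "reduced_path T (f # fs)"
    using assms by (auto simp: tow_def)
  show ?thesis
  proof (cases "last (f # fs) = e")
    case True
    then have "fs \<noteq> []" using assms by auto
    then have e: "fs = butlast fs @ [e]" using True append_butlast_last_id[of fs] by auto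
    then have "gpath T (gsrc T f) ((f # butlast fs) @ [e]) (gtgt T e)" using fs by simp
    then have "gpath T (gsrc T f) (f # butlast fs) (gsrc T e)"
      unfolding path_app by auto
    moreover have "reduced_path T (f # butlast fs)"
    proof (cases "butlast fs = []")
      case False
      then obtain ys g where "butlast fs = ys @ [g]" by (metis append_butlast_last_id)
      then have "f # fs = (f # ys) @ g # [e]" using e by simp
      then show ?thesis using fs(2) reduced_path_append[of T "f # ys" g "[e]"] \<open>butlast fs = ys @ [g]\<close> by simp
    qed auto
    ultimately show ?thesis using assms by (auto simp: tow_def)
  next
    case False
    have l: "f # fs = butlast (f # fs) @ [last (f # fs)]" by simp
    have "last (f # fs) \<in> garcs T" using gpath_verts(3)[OF sg fs(1)] last_in_set[of "f # fs"] by blast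
    then have "gbar T e \<noteq> gbar T (last (f # fs))" using False sgD assms by metis
    then have "reduced_path T (butlast (f # fs) @ last (f # fs) # [gbar T e])"
      using reduced_path_append[of T "butlast (f # fs)" "last (f # fs)" "[gbar T e]"] fs(2) l by auto
    then have "reduced_path T (f # fs @ [gbar T e])"
      using l by (metis append_Cons append_Nil append_assoc)
    moreover have "gpath T (gsrc T f) (f # fs @ [gbar T e]) (gsrc T e)"
      using fs(1) path_app[of "gtgt T f" fs "[gbar T e]" "gsrc T e"] sgD[OF assms(1)] by auto
    ultimately show ?thesis using assms by (auto simp: tow_def)
  qed
qed

lemma tow_adj:
  assumes "e \<in> garcs T" "f \<in> garcs T" "f \<noteq> e" "f \<noteq> gbar T e"
  shows "f \<in> tow T (gtgt T e) \<longleftrightarrow> f \<in> tow T (gsrc T e)"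
  using tow_adj_half[OF assms(1-3)] tow_adj_half[of "gbar T e" f] assms sgD[OF assms(1)] by auto

lemma tow_src: "e \<in> garcs T \<Longrightarrow> gbar T e \<in> tow T (gsrc T e)"
  using tow_tgt[of "gbar T e"] sgD[of e] by simp

lemma tow_tgt_eq:
  assumes "e \<in> garcs T"
  shows "tow T (gtgt T e) - tow T (gsrc T e) = {e}"
proof -
  have "e \<notin> tow T (gsrc T e)" using tow_src[OF assms] tow_bar[OF assms] sgD[OF assms] by blast
  moreover have "gbar T e \<notin> tow T (gtgt T e)" using tow_tgt[OF assms] tow_bar[OF assms] sgD[OF assms] by blast
  ultimately show ?thesis using tow_tgt[OF assms] tow_adj[OF assms] tow_sub by fastforce
qed

lemma path_induct [consumes 2, case_names base step]:
  assumes "u \<in> gverts T" "v \<in> gverts T" "P u"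
    and step: "\<And>e. e \<in> garcs T \<Longrightarrow> P (gsrc T e) \<Longrightarrow> P (gtgt T e)"
  shows "P v"
proof -
  obtain es where "gpath T u es v" using path_exists assms by blast
  then show ?thesis using assms(3)
  proof (induction es arbitrary: u)
    case (Cons a es)
    then show ?case using step[of a] by auto
  qed auto
qed

lemma tow_diff_finite:
  assumes "u \<in> gverts T" "v \<in> gverts T"
  shows "finite (tow T v - tow T u)"
  using assms
proof (induction rule: path_induct)
  case (step e)
  have "tow T (gtgt T e) - tow T u \<subseteq> insert e (tow T (gsrc T e) - tow T u)"
    using tow_tgt_eq[OF step(1)] by blast
  then show ?case using step finite_subset by blast
qed auto

lemma tow_inj:
  assumes "u \<in> gverts T" "v \<in> gverts T" "tow T u = tow T v"
  shows "u = v"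
proof (rule ccontr)
  assume "u \<noteq> v"
  obtain es where es: "gpath T u es v" "reduced_path T es" using path_exists assms by blast
  then obtain e fs where e: "es = e # fs" using \<open>u \<noteq> v\<close> by (cases es) auto
  then have "e \<in> tow T v" "e \<in> garcs T" "gsrc T e = u" using es by (auto simp: tow_def)
  then show False using tow_src[of e] tow_bar[of e u] assms by auto
qed

text \<open>The reduced path to \<open>u\<close> starts with \<open>gbar T e\<close>, the one to
  \<open>v\<close> with \<open>e\<close>. Reversing the first and overlapping the two in
  \<open>e\<close> gives the reduced path from \<open>u\<close> to \<open>v\<close>.\<close>

lemma path_split:
  assumes "e \<in> garcs T" "u \<in> gverts T" "v \<in> gverts T" "e \<in> tow T v" "e \<notin> tow T u"
    and p: "gpath T u p v" "reduced_path T p"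
  shows "e \<in> set p"
proof -
  have "gbar T e \<in> tow T u" using tow_bar assms by blast
  then obtain fs where fs: "gpath T (gtgt T e) (gbar T e # fs) u" "reduced_path T (gbar T e # fs)"
    using sgD[OF assms(1)] by (auto simp: tow_def)
  obtain es where es: "gpath T (gsrc T e) (e # es) v" "reduced_path T (e # es)"
    using assms by (auto simp: tow_def)
  have 1: "gpath T u (grev T fs @ [e]) (gtgt T e)"
    using gpath_grev[OF sg fs(1)] sgD[OF assms(1)] by simp
  have 2: "reduced_path T (grev T fs @ [e])"
    using reduced_grev[OF sg gpath_verts(3)[OF sg fs(1)] fs(2)] sgD[OF assms(1)] by simp
  have "gpath T (gtgt T e) es v" using es by simp
  then have "gpath T u ((grev T fs @ [e]) @ es) v"
    unfolding path_app[of u "grev T fs @ [e]" es v] using 1 by blast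
  then have "gpath T u (grev T fs @ e # es) v" by simp
  moreover have "reduced_path T (grev T fs @ e # es)" using reduced_path_append[of T "grev T fs" e es] 2 es by auto
  ultimately have "p = grev T fs @ e # es" using path_unique p by blast
  then show ?thesis by simp
qed

text \<open>Half-trees shrink along a reduced path: the part behind \<open>f\<close> can be replaced
  by the reduced path from \<open>f\<close> to \<open>c\<close> without creating a
  backtrack.\<close>

lemma tow_order:
  assumes p: "gpath T u (p1 @ e # p2) v" "reduced_path T (p1 @ e # p2)" and f: "f \<in> set p2"
    and c: "f \<in> tow T c"
  shows "e \<in> tow T c"
proof -
  obtain q1 q2 where q: "p2 = q1 @ f # q2" using f by (auto simp: in_set_conv_decomp)
  obtain fs where fs: "gpath T (gsrc T f) (f # fs) c" "reduced_path T (f # fs)"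
    using c by (auto simp: tow_def)
  obtain x where x: "gpath T u p1 x" "gpath T x ((e # q1) @ f # q2) v"
    using p(1) path_app[of u p1 "e # p2" v] q by auto
  then have "gpath T x ((e # q1) @ [f]) (gtgt T f)"
    unfolding path_app[of x "e # q1"] using sgD by auto
  then have "gpath T x (((e # q1) @ [f]) @ fs) c" unfolding path_app[of _ "(e # q1) @ [f]"] using fs by auto
  moreover have "reduced_path T ((e # q1) @ f # fs)"
  proof -
    have "reduced_path T ((e # q1) @ f # q2)" using p(2) q reduced_path_suffix[of T p1] by simp
    then show ?thesis
      using reduced_path_append[of T "e # q1" f q2] reduced_path_append[of T "e # q1" f fs] fs by auto
  qed
  moreover have "gsrc T e = x" "e \<in> garcs T" using x(2) by auto
  ultimately show ?thesis by (auto simp: tow_def)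
qed

text \<open>Both arcs lie on the reduced path from \<open>a\<close> to \<open>d\<close>, and the
  half-tree of the later one is contained in that of the earlier one. So one of the two mixed
  quadrants, that of \<open>b\<close> or that of \<open>c\<close>, is empty.\<close>

lemma tow_nested:
  assumes "e \<in> garcs T" "f \<in> garcs T" "a \<in> gverts T" "d \<in> gverts T"
    and "e \<notin> tow T a" "f \<notin> tow T a" "e \<in> tow T d" "f \<in> tow T d"
    and "e \<in> tow T b" "f \<notin> tow T b" "e \<notin> tow T c" "f \<in> tow T c"
  shows False
proof -
  obtain p where p: "gpath T a p d" "reduced_path T p" using path_exists assms by blast
  have "e \<in> set p" "f \<in> set p" using path_split p assms by blast+
  then obtain p1 p2 where s: "p = p1 @ e # p2" by (auto simp: in_set_conv_decomp)
  consider "f \<in> set p1" | "f \<in> set p2" | "e = f" using \<open>f \<in> set p\<close> s by auto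
  then show False
  proof cases
    case 1
    then obtain q1 q2 where "p1 = q1 @ f # q2" by (auto simp: in_set_conv_decomp)
    then have "p = q1 @ f # (q2 @ e # p2)" using s by simp
    then show False using tow_order[of a q1 f "q2 @ e # p2" d e b] p assms by auto
  next
    case 2
    then show False using tow_order[of a p1 e p2 d f c] p assms s by auto
  qed (use assms in auto)
qed

text \<open>The majority of three vertices is the branch point of the tripod that they span. The
  induction walks from \<open>u\<close> towards \<open>v\<close> as long as this leads towards
  \<open>w\<close> as well.\<close>

lemma tow_maj:
  assumes "u \<in> gverts T" "v \<in> gverts T" "w \<in> gverts T"
  shows "\<exists>m \<in> gverts T. tow T m = (tow T u \<inter> tow T v) \<union> (tow T u \<inter> tow T w) \<union> (tow T v \<inter> tow T w)"
proof -
  obtain es where "gpath T u es v" "reduced_path T es" using path_exists assms by blast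
  then show ?thesis using assms(1)
  proof (induction es arbitrary: u)
    case Nil
    then show ?case by auto
  next
    case (Cons e es)
    have e: "e \<in> garcs T" "gsrc T e = u" "e \<in> tow T v" using Cons.prems by (auto simp: tow_def)
    have eu: "e \<notin> tow T u" "gbar T e \<in> tow T u" using tow_src e tow_bar Cons.prems by auto
    obtain m where m: "m \<in> gverts T" "tow T m = (tow T (gtgt T e) \<inter> tow T v) \<union> (tow T (gtgt T e) \<inter> tow T w) \<union> (tow T v \<inter> tow T w)"
    proof -
      have "gpath T (gtgt T e) es v" "reduced_path T es" using Cons.prems by (auto simp: reduced_path_Cons)
      then show ?thesis using Cons.IH[of "gtgt T e"] sgD(2)[OF e(1)] that by blast
    qed
    have adj: "f \<in> tow T (gtgt T e) \<longleftrightarrow> f \<in> tow T u" if "f \<noteq> e" "f \<noteq> gbar T e" for f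
      using tow_adj[OF e(1), of f] that e tow_sub by blast
    have bar: "gbar T f \<in> tow T x \<longleftrightarrow> f \<notin> tow T x" if "f \<in> garcs T" "x \<in> gverts T" for f x
      using tow_bar that by blast
    show ?case
    proof (cases "e \<in> tow T w")
      case True
      have "gbar T e \<notin> tow T v" "gbar T e \<notin> tow T w" using bar e True assms by auto
      then have "f \<in> tow T m \<longleftrightarrow> f \<in> (tow T u \<inter> tow T v) \<union> (tow T u \<inter> tow T w) \<union> (tow T v \<inter> tow T w)" for f
        using adj[of f] e True unfolding m(2) by (cases "f = e \<or> f = gbar T e") auto
      then have "tow T m = (tow T u \<inter> tow T v) \<union> (tow T u \<inter> tow T w) \<union> (tow T v \<inter> tow T w)"
        by blast
      then show ?thesis using m by blast
    next
      case False
      \<comment> \<open>The paths to \<open>v\<close> and \<open>w\<close> part at \<open>u\<close>,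
        so the median is \<open>u\<close> itself: an arc towards both but not towards
        \<open>u\<close> would cross \<open>e\<close>.\<close>
      have no: "f \<in> tow T u" if f: "f \<in> tow T v" "f \<in> tow T w" for f
      proof (rule ccontr)
        assume "f \<notin> tow T u"
        have "f \<in> garcs T" using f tow_sub by blast
        have "f \<noteq> e" "f \<noteq> gbar T e" using f False e \<open>f \<notin> tow T u\<close> bar[of e v] assms by auto
        then have "f \<notin> tow T (gtgt T e)" using adj \<open>f \<notin> tow T u\<close> by blast
        then show False
          using tow_nested[of e f u v "gtgt T e" w] e \<open>f \<in> garcs T\<close> Cons.prems assms eu \<open>f \<notin> tow T u\<close> f False tow_tgt[of e]
          by blast
      qed
      have "f \<in> tow T v \<or> f \<in> tow T w" if f: "f \<in> tow T u" for f
      proof (rule ccontr)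
        assume "\<not> (f \<in> tow T v \<or> f \<in> tow T w)"
        moreover have "f \<in> garcs T" using f tow_sub by blast
        ultimately have "gbar T f \<in> tow T u" using no[of "gbar T f"] bar assms by blast
        then show False using bar f \<open>f \<in> garcs T\<close> Cons.prems by blast
      qed
      then show ?thesis using no Cons.prems by blast
    qed
  qed
qed

end

section \<open>Protrees\<close>

text \<open>The inverse limit of the trees: \<open>E\<close> holds the arcs of all levels, \<open>X\<close> the limit points (each given by the
  arcs pointing towards it), and \<open>tip e\<close> is the limit of the heads of the lifts of \<open>e\<close>.\<close>

locale protree = group G for G :: "('g, 'm) monoid_scheme" (structure) +
  fixes E :: "'e set" and lev :: "'e \<Rightarrow> nat" and ea :: "'g \<Rightarrow> 'e \<Rightarrow> 'e" and br :: "'e \<Rightarrow> 'e"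
    and X :: "'e set set" and tip :: "'e \<Rightarrow> 'e set"
  assumes ea_cl: "\<lbrakk>g \<in> carrier G; e \<in> E\<rbrakk> \<Longrightarrow> ea g e \<in> E"
    and ea_one: "e \<in> E \<Longrightarrow> ea \<one> e = e"
    and ea_mult: "\<lbrakk>g \<in> carrier G; h \<in> carrier G; e \<in> E\<rbrakk> \<Longrightarrow> ea (g \<otimes> h) e = ea g (ea h e)"
    and br_cl: "e \<in> E \<Longrightarrow> br e \<in> E"
    and br_br: "e \<in> E \<Longrightarrow> br (br e) = e"
    and br_ne: "e \<in> E \<Longrightarrow> br e \<noteq> e"
    and ea_br: "\<lbrakk>g \<in> carrier G; e \<in> E\<rbrakk> \<Longrightarrow> ea g (br e) = br (ea g e)"
    and lev_ea: "\<lbrakk>g \<in> carrier G; e \<in> E\<rbrakk> \<Longrightarrow> lev (ea g e) = lev e"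
    and lev_br: "e \<in> E \<Longrightarrow> lev (br e) = lev e"
    and no_inv: "\<lbrakk>g \<in> carrier G; e \<in> E\<rbrakk> \<Longrightarrow> ea g e \<noteq> br e"
    and fin_stab: "e \<in> E \<Longrightarrow> finite {g \<in> carrier G. ea g e = e}"
    and fin_orb: "\<exists>F. finite F \<and> F \<subseteq> E \<and> (\<forall>e \<in> E. lev e = n \<longrightarrow> (\<exists>g \<in> carrier G. \<exists>f \<in> F. e = ea g f))"
    and X_ne: "X \<noteq> {}"
    and X_sub: "x \<in> X \<Longrightarrow> x \<subseteq> E"
    and X_br: "\<lbrakk>x \<in> X; e \<in> E\<rbrakk> \<Longrightarrow> br e \<in> x \<longleftrightarrow> e \<notin> x"
    and X_act: "\<lbrakk>g \<in> carrier G; x \<in> X\<rbrakk> \<Longrightarrow> ea g ` x \<in> X"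
    and fin_D: "\<lbrakk>x \<in> X; y \<in> X\<rbrakk> \<Longrightarrow> finite {e \<in> y - x. lev e = n}"
    and X_maj: "\<lbrakk>x \<in> X; y \<in> X; z \<in> X\<rbrakk> \<Longrightarrow> (x \<inter> y) \<union> (x \<inter> z) \<union> (y \<inter> z) \<in> X"
    and nest_lev: "\<lbrakk>e \<in> E; f \<in> E; lev e = lev f; a \<in> X; b \<in> X; c \<in> X; d \<in> X;
        e \<notin> a; f \<notin> a; e \<in> b; f \<notin> b; e \<notin> c; f \<in> c; e \<in> d; f \<in> d\<rbrakk> \<Longrightarrow> False"
    and tip_X: "e \<in> E \<Longrightarrow> tip e \<in> X"
    and tip_in: "e \<in> E \<Longrightarrow> e \<in> tip e"
    and tip_act: "\<lbrakk>g \<in> carrier G; e \<in> E\<rbrakk> \<Longrightarrow> tip (ea g e) = ea g ` tip e"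
    and tip_lev: "\<lbrakk>e \<in> E; f \<in> tip e; f \<notin> tip (br e); lev f = lev e\<rbrakk> \<Longrightarrow> f = e"
    and tip_half: "\<lbrakk>e \<in> E; f \<in> tip e; f \<notin> tip (br e); x \<in> X\<rbrakk> \<Longrightarrow> f \<in> x \<longleftrightarrow> e \<in> x"
    and lift: "e \<in> E \<Longrightarrow> \<exists>e' \<in> E. lev e' = Suc (lev e) \<and> (\<forall>x \<in> X. e \<in> x \<longleftrightarrow> e' \<in> x)"
    and reduced: "\<lbrakk>e \<in> E; \<forall>g \<in> carrier G. (\<forall>f \<in> E. lev f = lev e \<longrightarrow> (f \<in> ea g ` tip e \<longleftrightarrow> f \<in> tip e)) \<longrightarrow> ea g e = e\<rbrakk>
        \<Longrightarrow> \<exists>g \<in> carrier G. \<forall>f \<in> E. lev f = lev e \<longrightarrow> (f \<in> ea g ` tip e \<longleftrightarrow> f \<in> tip (br e))"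
begin

definition pact :: "'g \<Rightarrow> 'e set \<Rightarrow> 'e set" where "pact g x = ea g ` x"

text \<open>The two limit points have the same image in the \<open>n\<close>-th tree, because a
  vertex is determined by the arcs that point towards it.\<close>

definition lev_eq :: "nat \<Rightarrow> 'e set \<Rightarrow> 'e set \<Rightarrow> bool" where
  "lev_eq n x y \<longleftrightarrow> (\<forall>e \<in> E. lev e = n \<longrightarrow> (e \<in> x \<longleftrightarrow> e \<in> y))"

definition maj :: "'e set \<Rightarrow> 'e set \<Rightarrow> 'e set \<Rightarrow> 'e set" where
  "maj x y z = (x \<inter> y) \<union> (x \<inter> z) \<union> (y \<inter> z)"

text \<open>The interval of the median structure on \<open>X\<close>: its points agree with
  \<open>x\<close> and \<open>y\<close> on every arc on which these two agree.\<close>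

definition seg :: "'e set \<Rightarrow> 'e set \<Rightarrow> 'e set set" where
  "seg x y = {z \<in> X. x \<inter> y \<subseteq> z \<and> z \<subseteq> x \<union> y}"

text \<open>The half-tree of \<open>f\<close> is the smaller one: on a way that enters both,
  \<open>e\<close> is passed first.\<close>

definition beyond :: "'e \<Rightarrow> 'e \<Rightarrow> bool" where
  "beyond e f \<longleftrightarrow> (\<forall>z \<in> X. f \<in> z \<longrightarrow> e \<in> z)"

lemma ea_inv: "\<lbrakk>g \<in> carrier G; e \<in> E\<rbrakk> \<Longrightarrow> ea (inv g) (ea g e) = e"
  using ea_mult[of "inv g" g e] ea_one by simp

lemma ea_inv': "\<lbrakk>g \<in> carrier G; e \<in> E\<rbrakk> \<Longrightarrow> ea g (ea (inv g) e) = e"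
  using ea_mult[of g "inv g" e] ea_one by simp

lemma ea_inj: "\<lbrakk>g \<in> carrier G; e \<in> E; f \<in> E; ea g e = ea g f\<rbrakk> \<Longrightarrow> e = f"
  using ea_inv by metis

lemma pact_X: "\<lbrakk>g \<in> carrier G; x \<in> X\<rbrakk> \<Longrightarrow> pact g x \<in> X"
  by (simp add: pact_def X_act)

lemma mem_pact: "\<lbrakk>g \<in> carrier G; x \<in> X; e \<in> E\<rbrakk> \<Longrightarrow> ea g e \<in> pact g x \<longleftrightarrow> e \<in> x"
  unfolding pact_def using ea_inj X_sub by blast

lemma mem_pact': "\<lbrakk>g \<in> carrier G; x \<in> X; e \<in> E\<rbrakk> \<Longrightarrow> e \<in> pact g x \<longleftrightarrow> ea (inv g) e \<in> x"
  using mem_pact[of g x "ea (inv g) e"] ea_inv'[of g e] ea_cl[of "inv g" e] by simp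

lemma pact_one: "x \<in> X \<Longrightarrow> pact \<one> x = x"
  unfolding pact_def using ea_one X_sub[of x] by force

lemma pact_mult: "\<lbrakk>g \<in> carrier G; h \<in> carrier G; x \<in> X\<rbrakk> \<Longrightarrow> pact (g \<otimes> h) x = pact g (pact h x)"
  unfolding pact_def image_image using ea_mult X_sub[of x] by (intro image_cong) auto

lemma pact_inv: "\<lbrakk>g \<in> carrier G; x \<in> X\<rbrakk> \<Longrightarrow> pact (inv g) (pact g x) = x"
  using pact_mult[of "inv g" g x] pact_one by simp

lemma pact_inv': "\<lbrakk>g \<in> carrier G; x \<in> X\<rbrakk> \<Longrightarrow> pact g (pact (inv g) x) = x"
  using pact_mult[of g "inv g" x] pact_one by simp

lemma pact_eq: "\<lbrakk>g \<in> carrier G; x \<in> X; y \<in> X\<rbrakk> \<Longrightarrow> pact g x = pact g y \<longleftrightarrow> x = y"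
  using pact_inv by metis

lemma X_subD: "\<lbrakk>x \<in> X; e \<in> x\<rbrakk> \<Longrightarrow> e \<in> E" using X_sub by blast

text \<open>A point contains exactly one of \<open>e\<close> and \<open>br e\<close> for each arc,
  so no point properly contains another.\<close>

lemma X_eqI: assumes "x \<in> X" "y \<in> X" "x \<subseteq> y" shows "x = y"
proof -
  have "e \<in> x" if "e \<in> y" for e
    using that X_br[OF assms(1), of e] X_br[OF assms(2), of e] assms X_subD by blast
  then show ?thesis using assms by blast
qed

lemma maj_X: "\<lbrakk>x \<in> X; y \<in> X; z \<in> X\<rbrakk> \<Longrightarrow> maj x y z \<in> X"
  by (simp add: maj_def X_maj)

lemma pact_maj:
  assumes "g \<in> carrier G" "x \<in> X" "y \<in> X" "z \<in> X"
  shows "pact g (maj x y z) = maj (pact g x) (pact g y) (pact g z)"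
proof -
  have "e \<in> pact g (maj x y z) \<longleftrightarrow> e \<in> maj (pact g x) (pact g y) (pact g z)" if "e \<in> E" for e
    using that assms maj_X[of x y z] by (auto simp: mem_pact' maj_def)
  moreover have "pact g (maj x y z) \<subseteq> E" "maj (pact g x) (pact g y) (pact g z) \<subseteq> E"
    using X_sub pact_X maj_X assms by auto
  ultimately show ?thesis by blast
qed

lemma seg_X: "z \<in> seg x y \<Longrightarrow> z \<in> X" by (simp add: seg_def)

lemma seg_sym: "seg x y = seg y x" by (auto simp: seg_def)

lemma all_E_act: "g \<in> carrier G \<Longrightarrow> (\<forall>e \<in> E. P e) \<longleftrightarrow> (\<forall>e \<in> E. P (ea g e))"
  using ea_cl[of g] ea_cl[of "inv g"] ea_inv' by (metis inv_closed)

lemma X_subset_iff: "\<lbrakk>x \<in> X; y \<in> X; z \<in> X\<rbrakk> \<Longrightarrow> x \<inter> y \<subseteq> z \<longleftrightarrow> (\<forall>e \<in> E. e \<in> x \<longrightarrow> e \<in> y \<longrightarrow> e \<in> z)"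
  "\<lbrakk>x \<in> X; y \<in> X; z \<in> X\<rbrakk> \<Longrightarrow> z \<subseteq> x \<union> y \<longleftrightarrow> (\<forall>e \<in> E. e \<in> z \<longrightarrow> e \<in> x \<or> e \<in> y)"
  using X_subD by blast+

lemma pact_subset:
  assumes "g \<in> carrier G" "x \<in> X" "y \<in> X" "z \<in> X"
  shows "pact g x \<inter> pact g y \<subseteq> pact g z \<longleftrightarrow> x \<inter> y \<subseteq> z"
    and "pact g z \<subseteq> pact g x \<union> pact g y \<longleftrightarrow> z \<subseteq> x \<union> y"
proof -
  note p = pact_X[OF assms(1)]
  show "pact g x \<inter> pact g y \<subseteq> pact g z \<longleftrightarrow> x \<inter> y \<subseteq> z"
    unfolding X_subset_iff(1)[OF p p p, OF assms(2-4)] X_subset_iff(1)[OF assms(2-4)]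
    by (subst all_E_act[OF assms(1)]) (simp add: mem_pact[OF assms(1)] assms)
  show "pact g z \<subseteq> pact g x \<union> pact g y \<longleftrightarrow> z \<subseteq> x \<union> y"
    unfolding X_subset_iff(2)[OF p p p, OF assms(2-4)] X_subset_iff(2)[OF assms(2-4)]
    by (subst all_E_act[OF assms(1)]) (simp add: mem_pact[OF assms(1)] assms)
qed

lemma seg_pact:
  assumes "g \<in> carrier G" "x \<in> X" "y \<in> X" "z \<in> X"
  shows "pact g z \<in> seg (pact g x) (pact g y) \<longleftrightarrow> z \<in> seg x y"
  using pact_subset[OF assms] pact_X[OF assms(1)] assms by (auto simp: seg_def)

lemma lift_to:
  assumes "e \<in> E" "lev e \<le> n"
  shows "\<exists>e' \<in> E. lev e' = n \<and> (\<forall>x \<in> X. e \<in> x \<longleftrightarrow> e' \<in> x)"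
  using assms(2)
proof (induction n rule: dec_induct)
  case base
  then show ?case using assms by blast
next
  case (step n)
  then show ?case using lift by metis
qed

text \<open>Lifting an arc does not change its half-space, so arcs of different levels can be
  compared at the higher of the two levels.\<close>

lemma quad:
  assumes "e \<in> E" "f \<in> E" "a \<in> X" "b \<in> X" "c \<in> X" "d \<in> X"
    "e \<notin> a" "f \<notin> a" "e \<in> b" "f \<notin> b" "e \<notin> c" "f \<in> c" "e \<in> d" "f \<in> d"
  shows False
proof -
  obtain e' where e': "e' \<in> E" "lev e' = max (lev e) (lev f)" "\<forall>x \<in> X. e \<in> x \<longleftrightarrow> e' \<in> x"
    using lift_to[of e "max (lev e) (lev f)"] assms by auto
  obtain f' where f': "f' \<in> E" "lev f' = max (lev e) (lev f)" "\<forall>x \<in> X. f \<in> x \<longleftrightarrow> f' \<in> x"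
    using lift_to[of f "max (lev e) (lev f)"] assms by auto
  show False using nest_lev[of e' f' a b c d] e' f' assms by simp
qed

text \<open>An arc with the half-space of \<open>e\<close> separates the two tips of
  \<open>e\<close>, and \<open>e\<close> is the only arc of its level pointing from one tip to the
  other.\<close>

lemma half_eq:
  assumes "e \<in> E" "f \<in> E" "lev e = lev f" "\<And>z. z \<in> X \<Longrightarrow> e \<in> z \<longleftrightarrow> f \<in> z"
  shows "e = f"
proof -
  have "f \<in> tip e" using assms tip_X tip_in by blast
  moreover have "e \<notin> tip (br e)" using X_br[of "tip (br e)" e] tip_X tip_in br_cl assms by blast
  then have "f \<notin> tip (br e)" using assms tip_X br_cl by blast
  ultimately show ?thesis using tip_lev[of e f] assms by auto
qed

lemma beyond_total:
  assumes "e \<in> E" "f \<in> E" "x \<in> X" "y \<in> X" "e \<notin> x" "f \<notin> x" "e \<in> y" "f \<in> y"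
  shows "beyond e f \<or> beyond f e"
proof (rule ccontr)
  assume "\<not> (beyond e f \<or> beyond f e)"
  then obtain c b where "c \<in> X" "f \<in> c" "e \<notin> c" "b \<in> X" "e \<in> b" "f \<notin> b" unfolding beyond_def by auto
  then show False using quad[of e f x b c y] assms by simp
qed

lemma beyond_antisym: "\<lbrakk>e \<in> E; f \<in> E; lev e = lev f; beyond e f; beyond f e\<rbrakk> \<Longrightarrow> e = f"
  by (rule half_eq) (auto simp: beyond_def)

lemma beyond_trans: "beyond e f \<Longrightarrow> beyond f h \<Longrightarrow> beyond e h" unfolding beyond_def by blast

lemma beyond_refl: "beyond e e" unfolding beyond_def by blast

lemma all_X_act: "g \<in> carrier G \<Longrightarrow> (\<forall>z \<in> X. P z) \<longleftrightarrow> (\<forall>z \<in> X. P (pact g z))"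
  using pact_X[of g] pact_X[of "inv g"] pact_inv' by (metis inv_closed)

lemma beyond_pact:
  assumes "g \<in> carrier G" "e \<in> E" "f \<in> E"
  shows "beyond (ea g e) (ea g f) \<longleftrightarrow> beyond e f"
proof -
  have "beyond (ea g e) (ea g f) \<longleftrightarrow> (\<forall>z \<in> X. ea g f \<in> pact g z \<longrightarrow> ea g e \<in> pact g z)"
    unfolding beyond_def by (rule all_X_act[OF assms(1)])
  then show ?thesis unfolding beyond_def by (simp add: mem_pact assms)
qed

text \<open>An element that fixes two points permutes the finitely many arcs of one level between
  them and preserves their linear order by \<open>beyond\<close>; hence it fixes each of them. The
  finiteness of edge stabilisers in the graphs over \<open>X\<close> rests on this.\<close>

lemma fix_edge:
  assumes "g \<in> carrier G" "x \<in> X" "y \<in> X" "pact g x = x" "pact g y = y" "e \<in> y" "e \<notin> x"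
  shows "ea g e = e"
proof -
  define D where "D = {f \<in> y - x. lev f = lev e}"
  \<comment> \<open>The place of an arc in the linear order, counted from the \<open>y\<close> side.
    It is injective on \<open>D\<close> and invariant under \<open>g\<close>.\<close>
  define r where "r f = card {h \<in> D. beyond f h}" for f
  have fin: "finite D" unfolding D_def using fin_D assms by blast
  have DE: "D \<subseteq> E" using X_sub assms unfolding D_def by blast
  have eD: "e \<in> D" using assms by (simp add: D_def)
  have gD: "ea g f \<in> D \<longleftrightarrow> f \<in> D" if "f \<in> E" for f
    using mem_pact[of g x f] mem_pact[of g y f] assms that lev_ea[of g f] by (simp add: D_def)
  have inj: "f = f'" if f: "f \<in> D" "f' \<in> D" "r f = r f'" for f f'
  proof -
    have *: "f = f'" if f: "f \<in> D" "f' \<in> D" "r f = r f'" "beyond f f'" for f f'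
    proof -
      have "{h \<in> D. beyond f' h} \<subseteq> {h \<in> D. beyond f h}" using f beyond_trans by blast
      then have "{h \<in> D. beyond f' h} = {h \<in> D. beyond f h}"
        using f(3) fin unfolding r_def by (intro card_subset_eq) auto
      then have "beyond f' f" using f beyond_refl by blast
      then show ?thesis using beyond_antisym[of f f'] f DE by (auto simp: D_def)
    qed
    have "beyond f f' \<or> beyond f' f" using beyond_total[of f f' x y] f DE assms by (auto simp: D_def)
    then show ?thesis using *[of f f'] *[of f' f] f by auto
  qed
  have "{h \<in> D. beyond (ea g e) h} = ea g ` {h \<in> D. beyond e h}"
  proof -
    have "h \<in> ea g ` {h \<in> D. beyond e h}" if h: "h \<in> D" "beyond (ea g e) h" for h
    proof -
      have hE: "h \<in> E" using h DE by blast
      have k: "ea (inv g) h \<in> E" using ea_cl assms hE by simp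
      have "h = ea g (ea (inv g) h)" using ea_inv' assms hE by simp
      moreover have "ea (inv g) h \<in> D" using gD[OF k] ea_inv'[OF assms(1) hE] h by simp
      moreover have "beyond e (ea (inv g) h)"
        using beyond_pact[OF assms(1), of e "ea (inv g) h"] ea_inv'[OF assms(1) hE] h k eD DE by auto
      ultimately show ?thesis by blast
    qed
    then show ?thesis using gD beyond_pact[OF assms(1)] DE eD by blast
  qed
  moreover have "inj_on (ea g) {h \<in> D. beyond e h}" unfolding inj_on_def using ea_inj[OF assms(1)] DE by blast
  ultimately have "r (ea g e) = r e" unfolding r_def by (simp add: card_image)
  then show ?thesis using inj[of "ea g e" e] eD gD[of e] DE by auto
qed

lemma X_diff:
  assumes "x \<in> X" "y \<in> X" "x \<noteq> y"
  obtains e where "e \<in> E" "e \<in> y" "e \<notin> x"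
proof -
  have "\<not> y \<subseteq> x" using X_eqI[of y x] assms by auto
  then show ?thesis using that X_subD assms by blast
qed

lemma lev_eq_refl: "lev_eq n x x" by (simp add: lev_eq_def)
lemma lev_eq_sym: "lev_eq n x y \<Longrightarrow> lev_eq n y x" by (auto simp: lev_eq_def)
lemma lev_eq_trans: "lev_eq n x y \<Longrightarrow> lev_eq n y z \<Longrightarrow> lev_eq n x z" by (auto simp: lev_eq_def)

lemma lev_eq_pact:
  assumes "g \<in> carrier G" "x \<in> X" "y \<in> X"
  shows "lev_eq n (pact g x) (pact g y) \<longleftrightarrow> lev_eq n x y"
proof
  assume "lev_eq n (pact g x) (pact g y)"
  then show "lev_eq n x y" unfolding lev_eq_def using mem_pact lev_ea ea_cl assms by metis
next
  assume "lev_eq n x y"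
  then show "lev_eq n (pact g x) (pact g y)" unfolding lev_eq_def
    using mem_pact' lev_ea ea_cl assms by (metis inv_closed)
qed

lemma lev_eq_diff:
  assumes "x \<in> X" "y \<in> X" "\<not> lev_eq n x y"
  obtains e where "e \<in> E" "lev e = n" "e \<in> y" "e \<notin> x"
  using assms X_br[of x] X_br[of y] br_cl lev_br unfolding lev_eq_def by metis

lemma lev_eq_mono:
  assumes "x \<in> X" "y \<in> X" "\<not> lev_eq n x y" "n \<le> m"
  shows "\<not> lev_eq m x y"
proof -
  obtain e where e: "e \<in> E" "lev e = n" "e \<in> y" "e \<notin> x" using lev_eq_diff assms by metis
  then obtain e' where "e' \<in> E" "lev e' = m" "\<forall>z \<in> X. e \<in> z \<longleftrightarrow> e' \<in> z"
    using lift_to[of e m] assms by auto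
  then show ?thesis unfolding lev_eq_def using e assms by blast
qed

lemma X_sep:
  assumes "x \<in> X" "y \<in> X" "x \<noteq> y"
  obtains m where "\<And>n. m \<le> n \<Longrightarrow> \<not> lev_eq n x y"
proof -
  obtain e where e: "e \<in> E" "e \<in> y" "e \<notin> x" using X_diff assms by metis
  then have "\<not> lev_eq (lev e) x y" unfolding lev_eq_def by blast
  then show ?thesis using that lev_eq_mono assms by blast
qed

lemma sep_all:
  assumes "finite Y" "Y \<subseteq> X"
  shows "\<exists>m. \<forall>x \<in> Y. \<forall>y \<in> Y. x \<noteq> y \<longrightarrow> \<not> lev_eq m x y"
proof -
  have "\<forall>p \<in> Y \<times> Y. \<exists>m. fst p \<noteq> snd p \<longrightarrow> (\<forall>n \<ge> m. \<not> lev_eq n (fst p) (snd p))"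
    using X_sep assms(2) by (metis (full_types) SigmaE fst_conv snd_conv subsetD)
  then obtain f where f: "\<And>p n. p \<in> Y \<times> Y \<Longrightarrow> fst p \<noteq> snd p \<Longrightarrow> n \<ge> f p \<Longrightarrow> \<not> lev_eq n (fst p) (snd p)"
    by metis
  have "finite (f ` (Y \<times> Y))" using assms by auto
  then have "\<And>p. p \<in> Y \<times> Y \<Longrightarrow> f p \<le> Max (insert 0 (f ` (Y \<times> Y)))" by (intro Max_ge) auto
  then show ?thesis using f by (metis SigmaI fst_conv snd_conv)
qed

lemma fin_stab2:
  assumes "x \<in> X" "y \<in> X" "x \<noteq> y"
  shows "finite {g \<in> carrier G. pact g x = x \<and> pact g y = y}"
proof -
  obtain e where e: "e \<in> E" "e \<in> y" "e \<notin> x" using X_diff assms by metis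
  then have "{g \<in> carrier G. pact g x = x \<and> pact g y = y} \<subseteq> {g \<in> carrier G. ea g e = e}"
    using fix_edge assms by blast
  then show ?thesis using fin_stab[OF e(1)] finite_subset by blast
qed

lemma fin_trans2:
  assumes "x \<in> X" "y \<in> X" "x \<noteq> y"
  shows "finite {g \<in> carrier G. pact g x = x' \<and> pact g y = y'}"
proof (cases "\<exists>h \<in> carrier G. pact h x = x' \<and> pact h y = y'")
  case True
  then obtain h where h: "h \<in> carrier G" "pact h x = x'" "pact h y = y'" by blast
  have "{g \<in> carrier G. pact g x = x' \<and> pact g y = y'} \<subseteq> (\<lambda>k. h \<otimes> k) ` {g \<in> carrier G. pact g x = x \<and> pact g y = y}"
  proof
    fix g assume "g \<in> {g \<in> carrier G. pact g x = x' \<and> pact g y = y'}"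
    then have g: "g \<in> carrier G" "pact g x = x'" "pact g y = y'" by auto
    have "pact (inv h \<otimes> g) x = x" "pact (inv h \<otimes> g) y = y"
      using g(2,3) h(2,3) pact_mult[OF inv_closed[OF h(1)] g(1)] pact_inv[OF h(1)] assms(1,2) by metis+
    moreover have "g = h \<otimes> (inv h \<otimes> g)" using g h by (simp add: m_assoc[symmetric])
    moreover have "inv h \<otimes> g \<in> carrier G" using g h by simp
    ultimately show "g \<in> (\<lambda>k. h \<otimes> k) ` {g \<in> carrier G. pact g x = x \<and> pact g y = y}" by blast
  qed
  then show ?thesis using fin_stab2[OF assms] finite_subset by blast
next
  case False
  then have "{g \<in> carrier G. pact g x = x' \<and> pact g y = y'} = {}" by blast
  then show ?thesis by (simp only: finite.emptyI)
qed

lemma fin_pair: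
  assumes "card Y = 2" "Y \<subseteq> X"
  shows "finite {g \<in> carrier G. pact g ` Y = Z}"
proof -
  obtain x y where Y: "Y = {x, y}" "x \<noteq> y" using assms card_2_iff by metis
  show ?thesis
  proof (cases "card Z = 2")
    case True
    then obtain x' y' where Z: "Z = {x', y'}" "x' \<noteq> y'" using card_2_iff by metis
    have "{g \<in> carrier G. pact g ` Y = Z} \<subseteq>
      {g \<in> carrier G. pact g x = x' \<and> pact g y = y'} \<union> {g \<in> carrier G. pact g x = y' \<and> pact g y = x'}"
      unfolding Y Z by (auto simp: doubleton_eq_iff)
    then show ?thesis using fin_trans2[of x y] assms Y finite_subset by (meson finite_Un insert_subset)
  next
    case False
    have "card (pact g ` Y) = 2" if "g \<in> carrier G" for g
      using pact_eq[of g x y] assms Y that by auto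
    then have "{g \<in> carrier G. pact g ` Y = Z} = {}" using False by blast
    then show ?thesis by (simp only: finite.emptyI)
  qed
qed

text \<open>Two arcs that witness incomparability would take all four combinations of values on
  \<open>x\<close>, \<open>u\<close>, \<open>v\<close> and \<open>y\<close>, which
  \<open>quad\<close> forbids.\<close>

lemma seg_linear:
  assumes "x \<in> X" "y \<in> X" "u \<in> seg x y" "v \<in> seg x y"
  shows "u - x \<subseteq> v - x \<or> v - x \<subseteq> u - x"
proof (rule ccontr)
  assume "\<not> ?thesis"
  then obtain e f where e: "e \<in> u" "e \<notin> x" "e \<notin> v" and f: "f \<in> v" "f \<notin> x" "f \<notin> u" by blast
  have "e \<in> y" "f \<in> y" using e f assms by (auto simp: seg_def)
  moreover have "e \<in> E" "f \<in> E" "u \<in> X" "v \<in> X" using e f X_subD assms seg_X by blast+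
  ultimately show False using quad[of e f x u v y] assms(1,2) e f by simp
qed

text \<open>Reversing arcs turns one of the two inclusions in \<open>seg\<close> into the
  other.\<close>

lemma seg_mem_br:
  assumes "x \<in> X" "y \<in> X" "z \<in> X"
  shows "z \<in> seg x y \<longleftrightarrow> x \<inter> y \<subseteq> z"
proof -
  have "z \<subseteq> x \<union> y" if s: "x \<inter> y \<subseteq> z"
  proof
    fix e assume "e \<in> z"
    then have "e \<in> E" "br e \<notin> z" using X_subD X_br assms by blast+
    then have "br e \<notin> x \<or> br e \<notin> y" using s by blast
    then show "e \<in> x \<union> y" using X_br assms \<open>e \<in> E\<close> by blast
  qed
  then show ?thesis using assms by (auto simp: seg_def)
qed

text \<open>The arcs of \<open>u\<close> inside \<open>x\<close> can be recovered: they are the arcs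
  of \<open>x\<close> whose reverse is not in \<open>u - x\<close>.\<close>

lemma diff_eq:
  assumes "x \<in> X" "u \<in> X" "v \<in> X" "u - x = v - x"
  shows "u = v"
proof -
  have "e \<in> v" if e: "e \<in> u" for e
  proof (cases "e \<in> x")
    case True
    have "e \<in> E" using e X_subD assms by blast
    then have "br e \<notin> u - x" using e X_br assms by blast
    then show ?thesis using assms X_br[of x e] X_br[of v e] True \<open>e \<in> E\<close> by blast
  qed (use e assms in blast)
  then show ?thesis using X_eqI assms by blast
qed

end

section \<open>Flag multisets\<close>

text \<open>A variant of the multiset order in which \<open>J\<close> may be empty, so that it can be checked label by label.\<close>

definition mset_le :: "('a \<times> 'a) set \<Rightarrow> 'a multiset \<Rightarrow> 'a multiset \<Rightarrow> bool" where
  "mset_le r A B \<longleftrightarrow> (\<exists>I J K. A = I + K \<and> B = I + J \<and> (\<forall>k \<in># K. \<exists>j \<in># J. (k, j) \<in> r))"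

lemma mset_le_mult: assumes "mset_le r A B" shows "A = B \<or> (A, B) \<in> mult r"
proof -
  obtain I J K where *: "A = I + K" "B = I + J" "\<forall>k \<in># K. \<exists>j \<in># J. (k, j) \<in> r" using assms unfolding mset_le_def by metis
  show ?thesis
  proof (cases "J = {#}")
    case True
    then have "K = {#}" using * by (metis multiset_nonemptyE set_mset_empty empty_iff)
    then show ?thesis using * True by simp
  qed (use * one_step_implies_mult in blast)
qed

text \<open>One label per class. The representative is arbitrary, and in the applications the label
  is constant on classes. An infinite quotient would give the empty multiset, so finiteness is
  established separately where it matters.\<close>

definition qmset :: "'a set \<Rightarrow> ('a \<times> 'a) set \<Rightarrow> ('a \<Rightarrow> 'l) \<Rightarrow> 'l multiset" where
  "qmset A E l = image_mset (\<lambda>q. l (SOME a. a \<in> q)) (mset_set (A // (E \<inter> A \<times> A)))"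

lemma equiv_restr: "equiv W E \<Longrightarrow> A \<subseteq> W \<Longrightarrow> equiv A (E \<inter> A \<times> A)"
  unfolding equiv_def refl_on_def sym_def trans_def by blast

lemma qrep:
  assumes "equiv A E" "q \<in> A // E"
  shows "(SOME a. a \<in> q) \<in> A" "q = E `` {SOME a. a \<in> q}"
proof -
  obtain a where a: "a \<in> A" "q = E `` {a}" using assms(2) quotientE by blast
  then have "\<exists>a. a \<in> q" using assms equiv_class_self by fastforce
  then have s: "(SOME a. a \<in> q) \<in> q" by (rule someI_ex)
  then show "(SOME a. a \<in> q) \<in> A" using in_quotient_imp_subset assms by blast
  have "(a, SOME a. a \<in> q) \<in> E" using s a by simp
  then show "q = E `` {SOME a. a \<in> q}" using trans[OF a(2) equiv_class_eq[OF assms(1)]] by blast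
qed

text \<open>The classes whose label does not drop form \<open>N\<close>. They are mapped
  injectively, and no other class shares an image with them, because a collision forces both labels
  to drop. So \<open>N\<close> yields the common part \<open>I\<close>, and each remaining label
  lies strictly below the label of a class of \<open>B\<close> outside the image of
  \<open>N\<close>.\<close>

lemma qmset_dom:
  assumes A: "equiv A (EA \<inter> A \<times> A)" "finite (A // (EA \<inter> A \<times> A))"
    and B: "equiv B (EB \<inter> B \<times> B)" "finite (B // (EB \<inter> B \<times> B))"
    and l: "\<And>b b'. (b, b') \<in> EB \<Longrightarrow> b \<in> B \<Longrightarrow> b' \<in> B \<Longrightarrow> l b = l b'"
    and f: "\<And>t. t \<in> A \<Longrightarrow> f t \<in> B" "\<And>t. t \<in> A \<Longrightarrow> l' t = l (f t) \<or> (l' t, l (f t)) \<in> r"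
    and c: "\<And>t s. t \<in> A \<Longrightarrow> s \<in> A \<Longrightarrow> (t, s) \<notin> EA \<Longrightarrow> (f t, f s) \<in> EB \<Longrightarrow> (l' t, l (f t)) \<in> r"
  shows "mset_le r (qmset A EA l') (qmset B EB l)"
proof -
  define QA where "QA = A // (EA \<inter> A \<times> A)"
  define QB where "QB = B // (EB \<inter> B \<times> B)"
  define a where "a q = (SOME x. x \<in> q)" for q :: "'a set"
  define b where "b q = (SOME x. x \<in> q)" for q :: "'b set"
  define F where "F q = (EB \<inter> B \<times> B) `` {f (a q)}" for q
  have aq: "a q \<in> A" "q = (EA \<inter> A \<times> A) `` {a q}" if "q \<in> QA" for q
    using qrep[OF A(1)] that unfolding QA_def a_def by blast+
  have bq: "b q \<in> B" "q = (EB \<inter> B \<times> B) `` {b q}" if "q \<in> QB" for q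
    using qrep[OF B(1)] that unfolding QB_def b_def by blast+
  have FQ: "F q \<in> QB" if "q \<in> QA" for q
    unfolding F_def QB_def using quotientI f(1) aq(1)[OF that] by metis
  have bF: "l (b (F q)) = l (f (a q))" if "q \<in> QA" for q
  proof -
    have 1: "b (F q) \<in> B" and 2: "F q = (EB \<inter> B \<times> B) `` {b (F q)}" using bq FQ[OF that] by blast+
    have 3: "f (a q) \<in> B" using f aq that by blast
    have "(b (F q), f (a q)) \<in> EB \<inter> B \<times> B"
      using eq_equiv_class[OF 2[symmetric, unfolded F_def] B(1) 3] by (simp add: F_def)
    then show ?thesis using l 1 3 by blast
  qed
  have Fs: "(l' (a q), l (f (a q))) \<in> r" if "q \<in> QA" "s \<in> QA" "q \<noteq> s" "F q = F s" for q s
  proof -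
    have "(a q, a s) \<notin> EA"
      using that aq equiv_class_eq[OF A(1), of "a q" "a s"] by blast
    moreover have "(f (a q), f (a s)) \<in> EB"
      using that(4) f(1) aq that eq_equiv_class[OF _ B(1), of "f (a q)" "f (a s)"] unfolding F_def by blast
    ultimately show ?thesis using c aq that by blast
  qed
  define N where "N = {q \<in> QA. (l' (a q), l (f (a q))) \<notin> r}"
  have NQ: "N \<subseteq> QA" by (auto simp: N_def)
  have fin: "finite QA" "finite QB" using A B unfolding QA_def QB_def by auto
  have inj: "inj_on F N" using Fs unfolding N_def inj_on_def by blast
  have FN: "F ` N \<subseteq> QB" using FQ N_def by blast
  define I where "I = image_mset (\<lambda>q. l' (a q)) (mset_set N)"
  define K where "K = image_mset (\<lambda>q. l' (a q)) (mset_set (QA - N))"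
  define J where "J = image_mset (\<lambda>q. l (b q)) (mset_set (QB - F ` N))"
  have "mset_set QA = mset_set N + mset_set (QA - N)"
    using fin mset_set_Union[of N "QA - N"] NQ finite_subset[OF NQ] by (simp add: Un_absorb1)
  then have 1: "qmset A EA l' = I + K" unfolding qmset_def I_def K_def a_def QA_def by simp
  have "mset_set QB = mset_set (F ` N) + mset_set (QB - F ` N)"
    using fin mset_set_Union[of "F ` N" "QB - F ` N"] FN finite_subset[OF FN] by (simp add: Un_absorb1)
  moreover have "image_mset (\<lambda>q. l (b q)) (mset_set (F ` N)) = I"
  proof -
    have "image_mset (\<lambda>q. l (b q)) (mset_set (F ` N)) = image_mset (\<lambda>q. l (b (F q))) (mset_set N)"
      using image_mset_mset_set[OF inj, symmetric] by (simp add: multiset.map_comp comp_def)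
    also have "\<dots> = I" unfolding I_def
    proof (rule image_mset_cong)
      fix q assume "q \<in># mset_set N"
      then have "q \<in> N" using finite_subset[OF NQ fin(1)] by simp
      then show "l (b (F q)) = l' (a q)" using bF f(2)[of "a q"] aq by (auto simp: N_def)
    qed
    finally show ?thesis .
  qed
  ultimately have 2: "qmset B EB l = I + J" unfolding qmset_def J_def b_def QB_def by simp
  have "\<exists>j \<in># J. (k, j) \<in> r" if k: "k \<in># K" for k
  proof -
    obtain q where q: "q \<in> QA" "q \<notin> N" "k = l' (a q)" using k fin unfolding K_def by auto
    then have r: "(k, l (f (a q))) \<in> r" by (simp add: N_def)
    have "F q \<notin> F ` N" using Fs q unfolding N_def by blast
    then have "l (b (F q)) \<in># J" using FQ q fin unfolding J_def by auto
    then show ?thesis using r bF q by metis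
  qed
  then show ?thesis unfolding mset_le_def using 1 2 by blast
qed

lemma qmset_eq:
  assumes A: "equiv A (EA \<inter> A \<times> A)" and B: "equiv B (EB \<inter> B \<times> B)"
    and l: "\<And>b b'. (b, b') \<in> EB \<Longrightarrow> b \<in> B \<Longrightarrow> b' \<in> B \<Longrightarrow> l b = l b'"
    and f: "\<And>t. t \<in> A \<Longrightarrow> f t \<in> B" "\<And>t. t \<in> A \<Longrightarrow> l' t = l (f t)"
    and c: "\<And>t s. t \<in> A \<Longrightarrow> s \<in> A \<Longrightarrow> (f t, f s) \<in> EB \<longleftrightarrow> (t, s) \<in> EA"
    and s: "\<And>b. b \<in> B \<Longrightarrow> \<exists>t \<in> A. (f t, b) \<in> EB"
  shows "qmset A EA l' = qmset B EB l"
proof -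
  define QA where "QA = A // (EA \<inter> A \<times> A)"
  define QB where "QB = B // (EB \<inter> B \<times> B)"
  define a where "a q = (SOME x. x \<in> q)" for q :: "'a set"
  define b where "b q = (SOME x. x \<in> q)" for q :: "'b set"
  define F where "F q = (EB \<inter> B \<times> B) `` {f (a q)}" for q
  have aq: "a q \<in> A" "q = (EA \<inter> A \<times> A) `` {a q}" if "q \<in> QA" for q
    using qrep[OF A(1)] that unfolding QA_def a_def by blast+
  have bq: "b q \<in> B" "q = (EB \<inter> B \<times> B) `` {b q}" if "q \<in> QB" for q
    using qrep[OF B(1)] that unfolding QB_def b_def by blast+
  have FQ: "F q \<in> QB" if "q \<in> QA" for q
    unfolding F_def QB_def using quotientI f(1) aq(1)[OF that] by metis
  have bF: "l (b (F q)) = l' (a q)" if "q \<in> QA" for q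
  proof -
    have 1: "b (F q) \<in> B" and 2: "F q = (EB \<inter> B \<times> B) `` {b (F q)}" using bq FQ[OF that] by blast+
    have 3: "f (a q) \<in> B" using f aq that by blast
    have "(b (F q), f (a q)) \<in> EB \<inter> B \<times> B"
      using eq_equiv_class[OF 2[symmetric, unfolded F_def] B(1) 3] by (simp add: F_def)
    then have "l (b (F q)) = l (f (a q))" using l 1 3 by blast
    then show ?thesis using f(2)[of "a q"] aq[OF that] by simp
  qed
  have inj: "inj_on F QA"
  proof (rule inj_onI)
    fix q s assume qs: "q \<in> QA" "s \<in> QA" "F q = F s"
    have "(f (a q), f (a s)) \<in> EB"
      using qs(3) f(1) aq qs eq_equiv_class[OF _ B, of "f (a q)" "f (a s)"] unfolding F_def by blast
    then have "(a q, a s) \<in> EA \<inter> A \<times> A" using c aq qs by blast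
    then show "q = s" using aq qs equiv_class_eq[OF A] by metis
  qed
  have sur: "F ` QA = QB"
  proof -
    have "q \<in> F ` QA" if q: "q \<in> QB" for q
    proof -
      obtain t where t: "t \<in> A" "(f t, b q) \<in> EB" using s bq q by blast
      have Q: "(EA \<inter> A \<times> A) `` {t} \<in> QA" (is "?s \<in> _") unfolding QA_def using t quotientI by metis
      have "(a ?s, t) \<in> EA" "a ?s \<in> A" using aq[OF Q] t eq_equiv_class[OF _ A, of "a ?s" t] by blast+
      then have "(f (a ?s), f t) \<in> EB \<inter> B \<times> B" "(f t, b q) \<in> EB \<inter> B \<times> B" using c t f bq q by auto
      then have "F ?s = (EB \<inter> B \<times> B) `` {b q}" unfolding F_def using equiv_class_eq[OF B] by metis
      then show ?thesis using bq q Q by blast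
    qed
    then show ?thesis using FQ by blast
  qed
  show ?thesis
  proof (cases "finite QA")
    case True
    have "image_mset (\<lambda>q. l (b q)) (mset_set QB) = image_mset (\<lambda>q. l (b (F q))) (mset_set QA)"
      using image_mset_mset_set[OF inj, symmetric] sur by (simp add: multiset.map_comp comp_def)
    also have "\<dots> = image_mset (\<lambda>q. l' (a q)) (mset_set QA)"
      by (rule image_mset_cong) (use bF True in simp)
    finally show ?thesis unfolding qmset_def a_def b_def QA_def QB_def by simp
  next
    case False
    then have "infinite QB" using sur inj finite_imageD by blast
    then show ?thesis unfolding qmset_def using False QA_def QB_def by simp
  qed
qed

section \<open>Conjugacy classes of finite subgroups\<close>

context group begin

definition conj_by :: "'a \<Rightarrow> 'a set \<Rightarrow> 'a set" where "conj_by g F = (\<lambda>f. g \<otimes> f \<otimes> inv g) ` F"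

definition conj_class :: "'a set \<Rightarrow> 'a set set" where "conj_class F = (\<lambda>g. conj_by g F) ` carrier G"

text \<open>Inclusion is reversed, so that growing stabilisers count as descent: folding enlarges
  stabilisers. Conjugacy classes are needed because an orbit of flags determines a stabiliser only
  up to conjugation.\<close>

definition stab_less :: "('a set set \<times> 'a set set) set" where
  "stab_less = {(conj_class F', conj_class F) | F F'. subgroup F G \<and> subgroup F' G \<and> finite F' \<and> F \<subset> F'}"

lemma conj_by_mult: "\<lbrakk>g \<in> carrier G; h \<in> carrier G; F \<subseteq> carrier G\<rbrakk> \<Longrightarrow> conj_by (g \<otimes> h) F = conj_by g (conj_by h F)"
  unfolding conj_by_def image_image by (rule image_cong) (auto simp: inv_mult_group m_assoc subsetD)

lemma conj_by_one: "F \<subseteq> carrier G \<Longrightarrow> conj_by \<one> F = F"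
  unfolding conj_by_def by (force simp: subsetD)

lemma conj_by_carrier: "\<lbrakk>g \<in> carrier G; F \<subseteq> carrier G\<rbrakk> \<Longrightarrow> conj_by g F \<subseteq> carrier G"
  unfolding conj_by_def by auto

lemma conj_class_cj: assumes "g \<in> carrier G" "F \<subseteq> carrier G" shows "conj_class (conj_by g F) = conj_class F"
proof -
  have 1: "conj_by h (conj_by g F) \<in> conj_class F" if "h \<in> carrier G" for h
    using conj_by_mult[OF that assms] that assms unfolding conj_class_def by (metis imageI m_closed)
  have 2: "conj_by h F \<in> conj_class (conj_by g F)" if h: "h \<in> carrier G" for h
  proof -
    have "h \<otimes> inv g \<otimes> g = h" using h assms by (simp add: m_assoc)
    then have "conj_by h F = conj_by (h \<otimes> inv g) (conj_by g F)" using conj_by_mult[of "h \<otimes> inv g" g F] h assms by simp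
    then show ?thesis unfolding conj_class_def using h assms by (metis imageI m_closed inv_closed)
  qed
  show ?thesis using 1 2 unfolding conj_class_def by blast
qed

lemma conj_class_eqD: assumes "conj_class F = conj_class H" "F \<subseteq> carrier G" obtains g where "g \<in> carrier G" "F = conj_by g H"
proof -
  have "F \<in> conj_class F" using conj_by_one[OF assms(2)] unfolding conj_class_def by (metis imageI one_closed)
  then show ?thesis using that assms unfolding conj_class_def by auto
qed

lemma conj_by_mono: assumes "g \<in> carrier G" "F \<subset> H" "H \<subseteq> carrier G" shows "conj_by g F \<subset> conj_by g H"
proof -
  have "inj_on (\<lambda>f. g \<otimes> f \<otimes> inv g) (carrier G)" using assms(1) by (auto simp: inj_on_def)
  then show ?thesis unfolding conj_by_def using assms by (metis image_strict_mono inj_on_subset)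
qed

lemma conj_by_subgroup: assumes "g \<in> carrier G" "subgroup F G" shows "subgroup (conj_by g F) G"
proof (rule subgroupI)
  have sub: "F \<subseteq> carrier G" using assms subgroup.subset by blast
  show "conj_by g F \<subseteq> carrier G" using conj_by_carrier assms sub by blast
  show "conj_by g F \<noteq> {}" unfolding conj_by_def using assms subgroup.one_closed by blast
  show "inv a \<in> conj_by g F" if "a \<in> conj_by g F" for a
  proof -
    obtain f where f: "f \<in> F" "a = g \<otimes> f \<otimes> inv g" using \<open>a \<in> conj_by g F\<close> unfolding conj_by_def by blast
    have "f \<in> carrier G" using f sub by blast
    then have "inv a = g \<otimes> inv f \<otimes> inv g" using f assms(1) by (simp add: inv_mult_group m_assoc)
    then show ?thesis unfolding conj_by_def using f subgroup.m_inv_closed[OF assms(2)] by blast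
  qed
  show "a \<otimes> b \<in> conj_by g F" if ab: "a \<in> conj_by g F" "b \<in> conj_by g F" for a b
  proof -
    obtain f k where f: "f \<in> F" "a = g \<otimes> f \<otimes> inv g" "k \<in> F" "b = g \<otimes> k \<otimes> inv g" using ab unfolding conj_by_def by blast
    have "f \<in> carrier G" "k \<in> carrier G" using f sub by blast+
    moreover have "inv g \<otimes> (g \<otimes> x) = x" if "x \<in> carrier G" for x using that assms(1) by (simp add: m_assoc[symmetric])
    ultimately have "a \<otimes> b = g \<otimes> (f \<otimes> k) \<otimes> inv g" using f assms(1) by (simp add: m_assoc)
    then show ?thesis unfolding conj_by_def using f subgroup.m_closed[OF assms(2)] by blast
  qed
qed

text \<open>A descending chain of classes only compares suitable representatives of neighbouring
  terms. Conjugating each next subgroup so that it contains the one already chosen gives an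
  ascending chain of subgroups.\<close>

lemma wf_ltr:
  assumes "\<nexists>H. \<forall>i::nat. subgroup (H i) G \<and> finite (H i) \<and> H i \<subset> H (Suc i)"
  shows "wf stab_less"
proof (rule ccontr)
  assume "\<not> wf stab_less"
  then obtain c where c: "\<And>i. (c (Suc i), c i) \<in> stab_less" using wf_iff_no_infinite_down_chain by metis
  let ?P = "\<lambda>i H. subgroup H G \<and> finite H \<and> conj_class H = c i"
  have "\<exists>H. \<forall>i. ?P i (H i) \<and> H i \<subset> H (Suc i)"
  proof (rule dependent_nat_choice)
    obtain F F' where "subgroup F G" "finite F'" "F \<subset> F'" "c 0 = conj_class F" using c[of 0] unfolding stab_less_def by blast
    then show "\<exists>H. ?P 0 H" using finite_subset by blast
  next
    fix H i assume H: "?P i H"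
    obtain F F' where F: "subgroup F G" "subgroup F' G" "finite F'" "F \<subset> F'" "c i = conj_class F" "c (Suc i) = conj_class F'"
      using c[of i] unfolding stab_less_def by blast
    have sub: "H \<subseteq> carrier G" "F' \<subseteq> carrier G" using H F subgroup.subset by blast+
    have "conj_class H = conj_class F" using H F(5) by simp
    from conj_class_eqD[OF this sub(1)] obtain g where g: "g \<in> carrier G" "H = conj_by g F" .
    have "subgroup (conj_by g F') G" by (rule conj_by_subgroup[OF g(1) F(2)])
    moreover have "finite (conj_by g F')" using F(3) unfolding conj_by_def by simp
    moreover have "conj_class (conj_by g F') = c (Suc i)" using conj_class_cj[OF g(1) sub(2)] F(6) by simp
    ultimately have "?P (Suc i) (conj_by g F')" by blast
    moreover have "H \<subset> conj_by g F'" using conj_by_mono[OF g(1) F(4) sub(2)] g(2) by simp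
    ultimately show "\<exists>H'. ?P (Suc i) H' \<and> H \<subset> H'" by blast
  qed
  then show False using assms by blast
qed

end

section \<open>Equivariant graphs with a parent map\<close>

text \<open>Quotient graphs are never formed: every notion is relative to an invariant equivalence \<open>R\<close>, and \<open>par R p\<close> says
  that \<open>p\<close> is a parent map of the quotient by \<open>R\<close>. Graphs are bipartite, coloured by \<open>col \<circ> pos\<close>.\<close>

locale ggraph = group G for G :: "('g, 'm) monoid_scheme" (structure) +
  fixes W :: "'w set" and wa :: "'g \<Rightarrow> 'w \<Rightarrow> 'w" and ad :: "('w \<times> 'w) set"
    and pos :: "'w \<Rightarrow> 'p" and pa :: "'g \<Rightarrow> 'p \<Rightarrow> 'p" and col :: "'p \<Rightarrow> bool"
  assumes wa_cl: "\<lbrakk>g \<in> carrier G; w \<in> W\<rbrakk> \<Longrightarrow> wa g w \<in> W"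
    and wa_one: "w \<in> W \<Longrightarrow> wa \<one> w = w"
    and wa_mult: "\<lbrakk>g \<in> carrier G; h \<in> carrier G; w \<in> W\<rbrakk> \<Longrightarrow> wa (g \<otimes> h) w = wa g (wa h w)"
    and ad_W: "(x, y) \<in> ad \<Longrightarrow> x \<in> W \<and> y \<in> W"
    and ad_sym: "(x, y) \<in> ad \<Longrightarrow> (y, x) \<in> ad"
    and ad_act: "\<lbrakk>g \<in> carrier G; (x, y) \<in> ad\<rbrakk> \<Longrightarrow> (wa g x, wa g y) \<in> ad"
    and pos_act: "\<lbrakk>g \<in> carrier G; w \<in> W\<rbrakk> \<Longrightarrow> pos (wa g w) = pa g (pos w)"
    and col_act: "\<lbrakk>g \<in> carrier G; w \<in> W\<rbrakk> \<Longrightarrow> col (pa g (pos w)) = col (pos w)"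
    and ad_col: "(x, y) \<in> ad \<Longrightarrow> col (pos x) \<noteq> col (pos y)"
    and fin_lab: "(x, y) \<in> ad \<Longrightarrow> finite {g \<in> carrier G. pa g (pos x) = pos x \<and> pa g (pos y) = pos y}"
    and fin_ad: "\<exists>F. finite F \<and> F \<subseteq> ad \<and> (\<forall>(x, y) \<in> ad. \<exists>g \<in> carrier G. \<exists>(x', y') \<in> F. x = wa g x' \<and> y = wa g y')"
begin

definition adR :: "('w \<times> 'w) set \<Rightarrow> ('w \<times> 'w) set" where
  "adR R = {(x, y). \<exists>a b. (a, b) \<in> ad \<and> (x, a) \<in> R \<and> (y, b) \<in> R}"

definition req :: "('w \<times> 'w) set \<Rightarrow> bool" where
  "req R \<longleftrightarrow> equiv W R \<and> (\<forall>g \<in> carrier G. \<forall>(x, y) \<in> R. (wa g x, wa g y) \<in> R) \<and> (\<forall>(x, y) \<in> R. pos x = pos y)"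

definition par :: "('w \<times> 'w) set \<Rightarrow> ('w \<Rightarrow> 'w) \<Rightarrow> bool" where
  "par R p \<longleftrightarrow> (\<forall>x \<in> W. p x \<in> W) \<and> (\<forall>(x, y) \<in> R. (p x, p y) \<in> R) \<and>
     (\<forall>g \<in> carrier G. \<forall>x \<in> W. (p (wa g x), wa g (p x)) \<in> R) \<and> (\<forall>x \<in> W. (p x, x) \<in> R \<or> (p x, x) \<in> adR R)"

definition flag_rel :: "('w \<times> 'w) set \<Rightarrow> (('w \<times> 'w) \<times> ('w \<times> 'w)) set" where
  "flag_rel R = {((x, y), (x', y')). x \<in> W \<and> y \<in> W \<and> x' \<in> W \<and> y' \<in> W \<and>
     (\<exists>g \<in> carrier G. (wa g x, x') \<in> R \<and> (wa g y, y') \<in> R)}"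

definition st :: "('w \<times> 'w) set \<Rightarrow> 'w \<Rightarrow> 'g set" where
  "st R x = {g \<in> carrier G. (wa g x, x) \<in> R}"

definition flag_stab :: "('w \<times> 'w) set \<Rightarrow> 'w \<times> 'w \<Rightarrow> 'g set" where
  "flag_stab R t = st R (fst t) \<inter> st R (snd t)"

definition lab :: "('w \<times> 'w) set \<Rightarrow> 'w \<times> 'w \<Rightarrow> 'g set set" where
  "lab R t = conj_class (flag_stab R t)"

text \<open>The free flags: edges along which neither end is the parent of the other, oriented to
  start at colour \<open>k\<close>. They are taken from \<open>ad\<close> itself even for the
  quotient by \<open>R\<close>, since \<open>flag_rel R\<close> identifies those that agree
  there.\<close>

definition fflags :: "bool \<Rightarrow> ('w \<times> 'w) set \<Rightarrow> ('w \<Rightarrow> 'w) \<Rightarrow> ('w \<times> 'w) set" where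
  "fflags k R p = {(x, y) \<in> ad. col (pos x) = k \<and> (p x, y) \<notin> R \<and> (p y, x) \<notin> R}"

definition flag_mset :: "bool \<Rightarrow> ('w \<times> 'w) set \<Rightarrow> ('w \<Rightarrow> 'w) \<Rightarrow> 'g set set multiset" where
  "flag_mset k R p = qmset (fflags k R p) (flag_rel R) (lab R)"

lemma wa_inv: "\<lbrakk>g \<in> carrier G; w \<in> W\<rbrakk> \<Longrightarrow> wa (inv g) (wa g w) = w"
  using wa_mult[of "inv g" g w] wa_one by simp

lemma wa_inv': "\<lbrakk>g \<in> carrier G; w \<in> W\<rbrakk> \<Longrightarrow> wa g (wa (inv g) w) = w"
  using wa_mult[of g "inv g" w] wa_one by simp

lemma reqD:
  assumes "req R"
  shows "x \<in> W \<Longrightarrow> (x, x) \<in> R" "(x, y) \<in> R \<Longrightarrow> (y, x) \<in> R" "(x, y) \<in> R \<Longrightarrow> (y, z) \<in> R \<Longrightarrow> (x, z) \<in> R"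
    "(x, y) \<in> R \<Longrightarrow> x \<in> W" "(x, y) \<in> R \<Longrightarrow> y \<in> W"
    "g \<in> carrier G \<Longrightarrow> (x, y) \<in> R \<Longrightarrow> (wa g x, wa g y) \<in> R" "(x, y) \<in> R \<Longrightarrow> pos x = pos y"
  using assms unfolding req_def equiv_def refl_on_def sym_def trans_def by blast+

lemma req_shift:
  assumes "req R" "g \<in> carrier G" "x \<in> W" "y \<in> W"
  shows "(wa g x, y) \<in> R \<longleftrightarrow> (x, wa (inv g) y) \<in> R"
  using reqD(6)[OF assms(1), of g x "wa (inv g) y"] reqD(6)[OF assms(1), of "inv g" "wa g x" y]
    wa_inv[of g x] wa_inv'[of g y] assms by auto

lemma parD:
  assumes "par R p"
  shows "x \<in> W \<Longrightarrow> p x \<in> W" "(x, y) \<in> R \<Longrightarrow> (p x, p y) \<in> R"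
    "g \<in> carrier G \<Longrightarrow> x \<in> W \<Longrightarrow> (p (wa g x), wa g (p x)) \<in> R" "x \<in> W \<Longrightarrow> (p x, x) \<in> R \<or> (p x, x) \<in> adR R"
  using assms unfolding par_def by blast+

lemma adR_D:
  assumes "req R" "(x, y) \<in> adR R"
  shows "x \<in> W" "y \<in> W" "(y, x) \<in> adR R" "col (pos x) \<noteq> col (pos y)" "(x, y) \<notin> R"
    "finite {g \<in> carrier G. pa g (pos x) = pos x \<and> pa g (pos y) = pos y}"
proof -
  obtain a b where *: "(a, b) \<in> ad" "(x, a) \<in> R" "(y, b) \<in> R" using assms(2) unfolding adR_def by blast
  have "pos x = pos a" "pos y = pos b" using * reqD(7)[OF assms(1)] by blast+
  then show "col (pos x) \<noteq> col (pos y)" "finite {g \<in> carrier G. pa g (pos x) = pos x \<and> pa g (pos y) = pos y}"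
    using ad_col * fin_lab by auto
  then show "(x, y) \<notin> R" using reqD(7)[OF assms(1)] by metis
  show "x \<in> W" "y \<in> W" using * reqD[OF assms(1)] by blast+
  show "(y, x) \<in> adR R" using * ad_sym unfolding adR_def by blast
qed

lemma adR_mono: "R \<subseteq> R' \<Longrightarrow> adR R \<subseteq> adR R'" unfolding adR_def by blast

lemma ad_adR: "req R \<Longrightarrow> (x, y) \<in> ad \<Longrightarrow> (x, y) \<in> adR R"
  using reqD(1) ad_W unfolding adR_def by blast

lemma adR_R: "req R \<Longrightarrow> (x, y) \<in> adR R \<Longrightarrow> (x, x') \<in> R \<Longrightarrow> (y, y') \<in> R \<Longrightarrow> (x', y') \<in> adR R"
  unfolding adR_def using reqD(2,3)[of R] by blast

lemma adR_act: "req R \<Longrightarrow> (x, y) \<in> adR R \<Longrightarrow> g \<in> carrier G \<Longrightarrow> (wa g x, wa g y) \<in> adR R"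
  unfolding adR_def using reqD(6)[of R] ad_act by blast

lemma THI: "\<lbrakk>req R; x \<in> W; y \<in> W; g \<in> carrier G; (wa g x, x') \<in> R; (wa g y, y') \<in> R\<rbrakk> \<Longrightarrow> ((x, y), (x', y')) \<in> flag_rel R"
  unfolding flag_rel_def using reqD(5)[of R] by blast

lemma flag_rel_equiv: assumes R: "req R" shows "equiv (W \<times> W) (flag_rel R)"
proof (rule equivI)
  show "flag_rel R \<subseteq> (W \<times> W) \<times> W \<times> W" unfolding flag_rel_def by blast
  show "refl_on (W \<times> W) (flag_rel R)"
  proof (rule refl_onI)
    fix t assume "t \<in> W \<times> W"
    then show "(t, t) \<in> flag_rel R" using THI[OF R, of "fst t" "snd t" \<one> "fst t" "snd t"] wa_one reqD(1)[OF R] by auto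
  qed
  show "sym (flag_rel R)"
  proof (rule symI, clarify)
    fix x y x' y' assume "((x, y), (x', y')) \<in> flag_rel R"
    then obtain g where g: "g \<in> carrier G" "(wa g x, x') \<in> R" "(wa g y, y') \<in> R" "x \<in> W" "y \<in> W" "x' \<in> W" "y' \<in> W"
      unfolding flag_rel_def by blast
    then have "(wa (inv g) x', x) \<in> R" "(wa (inv g) y', y) \<in> R" using req_shift[OF R] reqD(2)[OF R] by blast+
    then show "((x', y'), (x, y)) \<in> flag_rel R" using THI[OF R] g by blast
  qed
  show "trans (flag_rel R)"
  proof (rule transI, clarify)
    fix x y x' y' x'' y'' assume "((x, y), (x', y')) \<in> flag_rel R" "((x', y'), (x'', y'')) \<in> flag_rel R"
    then obtain g h where g: "g \<in> carrier G" "(wa g x, x') \<in> R" "(wa g y, y') \<in> R" "x \<in> W" "y \<in> W"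
      and h: "h \<in> carrier G" "(wa h x', x'') \<in> R" "(wa h y', y'') \<in> R"
      unfolding flag_rel_def by blast
    then have "(wa (h \<otimes> g) x, x'') \<in> R" "(wa (h \<otimes> g) y, y'') \<in> R"
      using wa_mult[OF h(1) g(1)] reqD(3,6)[OF R] by metis+
    then show "((x, y), (x'', y'')) \<in> flag_rel R" using THI[OF R] g h by blast
  qed
qed

lemma flag_rel_D:
  assumes "req R"
  shows "t \<in> W \<times> W \<Longrightarrow> (t, t) \<in> flag_rel R" "(t, s) \<in> flag_rel R \<Longrightarrow> (s, t) \<in> flag_rel R"
    "(t, s) \<in> flag_rel R \<Longrightarrow> (s, r) \<in> flag_rel R \<Longrightarrow> (t, r) \<in> flag_rel R"
  using flag_rel_equiv[OF assms] unfolding equiv_def refl_on_def sym_def trans_def by blast+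

lemma flag_rel_mono: "R \<subseteq> R' \<Longrightarrow> flag_rel R \<subseteq> flag_rel R'" unfolding flag_rel_def by blast

lemma st_sub: "st R x \<subseteq> carrier G" by (auto simp: st_def)

lemma st_R_sub: assumes "req R" "(x, y) \<in> R" shows "st R x \<subseteq> st R y"
proof
  fix g assume g: "g \<in> st R x"
  then have "(wa g x, wa g y) \<in> R" "(wa g x, x) \<in> R" using reqD(6)[OF assms(1)] assms(2) by (auto simp: st_def)
  then have "(wa g y, y) \<in> R" using reqD(2,3)[OF assms(1)] assms(2) by metis
  then show "g \<in> st R y" using g by (simp add: st_def)
qed

lemma st_R: assumes "req R" "(x, y) \<in> R" shows "st R x = st R y"
  using st_R_sub[OF assms] st_R_sub[OF assms(1) reqD(2)[OF assms]] by blast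

lemma st_wa: assumes "req R" "g \<in> carrier G" "x \<in> W" shows "st R (wa g x) = conj_by g (st R x)"
proof -
  have 1: "h \<in> st R (wa g x) \<longleftrightarrow> inv g \<otimes> h \<otimes> g \<in> st R x" if h: "h \<in> carrier G" for h
  proof -
    have "wa (inv g) (wa h (wa g x)) = wa (inv g \<otimes> h \<otimes> g) x" using h assms by (simp add: wa_mult wa_cl)
    moreover have "(wa h (wa g x), wa g x) \<in> R \<longleftrightarrow> (wa (inv g) (wa h (wa g x)), x) \<in> R"
      using req_shift[OF assms(1), of "inv g" "wa h (wa g x)" x] assms h wa_cl by simp
    ultimately show ?thesis using h assms by (simp add: st_def)
  qed
  have 2: "g \<otimes> h \<otimes> inv g \<in> carrier G" "inv g \<otimes> (g \<otimes> h \<otimes> inv g) \<otimes> g = h" if "h \<in> carrier G" for h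
    using that assms(2) by (simp_all add: m_assoc) (simp add: m_assoc[symmetric])
  have 3: "h = g \<otimes> (inv g \<otimes> h \<otimes> g) \<otimes> inv g" if "h \<in> carrier G" for h
    using that assms(2) by (simp add: m_assoc) (simp add: m_assoc[symmetric])
  show ?thesis unfolding conj_by_def
  proof (intro equalityI subsetI)
    fix h assume h: "h \<in> st R (wa g x)"
    then have "h \<in> carrier G" using st_sub by blast
    then show "h \<in> (\<lambda>f. g \<otimes> f \<otimes> inv g) ` st R x" using 1 3 h by blast
  next
    fix h assume "h \<in> (\<lambda>f. g \<otimes> f \<otimes> inv g) ` st R x"
    then obtain f where f: "f \<in> st R x" "h = g \<otimes> f \<otimes> inv g" by blast
    then have "f \<in> carrier G" using st_sub by blast
    then show "h \<in> st R (wa g x)" using 1 2 f by metis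
  qed
qed

lemma st_subgroup: assumes "req R" "x \<in> W" shows "subgroup (st R x) G"
proof (rule subgroupI)
  show "st R x \<subseteq> carrier G" by (rule st_sub)
  show "st R x \<noteq> {}" using wa_one[OF assms(2)] reqD(1)[OF assms] unfolding st_def by force
  show "inv g \<in> st R x" if "g \<in> st R x" for g
    using that req_shift[OF assms(1), of g x x] reqD(2)[OF assms(1), of x "wa (inv g) x"] assms(2) by (auto simp: st_def)
  show "g \<otimes> h \<in> st R x" if "g \<in> st R x" "h \<in> st R x" for g h
    using that wa_mult[of g h x] reqD(3)[OF assms(1), of "wa g (wa h x)" "wa g x" x]
      reqD(6)[OF assms(1), of g "wa h x" x] assms(2) by (simp add: st_def)
qed

lemma conj_by_Int: assumes "g \<in> carrier G" "A \<subseteq> carrier G" "B \<subseteq> carrier G" shows "conj_by g (A \<inter> B) = conj_by g A \<inter> conj_by g B"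
proof -
  have "inj_on (\<lambda>f. g \<otimes> f \<otimes> inv g) (carrier G)" using assms(1) by (auto simp: inj_on_def)
  then show ?thesis unfolding conj_by_def using assms by (metis inj_on_image_Int)
qed

lemma flag_stab_sub: "flag_stab R t \<subseteq> carrier G" using st_sub by (auto simp: flag_stab_def)

lemma lab_TH: assumes "req R" "(t, s) \<in> flag_rel R" shows "lab R t = lab R s"
proof -
  obtain x y x' y' g where *: "t = (x, y)" "s = (x', y')" "x \<in> W" "y \<in> W" "g \<in> carrier G" "(wa g x, x') \<in> R" "(wa g y, y') \<in> R"
    using assms(2) unfolding flag_rel_def by blast
  have "st R x' = conj_by g (st R x)" "st R y' = conj_by g (st R y)"
    using st_R[OF assms(1) *(6)] st_R[OF assms(1) *(7)] st_wa[OF assms(1) *(5) *(3)] st_wa[OF assms(1) *(5) *(4)] by simp_all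
  then have "flag_stab R s = conj_by g (flag_stab R t)" unfolding flag_stab_def using *(1,2) conj_by_Int[OF *(5) st_sub st_sub] by simp
  then show ?thesis unfolding lab_def using conj_class_cj[OF *(5) flag_stab_sub] by simp
qed

lemma flag_stab_subgroup: "req R \<Longrightarrow> t \<in> W \<times> W \<Longrightarrow> subgroup (flag_stab R t) G"
  unfolding flag_stab_def by (intro subgroups_Inter_pair st_subgroup) auto

text \<open>Passing to the quotient keeps positions, so the stabiliser still fixes two positions,
  and \<open>fin_lab\<close> bounds it.\<close>

lemma flag_stab_fin: assumes "req R" "t \<in> adR R" shows "finite (flag_stab R t)"
proof -
  obtain x y where t: "t = (x, y)" by force
  have W: "x \<in> W" "y \<in> W" using adR_D[OF assms(1), of x y] assms(2) t by auto
  have "flag_stab R t \<subseteq> {g \<in> carrier G. pa g (pos x) = pos x \<and> pa g (pos y) = pos y}"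
  proof
    fix g assume "g \<in> flag_stab R t"
    then have g: "g \<in> carrier G" "(wa g x, x) \<in> R" "(wa g y, y) \<in> R" using t by (auto simp: flag_stab_def st_def)
    then show "g \<in> {g \<in> carrier G. pa g (pos x) = pos x \<and> pa g (pos y) = pos y}"
      using reqD(7)[OF assms(1) g(2)] reqD(7)[OF assms(1) g(3)] pos_act W by simp
  qed
  then show ?thesis using adR_D(6)[OF assms(1), of x y] assms(2) t finite_subset by blast
qed

text \<open>Ascent of stabilisers is descent of labels. The order also asks for the larger group to
  be finite, which holds because it fixes an edge of a quotient.\<close>

lemma lab_le:
  assumes "req R" "req R'" "t \<in> adR R'" "s \<in> W \<times> W"
  shows "flag_stab R s \<subseteq> flag_stab R' t \<Longrightarrow> lab R' t = lab R s \<or> (lab R' t, lab R s) \<in> stab_less"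
    and "flag_stab R s \<subset> flag_stab R' t \<Longrightarrow> (lab R' t, lab R s) \<in> stab_less"
proof -
  have t: "t \<in> W \<times> W" using adR_D(1,2)[OF assms(2), of "fst t" "snd t"] assms(3) by (simp add: mem_Times_iff)
  show 1: "(lab R' t, lab R s) \<in> stab_less" if "flag_stab R s \<subset> flag_stab R' t"
    unfolding stab_less_def lab_def using flag_stab_subgroup[OF assms(1,4)] flag_stab_subgroup[OF assms(2) t] flag_stab_fin[OF assms(2,3)] that by blast
  show "lab R' t = lab R s \<or> (lab R' t, lab R s) \<in> stab_less" if "flag_stab R s \<subseteq> flag_stab R' t"
  proof (cases "flag_stab R s = flag_stab R' t")
    case False
    then show ?thesis using 1 that by simp
  qed (simp add: lab_def)
qed

text \<open>By equivariance, whatever fixes a vertex fixes its parent. The comparisons of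
  stabilisers made for a fold come from here.\<close>

lemma par_st: assumes "req R" "par R p" "x \<in> W" shows "st R x \<subseteq> st R (p x)"
proof
  fix g assume g: "g \<in> st R x"
  then have "(p (wa g x), p x) \<in> R" "(p (wa g x), wa g (p x)) \<in> R" using parD(2,3)[OF assms(2)] assms(3) by (auto simp: st_def)
  then show "g \<in> st R (p x)" using g reqD(2,3)[OF assms(1)] unfolding st_def by blast
qed

lemma fflags_inv:
  assumes "req R" "par R p" "((x, y), (x', y')) \<in> flag_rel R"
  shows "(p x, y) \<in> R \<longleftrightarrow> (p x', y') \<in> R" "(p y, x) \<in> R \<longleftrightarrow> (p y', x') \<in> R" "col (pos x) = col (pos x')" "col (pos y) = col (pos y')"
proof -
  have *: "(p x', y') \<in> R" if "(p x, y) \<in> R" "g \<in> carrier G" "x \<in> W" "y \<in> W" "(wa g x, x') \<in> R" "(wa g y, y') \<in> R" for x y x' y' g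
  proof -
    have "(p (wa g x), p x') \<in> R" "(p (wa g x), wa g (p x)) \<in> R" "(wa g (p x), wa g y) \<in> R"
      using that parD(2,3)[OF assms(2)] reqD(6)[OF assms(1)] by blast+
    then show ?thesis using reqD(2,3)[OF assms(1)] that(6) by metis
  qed
  have **: "(p x, y) \<in> R \<longleftrightarrow> (p x', y') \<in> R" if t: "((x, y), (x', y')) \<in> flag_rel R" for x y x' y'
  proof -
    obtain g where "g \<in> carrier G" "x \<in> W" "y \<in> W" "(wa g x, x') \<in> R" "(wa g y, y') \<in> R" using t unfolding flag_rel_def by blast
    moreover obtain h where "h \<in> carrier G" "x' \<in> W" "y' \<in> W" "(wa h x', x) \<in> R" "(wa h y', y) \<in> R"
      using flag_rel_D(2)[OF assms(1) t] unfolding flag_rel_def by blast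
    ultimately show ?thesis using * by blast
  qed
  show "(p x, y) \<in> R \<longleftrightarrow> (p x', y') \<in> R" by (rule **[OF assms(3)])
  have "((y, x), (y', x')) \<in> flag_rel R" using assms(3) unfolding flag_rel_def by blast
  then show "(p y, x) \<in> R \<longleftrightarrow> (p y', x') \<in> R" by (rule **)
  obtain g where g: "g \<in> carrier G" "x \<in> W" "y \<in> W" "(wa g x, x') \<in> R" "(wa g y, y') \<in> R" using assms(3) unfolding flag_rel_def by blast
  then have "pos x' = pa g (pos x)" "pos y' = pa g (pos y)" using reqD(7)[OF assms(1)] pos_act by metis+
  then show "col (pos x) = col (pos x')" "col (pos y) = col (pos y')" using col_act g by auto
qed

lemma fflags_ad: "fflags k R p \<subseteq> ad" by (auto simp: fflags_def)

lemma ad_sub: "ad \<subseteq> W \<times> W" using ad_W by auto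

lemma fflags_equiv: "req R \<Longrightarrow> equiv (fflags k R p) (flag_rel R \<inter> fflags k R p \<times> fflags k R p)"
  using equiv_restr[OF flag_rel_equiv, of R "fflags k R p"] fflags_ad ad_sub by blast

lemma fin_quot:
  assumes R: "req R" and A: "A \<subseteq> ad"
  shows "finite (A // (flag_rel R \<inter> A \<times> A))"
proof -
  obtain F where F: "finite F" "F \<subseteq> ad" "\<forall>(x, y) \<in> ad. \<exists>g \<in> carrier G. \<exists>(x', y') \<in> F. x = wa g x' \<and> y = wa g y'"
    using fin_ad by blast
  have "A // (flag_rel R \<inter> A \<times> A) \<subseteq> (\<lambda>f. flag_rel R `` {f} \<inter> A) ` F"
  proof
    fix q assume "q \<in> A // (flag_rel R \<inter> A \<times> A)"
    then obtain t where t: "t \<in> A" "q = (flag_rel R \<inter> A \<times> A) `` {t}" by (rule quotientE)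
    obtain x y where xy: "t = (x, y)" "(x, y) \<in> ad" using t A by (metis surj_pair subsetD)
    then obtain g x' y' where g: "g \<in> carrier G" "(x', y') \<in> F" "x = wa g x'" "y = wa g y'" using F by blast
    have "((x', y'), t) \<in> flag_rel R" using g F(2) ad_W xy THI[OF R, of x' y' g x y] reqD(1)[OF R] by blast
    then have "q = flag_rel R `` {(x', y')} \<inter> A" using t flag_rel_D(2,3)[OF R] by blast
    then show "q \<in> (\<lambda>f. flag_rel R `` {f} \<inter> A) ` F" using g by blast
  qed
  then show ?thesis using F(1) finite_subset by blast
qed

lemma flag_mset_dom:
  assumes "req R" "req R'"
    and "\<And>t. t \<in> fflags k R' q \<Longrightarrow> f t \<in> fflags k R p" "\<And>t. t \<in> fflags k R' q \<Longrightarrow> lab R' t = lab R (f t) \<or> (lab R' t, lab R (f t)) \<in> stab_less"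
    and "\<And>t s. t \<in> fflags k R' q \<Longrightarrow> s \<in> fflags k R' q \<Longrightarrow> (t, s) \<notin> flag_rel R' \<Longrightarrow> (f t, f s) \<in> flag_rel R \<Longrightarrow> (lab R' t, lab R (f t)) \<in> stab_less"
  shows "mset_le stab_less (flag_mset k R' q) (flag_mset k R p)"
  unfolding flag_mset_def
  by (rule qmset_dom[OF fflags_equiv[OF assms(2)] fin_quot[OF assms(2) fflags_ad] fflags_equiv[OF assms(1)] fin_quot[OF assms(1) fflags_ad],
    where f = f]) (use assms lab_TH in blast)+

text \<open>Reversing a flag keeps the intersection of the two stabilisers. This makes the result of
  a fold independent of the colour of the vertex \<open>u\<close> at which it takes place.\<close>

lemma flag_mset_swap: assumes R: "req R" shows "flag_mset k R p = flag_mset (\<not> k) R p"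
  unfolding flag_mset_def
proof (rule qmset_eq[where f = prod.swap, OF fflags_equiv[OF R] fflags_equiv[OF R]])
  show "lab R b = lab R b'" if "(b, b') \<in> flag_rel R" for b b' using lab_TH[OF R that] .
  show "prod.swap t \<in> fflags (\<not> k) R p" if "t \<in> fflags k R p" for t
    using that ad_sym ad_col unfolding fflags_def by auto
  show "lab R t = lab R (prod.swap t)" for t unfolding lab_def flag_stab_def by (simp add: Int_commute)
  show "(prod.swap t, prod.swap s) \<in> flag_rel R \<longleftrightarrow> (t, s) \<in> flag_rel R" for t s
    unfolding flag_rel_def by (cases t, cases s) auto
  show "\<exists>t \<in> fflags k R p. (prod.swap t, b) \<in> flag_rel R" if "b \<in> fflags (\<not> k) R p" for b
  proof
    show "prod.swap b \<in> fflags k R p" using that ad_sym ad_col unfolding fflags_def by auto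
    have "b \<in> W \<times> W" using that fflags_ad ad_sub by blast
    then show "(prod.swap (prod.swap b), b) \<in> flag_rel R" using flag_rel_D(1)[OF R] by simp
  qed
qed

end

section \<open>Folding\<close>

text \<open>The fold identifies \<open>a\<close> with \<open>b\<close>. The new parent map sends the class of \<open>a\<close> to \<open>z\<close>, one of \<open>a\<close>, \<open>u\<close>, \<open>p a\<close>,
  \<open>p b\<close>; then at most the edges at \<open>u\<close> (\<open>Ae\<close>) and to the old parents (\<open>Ac\<close>) become flags, and each has to be
  dominated by a flag that the fold destroys.\<close>

locale fold_pair = ggraph +
  fixes R p u u' a b
  assumes R: "req R" and p: "par R p" and ua: "(u, a) \<in> ad" and ub: "(u', b) \<in> ad" and uu: "(u, u') \<in> R"
    and ab: "pos a = pos b" and nab: "(a, b) \<notin> R"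
begin

definition Gen where "Gen = {(wa g a, wa g b) | g. g \<in> carrier G} \<union> {(wa g b, wa g a) | g. g \<in> carrier G}"

definition R' where "R' = (R \<union> Gen)\<^sup>+"

abbreviation "k \<equiv> col (pos u)"

lemma inW: "u \<in> W" "u' \<in> W" "a \<in> W" "b \<in> W" using ad_W ua ub by blast+

lemma RR': "(x, y) \<in> R \<Longrightarrow> (x, y) \<in> R'" unfolding R'_def by blast
lemma RR'_sub: "R \<subseteq> R'" using RR' by auto

lemma R'_induct:
  assumes "(x, y) \<in> R'" "\<And>x y. (x, y) \<in> R \<Longrightarrow> P x y" "\<And>g. g \<in> carrier G \<Longrightarrow> P (wa g a) (wa g b)"
    "\<And>g. g \<in> carrier G \<Longrightarrow> P (wa g b) (wa g a)" "\<And>x y z. (x, y) \<in> R' \<Longrightarrow> P x y \<Longrightarrow> P y z \<Longrightarrow> P x z"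
  shows "P x y"
  using assms(1) unfolding R'_def
proof (induction rule: trancl_induct)
  case (base y)
  then show ?case using assms(2-4) unfolding Gen_def by blast
next
  case (step y z)
  then have "P y z" using assms(2-4) unfolding Gen_def by blast
  then show ?case using step assms(5)[of x y z] unfolding R'_def by blast
qed

lemma R': "req R'"
  unfolding req_def
proof (intro conjI ballI)
  have sub: "R \<union> Gen \<subseteq> W \<times> W" using inW wa_cl reqD(4,5)[OF R] unfolding Gen_def by auto
  show "equiv W R'"
  proof (rule equivI)
    show "R' \<subseteq> W \<times> W" unfolding R'_def using trancl_subset_Sigma[OF sub] .
    show "refl_on W R'" using RR' reqD(1)[OF R] by (auto intro: refl_onI)
    have "sym (R \<union> Gen)" using reqD(2)[OF R] unfolding Gen_def by (intro symI) blast
    then show "sym R'" unfolding R'_def by (rule sym_trancl)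
    show "trans R'" unfolding R'_def by (rule trans_trancl)
  qed
  have G1: "(wa g (wa h a), wa g (wa h b)) \<in> R'" "(wa g (wa h b), wa g (wa h a)) \<in> R'" if "g \<in> carrier G" "h \<in> carrier G" for g h
  proof -
    have "(wa (g \<otimes> h) a, wa (g \<otimes> h) b) \<in> Gen" "(wa (g \<otimes> h) b, wa (g \<otimes> h) a) \<in> Gen" using that unfolding Gen_def by blast+
    then show "(wa g (wa h a), wa g (wa h b)) \<in> R'" "(wa g (wa h b), wa g (wa h a)) \<in> R'"
      using wa_mult that inW unfolding R'_def by auto
  qed
  have "(wa g x, wa g y) \<in> R'" if g: "g \<in> carrier G" and xy: "(x, y) \<in> R'" for g x y
    using xy
  proof (rule R'_induct)
    show "(wa g x, wa g z) \<in> R'" if "(wa g x, wa g y) \<in> R'" "(wa g y, wa g z) \<in> R'" for x y z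
      using that unfolding R'_def by (rule trancl_trans)
    show "(wa g x, wa g y) \<in> R'" if "(x, y) \<in> R" for x y using RR'[OF reqD(6)[OF R g that]] .
  qed (use G1[OF g] in simp_all)
  then show "\<And>g xy. g \<in> carrier G \<Longrightarrow> xy \<in> R' \<Longrightarrow> case xy of (x, y) \<Rightarrow> (wa g x, wa g y) \<in> R'" by auto
  have "pos x = pos y" if "(x, y) \<in> R'" for x y
    using that by (rule R'_induct) (use reqD(7)[OF R] pos_act inW ab in auto)
  then show "\<And>xy. xy \<in> R' \<Longrightarrow> case xy of (x, y) \<Rightarrow> pos x = pos y" by auto
qed

lemma aR'b: "(a, b) \<in> R'"
proof -
  have "(wa \<one> a, wa \<one> b) \<in> Gen" unfolding Gen_def by blast
  then show ?thesis using wa_one inW unfolding R'_def by auto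
qed

definition hit where "hit g x \<longleftrightarrow> g \<in> carrier G \<and> ((wa g a, x) \<in> R \<or> (wa g b, x) \<in> R)"

text \<open>Only classes that take part in the identification get a new parent, namely the
  corresponding translate of \<open>z\<close>. Under \<open>Hz z\<close> the choice of
  \<open>g\<close> is immaterial modulo \<open>R'\<close>.\<close>

definition q where "q z x = (if \<exists>g. hit g x then wa (SOME g. hit g x) z else p x)"

text \<open>What makes \<open>q z\<close> a parent map: \<open>z\<close> may serve as parent of
  \<open>a\<close>, and it is fixed modulo \<open>R'\<close> by every element that carries one of
  \<open>a\<close>, \<open>b\<close> to one of them.\<close>

definition Hz where "Hz z \<longleftrightarrow> z \<in> W \<and> ((z, a) \<in> R' \<or> (z, a) \<in> adR R') \<and>
  (\<forall>g \<in> carrier G. \<forall>c \<in> {a, b}. \<forall>d \<in> {a, b}. (wa g c, d) \<in> R \<longrightarrow> (wa g z, z) \<in> R')"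

definition reducible where "reducible \<longleftrightarrow> (\<exists>q. par R' q \<and> mset_le stab_less (flag_mset k R' q) (flag_mset k R p))"

definition inequiv where "inequiv \<longleftrightarrow> (\<forall>g \<in> carrier G. (wa g a, b) \<notin> R)"

text \<open>Necessary for the merged edge between \<open>u\<close> and \<open>a\<close> to be a flag
  after the fold.\<close>

definition Ae where "Ae z \<longleftrightarrow> (z, u) \<notin> R' \<and> (p u, a) \<notin> R \<and> (p u, b) \<notin> R"
text \<open>Necessary for the edge from \<open>c\<close> to its old parent to be a flag after the
  fold that is not already accounted for as the merged edge.\<close>

definition Ac where "Ac z c \<longleftrightarrow> (p c, c) \<notin> R \<and> (z, p c) \<notin> R' \<and> (p c, u) \<notin> R \<and> ((p c, c), (u, a)) \<notin> flag_rel R'"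

text \<open>The flag \<open>s\<close> is destroyed by the fold and may pay for the new flag
  \<open>t\<close>: it is one of the two edges that become one, and its stabiliser is not
  larger.\<close>

definition good where "good s t \<longleftrightarrow> s \<in> fflags k R p \<and> s \<in> {(u, a), (u', b)} \<and> flag_stab R s \<subseteq> flag_stab R' t"
definition strict where "strict s t \<longleftrightarrow> flag_stab R s \<subset> flag_stab R' t"

lemma hit_R: "hit g x \<Longrightarrow> (x, y) \<in> R \<Longrightarrow> hit g y"
  using reqD(3)[OF R] unfolding hit_def by blast

lemma hit_wa: assumes "hit g x" "h \<in> carrier G" shows "hit (h \<otimes> g) (wa h x)"
proof -
  have g: "g \<in> carrier G" using assms hit_def by blast
  have "(wa h (wa g c), wa h x) \<in> R" if "(wa g c, x) \<in> R" for c using reqD(6)[OF R assms(2) that] .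
  then show ?thesis using assms g wa_mult[OF assms(2) g] inW unfolding hit_def by auto
qed

lemma hit_ab: "g \<in> carrier G \<Longrightarrow> hit g (wa g a)" "g \<in> carrier G \<Longrightarrow> hit g (wa g b)"
  unfolding hit_def using reqD(1)[OF R] wa_cl inW by blast+

lemma hit_id: "hit \<one> a" "hit \<one> b"
  using hit_ab[of \<one>] wa_one inW by auto

lemma hit_pos: "hit g x \<Longrightarrow> pos x = pa g (pos a)"
  using reqD(7)[OF R] pos_act inW ab unfolding hit_def by metis

lemma hit_col: assumes "hit g x" shows "col (pos x) \<noteq> k"
  using hit_pos[OF assms] col_act[of g a] assms inW ad_col[OF ua] unfolding hit_def by auto

lemma u_nhit: "\<not> hit g (wa h u)" if "h \<in> carrier G"
  using hit_col[of g "wa h u"] col_act[of h u] pos_act[of h u] inW that by auto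

text \<open>Two elements that hit \<open>x\<close> differ by one that carries an element of
  \<open>{a, b}\<close> to an element of \<open>{a, b}\<close>, and \<open>Hz z\<close> says that
  this one fixes \<open>z\<close>.\<close>

lemma q_hit: assumes "Hz z" "hit g x" shows "(q z x, wa g z) \<in> R'"
proof -
  define h where "h = (SOME g. hit g x)"
  have h: "hit h x" unfolding h_def using assms(2) by (rule someI)
  have gh: "g \<in> carrier G" "h \<in> carrier G" "inv g \<otimes> h \<in> carrier G" using h assms unfolding hit_def by auto
  have zW: "z \<in> W" using assms unfolding Hz_def by blast
  obtain c where c: "c \<in> {a, b}" "(wa h c, x) \<in> R" using h unfolding hit_def by blast
  obtain d where d: "d \<in> {a, b}" "(wa g d, x) \<in> R" using assms(2) unfolding hit_def by blast
  have cW: "c \<in> W" "d \<in> W" using c d inW by auto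
  have "(wa g d, wa h c) \<in> R" using c d reqD(2,3)[OF R] by metis
  then have "(d, wa (inv g) (wa h c)) \<in> R" using req_shift[OF R gh(1) cW(2)] gh cW wa_cl by simp
  then have "(wa (inv g \<otimes> h) c, d) \<in> R" using wa_mult[of "inv g" h c] gh cW reqD(2)[OF R] by simp
  then have "(wa (inv g \<otimes> h) z, z) \<in> R'" using assms(1) c d gh unfolding Hz_def by blast
  then have "(wa g (wa (inv g \<otimes> h) z), wa g z) \<in> R'" using reqD(6)[OF R'] gh by blast
  moreover have "wa g (wa (inv g \<otimes> h) z) = wa h z"
    using gh zW wa_mult[of g "inv g \<otimes> h" z] by (simp add: m_assoc[symmetric])
  moreover have "q z x = wa h z" unfolding q_def h_def using assms(2) by auto
  ultimately show ?thesis by simp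
qed

lemma q_nhit: "\<forall>g. \<not> hit g x \<Longrightarrow> q z x = p x" by (simp add: q_def)

lemma par_q: assumes "Hz z" shows "par R' (q z)"
  unfolding par_def
proof (intro conjI ballI)
  have zW: "z \<in> W" using assms unfolding Hz_def by blast
  show qW: "q z x \<in> W" if "x \<in> W" for x
  proof (cases "\<exists>g. hit g x")
    case True
    then show ?thesis using q_hit[OF assms] reqD(4)[OF R'] by blast
  qed (use q_nhit parD(1)[OF p that] in simp)
  have "(q z x, q z y) \<in> R'" if "(x, y) \<in> R'" for x y
    using that
  proof (rule R'_induct)
    show "(q z x, q z y) \<in> R'" if xy: "(x, y) \<in> R" for x y
    proof (cases "\<exists>g. hit g x")
      case True
      then obtain g where "hit g x" "hit g y" using hit_R xy by blast
      then show ?thesis using q_hit[OF assms] reqD(2,3)[OF R'] by metis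
    next
      case False
      then have "\<forall>g. \<not> hit g y" using hit_R[of _ y x] reqD(2)[OF R xy] by blast
      then show ?thesis using q_nhit False RR' parD(2)[OF p xy] by auto
    qed
    show "(q z (wa g a), q z (wa g b)) \<in> R'" "(q z (wa g b), q z (wa g a)) \<in> R'" if "g \<in> carrier G" for g
      using q_hit[OF assms] hit_ab[OF that] reqD(2,3)[OF R'] by metis+
    show "(q z x, q z y) \<in> R'" if "(q z x, q z w) \<in> R'" "(q z w, q z y) \<in> R'" for x w y
      using that reqD(3)[OF R'] by metis
  qed
  then show "\<And>xy. xy \<in> R' \<Longrightarrow> case xy of (x, y) \<Rightarrow> (q z x, q z y) \<in> R'" by auto
  show "(q z (wa g x), wa g (q z x)) \<in> R'" if g: "g \<in> carrier G" and x: "x \<in> W" for g x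
  proof (cases "\<exists>h. hit h x")
    case True
    then obtain h where h: "hit h x" by blast
    then have hG: "h \<in> carrier G" unfolding hit_def by blast
    have "(q z (wa g x), wa (g \<otimes> h) z) \<in> R'" using q_hit[OF assms hit_wa[OF h g]] .
    moreover have "(wa g (q z x), wa g (wa h z)) \<in> R'" using reqD(6)[OF R' g q_hit[OF assms h]] .
    ultimately show ?thesis using wa_mult[OF g hG zW] reqD(2,3)[OF R'] by metis
  next
    case False
    have "\<not> hit h (wa g x)" for h
      using False hit_wa[of h "wa g x" "inv g"] g wa_inv[OF g x] by auto
    then show ?thesis using q_nhit False parD(3)[OF p g x] RR' by auto
  qed
  show "(q z x, x) \<in> R' \<or> (q z x, x) \<in> adR R'" if x: "x \<in> W" for x
  proof (cases "\<exists>h. hit h x")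
    case True
    then obtain h where h: "hit h x" by blast
    then have hG: "h \<in> carrier G" unfolding hit_def by blast
    have 1: "(q z x, wa h z) \<in> R'" "(wa h z, q z x) \<in> R'" using q_hit[OF assms h] reqD(2)[OF R'] by blast+
    have "(wa h b, wa h a) \<in> R'" using reqD(2,6)[OF R'] aR'b hG by blast
    then have 2: "(wa h a, x) \<in> R'" using h RR' reqD(2,3)[OF R'] unfolding hit_def by metis
    show ?thesis
    proof (cases "(z, a) \<in> R'")
      case True
      then have "(wa h z, wa h a) \<in> R'" using reqD(6)[OF R' hG] by blast
      then show ?thesis using 1 2 reqD(3)[OF R'] by metis
    next
      case False
      then have "(wa h z, wa h a) \<in> adR R'" using adR_act[OF R' _ hG] assms unfolding Hz_def by blast
      then show ?thesis using adR_R[OF R' _ 1(2) 2] by blast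
    qed
  next
    case False
    then show ?thesis using q_nhit parD(4)[OF p x] RR' adR_mono[OF RR'_sub] by auto
  qed
qed

lemma st_mono: "st R x \<subseteq> st R' x" unfolding st_def using RR' by blast
lemma flag_stab_mono: "flag_stab R x \<subseteq> flag_stab R' x" unfolding flag_stab_def using st_mono by blast

lemma flag_rel_up: "(t, s) \<in> flag_rel R \<Longrightarrow> (t, s) \<in> flag_rel R'" using flag_rel_mono[OF RR'_sub] by blast

lemma o_TH: "((u, a), (u', b)) \<in> flag_rel R'"
  using THI[OF R', of u a \<one> u' b] inW wa_one RR'[OF uu] aR'b by simp

text \<open>Bookkeeping for all cases. A flag after the fold is the merged edge, an edge from
  \<open>a\<close> or \<open>b\<close> to its old parent, or an old flag; the first three are paid
  for by \<open>se\<close>, \<open>sa\<close> and \<open>sb\<close>, and an old flag by itself. The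
  hypotheses \<open>c1\<close> to \<open>c3\<close> treat payments that coincide.\<close>

lemma fold_core:
  assumes z: "Hz z"
    and e: "Ae z \<Longrightarrow> good se (u, a)"
    and ea: "Ac z a \<Longrightarrow> good sa (p a, a)"
    and eb: "Ac z b \<Longrightarrow> inequiv \<Longrightarrow> good sb (p b, b)"
    and c1: "Ae z \<Longrightarrow> Ac z a \<Longrightarrow> (se, sa) \<in> flag_rel R \<Longrightarrow> strict se (u, a) \<and> strict sa (p a, a)"
    and c2: "Ae z \<Longrightarrow> Ac z b \<Longrightarrow> inequiv \<Longrightarrow> (se, sb) \<in> flag_rel R \<Longrightarrow> strict se (u, a) \<and> strict sb (p b, b)"
    and c3: "Ac z a \<Longrightarrow> Ac z b \<Longrightarrow> inequiv \<Longrightarrow> (sa, sb) \<in> flag_rel R \<Longrightarrow> strict sa (p a, a) \<and> strict sb (p b, b)"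
  shows reducible
proof -
  define A where "A = fflags k R' (q z)"
  define C1 where "C1 t \<longleftrightarrow> (t, (u, a)) \<in> flag_rel R'" for t
  define C2 where "C2 t \<longleftrightarrow> \<not> C1 t \<and> (t, (p a, a)) \<in> flag_rel R" for t
  define C3 where "C3 t \<longleftrightarrow> \<not> C1 t \<and> \<not> C2 t \<and> (t, (p b, b)) \<in> flag_rel R" for t
  define C4 where "C4 t \<longleftrightarrow> \<not> C1 t \<and> \<not> C2 t \<and> \<not> C3 t" for t
  define f where "f t = (if C1 t then se else if C2 t then sa else if C3 t then sb else t)" for t
  note q = par_q[OF z]
  have AeI: "Ae z" if t: "t \<in> A" "C1 t" for t
  proof -
    obtain x y where xy: "t = (x, y)" "((x, y), (u, a)) \<in> flag_rel R'" using t C1_def by (metis surj_pair)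
    have "(q z x, y) \<notin> R'" "(q z y, x) \<notin> R'" using t(1) xy unfolding A_def fflags_def by auto
    then have *: "(q z u, a) \<notin> R'" "(q z a, u) \<notin> R'" using fflags_inv[OF R' q xy(2)] by auto
    have "(q z a, z) \<in> R'" using q_hit[OF z hit_id(1)] wa_one z unfolding Hz_def by auto
    moreover have "q z u = p u" using q_nhit u_nhit[of \<one>] wa_one inW by simp
    ultimately show ?thesis using * RR' aR'b reqD(2,3)[OF R'] unfolding Ae_def by metis
  qed
  have AcI: "Ac z c" if t: "t \<in> A" "\<not> C1 t" and c: "c = a \<or> c = b" and th: "(t, (p c, c)) \<in> flag_rel R" for t c
  proof -
    have cW: "c \<in> W" using c inW by blast
    obtain x y where xy: "t = (x, y)" "((x, y), (p c, c)) \<in> flag_rel R" using th by (metis surj_pair)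
    have t': "(x, y) \<in> ad" "col (pos x) = k" "(q z y, x) \<notin> R'" using t(1) xy unfolding A_def fflags_def by auto
    have "col (pos x) \<noteq> col (pos y)" using ad_col[OF t'(1)] .
    then have pcc: "(p c, c) \<notin> R" using fflags_inv(3,4)[OF R p xy(2)] reqD(7)[OF R] by metis
    have "(q z c, p c) \<notin> R'" using fflags_inv(2)[OF R' q flag_rel_up[OF xy(2)]] t' by auto
    moreover have "hit \<one> c" using hit_id c by blast
    then have "(q z c, z) \<in> R'" using q_hit[OF z, of \<one> c] wa_one z unfolding Hz_def by auto
    ultimately have "(z, p c) \<notin> R'" using reqD(3)[OF R'] by metis
    moreover have "(p c, u) \<notin> R"
    proof
      assume "(p c, u) \<in> R"
      then have "(p c, u) \<in> R'" "(c, a) \<in> R'" using RR' c aR'b reqD(1,2)[OF R'] inW by blast+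
      then have "((p c, c), (u, a)) \<in> flag_rel R'" using THI[OF R', of "p c" c \<one> u a] wa_one parD(1)[OF p cW] cW by simp
      then have "C1 t" unfolding C1_def using xy flag_rel_D(3)[OF R' flag_rel_up[OF xy(2)]] by blast
      then show False using t by blast
    qed
    moreover have "((p c, c), (u, a)) \<notin> flag_rel R'"
      using t flag_rel_D(2,3)[OF R'] flag_rel_up[OF th] unfolding C1_def by blast
    ultimately show ?thesis using pcc unfolding Ac_def by blast
  qed
  \<comment> \<open>If \<open>a\<close> and \<open>b\<close> lie in one orbit, then so do their
    edges to the old parents, and \<open>C2\<close> already covers both.\<close>
  have C3_nor: inequiv if "C3 t" for t
    unfolding inequiv_def
  proof (intro ballI notI)
    fix g assume g: "g \<in> carrier G" "(wa g a, b) \<in> R"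
    have "(p (wa g a), p b) \<in> R" "(p (wa g a), wa g (p a)) \<in> R" using g parD(2,3)[OF p] inW by blast+
    then have "(wa g (p a), p b) \<in> R" using reqD(2,3)[OF R] by metis
    then have "((p a, a), (p b, b)) \<in> flag_rel R" using THI[OF R, of "p a" a g] g inW parD(1)[OF p] by blast
    then have "(t, (p a, a)) \<in> flag_rel R" using that flag_rel_D(2,3)[OF R] unfolding C3_def by blast
    then show False using that unfolding C3_def C2_def by blast
  qed
  have dflt: "t \<in> fflags k R p" if t: "t \<in> A" "C4 t" for t
  proof -
    obtain x y where xy: "t = (x, y)" "(x, y) \<in> ad" "col (pos x) = k" "(q z x, y) \<notin> R'" "(q z y, x) \<notin> R'"
      using t unfolding A_def fflags_def by auto
    have W: "x \<in> W" "y \<in> W" using ad_W xy by blast+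
    have "\<forall>g. \<not> hit g x" using hit_col xy(3) by blast
    then have 1: "(p x, y) \<notin> R" using q_nhit xy RR' by metis
    have "(p y, x) \<notin> R"
    proof
      assume py: "(p y, x) \<in> R"
      have "\<exists>g. hit g y" using py q_nhit xy(5) RR' by metis
      then obtain g c where g: "g \<in> carrier G" "(wa g c, y) \<in> R" "c = a \<or> c = b" unfolding hit_def by blast
      have cW: "c \<in> W" using g inW by blast
      have "(p (wa g c), p y) \<in> R" "(p (wa g c), wa g (p c)) \<in> R" using g parD(2,3)[OF p] cW by blast+
      then have "(wa g (p c), x) \<in> R" using py reqD(2,3)[OF R] by metis
      then have "((p c, c), (x, y)) \<in> flag_rel R" using THI[OF R, of "p c" c g x y] g cW parD(1)[OF p] by blast
      then have "(t, (p c, c)) \<in> flag_rel R" using flag_rel_D(2)[OF R] xy by blast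
      then show False using t g(3) unfolding C4_def C3_def C2_def by blast
    qed
    then show ?thesis using xy 1 unfolding fflags_def by auto
  qed
  have special: "good (f t) s \<and> (t, s) \<in> flag_rel R' \<and> s \<in> adR R'"
    if t: "t \<in> A" "\<not> C4 t" and s: "s = (if C1 t then (u, a) else if C2 t then (p a, a) else (p b, b))" for t s
  proof -
    have adc: "(p c, c) \<in> adR R'" if "(p c, c) \<notin> R" "c \<in> W" for c using parD(4)[OF p] that adR_mono[OF RR'_sub] by blast
    consider "C1 t" | "C2 t" | "C3 t" using t C4_def by blast
    then show ?thesis
    proof cases
      case 1
      then show ?thesis using e AeI[OF t(1)] s ad_adR[OF R' ua] unfolding f_def C1_def by auto
    next
      case 2
      then have "\<not> C1 t" "(t, (p a, a)) \<in> flag_rel R" unfolding C2_def by blast+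
      moreover then have "Ac z a" using AcI[OF t(1), of a] by blast
      ultimately show ?thesis using ea s 2 flag_rel_up adc inW unfolding f_def Ac_def by auto
    next
      case 3
      then have "\<not> C1 t" "\<not> C2 t" "(t, (p b, b)) \<in> flag_rel R" unfolding C3_def by blast+
      moreover then have "Ac z b" using AcI[OF t(1), of b] by blast
      ultimately show ?thesis using eb C3_nor[OF 3] s 3 flag_rel_up adc inW unfolding f_def Ac_def by auto
    qed
  qed
  \<comment> \<open>A new flag equivalent to one of the two edges being merged belongs to
    \<open>C1\<close>. Hence an old flag that pays for itself never collides with \<open>se\<close>,
    \<open>sa\<close> or \<open>sb\<close>.\<close>
  have oC: "C1 t" if "(t, s) \<in> flag_rel R" "s \<in> {(u, a), (u', b)}" for t s
    using that flag_rel_up flag_rel_D(2,3)[OF R'] o_TH unfolding C1_def by blast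
  have npW: "s \<in> fflags k R p \<Longrightarrow> s \<in> W \<times> W" for s using fflags_ad ad_sub by blast
  have ltrI: "(lab R' t, lab R (f t)) \<in> stab_less"
    if "t \<in> A" "\<not> C4 t" "s = (if C1 t then (u, a) else if C2 t then (p a, a) else (p b, b))" "strict (f t) s" for t s
  proof -
    note sp = special[OF that(1-3)]
    have "(lab R' s, lab R (f t)) \<in> stab_less"
      by (rule lab_le(2)[OF R R']) (use sp that(4) npW in \<open>auto simp: good_def strict_def\<close>)
    then show ?thesis using lab_TH[OF R'] sp by metis
  qed
  have "mset_le stab_less (flag_mset k R' (q z)) (flag_mset k R p)"
  proof (rule flag_mset_dom[OF R R', where f = f], unfold A_def[symmetric])
    show "f t \<in> fflags k R p" if t: "t \<in> A" for t
      using special[OF t _ refl] dflt[OF t] unfolding good_def f_def C4_def by auto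
    show "lab R' t = lab R (f t) \<or> (lab R' t, lab R (f t)) \<in> stab_less" if t: "t \<in> A" for t
    proof (cases "C4 t")
      case True
      then have ft: "f t = t" by (simp add: f_def C4_def)
      have "t \<in> adR R'" using t fflags_ad ad_adR[OF R'] unfolding A_def by (metis subsetD surj_pair)
      then show ?thesis using lab_le(1)[OF R R', of t t] flag_stab_mono ft npW[OF dflt[OF t True]] by simp
    next
      case False
      define s where "s = (if C1 t then (u, a) else if C2 t then (p a, a) else (p b, b))"
      note sp = special[OF t False s_def]
      then have "lab R' s = lab R (f t) \<or> (lab R' s, lab R (f t)) \<in> stab_less"
        by (intro lab_le(1)[OF R R']) (use npW in \<open>auto simp: good_def\<close>)
      then show ?thesis using lab_TH[OF R'] sp by metis
    qed
    show "(lab R' t, lab R (f t)) \<in> stab_less" if t: "t \<in> A" "s \<in> A" "(t, s) \<notin> flag_rel R'" "(f t, f s) \<in> flag_rel R" for t s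
    proof -
      have f4: "\<not> C4 s \<Longrightarrow> f s \<in> {(u, a), (u', b)}" "\<not> C4 t \<Longrightarrow> f t \<in> {(u, a), (u', b)}"
        using special[OF t(1) _ refl] special[OF t(2) _ refl] unfolding good_def by blast+
      have n4: "\<not> C4 t" "\<not> C4 s"
      proof -
        have i: "f r = r" if "C4 r" for r using that by (simp add: f_def C4_def)
        have "C4 t \<Longrightarrow> C4 s \<Longrightarrow> False" using t i flag_rel_up by auto
        moreover have "C4 t \<Longrightarrow> \<not> C4 s \<Longrightarrow> False" using t(4) i oC[of t "f s"] f4 C4_def by auto
        moreover have "C4 s \<Longrightarrow> \<not> C4 t \<Longrightarrow> False" using flag_rel_D(2)[OF R t(4)] i oC[of s "f t"] f4 C4_def by auto
        ultimately show "\<not> C4 t" "\<not> C4 s" by blast+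
      qed
      have both: False if "(t, r) \<in> flag_rel R'" "(s, r) \<in> flag_rel R'" for r using t that flag_rel_D(2,3)[OF R'] by blast
      have d: "C1 t \<or> C2 t \<or> C3 t" "C1 s \<or> C2 s \<or> C3 s" using n4 unfolding C4_def by blast+
      have x1: "\<not> (C1 t \<and> C1 s)" using both[of "(u, a)"] unfolding C1_def by blast
      have x2: "\<not> (C2 t \<and> C2 s)" using both[of "(p a, a)"] flag_rel_up unfolding C2_def by blast
      have x3: "\<not> (C3 t \<and> C3 s)" using both[of "(p b, b)"] flag_rel_up unfolding C3_def by blast
      have fs: "C1 r \<Longrightarrow> f r = se" "C2 r \<Longrightarrow> f r = sa" "C3 r \<Longrightarrow> f r = sb" for r
        unfolding f_def C3_def C2_def by auto
      have ad: "C2 r \<Longrightarrow> Ac z a" "C3 r \<Longrightarrow> Ac z b" if "r \<in> A" for r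
        using AcI[OF that, of a] AcI[OF that, of b] unfolding C3_def C2_def by blast+
      note sy = flag_rel_D(2)[OF R t(4)]
      have "strict (f t) (if C1 t then (u, a) else if C2 t then (p a, a) else (p b, b))"
      proof (cases "C1 t")
        case True
        have "C2 s \<or> C3 s" using x1 d True by blast
        then show ?thesis using c1 c2 AeI[OF t(1) True] ad[OF t(2)] C3_nor[of s] t(4) fs[of t] fs[of s] True by auto
      next
        case n1: False
        show ?thesis
        proof (cases "C2 t")
          case True
          then have "C1 s \<or> C3 s" using x2 d by blast
          then show ?thesis using c1 c3 AeI[OF t(2)] ad[OF t(2)] ad[OF t(1)] C3_nor[of s] t(4) sy fs[of t] fs[of s] True n1 by auto
        next
          case False
          then have "C3 t" using d n1 by blast
          moreover then have "C1 s \<or> C2 s" using x3 d by blast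
          ultimately show ?thesis using c2 c3 AeI[OF t(2)] ad[OF t(2)] ad[OF t(1)] C3_nor[of t] t(4) sy fs[of t] fs[of s] False n1 by auto
        qed
      qed
      then show ?thesis using ltrI[OF t(1) n4(1) refl] by blast
    qed
  qed
  then show ?thesis unfolding reducible_def using q by blast
qed

lemma st_u': "st R u' = st R u" using st_R[OF R uu] by simp

lemma fflags_oa: "(p u, a) \<notin> R \<Longrightarrow> (p a, u) \<notin> R \<Longrightarrow> (u, a) \<in> fflags k R p"
  using ua by (simp add: fflags_def)

lemma fflags_ob: assumes "(p u, b) \<notin> R" "(p b, u) \<notin> R" shows "(u', b) \<in> fflags k R p"
proof -
  have "(p u', b) \<notin> R" using parD(2)[OF p uu] assms reqD(3)[OF R] by metis
  moreover have "(p b, u') \<notin> R" using assms uu reqD(2,3)[OF R] by metis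
  ultimately show ?thesis using ub reqD(7)[OF R uu] by (simp add: fflags_def)
qed

lemma st_p: "x \<in> W \<Longrightarrow> st R x \<subseteq> st R (p x)" using par_st[OF R p] .

lemma st_eq': "(x, y) \<in> R' \<Longrightarrow> st R' x = st R' y" using st_R[OF R'] .

lemma st_pR: "x \<in> W \<Longrightarrow> (p x, y) \<in> R \<Longrightarrow> st R x \<subseteq> st R y" using st_p st_R[OF R] by metis

lemma sub_e: "st R u \<inter> st R a \<subseteq> flag_stab R' (u, a)" "st R u \<inter> st R b \<subseteq> flag_stab R' (u, a)"
  using st_mono[of u] st_mono[of a] st_mono[of b] st_eq'[OF aR'b] unfolding flag_stab_def by auto

lemma sub_a: "st R a \<subseteq> flag_stab R' (p a, a)" and sub_b: "st R b \<subseteq> flag_stab R' (p b, b)"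
  using st_mono st_p inW unfolding flag_stab_def by fastforce+

lemma flag_stab_oa: "flag_stab R (u, a) = st R u \<inter> st R a" and flag_stab_ob: "flag_stab R (u', b) = st R u \<inter> st R b"
  unfolding flag_stab_def using st_u' by auto

text \<open>When \<open>a\<close> and \<open>b\<close> lie in different orbits, the elements in the
  condition of \<open>Hz\<close> are just those of the two stabilisers.\<close>

lemma Hz_nor:
  assumes inequiv "z \<in> W" "(z, a) \<in> R' \<or> (z, a) \<in> adR R'" "st R a \<subseteq> st R' z" "st R b \<subseteq> st R' z"
  shows "Hz z"
proof -
  have "(wa g z, z) \<in> R'" if g: "g \<in> carrier G" "(wa g c, d) \<in> R" "c \<in> {a, b}" "d \<in> {a, b}" for g c d
  proof -
    have "\<not> (c = a \<and> d = b)" using assms(1) g unfolding inequiv_def by blast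
    moreover have "\<not> (c = b \<and> d = a)"
    proof
      assume "c = b \<and> d = a"
      then have "(wa (inv g) a, b) \<in> R" using g req_shift[OF R g(1), of b a] reqD(2)[OF R] inW by auto
      then show False using assms(1) g unfolding inequiv_def by auto
    qed
    ultimately have "g \<in> st R a \<or> g \<in> st R b" using g unfolding st_def by auto
    then have "g \<in> st R' z" using assms by blast
    then show ?thesis by (simp add: st_def)
  qed
  then show ?thesis unfolding Hz_def using assms by blast
qed

text \<open>When \<open>h\<close> carries \<open>a\<close> to \<open>b\<close>, every element in the
  condition of \<open>Hz\<close> is a product of elements of \<open>st R a\<close>, \<open>h\<close>
  and \<open>inv h\<close>.\<close>

lemma Hz_h:
  assumes h: "h \<in> carrier G" "(wa h a, b) \<in> R" and z: "z \<in> W" "(z, a) \<in> R' \<or> (z, a) \<in> adR R'"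
    and s: "st R a \<subseteq> st R' z" "h \<in> st R' z"
  shows "Hz z"
proof -
  note sg = st_subgroup[OF R' z(1)]
  have over_pt: "x \<otimes> y \<in> st R' z" if "x \<in> st R' z" "y \<in> st R' z" for x y using subgroup.m_closed[OF sg that] .
  have hi: "inv h \<in> st R' z" using subgroup.m_inv_closed[OF sg s(2)] .
  have bh: "(b, wa h a) \<in> R" using h reqD(2)[OF R] by blast
  have ga: "g \<in> st R' z" if "g \<in> carrier G" "(wa g a, a) \<in> R" for g using that s unfolding st_def by blast
  have gab: "g \<in> st R' z" if g: "g \<in> carrier G" "(wa g a, b) \<in> R" for g
  proof -
    have "(wa g a, wa h a) \<in> R" using g bh reqD(3)[OF R] by metis
    then have "(wa (inv h) (wa g a), a) \<in> R" using req_shift[OF R, of "inv h" "wa g a" a] h g wa_cl inW by simp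
    then have "inv h \<otimes> g \<in> st R' z" using ga[of "inv h \<otimes> g"] wa_mult g h inW by simp
    then have "h \<otimes> (inv h \<otimes> g) \<in> st R' z" using over_pt s by blast
    then show ?thesis using g h by (simp add: m_assoc[symmetric])
  qed
  have gb: "g \<in> st R' z" if g: "g \<in> carrier G" "(wa g b, a) \<in> R \<or> (wa g b, b) \<in> R" for g
  proof -
    have "(wa g (wa h a), wa g b) \<in> R" using reqD(6)[OF R g(1) h(2)] .
    then have "(wa (g \<otimes> h) a, a) \<in> R \<or> (wa (g \<otimes> h) a, b) \<in> R" using g reqD(3)[OF R] wa_mult[OF g(1) h(1)] inW by metis
    then have "g \<otimes> h \<in> st R' z" using ga gab g h by blast
    then have "g \<otimes> h \<otimes> inv h \<in> st R' z" using over_pt hi by blast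
    then show ?thesis using g h by (simp add: m_assoc)
  qed
  have "(wa g z, z) \<in> R'" if g: "g \<in> carrier G" "(wa g c, d) \<in> R" "c \<in> {a, b}" "d \<in> {a, b}" for g c d
  proof -
    have "g \<in> st R' z" using g ga gab gb by blast
    then show ?thesis by (simp add: st_def)
  qed
  then show ?thesis unfolding Hz_def using z by blast
qed

lemma aW': "(a, a) \<in> R'" "(u, a) \<in> adR R'" using reqD(1)[OF R'] inW ad_adR[OF R' ua] by blast+

lemma Hz_u: "inequiv \<Longrightarrow> st R a \<subseteq> st R u \<Longrightarrow> st R b \<subseteq> st R u \<Longrightarrow> Hz u"
  using Hz_nor[of u] aW' inW st_mono[of u] by blast

lemma Hz_a: "inequiv \<Longrightarrow> Hz a"
  using Hz_nor[of a] aW' inW st_mono[of a] st_mono[of b] st_eq'[OF aR'b] by blast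

lemma Hz_pa: "inequiv \<Longrightarrow> st R b \<subseteq> st R (p a) \<Longrightarrow> Hz (p a)"
  using Hz_nor[of "p a"] parD(1,4)[OF p inW(3)] RR' adR_mono[OF RR'_sub] st_p[OF inW(3)] st_mono[of "p a"] by blast

lemma Hz_pb: "inequiv \<Longrightarrow> st R a \<subseteq> st R (p b) \<Longrightarrow> Hz (p b)"
proof -
  assume n: inequiv "st R a \<subseteq> st R (p b)"
  have "(p b, b) \<in> R' \<or> (p b, b) \<in> adR R'" using parD(4)[OF p inW(4)] RR' adR_mono[OF RR'_sub] by blast
  then have "(p b, a) \<in> R' \<or> (p b, a) \<in> adR R'"
    using reqD(2,3)[OF R'] aR'b adR_R[OF R', of "p b" b "p b" a] reqD(1)[OF R'] parD(1)[OF p inW(4)] by metis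
  then show ?thesis using Hz_nor[of "p b"] n parD(1)[OF p inW(4)] st_p[OF inW(4)] st_mono[of "p b"] by blast
qed

lemma pu_not_both: "(p u, a) \<in> R \<Longrightarrow> (p u, b) \<notin> R"
  using nab reqD(2,3)[OF R] by metis

lemma Ac_p: "\<not> Ac (p c) c" if "c \<in> W" for c
  unfolding Ac_def using reqD(1)[OF R'] parD(1)[OF p that] by blast

lemma Ae_u: "\<not> Ae u" unfolding Ae_def using reqD(1)[OF R'] inW by blast

lemma inc_strict: "\<not> A \<subseteq> B \<Longrightarrow> D \<subseteq> A \<Longrightarrow> D \<subseteq> B \<Longrightarrow> A \<subseteq> S \<Longrightarrow> D \<subset> S" by blast

lemma o_nTH: "inequiv \<Longrightarrow> ((u, a), (u', b)) \<notin> flag_rel R" "inequiv \<Longrightarrow> ((u', b), (u, a)) \<notin> flag_rel R"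
proof -
  show 1: "((u, a), (u', b)) \<notin> flag_rel R" if inequiv using that unfolding flag_rel_def inequiv_def by blast
  show "((u', b), (u, a)) \<notin> flag_rel R" if inequiv using 1[OF that] flag_rel_D(2)[OF R] by blast
qed

lemmas gs = good_def strict_def flag_stab_oa flag_stab_ob

text \<open>The merged edge joins \<open>u\<close> to its parent and is no flag; only the two old
  parent edges matter. If \<open>p b\<close> is \<open>u\<close>, nothing has to be paid. Otherwise
  \<open>(u', b)\<close> is available. The new parent is that of the vertex with the larger
  stabiliser; if the stabilisers are incomparable, the merged vertex becomes its own parent, and
  both edges to the old parents have strictly larger stabilisers than
  \<open>(u', b)\<close>.\<close>

lemma case1:
  assumes n: inequiv and pu: "(p u, a) \<in> R"
  shows reducible
proof -
  have pub: "(p u, b) \<notin> R" using pu_not_both pu by blast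
  have Ae: "\<not> Ae z" for z using pu by (simp add: Ae_def)
  have UA: "st R u \<subseteq> st R a" using st_pR[OF inW(1) pu] .
  show ?thesis
  proof (cases "(p b, u) \<in> R")
    case True
    have "st R b \<subseteq> st R u" using st_pR[OF inW(4) True] .
    then have "Hz (p a)" using Hz_pa[OF n] UA st_p[OF inW(3)] by blast
    then show ?thesis by (rule fold_core[where sa = "(u,a)" and sb = "(u,a)" and se = "(u,a)"]) (use Ae Ac_p[OF inW(3)] True in \<open>auto simp: Ac_def\<close>)
  next
    case False
    have ob: "(u', b) \<in> fflags k R p" using fflags_ob[OF pub False] .
    consider "st R b \<subseteq> st R a" | "st R a \<subseteq> st R b" | "\<not> st R b \<subseteq> st R a" "\<not> st R a \<subseteq> st R b" by blast
    then show ?thesis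
    proof cases
      case 1
      then have "Hz (p a)" using Hz_pa[OF n] st_p[OF inW(3)] by blast
      then show ?thesis by (rule fold_core[where sa = "(u',b)" and sb = "(u',b)" and se = "(u',b)"]) (use Ae Ac_p[OF inW(3)] ob sub_b in \<open>auto simp: gs\<close>)
    next
      case 2
      then have "Hz (p b)" using Hz_pb[OF n] st_p[OF inW(4)] by blast
      then show ?thesis by (rule fold_core[where sa = "(u',b)" and sb = "(u',b)" and se = "(u',b)"])
         (use Ae Ac_p[OF inW(4)] ob sub_a UA in \<open>auto simp: gs\<close>)
    next
      case 3
      have s: "strict (u', b) (p a, a)" "strict (u', b) (p b, b)"
        using inc_strict[OF 3(2) _ _ sub_a, of "st R u \<inter> st R b"] inc_strict[OF 3(1) _ _ sub_b, of "st R u \<inter> st R b"] UA unfolding gs by auto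
      show ?thesis by (rule fold_core[where sa = "(u',b)" and sb = "(u',b)" and se = "(u',b)", OF Hz_a[OF n]])
         (use s Ae ob in \<open>auto simp: gs\<close>)
    qed
  qed
qed

text \<open>Only \<open>(u', b)\<close> can pay, and the edge from \<open>a\<close> to its parent is
  the merged edge itself. With \<open>p b\<close> or \<open>u\<close> as new parent at most one new
  flag appears. If the stabilisers forbid both, the merged vertex becomes its own parent, and the
  two possible new flags have strictly larger stabilisers than \<open>(u', b)\<close>.\<close>

lemma case2b:
  assumes n: inequiv and pu: "(p u, a) \<notin> R" "(p u, b) \<notin> R" and pa: "(p a, u) \<in> R" "(p b, u) \<notin> R"
  shows reducible
proof -
  have AU: "st R a \<subseteq> st R u" using st_pR[OF inW(3) pa(1)] .
  have ob: "(u', b) \<in> fflags k R p" using fflags_ob[OF pu(2) pa(2)] .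
  have na: "\<not> Ac z a" for z using pa by (simp add: Ac_def)
  have ge: "good (u', b) (u, a)" using ob sub_e by (simp add: gs)
  consider "st R a \<subseteq> st R b" | "st R b \<subseteq> st R u" | "\<not> st R b \<subseteq> st R u" "\<not> st R a \<subseteq> st R b" by blast
  then show ?thesis
  proof cases
    case 1
    then have "Hz (p b)" using Hz_pb[OF n] st_p[OF inW(4)] by blast
    then show ?thesis by (rule fold_core[where sa = "(u',b)" and sb = "(u',b)" and se = "(u',b)"])
         (use na Ac_p[OF inW(4)] ge in auto)
  next
    case 2
    have "good (u', b) (p b, b)" using ob sub_b by (auto simp: gs)
    then show ?thesis by (intro fold_core[where sa = "(u',b)" and sb = "(u',b)" and se = "(u',b)", OF Hz_u[OF n AU 2]])
         (use na Ae_u in auto)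
  next
    case 3
    have g: "good (u', b) (p b, b)" using ob sub_b by (auto simp: gs)
    have s: "strict (u', b) (u, a)" "strict (u', b) (p b, b)"
      using 3 AU sub_e sub_b inc_strict[OF 3(1) _ _ sub_b, of "st R u \<inter> st R b"] unfolding gs by auto
    show ?thesis by (rule fold_core[where sa = "(u',b)" and sb = "(u',b)" and se = "(u',b)", OF Hz_a[OF n]])
         (use s na g ge in auto)
  qed
qed

text \<open>The parent of \<open>b\<close> serves both, as \<open>b\<close> has the larger
  stabiliser. The two destroyed flags are inequivalent: \<open>(u', b)\<close> pays for the merged
  edge, and \<open>(u, a)\<close> for the edge from \<open>a\<close> to its old parent.\<close>

lemma case2c_le:
  assumes n: inequiv and pu: "(p u, a) \<notin> R" "(p u, b) \<notin> R" and pa: "(p a, u) \<notin> R" "(p b, u) \<notin> R"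
    and AB: "st R a \<subseteq> st R b"
  shows reducible
proof -
  have oa: "(u, a) \<in> fflags k R p" "(u', b) \<in> fflags k R p" using fflags_oa[OF pu(1) pa(1)] fflags_ob[OF pu(2) pa(2)] .
  have "good (u', b) (u, a)" "good (u, a) (p a, a)" using oa sub_e sub_a by (auto simp: gs)
  moreover have "Hz (p b)" using Hz_pb[OF n] st_p[OF inW(4)] AB by blast
  ultimately show ?thesis by (intro fold_core[where sa = "(u,a)" and sb = "(u',b)" and se = "(u',b)"])
       (use o_nTH[OF n] Ac_p[OF inW(4)] in auto)
qed

text \<open>The merged vertex becomes its own parent, so three possible new flags face two destroyed
  ones, and one of these has to pay twice with both labels dropping. If
  \<open>st R u \<inter> st R b\<close> is not contained in \<open>st R a\<close>, then
  \<open>(u, a)\<close> pays for the merged edge and the edge to \<open>p a\<close>; otherwise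
  \<open>(u', b)\<close> pays for the edges to \<open>p a\<close> and \<open>p b\<close>.\<close>

lemma case2c_inc:
  assumes n: inequiv and pu: "(p u, a) \<notin> R" "(p u, b) \<notin> R" and pa: "(p a, u) \<notin> R" "(p b, u) \<notin> R"
    and inc: "\<not> st R a \<subseteq> st R b" "\<not> st R b \<subseteq> st R a" and AU: "\<not> st R a \<subseteq> st R u"
  shows reducible
proof -
  have oa: "(u, a) \<in> fflags k R p" "(u', b) \<in> fflags k R p" using fflags_oa[OF pu(1) pa(1)] fflags_ob[OF pu(2) pa(2)] .
  have g: "good (u', b) (p b, b)" "good (u, a) (p a, a)" "good (u, a) (u, a)" using oa sub_e sub_a sub_b by (auto simp: gs)
  have sa: "strict (u, a) (p a, a)" using sub_a AU unfolding gs by blast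
  show ?thesis
  proof (cases "st R u \<inter> st R b \<subseteq> st R u \<inter> st R a")
    case False
    then have "strict (u, a) (u, a)" using sub_e unfolding gs by blast
    then show ?thesis by (intro fold_core[where sa = "(u,a)" and sb = "(u',b)" and se = "(u,a)", OF Hz_a[OF n]])
       (use sa g o_nTH[OF n] in auto)
  next
    case True
    have s: "strict (u', b) (p a, a)" using True AU sub_a unfolding gs by blast
    moreover have "strict (u', b) (p b, b)" using True inc sub_b unfolding gs by blast
    moreover have "good (u', b) (p a, a)" using s oa by (auto simp: gs)
    ultimately show ?thesis by (intro fold_core[where sa = "(u',b)" and sb = "(u',b)" and se = "(u,a)", OF Hz_a[OF n]])
       (use g o_nTH[OF n] in auto)
  qed
qed

text \<open>With \<open>u\<close> as new parent the merged edge is no flag, and each edge to an old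
  parent is paid for by the flag of its own child.\<close>

lemma case2c_U:
  assumes n: inequiv and pu: "(p u, a) \<notin> R" "(p u, b) \<notin> R" and pa: "(p a, u) \<notin> R" "(p b, u) \<notin> R"
    and U: "st R a \<subseteq> st R u" "st R b \<subseteq> st R u"
  shows reducible
proof -
  have oa: "(u, a) \<in> fflags k R p" "(u', b) \<in> fflags k R p" using fflags_oa[OF pu(1) pa(1)] fflags_ob[OF pu(2) pa(2)] .
  have "good (u', b) (p b, b)" "good (u, a) (p a, a)" using oa sub_a sub_b by (auto simp: gs)
  then show ?thesis by (intro fold_core[where sa = "(u,a)" and sb = "(u',b)" and se = "(u,a)", OF Hz_u[OF n U]])
       (use o_nTH[OF n] Ae_u in auto)
qed

lemma case2a:
  assumes n: inequiv and pa: "(p a, u) \<in> R" "(p b, u) \<in> R"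
  shows reducible
  by (rule fold_core[where sa = "(u,a)" and sb = "(u',b)" and se = "(u,a)", OF Hz_u[OF n]])
    (use st_pR inW pa Ae_u in \<open>auto simp: Ac_def\<close>)

lemma hpc: assumes h: "h \<in> carrier G" "(wa h a, b) \<in> R" shows "(wa h (p a), p b) \<in> R"
  using parD(2)[OF p h(2)] parD(3)[OF p h(1) inW(3)] reqD(2,3)[OF R] by metis

lemma hp_u: assumes h: "h \<in> carrier G" "(wa h a, b) \<in> R" "(p a, u) \<in> R" "(p b, u) \<in> R" shows "(wa h u, u) \<in> R"
  using hpc[OF h(1,2)] h(3,4) reqD(6)[OF R h(1) h(3)] reqD(2,3)[OF R] by metis

lemma Hz_a': assumes h: "h \<in> carrier G" "(wa h a, b) \<in> R" shows "Hz a"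
proof (rule Hz_h[OF h inW(3)])
  have "(wa h a, a) \<in> R'" using RR'[OF h(2)] aR'b reqD(2,3)[OF R'] by metis
  then show "h \<in> st R' a" using h by (simp add: st_def)
qed (use aW' st_mono in blast)+

text \<open>Here \<open>h\<close> makes the two edges a single orbit, so at most one flag is
  destroyed. In exchange \<open>h\<close> enters the stabiliser of the merged edge, which grows
  strictly; this allows a shared payment when the edge to \<open>p a\<close> becomes a flag as
  well.\<close>

lemma caseE1:
  assumes h: "h \<in> carrier G" "(wa h a, b) \<in> R" "(wa h u, u) \<in> R"
  shows reducible
proof -
  have nn: "\<not> inequiv" using h unfolding inequiv_def by blast
  have hU: "h \<in> st R u" using h by (simp add: st_def)
  have hA: "h \<notin> st R a" using h nab reqD(2,3)[OF R] unfolding st_def by (metis (mono_tags, lifting) mem_Collect_eq)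
  have Hzu: "Hz u" if "st R a \<subseteq> st R u"
    by (rule Hz_h[OF h(1,2) inW(1)]) (use aW' that st_mono[of u] hU in blast)+
  have pb: "(wa h (p u), p u) \<in> R" using parD(3)[OF p h(1) inW(1)] parD(2)[OF p h(3)] reqD(2,3)[OF R] by metis
  \<comment> \<open>The class of \<open>p u\<close> is fixed by \<open>h\<close>, that of
    \<open>a\<close> is not.\<close>
  have pua: "(p u, a) \<notin> R"
  proof
    assume pu: "(p u, a) \<in> R"
    have "(wa h (p u), wa h a) \<in> R" using reqD(6)[OF R h(1) pu] .
    then show False using pu pb h nab reqD(2,3)[OF R] by metis
  qed
  show ?thesis
  proof (cases "(p a, u) \<in> R")
    case True
    then have "st R a \<subseteq> st R u" using st_pR inW by blast
    then show ?thesis by (intro fold_core[where sa = "(u,a)" and sb = "(u',b)" and se = "(u,a)", OF Hzu])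
       (use Ae_u nn True in \<open>auto simp: Ac_def\<close>)
  next
    case False
    have oa: "(u, a) \<in> fflags k R p" using fflags_oa[OF pua False] .
    have g: "good (u, a) (p a, a)" "good (u, a) (u, a)" using oa sub_e sub_a by (auto simp: gs)
    show ?thesis
    proof (cases "st R a \<subseteq> st R u")
      case True
      then show ?thesis by (intro fold_core[where sa = "(u,a)" and sb = "(u',b)" and se = "(u,a)", OF Hzu])
       (use Ae_u nn g in auto)
    next
      case 2: False
      have "(wa h a, a) \<in> R'" using RR'[OF h(2)] aR'b reqD(2,3)[OF R'] by metis
      then have "h \<in> st R' a" using h by (simp add: st_def)
      then have "h \<in> flag_stab R' (u, a)" using hU st_mono[of u] unfolding flag_stab_def by auto
      then have "strict (u, a) (u, a)" using hA sub_e unfolding gs by blast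
      moreover have "strict (u, a) (p a, a)" using 2 sub_a unfolding gs by blast
      ultimately show ?thesis by (intro fold_core[where sa = "(u,a)" and sb = "(u',b)" and se = "(u,a)", OF Hz_a'[OF h(1,2)]])
       (use nn g in auto)
    qed
  qed
qed

text \<open>The merged vertex becomes its own parent, which is always equivariant. The edges to
  \<open>p a\<close> and \<open>p b\<close> are translates, so there are two new flags to consider.
  If both \<open>(u, a)\<close> and \<open>(u', b)\<close> are flags, they are inequivalent, since
  no element carries \<open>a\<close> to \<open>b\<close> and fixes \<open>u\<close>, and pay one
  each.\<close>

lemma caseE2:
  assumes h: "h \<in> carrier G" "(wa h a, b) \<in> R" and no: "\<And>g. g \<in> carrier G \<Longrightarrow> (wa g a, b) \<in> R \<Longrightarrow> (wa g u, u) \<notin> R"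
    and w: "(p u, a) \<notin> R"
  shows reducible
proof -
  have nn: "\<not> inequiv" using h unfolding inequiv_def by blast
  note Hza = Hz_a'[OF h]
  show ?thesis
  proof (cases "(p u, b) \<in> R")
    case pub: True
    have "(p a, u) \<notin> R \<Longrightarrow> good (u, a) (p a, a)" using fflags_oa[OF w] sub_a by (auto simp: gs)
    then show ?thesis by (intro fold_core[where sa = "(u,a)" and sb = "(u',b)" and se = "(u,a)", OF Hza])
       (use nn pub in \<open>auto simp: Ae_def Ac_def\<close>)
  next
    case pub: False
    show ?thesis
    proof (cases "(p a, u) \<in> R")
      case pau: True
      then have "(p b, u) \<notin> R" using hp_u[OF h] no h by blast
      then have "good (u', b) (u, a)" using fflags_ob[OF pub] sub_e by (simp add: gs)
      then show ?thesis by (intro fold_core[where sa = "(u',b)" and sb = "(u',b)" and se = "(u',b)", OF Hza])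
       (use nn pau in \<open>auto simp: Ac_def\<close>)
    next
      case pau: False
      have oa: "(u, a) \<in> fflags k R p" using fflags_oa[OF w pau] .
      show ?thesis
      proof (cases "(p b, u) \<in> R")
        case True
        have 1: "(wa h (p a), u) \<in> R'" using RR'[OF hpc[OF h]] RR'[OF True] reqD(3)[OF R'] by metis
        have 2: "(wa h a, a) \<in> R'" using RR'[OF h(2)] aR'b reqD(2,3)[OF R'] by metis
        \<comment> \<open>Applying \<open>h\<close> to the edge between \<open>p a\<close> and
          \<open>a\<close> gives the edge between \<open>u\<close> and \<open>b\<close>, which is
          identified with the one between \<open>u\<close> and \<open>a\<close>.\<close>
        have "((p a, a), (u, a)) \<in> flag_rel R'" using THI[OF R' _ _ h(1) 1 2] parD(1)[OF p] inW by blast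
        then have "\<not> Ac z a" for z by (simp add: Ac_def)
        moreover have "good (u, a) (u, a)" using oa sub_e by (auto simp: gs)
        ultimately show ?thesis by (intro fold_core[where sa = "(u,a)" and sb = "(u',b)" and se = "(u,a)", OF Hza])
          (use nn in auto)
      next
        case False
        have ob: "(u', b) \<in> fflags k R p" using fflags_ob[OF pub False] .
        have nt: "((u', b), (u, a)) \<notin> flag_rel R"
        proof
          assume "((u', b), (u, a)) \<in> flag_rel R"
          then have "((u, a), (u', b)) \<in> flag_rel R" using flag_rel_D(2)[OF R] by blast
          then obtain g where "g \<in> carrier G" "(wa g u, u') \<in> R" "(wa g a, b) \<in> R" unfolding flag_rel_def by blast
          then show False using no[of g] uu reqD(2,3)[OF R] by metis
        qed
        have "good (u', b) (u, a)" "good (u, a) (p a, a)" using oa ob sub_e sub_a by (auto simp: gs)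
        then show ?thesis by (intro fold_core[where sa = "(u,a)" and sb = "(u',b)" and se = "(u',b)", OF Hza])
          (use nn nt in auto)
      qed
    qed
  qed
qed

lemma inequiv_cases:
  assumes n: inequiv and pu: "(p u, a) \<notin> R" "(p u, b) \<notin> R"
    and w: "(p a, u) \<in> R \<or> (p b, u) \<notin> R" "(p b, u) \<in> R \<or> \<not> st R b \<subseteq> st R a" "(p b, u) \<in> R \<or> st R b \<subseteq> st R u \<or> \<not> st R a \<subseteq> st R u"
  shows reducible
proof (cases "(p b, u) \<in> R")
  case True
  then show ?thesis using case2a n w by blast
next
  case False
  then show ?thesis using case2b[OF n pu] case2c_le[OF n pu] case2c_inc[OF n pu] case2c_U[OF n pu] w by blast
qed

text \<open>The situation is symmetric in \<open>(u, a)\<close> and \<open>(u', b)\<close>; the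
  mirrored cases come from the interpretation \<open>sw\<close>, which has the same
  \<open>R'\<close>.\<close>

lemma fold_goal: reducible
proof -
  interpret sw: fold_pair G W wa ad pos pa col R p u' u b a
    by unfold_locales (use R p ua ub reqD(2)[OF R] uu ab nab in auto)
  have "sw.Gen = Gen" unfolding sw.Gen_def Gen_def by blast
  then have R'e: "sw.R' = R'" unfolding sw.R'_def R'_def by simp
  have ke: "col (pos u') = k" using reqD(7)[OF R uu] by simp
  have swG: reducible if sw.reducible using that unfolding sw.reducible_def reducible_def R'e ke .
  have pu': "(p u', c) \<in> R \<longleftrightarrow> (p u, c) \<in> R" "(p c, u') \<in> R \<longleftrightarrow> (p c, u) \<in> R" for c
    using parD(2)[OF p uu] uu reqD(2,3)[OF R] by metis+
  show ?thesis
  proof (cases inequiv)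
    case n: True
    have swn: sw.inequiv unfolding sw.inequiv_def
    proof (intro ballI notI)
      fix g assume g: "g \<in> carrier G" "(wa g b, a) \<in> R"
      then have "(wa (inv g) a, b) \<in> R" using req_shift[OF R g(1), of b a] reqD(2)[OF R] inW by auto
      then show False using n g unfolding inequiv_def by auto
    qed
    consider "(p u, a) \<in> R" | "(p u, b) \<in> R" | "(p u, a) \<notin> R" "(p u, b) \<notin> R" by blast
    then show ?thesis
    proof cases
      case 1
      then show ?thesis using case1[OF n] by blast
    next
      case 2
      then show ?thesis using sw.case1[OF swn] pu' swG by blast
    next
      case 3
      then have s3: "(p u', b) \<notin> R" "(p u', a) \<notin> R" using pu' by blast+
      show ?thesis
      proof (cases "((p a, u) \<in> R \<or> (p b, u) \<notin> R) \<and> ((p b, u) \<in> R \<or> \<not> st R b \<subseteq> st R a) \<and> ((p b, u) \<in> R \<or> st R b \<subseteq> st R u \<or> \<not> st R a \<subseteq> st R u)")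
        case True
        then show ?thesis using inequiv_cases[OF n 3] by blast
      next
        case False
        then consider "(p a, u) \<notin> R" "(p b, u) \<in> R" | "(p a, u) \<in> R" "(p b, u) \<notin> R"
          | "(p a, u) \<notin> R" "(p b, u) \<notin> R" "st R b \<subseteq> st R a"
          | "(p a, u) \<notin> R" "(p b, u) \<notin> R" "\<not> st R b \<subseteq> st R a" "\<not> st R b \<subseteq> st R u" "st R a \<subseteq> st R u" by blast
        then show ?thesis
        proof cases
          case 1
          then show ?thesis using sw.case2b[OF swn s3] pu' swG by blast
        next
          case 2
          then show ?thesis using case2b[OF n 3] by blast
        next
          case 3
          then show ?thesis using sw.case2c_le[OF swn s3] pu' swG by blast
        next
          case 4
          show ?thesis
          proof (cases "st R a \<subseteq> st R b")
            case True
            then show ?thesis using case2c_le[OF n 3] 4 by blast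
          next
            case False
            then show ?thesis using sw.case2c_inc[OF swn s3] 4 pu' swG st_u' by auto
          qed
        qed
      qed
    qed
  next
    case False
    then obtain h where h: "h \<in> carrier G" "(wa h a, b) \<in> R" unfolding inequiv_def by blast
    show ?thesis
    proof (cases "\<exists>g \<in> carrier G. (wa g a, b) \<in> R \<and> (wa g u, u) \<in> R")
      case True
      then show ?thesis using caseE1 by blast
    next
      case no: False
      show ?thesis
      proof (cases "(p u, a) \<in> R")
        case True
        have h': "inv h \<in> carrier G" "(wa (inv h) b, a) \<in> R"
          using h req_shift[OF R, of "inv h" b a] reqD(2)[OF R] inW by auto
        have "(wa g u', u') \<notin> R" if g: "g \<in> carrier G" "(wa g b, a) \<in> R" for g
        proof
          assume "(wa g u', u') \<in> R"
          then have "g \<in> st R u" using st_u' g by (auto simp: st_def)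
          then have "inv g \<in> st R u" using subgroup.m_inv_closed[OF st_subgroup[OF R inW(1)]] by blast
          moreover have "(wa (inv g) a, b) \<in> R" using g req_shift[OF R g(1), of b a] reqD(2)[OF R] inW by auto
          ultimately show False using no by (auto simp: st_def)
        qed
        then show ?thesis using sw.caseE2[OF h'] pu' pu_not_both[OF True] swG by blast
      next
        case False
        then show ?thesis using caseE2[OF h] no by blast
      qed
    qed
  qed
qed

end

context ggraph begin

lemma fold:
  assumes "req R" "par R p" "(u, a) \<in> ad" "(u', b) \<in> ad" "(u, u') \<in> R" "pos a = pos b" "(a, b) \<notin> R"
  obtains R' q where "req R'" "par R' q" "R \<subseteq> R'" "(a, b) \<in> R'" "mset_le stab_less (flag_mset k R' q) (flag_mset k R p)"
proof -
  interpret f: fold_pair G W wa ad pos pa col R p u u' a b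
    by unfold_locales (use assms in auto)
  obtain q where q: "par f.R' q" "mset_le stab_less (flag_mset (col (pos u)) f.R' q) (flag_mset (col (pos u)) R p)"
    using f.fold_goal unfolding f.reducible_def by blast
  have "mset_le stab_less (flag_mset k f.R' q) (flag_mset k R p)"
    using q(2) flag_mset_swap[OF assms(1), of "col (pos u)" p] flag_mset_swap[OF f.R', of "col (pos u)" q] by (cases "k = col (pos u)") auto
  then show ?thesis using that[OF f.R' q(1) f.RR'_sub f.aR'b] by blast
qed

end

section \<open>Graphs over a protree\<close>

text \<open>A vertex lies over a point of \<open>X\<close> or, as the midpoint of a strand, over a pair of points.\<close>

locale xgraph = protree G E lev ea br X tip + ggraph G W wa ad pos "\<lambda>g. image (image (ea g))" "\<lambda>Y. card Y = 1"
  for G :: "('g, 'm) monoid_scheme" (structure) and E :: "'e set" and lev ea br X tip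
    and W :: "'w set" and wa ad and pos :: "'w \<Rightarrow> 'e set set" +
  assumes pos_X: "w \<in> W \<Longrightarrow> pos w \<subseteq> X"
    and pos_card: "w \<in> W \<Longrightarrow> card (pos w) = 1 \<or> card (pos w) = 2"
    and ad_pos: "(x, y) \<in> ad \<Longrightarrow> pos x \<subseteq> pos y \<or> pos y \<subseteq> pos x"
    and S_nb: "\<lbrakk>c \<in> W; card (pos c) = 2; v \<in> pos c\<rbrakk> \<Longrightarrow> \<exists>a. (c, a) \<in> ad \<and> pos a = {v}"
    and conn: "\<lbrakk>x \<in> W; y \<in> W\<rbrakk> \<Longrightarrow> (x, y) \<in> ad\<^sup>*"
    and W_ne: "W \<noteq> {}"

context protree begin

lemma pact_eta: "image (ea g) = pact g" by (auto simp: pact_def)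

lemma card_pact: assumes "g \<in> carrier G" "Y \<subseteq> X" shows "card (pact g ` Y) = card Y"
  by (rule card_image) (use pact_eq[OF assms(1)] assms(2) in \<open>auto simp: inj_on_def\<close>)

text \<open>The finiteness of labels demanded by \<open>ggraph\<close> is automatic: one end of each
  edge lies over a pair of points, and only finitely many elements map a pair of points to
  itself.\<close>

lemma xgraphI:
  fixes W :: "'w set" and pos :: "'w \<Rightarrow> 'e set set"
  assumes wa_cl: "\<And>g w. \<lbrakk>g \<in> carrier G; w \<in> W\<rbrakk> \<Longrightarrow> wa g w \<in> W"
    and wa_one: "\<And>w. w \<in> W \<Longrightarrow> wa \<one> w = w"
    and wa_mult: "\<And>g h w. \<lbrakk>g \<in> carrier G; h \<in> carrier G; w \<in> W\<rbrakk> \<Longrightarrow> wa (g \<otimes> h) w = wa g (wa h w)"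
    and ad_W: "\<And>x y. (x, y) \<in> ad \<Longrightarrow> x \<in> W \<and> y \<in> W"
    and ad_sym: "\<And>x y. (x, y) \<in> ad \<Longrightarrow> (y, x) \<in> ad"
    and ad_act: "\<And>g x y. \<lbrakk>g \<in> carrier G; (x, y) \<in> ad\<rbrakk> \<Longrightarrow> (wa g x, wa g y) \<in> ad"
    and pos_act: "\<And>g w. \<lbrakk>g \<in> carrier G; w \<in> W\<rbrakk> \<Longrightarrow> pos (wa g w) = pact g ` pos w"
    and ad_col: "\<And>x y. (x, y) \<in> ad \<Longrightarrow> (card (pos x) = 1) \<noteq> (card (pos y) = 1)"
    and fin_ad: "\<exists>F. finite F \<and> F \<subseteq> ad \<and> (\<forall>(x, y) \<in> ad. \<exists>g \<in> carrier G. \<exists>(x', y') \<in> F. x = wa g x' \<and> y = wa g y')"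
    and pos_X: "\<And>w. w \<in> W \<Longrightarrow> pos w \<subseteq> X"
    and pos_card: "\<And>w. w \<in> W \<Longrightarrow> card (pos w) = 1 \<or> card (pos w) = 2"
    and ad_pos: "\<And>x y. (x, y) \<in> ad \<Longrightarrow> pos x \<subseteq> pos y \<or> pos y \<subseteq> pos x"
    and S_nb: "\<And>c y. \<lbrakk>c \<in> W; card (pos c) = 2; y \<in> pos c\<rbrakk> \<Longrightarrow> \<exists>a. (c, a) \<in> ad \<and> pos a = {y}"
    and conn: "\<And>x y. \<lbrakk>x \<in> W; y \<in> W\<rbrakk> \<Longrightarrow> (x, y) \<in> ad\<^sup>*"
    and W_ne: "W \<noteq> {}"
  shows "xgraph G E lev ea br X tip W wa ad pos"
proof unfold_locales
  show "pos (wa g w) = (`) (ea g) ` pos w" if "g \<in> carrier G" "w \<in> W" for g w using pos_act[OF that] by (simp add: pact_eta)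
  show "(card ((`) (ea g) ` pos w) = 1) = (card (pos w) = 1)" if "g \<in> carrier G" "w \<in> W" for g w
    using card_pact[OF that(1) pos_X[OF that(2)]] by (simp add: pact_eta)
  show "finite {g \<in> carrier G. (`) (ea g) ` pos x = pos x \<and> (`) (ea g) ` pos y = pos y}" if a: "(x, y) \<in> ad" for x y
  proof -
    have "card (pos x) = 2 \<or> card (pos y) = 2" using ad_col[OF a] pos_card ad_W[OF a] by blast
    moreover have "finite {g \<in> carrier G. pact g ` pos z = pos z}" if "card (pos z) = 2" "z \<in> W" for z
      using fin_pair pos_X that by blast
    ultimately obtain z where "z \<in> {x, y}" "finite {g \<in> carrier G. pact g ` pos z = pos z}" using ad_W[OF a] by blast
    then show ?thesis unfolding pact_eta by (rule_tac finite_subset) auto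
  qed
qed (fact assms)+

text \<open>The competitors among which a minimal \<open>M\<close> is chosen. The relation is
  \<open>Id_on W\<close>, so all identifications have already been carried out.\<close>

definition net where
  "net W wa ad pos p M \<longleftrightarrow> xgraph G E lev ea br X tip W wa ad pos \<and> ggraph.par G W wa ad (Id_on W) p \<and>
     M = ggraph.flag_mset G W wa ad pos (\<lambda>Y. card Y = 1) True (Id_on W) p"

end

section \<open>Immersions and quotient graphs\<close>

context ggraph begin

text \<open>Here no fold is left: the neighbours of a vertex of the quotient are told apart by their
  positions.\<close>

definition immersed where "immersed R \<longleftrightarrow> (\<forall>u a u' b. (u, a) \<in> ad \<longrightarrow> (u', b) \<in> ad \<longrightarrow> (u, u') \<in> R \<longrightarrow> pos a = pos b \<longrightarrow> (a, b) \<in> R)"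

lemma req_Id: "req (Id_on W)"
  unfolding req_def equiv_def refl_on_def sym_def trans_def using wa_cl by auto

lemma immD: "immersed R \<Longrightarrow> (u, a) \<in> ad \<Longrightarrow> (u', b) \<in> ad \<Longrightarrow> (u, u') \<in> R \<Longrightarrow> pos a = pos b \<Longrightarrow> (a, b) \<in> R"
  unfolding immersed_def by blast

end

context xgraph begin

lemma pos_wa: "g \<in> carrier G \<Longrightarrow> w \<in> W \<Longrightarrow> pos (wa g w) = pact g ` pos w"
  using pos_act by (simp add: pact_eta)

lemma fin_pos: assumes "c \<in> W" "card (pos c) = 2" shows "finite {g \<in> carrier G. pact g ` pos c = Z}"
  using fin_pair[OF assms(2) pos_X[OF assms(1)]] .

text \<open>There are finitely many orbits of edges, and each edge has a strand as one end, whose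
  pair of points is carried to a given pair by finitely many elements only.\<close>

lemma fin_over: "finite {t \<in> ad. pos (fst t) = P \<and> pos (snd t) = Q}"
proof -
  obtain F where F: "finite F" "F \<subseteq> ad" "\<forall>(x, y) \<in> ad. \<exists>g \<in> carrier G. \<exists>(x', y') \<in> F. x = wa g x' \<and> y = wa g y'"
    using fin_ad by blast
  define H where "H t = {g \<in> carrier G. pact g ` pos (fst t) = P \<and> pact g ` pos (snd t) = Q}" for t
  have fH: "finite (H t)" if t: "t \<in> F" for t
  proof -
    obtain x y where xy: "t = (x, y)" "(x, y) \<in> ad" using t F(2) by (metis subsetD surj_pair)
    have W: "x \<in> W" "y \<in> W" using ad_W xy by blast+
    have "card (pos x) = 2 \<or> card (pos y) = 2" using ad_col[OF xy(2)] pos_card W by blast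
    moreover have "H t \<subseteq> {g \<in> carrier G. pact g ` pos x = P}" "H t \<subseteq> {g \<in> carrier G. pact g ` pos y = Q}"
      using xy unfolding H_def by auto
    ultimately show ?thesis
      using finite_subset[of "H t", OF _ fin_pos[OF W(1), of P]] finite_subset[of "H t", OF _ fin_pos[OF W(2), of Q]] by argo
  qed
  have "{t \<in> ad. pos (fst t) = P \<and> pos (snd t) = Q} \<subseteq> (\<Union>t \<in> F. (\<lambda>g. (wa g (fst t), wa g (snd t))) ` H t)"
  proof
    fix t assume t: "t \<in> {t \<in> ad. pos (fst t) = P \<and> pos (snd t) = Q}"
    obtain x y where xy: "t = (x, y)" "(x, y) \<in> ad" using t by (metis (lifting) mem_Collect_eq surj_pair)
    then obtain g x' y' where g: "g \<in> carrier G" "(x', y') \<in> F" "x = wa g x'" "y = wa g y'" using F(3) by blast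
    then have "x' \<in> W" "y' \<in> W" using F(2) ad_W by blast+
    then have "g \<in> H (x', y')" using t xy g pos_wa unfolding H_def by auto
    then show "t \<in> (\<Union>t \<in> F. (\<lambda>g. (wa g (fst t), wa g (snd t))) ` H t)" using g xy by force
  qed
  then show ?thesis using F(1) fH finite_subset by (metis (no_types, lifting) finite_UN finite_imageI)
qed

text \<open>Folding terminates: \<open>A\<close> holds the finitely many edges over the positions of
  the orbit representatives, and a fold identifies a further pair of them. So a relation with as
  many identified pairs as possible, among those whose multiset has not grown, admits no
  fold.\<close>

lemma immerse:
  assumes R0: "req R0" and p0: "par R0 p0"
  obtains R q where "req R" "par R q" "immersed R" "flag_mset k R q = flag_mset k R0 p0 \<or> (flag_mset k R q, flag_mset k R0 p0) \<in> mult stab_less"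
proof -
  obtain F where F: "finite F" "F \<subseteq> ad" "\<forall>(x, y) \<in> ad. \<exists>g \<in> carrier G. \<exists>(x', y') \<in> F. x = wa g x' \<and> y = wa g y'"
    using fin_ad by blast
  define A where "A = (\<Union>f \<in> F. {t \<in> ad. pos (fst t) = pos (fst f) \<and> pos (snd t) = pos (snd f)})"
  have fA: "finite A" unfolding A_def using F(1) fin_over by blast
  define Z where "Z R = {(t, s) \<in> A \<times> A. (fst t, fst s) \<in> R \<and> (snd t, snd s) \<in> R}" for R
  define Q where "Q R = (req R \<and> (\<exists>q. par R q \<and> (flag_mset k R q = flag_mset k R0 p0 \<or> (flag_mset k R q, flag_mset k R0 p0) \<in> mult stab_less)))" for R
  have Q0: "Q R0" unfolding Q_def using R0 p0 by blast
  have b: "card (Z R) \<le> card (A \<times> A)" for R by (rule card_mono) (use fA in \<open>auto simp: Z_def\<close>)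
  have "\<exists>R. Q R \<and> (\<forall>R'. Q R' \<longrightarrow> card (Z R') \<le> card (Z R))"
    using ex_has_greatest_nat[of Q R0 "\<lambda>R. card (Z R)" "Suc (card (A \<times> A))"] Q0 b by (simp add: le_imp_less_Suc)
  then obtain R where R: "Q R" "\<And>R'. Q R' \<Longrightarrow> card (Z R') \<le> card (Z R)" by blast
  obtain q where q: "req R" "par R q" "flag_mset k R q = flag_mset k R0 p0 \<or> (flag_mset k R q, flag_mset k R0 p0) \<in> mult stab_less" using R(1) unfolding Q_def by blast
  have "immersed R" unfolding immersed_def
  proof (intro allI impI, rule ccontr)
    fix u a u' b assume as: "(u, a) \<in> ad" "(u', b) \<in> ad" "(u, u') \<in> R" "pos a = pos b" "(a, b) \<notin> R"
    obtain R' q' where R': "req R'" "par R' q'" "R \<subseteq> R'" "(a, b) \<in> R'" "mset_le stab_less (flag_mset k R' q') (flag_mset k R q)"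
      using fold[OF q(1,2) as] by metis
    have "flag_mset k R' q' = flag_mset k R q \<or> (flag_mset k R' q', flag_mset k R q) \<in> mult stab_less" by (rule mset_le_mult[OF R'(5)])
    then have "flag_mset k R' q' = flag_mset k R0 p0 \<or> (flag_mset k R' q', flag_mset k R0 p0) \<in> mult stab_less"
      using q(3) trancl_trans[of "flag_mset k R' q'" "flag_mset k R q" "mult1 stab_less" "flag_mset k R0 p0"] unfolding mult_def by auto
    then have "Q R'" unfolding Q_def using R' by blast
    then have le: "card (Z R') \<le> card (Z R)" by (rule R(2))
    \<comment> \<open>The violation is moved to a representative edge, so that the new
      identification becomes visible inside \<open>A\<close>.\<close>
    obtain g x y where g: "g \<in> carrier G" "(x, y) \<in> F" "u = wa g x" "a = wa g y" using F(3) as(1) by blast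
    define h where "h = inv g"
    have h: "h \<in> carrier G" "wa h u = x" "wa h a = y" using g wa_inv F(2) ad_W[of x y] unfolding h_def by auto
    have W: "a \<in> W" "b \<in> W" "u \<in> W" "u' \<in> W" using as ad_W by blast+
    have "pos (wa h u') = pos x" "pos (wa h b) = pos y"
      using h pos_wa[OF h(1)] W as(4) reqD(7)[OF q(1) as(3)] by metis+
    moreover have "(x, y) \<in> ad" using F(2) g(2) by blast
    ultimately have i: "(x, y) \<in> A" "(wa h u', wa h b) \<in> A"
      using ad_act[OF h(1) as(2)] unfolding A_def by (auto intro!: bexI[OF _ g(2)])
    have r: "(x, wa h u') \<in> R" using reqD(6)[OF q(1) h(1) as(3)] h by simp
    have "(y, wa h b) \<in> R'" using reqD(6)[OF R'(1) h(1) R'(4)] h by simp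
    then have 1: "((x, y), (wa h u', wa h b)) \<in> Z R'" using i r R'(3) unfolding Z_def by auto
    have "(y, wa h b) \<notin> R"
    proof
      assume "(y, wa h b) \<in> R"
      then have "(wa g y, wa g (wa h b)) \<in> R" using reqD(6)[OF q(1) g(1)] by blast
      then show False using as(5) g wa_inv'[OF g(1) W(2)] unfolding h_def by simp
    qed
    then have 2: "((x, y), (wa h u', wa h b)) \<notin> Z R" unfolding Z_def by auto
    have "Z R \<subset> Z R'" using 1 2 R'(3) unfolding Z_def by blast
    moreover have "finite (Z R')" using fA unfolding Z_def by (rule_tac finite_subset[of _ "A \<times> A"]) auto
    ultimately have "card (Z R) < card (Z R')" by (rule psubset_card_mono[rotated])
    then show False using le by simp
  qed
  then show ?thesis using that q by blast
qed

text \<open>Minimality has to range over graphs of one fixed vertex type that is large enough for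
  all quotients. A class is coded by the number of a representative of its orbit together with the
  set of elements carrying this representative into the class, a coset of the stabiliser of its
  class.\<close>

lemma transfer:
  assumes R: "req R" and q: "par R q"
  shows "\<exists>(W' :: (nat \<times> 'g set) set) wa' ad' pos' p'. net W' wa' ad' pos' p' (flag_mset True R q) \<and>
    (immersed R \<longrightarrow> ggraph.immersed ad' pos' (Id_on W')) \<and>
    (\<exists>j. W' = j ` W \<and> (\<forall>x \<in> W. \<forall>y \<in> W. j x = j y \<longleftrightarrow> (x, y) \<in> R) \<and> (\<forall>w \<in> W. pos' (j w) = pos w))"
proof -
  obtain F where F: "finite F" "F \<subseteq> ad" "\<forall>(x, y) \<in> ad. \<exists>g \<in> carrier G. \<exists>(x', y') \<in> F. x = wa g x' \<and> y = wa g y'"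
    using fin_ad by blast
  obtain w0 where w0: "w0 \<in> W" using W_ne by blast
  define F' where "F' = insert w0 (fst ` F)"
  have F': "finite F'" "F' \<subseteq> W" using F w0 ad_W unfolding F'_def by force+
  have ex: "\<exists>r. r \<in> F' \<and> (\<exists>g \<in> carrier G. (wa g r, w) \<in> R)" if w: "w \<in> W" for w
  proof (cases "w = w0")
    case True
    have "(wa \<one> w0, w0) \<in> R" using wa_one[OF w0] reqD(1)[OF R w0] by simp
    then show ?thesis using True unfolding F'_def by blast
  next
    case False
    then obtain v where "(w, v) \<in> ad" using conn[OF w w0] by (metis converse_rtranclE)
    then obtain g x y where g: "g \<in> carrier G" "(x, y) \<in> F" "w = wa g x" using F(3) by blast
    then have "x \<in> F'" unfolding F'_def by force
    then show ?thesis using g reqD(1)[OF R w] by blast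
  qed
  define \<rho> where "\<rho> w = (SOME r. r \<in> F' \<and> (\<exists>g \<in> carrier G. (wa g r, w) \<in> R))" for w
  have \<rho>: "\<rho> w \<in> F'" "\<exists>g \<in> carrier G. (wa g (\<rho> w), w) \<in> R" if "w \<in> W" for w
    using someI_ex[OF ex[OF that]] unfolding \<rho>_def by auto
  define j where "j w = (to_nat_on F' (\<rho> w), {g \<in> carrier G. (wa g (\<rho> w), w) \<in> R})" for w
  have j: "j x = j y \<longleftrightarrow> (x, y) \<in> R" if xy: "x \<in> W" "y \<in> W" for x y
  proof
    assume "j x = j y"
    then have "to_nat_on F' (\<rho> x) = to_nat_on F' (\<rho> y)" and s: "{g \<in> carrier G. (wa g (\<rho> x), x) \<in> R} = {g \<in> carrier G. (wa g (\<rho> y), y) \<in> R}"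
      unfolding j_def by auto
    then have "\<rho> x = \<rho> y" using \<rho>(1) xy countable_finite[OF F'(1)] by simp
    moreover obtain g where "g \<in> carrier G" "(wa g (\<rho> x), x) \<in> R" using \<rho>(2) xy by blast
    ultimately have "(wa g (\<rho> x), x) \<in> R" "(wa g (\<rho> x), y) \<in> R" using s by auto
    then show "(x, y) \<in> R" using reqD(2,3)[OF R] by metis
  next
    assume a: "(x, y) \<in> R"
    have e: "(z, x) \<in> R \<longleftrightarrow> (z, y) \<in> R" for z using a reqD(2,3)[OF R] by metis
    then have "\<rho> x = \<rho> y" unfolding \<rho>_def by simp
    then show "j x = j y" unfolding j_def using e by simp
  qed
  define rp where "rp v = (SOME w. w \<in> W \<and> j w = v)" for v
  define W' where "W' = j ` W"
  define wa' where "wa' g v = j (wa g (rp v))" for g v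
  define ad' where "ad' = (\<lambda>(x, y). (j x, j y)) ` ad"
  define pos' where "pos' v = pos (rp v)" for v
  define p' where "p' v = j (q (rp v))" for v
  have rp: "rp (j w) \<in> W" "(rp (j w), w) \<in> R" if "w \<in> W" for w
  proof -
    have "rp (j w) \<in> W \<and> j (rp (j w)) = j w" unfolding rp_def by (rule someI[of _ w]) (use that in simp)
    then show "rp (j w) \<in> W" "(rp (j w), w) \<in> R" using j that by auto
  qed
  have wa'j: "wa' g (j w) = j (wa g w)" if "g \<in> carrier G" "w \<in> W" for g w
    unfolding wa'_def using j rp[OF that(2)] wa_cl that reqD(6)[OF R] by simp
  have pos'j: "pos' (j w) = pos w" if "w \<in> W" for w
    unfolding pos'_def using rp[OF that] reqD(7)[OF R] by blast
  have p'j: "p' (j w) = j (q w)" if "w \<in> W" for w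
    unfolding p'_def using j rp[OF that] parD(1,2)[OF q] that by simp
  have ad'j: "(j x, j y) \<in> ad' \<longleftrightarrow> (x, y) \<in> adR R" if xy: "x \<in> W" "y \<in> W" for x y
  proof -
    have "(j x, j y) \<in> ad' \<longleftrightarrow> (\<exists>a b. (a, b) \<in> ad \<and> j x = j a \<and> j y = j b)" unfolding ad'_def by auto
    also have "\<dots> \<longleftrightarrow> (x, y) \<in> adR R" unfolding adR_def using j xy ad_W by blast
    finally show ?thesis .
  qed
  have ad'E: "\<exists>x y. (x, y) \<in> ad \<and> v = j x \<and> w = j y \<and> x \<in> W \<and> y \<in> W" if "(v, w) \<in> ad'" for v w
    using that ad_W unfolding ad'_def by auto
  have ad'I: "(j x, j y) \<in> ad'" if "(x, y) \<in> ad" for x y using that unfolding ad'_def by auto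
  have W'E: "\<exists>w. w \<in> W \<and> v = j w" if "v \<in> W'" for v using that unfolding W'_def by auto
  have W'I: "j w \<in> W'" if "w \<in> W" for w using that unfolding W'_def by auto
  have xg: "xgraph G E lev ea br X tip W' wa' ad' pos'"
  proof (rule xgraphI)
    show "wa' g w \<in> W'" if "g \<in> carrier G" "w \<in> W'" for g w using W'E[OF that(2)] wa'j wa_cl W'I that by auto
    show "wa' \<one> w = w" if "w \<in> W'" for w using W'E[OF that] wa'j wa_one by auto
    show "wa' (g \<otimes> h) w = wa' g (wa' h w)" if "g \<in> carrier G" "h \<in> carrier G" "w \<in> W'" for g h w
      using W'E[OF that(3)] wa'j wa_mult wa_cl that by auto
    show "x \<in> W' \<and> y \<in> W'" if "(x, y) \<in> ad'" for x y using ad'E[OF that] W'I by auto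
    show "(y, x) \<in> ad'" if "(x, y) \<in> ad'" for x y using ad'E[OF that] ad_sym ad'I by auto
    show "(wa' g x, wa' g y) \<in> ad'" if "g \<in> carrier G" "(x, y) \<in> ad'" for g x y using ad'E[OF that(2)] ad_act ad'I that(1) wa'j by auto
    show "pos' (wa' g w) = pact g ` pos' w" if "g \<in> carrier G" "w \<in> W'" for g w
      using W'E[OF that(2)] wa'j pos'j pos_wa wa_cl that by auto
    show "(card (pos' x) = 1) \<noteq> (card (pos' y) = 1)" if "(x, y) \<in> ad'" for x y using ad'E[OF that] ad_col pos'j by auto
    show "\<exists>F. finite F \<and> F \<subseteq> ad' \<and> (\<forall>(x, y) \<in> ad'. \<exists>g \<in> carrier G. \<exists>(x', y') \<in> F. x = wa' g x' \<and> y = wa' g y')"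
    proof (intro exI conjI)
      show "finite ((\<lambda>(x, y). (j x, j y)) ` F)" using F(1) by simp
      show "(\<lambda>(x, y). (j x, j y)) ` F \<subseteq> ad'" using F(2) ad'I by auto
      show "\<forall>(x, y) \<in> ad'. \<exists>g \<in> carrier G. \<exists>(x', y') \<in> (\<lambda>(x, y). (j x, j y)) ` F. x = wa' g x' \<and> y = wa' g y'"
      proof clarify
        fix v w assume "(v, w) \<in> ad'"
        then obtain x y where xy: "(x, y) \<in> ad" "v = j x" "w = j y" using ad'E by blast
        then obtain g x' y' where g: "g \<in> carrier G" "(x', y') \<in> F" "x = wa g x'" "y = wa g y'" using F(3) by blast
        then have "x' \<in> W" "y' \<in> W" using F(2) ad_W by blast+
        then have "v = wa' g (j x')" "w = wa' g (j y')" using xy g wa'j by auto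
        then show "\<exists>g \<in> carrier G. \<exists>(x', y') \<in> (\<lambda>(x, y). (j x, j y)) ` F. v = wa' g x' \<and> w = wa' g y'" using g by force
      qed
    qed
    show "pos' w \<subseteq> X" if "w \<in> W'" for w using W'E[OF that] pos'j pos_X by auto
    show "card (pos' w) = 1 \<or> card (pos' w) = 2" if "w \<in> W'" for w using W'E[OF that] pos'j pos_card by metis
    show "pos' x \<subseteq> pos' y \<or> pos' y \<subseteq> pos' x" if "(x, y) \<in> ad'" for x y using ad'E[OF that] ad_pos pos'j by metis
    show "\<exists>a. (c, a) \<in> ad' \<and> pos' a = {y}" if c: "c \<in> W'" "card (pos' c) = 2" "y \<in> pos' c" for c y
    proof -
      obtain w where w: "w \<in> W" "c = j w" using W'E[OF c(1)] by blast
      then obtain a where "(w, a) \<in> ad" "pos a = {y}" using S_nb[of w y] pos'j c by auto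
      then show ?thesis using w ad'I pos'j ad_W by metis
    qed
    show "(x, y) \<in> ad'\<^sup>*" if xy: "x \<in> W'" "y \<in> W'" for x y
    proof -
      obtain u v where uv: "u \<in> W" "x = j u" "v \<in> W" "y = j v" using W'E xy by metis
      from conn[OF uv(1,3)] have "(j u, j v) \<in> ad'\<^sup>*"
        by (induction rule: rtrancl_induct) (auto intro: rtrancl_into_rtrancl ad'I)
      then show ?thesis using uv by simp
    qed
    show "W' \<noteq> {}" using W_ne W'_def by simp
  qed
  interpret nn: xgraph G E lev ea br X tip W' wa' ad' pos' by (rule xg)
  have Id: "(j x, j y) \<in> Id_on W' \<longleftrightarrow> (x, y) \<in> R" if "x \<in> W" "y \<in> W" for x y using j[OF that] W'I that by (simp only: Id_on_iff simp_thms)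
  have aI: "nn.adR (Id_on W') = ad'"
  proof (intro equalityI subrelI)
    show "(v, w) \<in> ad'" if "(v, w) \<in> nn.adR (Id_on W')" for v w using that unfolding nn.adR_def Id_on_iff by blast
    show "(v, w) \<in> nn.adR (Id_on W')" if "(v, w) \<in> ad'" for v w using nn.ad_adR[OF nn.req_Id that] .
  qed
  have pr: "nn.par (Id_on W') p'"
    unfolding nn.par_def
  proof (intro conjI ballI)
    show "p' x \<in> W'" if "x \<in> W'" for x using W'E[OF that] p'j parD(1)[OF q] W'I by auto
    then show "\<And>xy. xy \<in> Id_on W' \<Longrightarrow> case xy of (x, y) \<Rightarrow> (p' x, p' y) \<in> Id_on W'" by auto
    show "(p' (wa' g x), wa' g (p' x)) \<in> Id_on W'" if g: "g \<in> carrier G" "x \<in> W'" for g x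
    proof -
      obtain w where "w \<in> W" "x = j w" using W'E[OF g(2)] by blast
      then show ?thesis using parD(1,3)[OF q] Id p'j wa'j wa_cl g by simp
    qed
    show "(p' x, x) \<in> Id_on W' \<or> (p' x, x) \<in> nn.adR (Id_on W')" if x: "x \<in> W'" for x
    proof -
      obtain w where "w \<in> W" "x = j w" using W'E[OF x] by blast
      then show ?thesis using parD(1,4)[OF q] Id p'j ad'j unfolding aI by simp
    qed
  qed
  have st: "nn.st (Id_on W') (j w) = st R w" if "w \<in> W" for w
    unfolding nn.st_def st_def by (rule Collect_cong) (use wa'j Id wa_cl that in \<open>simp cong: conj_cong\<close>)
  have M: "flag_mset True R q = nn.flag_mset True (Id_on W') p'"
    unfolding flag_mset_def nn.flag_mset_def
  proof (rule qmset_eq[where f = "\<lambda>(x, y). (j x, j y)", OF fflags_equiv[OF R] nn.fflags_equiv[OF nn.req_Id]])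
    show "nn.lab (Id_on W') b = nn.lab (Id_on W') b'" if "(b, b') \<in> nn.flag_rel (Id_on W')" for b b'
      by (rule nn.lab_TH[OF nn.req_Id that])
    show "(case t of (x, y) \<Rightarrow> (j x, j y)) \<in> nn.fflags True (Id_on W') p'" if t: "t \<in> fflags True R q" for t
    proof -
      obtain x y where xy: "t = (x, y)" "(x, y) \<in> ad" "card (pos x) = 1" "(q x, y) \<notin> R" "(q y, x) \<notin> R"
        using t unfolding fflags_def by auto
      have "x \<in> W" "y \<in> W" using ad_W xy by blast+
      then show ?thesis using xy pos'j p'j Id parD(1)[OF q] ad'I unfolding nn.fflags_def by simp
    qed
    show "lab R t = nn.lab (Id_on W') (case t of (x, y) \<Rightarrow> (j x, j y))" if "t \<in> fflags True R q" for t
      using that st ad_W unfolding fflags_def lab_def nn.lab_def flag_stab_def nn.flag_stab_def by auto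
    show "((case t of (x, y) \<Rightarrow> (j x, j y)), (case s of (x, y) \<Rightarrow> (j x, j y))) \<in> nn.flag_rel (Id_on W') \<longleftrightarrow> (t, s) \<in> flag_rel R"
      if ts: "t \<in> fflags True R q" "s \<in> fflags True R q" for t s
    proof -
      obtain x y where xy: "t = (x, y)" "x \<in> W" "y \<in> W" using ts ad_W unfolding fflags_def by blast
      obtain u v where uv: "s = (u, v)" "u \<in> W" "v \<in> W" using ts ad_W unfolding fflags_def by blast
      have "(wa' g (j z), j w) \<in> Id_on W' \<longleftrightarrow> (wa g z, w) \<in> R" if "g \<in> carrier G" "z \<in> W" "w \<in> W" for g z w
        using wa'j Id that wa_cl by simp
      then show ?thesis using xy uv W'I unfolding flag_rel_def nn.flag_rel_def by auto
    qed
    show "\<exists>t \<in> fflags True R q. ((case t of (x, y) \<Rightarrow> (j x, j y)), b) \<in> nn.flag_rel (Id_on W')" if b: "b \<in> nn.fflags True (Id_on W') p'" for b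
    proof -
      obtain v w where vw: "b = (v, w)" "(v, w) \<in> ad'" "card (pos' v) = 1" "(p' v, w) \<notin> Id_on W'" "(p' w, v) \<notin> Id_on W'"
        using b unfolding nn.fflags_def by auto
      obtain x y where xy: "(x, y) \<in> ad" "v = j x" "w = j y" "x \<in> W" "y \<in> W" using ad'E[OF vw(2)] by blast
      have "(x, y) \<in> fflags True R q" using vw xy pos'j p'j Id parD(1)[OF q] unfolding fflags_def by simp
      moreover have "b \<in> W' \<times> W'" using vw nn.ad_W by blast
      then have "((case (x, y) of (x, y) \<Rightarrow> (j x, j y)), b) \<in> nn.flag_rel (Id_on W')" using nn.flag_rel_D(1)[OF nn.req_Id] vw xy by simp
      ultimately show ?thesis by blast
    qed
  qed
  have im: "nn.immersed (Id_on W')" if "immersed R"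
    unfolding nn.immersed_def
  proof (intro allI impI)
    fix u a u' b assume as: "(u, a) \<in> ad'" "(u', b) \<in> ad'" "(u, u') \<in> Id_on W'" "pos' a = pos' b"
    obtain x y where xy: "(x, y) \<in> ad" "u = j x" "a = j y" "x \<in> W" "y \<in> W" using ad'E[OF as(1)] by blast
    obtain x' y' where xy': "(x', y') \<in> ad" "u' = j x'" "b = j y'" "x' \<in> W" "y' \<in> W" using ad'E[OF as(2)] by blast
    have "(y, y') \<in> R" by (rule immD[OF that xy(1) xy'(1)]) (use as xy xy' Id pos'j in auto)
    then show "(a, b) \<in> Id_on W'" using Id xy xy' by simp
  qed
  have "W' = j ` W \<and> (\<forall>x \<in> W. \<forall>y \<in> W. j x = j y \<longleftrightarrow> (x, y) \<in> R) \<and> (\<forall>w \<in> W. pos' (j w) = pos w)"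
    using j pos'j W'_def by blast
  then show ?thesis unfolding net_def using xg pr M im by blast
qed

end

section \<open>An initial graph and a minimal multiset\<close>

context protree begin

text \<open>A Cayley-type graph on the orbit of a point \<open>x0\<close>: a strand joins
  \<open>g x0\<close> to \<open>g s x0\<close> for every generator \<open>s\<close> that moves
  \<open>x0\<close>. Finiteness of \<open>S\<close> gives finitely many orbits of edges, and
  generation gives connectedness. Every vertex is its own parent, so all edges are flags.\<close>

lemma initial:
  assumes S: "finite S" "S \<subseteq> carrier G" "generate G S = carrier G"
  obtains M and W' :: "(nat \<times> 'g set) set" and wa' ad' pos' p' where "net W' wa' ad' pos' p' M"
proof -
  obtain x0 where x0: "x0 \<in> X" using X_ne by blast
  define V where "V = (\<lambda>g. {pact g x0}) ` carrier G"
  define C where "C = {{pact g x0, pact g (pact s x0)} | g s. g \<in> carrier G \<and> s \<in> S \<and> pact s x0 \<noteq> x0}"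
  define ad where "ad = {(x, y). x \<in> V \<and> y \<in> C \<and> x \<subseteq> y} \<union> {(y, x). x \<in> V \<and> y \<in> C \<and> x \<subseteq> y}"
  define W where "W = V \<union> C"
  have sX: "pact s x0 \<in> X" if "s \<in> S" for s using that S x0 pact_X by blast
  have V1: "card x = 1 \<and> x \<subseteq> X" if "x \<in> V" for x using that x0 pact_X unfolding V_def by auto
  have C2: "card x = 2 \<and> x \<subseteq> X" if "x \<in> C" for x
  proof -
    obtain g s where "x = {pact g x0, pact g (pact s x0)}" "g \<in> carrier G" "s \<in> S" "pact s x0 \<noteq> x0"
      using \<open>x \<in> C\<close> unfolding C_def by blast
    then show ?thesis using pact_eq[of g x0 "pact s x0"] x0 sX[of s] pact_X[of g] by auto
  qed
  have Va: "pact g ` x \<in> V" if "x \<in> V" "g \<in> carrier G" for x g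
  proof -
    obtain h where "h \<in> carrier G" "x = {pact h x0}" using \<open>x \<in> V\<close> unfolding V_def by blast
    then have "pact g ` x = {pact (g \<otimes> h) x0}" "g \<otimes> h \<in> carrier G" using pact_mult that x0 by auto
    then show ?thesis unfolding V_def by blast
  qed
  have Ca: "pact g ` x \<in> C" if "x \<in> C" "g \<in> carrier G" for x g
  proof -
    obtain h s where h: "x = {pact h x0, pact h (pact s x0)}" "h \<in> carrier G" "s \<in> S" "pact s x0 \<noteq> x0"
      using \<open>x \<in> C\<close> unfolding C_def by blast
    then have "pact g ` x = {pact (g \<otimes> h) x0, pact (g \<otimes> h) (pact s x0)}" "g \<otimes> h \<in> carrier G"
      using pact_mult that x0 sX by auto
    then show ?thesis unfolding C_def using h by blast
  qed
  have WX: "w \<subseteq> X" if "w \<in> W" for w using that V1 C2 unfolding W_def by blast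
  have step: "({pact h x0}, {pact (h \<otimes> s) x0}) \<in> ad\<^sup>*" if h: "h \<in> carrier G" "s \<in> S" for h s
  proof (cases "pact s x0 = x0")
    case True
    then have "pact (h \<otimes> s) x0 = pact h x0" using pact_mult[of h s x0] h S x0 by auto
    then show ?thesis by simp
  next
    case False
    have s: "s \<in> carrier G" using h S by blast
    define c where "c = {pact h x0, pact h (pact s x0)}"
    have "c \<in> C" unfolding C_def c_def using h False by blast
    moreover have "{pact h x0} \<in> V" unfolding V_def using h by blast
    moreover have "{pact (h \<otimes> s) x0} \<in> V" unfolding V_def using h s by blast
    moreover have "pact (h \<otimes> s) x0 \<in> c" unfolding c_def using pact_mult h s x0 by simp
    ultimately have "({pact h x0}, c) \<in> ad" "(c, {pact (h \<otimes> s) x0}) \<in> ad" unfolding ad_def c_def by auto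
    then show ?thesis by (meson converse_rtrancl_into_rtrancl r_into_rtrancl)
  qed
  have "sym ad" unfolding ad_def sym_def by blast
  then have syma: "sym (ad\<^sup>*)" by (rule sym_rtrancl)
  \<comment> \<open>A generator acts by right multiplication along the edges, so the induction has
    to allow any starting element \<open>h\<close>.\<close>
  have gen: "({pact h x0}, {pact (h \<otimes> g) x0}) \<in> ad\<^sup>*" if "h \<in> carrier G" "g \<in> generate G S" for h g
    using that(2,1)
  proof (induction arbitrary: h rule: generate.induct)
    case one
    then show ?case by simp
  next
    case (incl s)
    then show ?case using step by blast
  next
    case (inv s)
    have s: "s \<in> carrier G" using inv S by blast
    have "h \<otimes> inv s \<otimes> s = h" using inv s by (simp add: m_assoc)
    then have "({pact (h \<otimes> inv s) x0}, {pact h x0}) \<in> ad\<^sup>*" using step[of "h \<otimes> inv s" s] inv s by simp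
    then show ?case using syma symD by fast
  next
    case (eng a b)
    have "a \<in> carrier G" "b \<in> carrier G" using eng S generate_in_carrier by blast+
    then have "h \<otimes> (a \<otimes> b) = h \<otimes> a \<otimes> b" "h \<otimes> a \<in> carrier G" using eng by (simp_all add: m_assoc)
    then show ?case using eng(3)[of h] eng(4)[of "h \<otimes> a"] eng(5) by simp
  qed
  have c0: "({x0}, w) \<in> ad\<^sup>*" if w: "w \<in> W" for w
  proof -
    have v: "({x0}, {pact g x0}) \<in> ad\<^sup>*" if "g \<in> carrier G" for g
      using gen[of \<one> g] that S(3) pact_one[OF x0] by simp
    show ?thesis
    proof (cases "w \<in> V")
      case True
      then show ?thesis using v unfolding V_def by blast
    next
      case False
      then obtain g s where g: "w = {pact g x0, pact g (pact s x0)}" "g \<in> carrier G" "w \<in> C" using w unfolding W_def C_def by blast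
      then have "({pact g x0}, w) \<in> ad" unfolding ad_def V_def by auto
      then show ?thesis using v[OF g(2)] by (meson rtrancl_into_rtrancl)
    qed
  qed
  have xg: "xgraph G E lev ea br X tip W (\<lambda>g. image (pact g)) ad (\<lambda>w. w)"
  proof (rule xgraphI)
    show "pact g ` w \<in> W" if "g \<in> carrier G" "w \<in> W" for g w using that Va Ca unfolding W_def by blast
    show "pact \<one> ` w = w" if "w \<in> W" for w using WX[OF that] pact_one by force
    show "pact (g \<otimes> h) ` w = pact g ` pact h ` w" if "g \<in> carrier G" "h \<in> carrier G" "w \<in> W" for g h w
      unfolding image_image by (rule image_cong) (use WX[OF that(3)] pact_mult that in auto)
    show "(pact g ` x, pact g ` y) \<in> ad" if "g \<in> carrier G" "(x, y) \<in> ad" for g x y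

    proof -
      have "x \<in> V \<and> y \<in> C \<and> x \<subseteq> y \<or> y \<in> V \<and> x \<in> C \<and> y \<subseteq> x" using that(2) unfolding ad_def by auto
      then show ?thesis using Va Ca that(1) image_mono[of x y "pact g"] image_mono[of y x "pact g"] unfolding ad_def by auto
    qed
    show "\<exists>F. finite F \<and> F \<subseteq> ad \<and> (\<forall>(x, y) \<in> ad. \<exists>g \<in> carrier G. \<exists>(x', y') \<in> F. x = pact g ` x' \<and> y = pact g ` y')"
    proof (intro exI conjI)
      define F0 where "F0 = (\<Union>s \<in> S. {({z}, {x0, pact s x0}) | z. z \<in> {x0, pact s x0}})"
      have "finite F0" unfolding F0_def using S(1) by simp
      moreover define F where "F = (F0 \<union> prod.swap ` F0) \<inter> ad"
      ultimately show "finite F" by simp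
      show "F \<subseteq> ad" unfolding F_def by blast
      have k: "\<exists>g \<in> carrier G. \<exists>(x', y') \<in> F0. (x', y') \<in> ad \<and> x = pact g ` x' \<and> y = pact g ` y'"
        if xy: "x \<in> V" "y \<in> C" "x \<subseteq> y" for x y
      proof -
        obtain g s where g: "y = {pact g x0, pact g (pact s x0)}" "g \<in> carrier G" "s \<in> S"
          using xy unfolding C_def by blast
        obtain z where z: "x = {pact g z}" "z \<in> {x0, pact s x0}" using xy V1[OF xy(1)] g(1) by (auto simp: card_1_singleton_iff)
        have y': "pact (inv g) ` y = {x0, pact s x0}" using g x0 sX pact_inv by simp
        have "z \<in> X" using z x0 sX g by blast
        then have x': "pact (inv g) ` x = {z}" using g z pact_inv by simp
        have "{z} \<in> V" "{x0, pact s x0} \<in> C" using Va[OF xy(1), of "inv g"] Ca[OF xy(2), of "inv g"] x' y' g(2) by simp_all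
        then have "({z}, {x0, pact s x0}) \<in> ad" using z unfolding ad_def by auto
        moreover have "({z}, {x0, pact s x0}) \<in> F0" using z g unfolding F0_def by blast
        moreover have "x = pact g ` {z}" "y = pact g ` {x0, pact s x0}" using g z by auto
        ultimately show ?thesis using g(2) by blast
      qed
      show "\<forall>(x, y) \<in> ad. \<exists>g \<in> carrier G. \<exists>(x', y') \<in> F. x = pact g ` x' \<and> y = pact g ` y'"
      proof clarify
        fix x y assume "(x, y) \<in> ad"
        then consider "x \<in> V" "y \<in> C" "x \<subseteq> y" | "y \<in> V" "x \<in> C" "y \<subseteq> x" unfolding ad_def by blast
        then show "\<exists>g \<in> carrier G. \<exists>(x', y') \<in> F. x = pact g ` x' \<and> y = pact g ` y'"
        proof cases
          case 1
          then show ?thesis using k[OF 1] unfolding F_def by blast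
        next
          case 2
          then obtain g x' y' where "g \<in> carrier G" "(y', x') \<in> F0" "(y', x') \<in> ad" "x = pact g ` x'" "y = pact g ` y'" using k[OF 2] by blast
          moreover have "(x', y') \<in> ad" using calculation \<open>sym ad\<close> symD by fast
          moreover have "(x', y') \<in> prod.swap ` F0" using calculation by force
          ultimately show ?thesis unfolding F_def by blast
        qed
      qed
    qed
    show "(x, y) \<in> ad\<^sup>*" if "x \<in> W" "y \<in> W" for x y using c0 that syma by (meson rtrancl_trans symD)
    show "\<exists>a. (c, a) \<in> ad \<and> a = {y}" if c: "c \<in> W" "card c = 2" "y \<in> c" for c y
    proof -
      have cC: "c \<in> C" using c V1 unfolding W_def by force
      then obtain g s where g: "c = {pact g x0, pact g (pact s x0)}" "g \<in> carrier G" "s \<in> S" unfolding C_def by blast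
      then have "\<exists>h \<in> carrier G. y = pact h x0"
      proof (cases "y = pact g x0")
        case False
        then have "y = pact (g \<otimes> s) x0" "g \<otimes> s \<in> carrier G" using g c(3) pact_mult[of g s x0] S x0 by auto
        then show ?thesis by blast
      qed blast
      then have "{y} \<in> V" unfolding V_def by blast
      then show ?thesis using cC c(3) unfolding ad_def by auto
    qed
    show "x \<in> W \<and> y \<in> W" if "(x, y) \<in> ad" for x y using that unfolding ad_def W_def by blast
    show "(y, x) \<in> ad" if "(x, y) \<in> ad" for x y using that unfolding ad_def by blast
    show "(card x = 1) \<noteq> (card y = 1)" if "(x, y) \<in> ad" for x y using that V1 C2 unfolding ad_def by fastforce
    show "w \<subseteq> X" if "w \<in> W" for w using WX that .
    show "card w = 1 \<or> card w = 2" if "w \<in> W" for w using that V1 C2 unfolding W_def by blast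
    show "x \<subseteq> y \<or> y \<subseteq> x" if "(x, y) \<in> ad" for x y using that unfolding ad_def by blast
    show "W \<noteq> {}" unfolding W_def V_def by blast
  qed simp
  interpret x: xgraph G E lev ea br X tip W "\<lambda>g. image (pact g)" ad "\<lambda>w. w" by (rule xg)
  have "x.par (Id_on W) (\<lambda>w. w)" unfolding x.par_def using x.wa_cl by auto
  from x.transfer[OF x.req_Id this] show ?thesis by (elim exE conjE) (rule that)
qed

lemma minimal:
  assumes S: "finite S" "S \<subseteq> carrier G" "generate G S = carrier G" and wf: "wf stab_less"
  obtains M and W :: "(nat \<times> 'g set) set" and wa ad pos p where "net W wa ad pos p M"
    "\<And>M' (W' :: (nat \<times> 'g set) set) wa' ad' pos' p'. net W' wa' ad' pos' p' M' \<Longrightarrow> (M', M) \<notin> mult stab_less"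
proof -
  define Q where "Q = {M. \<exists>(W :: (nat \<times> 'g set) set) wa ad pos p. net W wa ad pos p M}"
  obtain M0 and W0 :: "(nat \<times> 'g set) set" and wa0 ad0 pos0 p0 where "net W0 wa0 ad0 pos0 p0 M0" by (rule initial[OF S])
  then have "M0 \<in> Q" unfolding Q_def mem_Collect_eq by (intro exI)
  then obtain M where "M \<in> Q" "\<And>M'. (M', M) \<in> mult stab_less \<Longrightarrow> M' \<notin> Q" by (rule wfE_min[OF wf_mult[OF wf]]) blast
  note M = this
  from M(1) show ?thesis unfolding Q_def mem_Collect_eq
  proof (elim exE)
    fix W :: "(nat \<times> 'g set) set" and wa ad pos p assume g: "net W wa ad pos p M"
    show ?thesis
    proof (rule that[OF g])
      show "(M', M) \<notin> mult stab_less" if g': "net W' wa' ad' pos' p' M'" for M' and W' :: "(nat \<times> 'g set) set" and wa' ad' pos' p'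
      proof
        assume "(M', M) \<in> mult stab_less"
        then have "M' \<notin> Q" by (rule M(2))
        moreover have "M' \<in> Q" unfolding Q_def mem_Collect_eq by (intro exI) (rule g')
        ultimately show False by blast
      qed
    qed
  qed
qed

section \<open>Last separating arcs\<close>

definition last_sep :: "'e set \<Rightarrow> 'e \<Rightarrow> 'e set \<Rightarrow> bool" where
  "last_sep p e y \<longleftrightarrow> e \<in> E \<and> e \<notin> p \<and> e \<in> y \<and> (\<forall>f \<in> E. lev f = lev e \<longrightarrow> f \<notin> p \<longrightarrow> f \<in> y \<longrightarrow> beyond f e)"

lemma last_sep_unique: "\<lbrakk>last_sep p e y; last_sep p e' y; lev e = lev e'\<rbrakk> \<Longrightarrow> e = e'"
  using beyond_antisym[of e e'] unfolding last_sep_def by simp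

lemma beyond_max:
  assumes "finite D" "D \<noteq> {}" "\<And>e f. e \<in> D \<Longrightarrow> f \<in> D \<Longrightarrow> beyond e f \<or> beyond f e"
  shows "\<exists>e \<in> D. \<forall>f \<in> D. beyond f e"
  using assms
proof (induction rule: finite_ne_induct)
  case (singleton x)
  then show ?case by (simp add: beyond_refl)
next
  case (insert x F)
  then obtain e where e: "e \<in> F" "\<forall>f \<in> F. beyond f e" by blast
  show ?case
  proof (cases "beyond x e")
    case False
    then have "beyond e x" using insert(5)[of x e] e by blast
    then show ?thesis using e beyond_trans beyond_refl by blast
  qed (use e in blast)
qed

lemma beyond_min:
  assumes "finite D" "D \<noteq> {}" "\<And>e f. e \<in> D \<Longrightarrow> f \<in> D \<Longrightarrow> beyond e f \<or> beyond f e"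
  shows "\<exists>e \<in> D. \<forall>f \<in> D. beyond e f"
  using assms
proof (induction rule: finite_ne_induct)
  case (singleton x)
  then show ?case by (simp add: beyond_refl)
next
  case (insert x F)
  then obtain e where e: "e \<in> F" "\<forall>f \<in> F. beyond e f" by blast
  show ?case
  proof (cases "beyond e x")
    case False
    then have "beyond x e" using insert(5)[of x e] e by blast
    then show ?thesis using e beyond_trans beyond_refl by blast
  qed (use e in blast)
qed

lemma last_sep_ex:
  assumes "p \<in> X" "y \<in> X" "\<not> lev_eq m p y"
  obtains e where "last_sep p e y" "lev e = m"
proof -
  define D where "D = {e \<in> y - p. lev e = m}"
  have D: "finite D" unfolding D_def using fin_D assms by blast
  have DE: "D \<subseteq> E" using X_sub assms unfolding D_def by blast
  have "D \<noteq> {}" using lev_eq_diff[OF assms] unfolding D_def by blast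
  moreover have "beyond e f \<or> beyond f e" if "e \<in> D" "f \<in> D" for e f
    using beyond_total[of e f p y] that assms DE unfolding D_def by blast
  ultimately obtain e where e: "e \<in> D" "\<forall>f \<in> D. beyond f e" using beyond_max[OF D] by blast
  then have "last_sep p e y" unfolding last_sep_def using DE unfolding D_def by blast
  then show ?thesis using that e unfolding D_def by blast
qed

text \<open>Every arc of this level that separates \<open>p\<close> from \<open>y\<close> comes
  before \<open>e\<close>, so it also separates \<open>p\<close> from \<open>z\<close>, which lies
  past \<open>e\<close>. Arcs that point towards \<open>p\<close> are treated by reversal.\<close>

lemma last_sep_nq:
  assumes "p \<in> X" "y \<in> X" "z \<in> X" "last_sep p e y" "last_sep p e z"
  shows "lev_eq (lev e) y z"
proof -
  have *: "f \<in> z" if f: "f \<in> E" "lev f = lev e" "f \<in> y" "f \<notin> p" "last_sep p e y" "last_sep p e z" "z \<in> X" for f y z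
    using f unfolding last_sep_def beyond_def by blast
  have 1: "f \<in> z" if f: "f \<in> E" "lev f = lev e" "f \<in> y" "last_sep p e y" "last_sep p e z" "y \<in> X" "z \<in> X" for f y z
  proof (cases "f \<in> p")
    case True
    show ?thesis
    proof (rule ccontr)
      assume "f \<notin> z"
      then have "br f \<in> z" "br f \<notin> p" using X_br f assms True by blast+
      then have "br f \<in> y" using *[of "br f" z y] f br_cl lev_br by simp
      then show False using X_br f by blast
    qed
  qed (use * f in blast)
  show ?thesis unfolding lev_eq_def using 1[of _ y z] 1[of _ z y] assms by blast
qed

end

section \<open>Strands and the arcs that they cross\<close>

context xgraph begin

definition Sv where "Sv = {c \<in> W. card (pos c) = 2}"

text \<open>The interval between the two ends, written without naming or ordering them.\<close>

definition sg where "sg c = {z \<in> X. \<Inter> (pos c) \<subseteq> z}"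

definition Oe where "Oe e = {c \<in> Sv. (\<exists>p \<in> pos c. e \<notin> p) \<and> (\<exists>q \<in> pos c. e \<in> q)}"

lemma SvD: "c \<in> Sv \<Longrightarrow> c \<in> W" "c \<in> Sv \<Longrightarrow> pos c \<subseteq> X" using pos_X by (auto simp: Sv_def)

lemma Sv_ends: assumes "c \<in> Sv" "p \<in> pos c" obtains q where "pos c = {p, q}" "p \<noteq> q" "p \<in> X" "q \<in> X"
proof -
  obtain a b where "pos c = {a, b}" "a \<noteq> b" using assms unfolding Sv_def by (auto simp: card_2_iff)
  then show ?thesis using that assms SvD(2)[OF assms(1)] by auto
qed

lemma sg_seg: assumes "pos c = {p, q}" "p \<in> X" "q \<in> X" shows "sg c = seg p q"
proof -
  have "\<Inter> (pos c) = p \<inter> q" unfolding assms(1) by simp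
  then show ?thesis unfolding sg_def using seg_mem_br[OF assms(2,3)] seg_X by blast
qed

lemma Oe_ends:
  assumes "c \<in> Oe e"
  obtains p q where "pos c = {p, q}" "p \<in> X" "q \<in> X" "e \<notin> p" "e \<in> q" "c \<in> Sv"
proof -
  obtain p where p: "p \<in> pos c" "e \<notin> p" "c \<in> Sv" using assms unfolding Oe_def by blast
  then obtain q where q: "pos c = {p, q}" "p \<in> X" "q \<in> X" using Sv_ends by metis
  then have "e \<in> q" using assms p unfolding Oe_def by auto
  then show ?thesis using that p q by blast
qed

lemma Oe_I: "\<lbrakk>c \<in> Sv; pos c = {p, q}; e \<notin> p; e \<in> q\<rbrakk> \<Longrightarrow> c \<in> Oe e" unfolding Oe_def by auto

lemma Sv_act: "g \<in> carrier G \<Longrightarrow> c \<in> Sv \<Longrightarrow> wa g c \<in> Sv"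
  unfolding Sv_def using wa_cl pos_wa card_pact pos_X by auto

lemma Oe_act: assumes "g \<in> carrier G" "c \<in> Sv" "e \<in> E" shows "wa g c \<in> Oe (ea g e) \<longleftrightarrow> c \<in> Oe e"
proof -
  have "pos (wa g c) = pact g ` pos c" using pos_wa assms SvD by blast
  moreover have "ea g e \<in> pact g x \<longleftrightarrow> e \<in> x" if "x \<in> pos c" for x using mem_pact assms SvD(2)[OF assms(2)] that by blast
  ultimately show ?thesis unfolding Oe_def using Sv_act assms by auto
qed

lemma sg_act: assumes "g \<in> carrier G" "c \<in> Sv" "y \<in> X" shows "pact g y \<in> sg (wa g c) \<longleftrightarrow> y \<in> sg c"
proof -
  obtain p where "p \<in> pos c" using assms(2) unfolding Sv_def by (force simp: card_2_iff)
  then obtain q where q: "pos c = {p, q}" "p \<in> X" "q \<in> X" using Sv_ends assms by metis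
  have "pos (wa g c) = {pact g p, pact g q}" using pos_wa assms SvD q by simp
  then have "sg (wa g c) = seg (pact g p) (pact g q)" by (rule sg_seg[OF _ pact_X[OF assms(1) q(2)] pact_X[OF assms(1) q(3)]])
  then show ?thesis using seg_pact[of g p q y] sg_seg[OF q] q assms by simp
qed

lemma fin_move: assumes "c \<in> Sv" shows "finite {g \<in> carrier G. wa g c = d}"
proof -
  have "{g \<in> carrier G. wa g c = d} \<subseteq> {g \<in> carrier G. pact g ` pos c = pos d}" using pos_wa SvD(1)[OF assms] by auto
  then show ?thesis using fin_pos[of c "pos d"] assms finite_subset unfolding Sv_def by blast
qed

lemma Sv_orbits: "\<exists>K. finite K \<and> K \<subseteq> Sv \<and> (\<forall>c \<in> Sv. \<exists>g \<in> carrier G. \<exists>k \<in> K. c = wa g k)"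
proof -
  obtain F where F: "finite F" "F \<subseteq> ad" "\<forall>(x, y) \<in> ad. \<exists>g \<in> carrier G. \<exists>(x', y') \<in> F. x = wa g x' \<and> y = wa g y'"
    using fin_ad by blast
  have "\<exists>g \<in> carrier G. \<exists>k \<in> fst ` F \<inter> Sv. c = wa g k" if c: "c \<in> Sv" for c
  proof -
    obtain p where "p \<in> pos c" using c unfolding Sv_def by (force simp: card_2_iff)
    then obtain a where "(c, a) \<in> ad" using S_nb c unfolding Sv_def by blast
    then obtain g x y where g: "g \<in> carrier G" "(x, y) \<in> F" "c = wa g x" using F(3) by blast
    have "x \<in> W" using g F(2) ad_W by blast
    then have "x \<in> Sv" using c g pos_wa card_pact[OF g(1) pos_X] unfolding Sv_def by auto
    then show ?thesis using g by force
  qed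
  then show ?thesis using F(1) by (intro exI[of _ "fst ` F \<inter> Sv"]) auto
qed

text \<open>Each of the finitely many representative strands crosses finitely many arcs of the level
  of \<open>e\<close>, and finitely many elements carry a given arc to \<open>e\<close>, because arc
  stabilisers are finite.\<close>

lemma fin_Oe: assumes "e \<in> E" shows "finite (Oe e)"
proof -
  obtain K where K: "finite K" "K \<subseteq> Sv" "\<forall>c \<in> Sv. \<exists>g \<in> carrier G. \<exists>k \<in> K. c = wa g k" using Sv_orbits by blast
  define D where "D k = {f \<in> E. lev f = lev e \<and> k \<in> Oe f}" for k
  have fD: "finite (D k)" if k: "k \<in> K" for k
  proof -
    have "k \<in> Sv" using k K by blast
    then obtain p where "p \<in> pos k" unfolding Sv_def by (force simp: card_2_iff)
    then obtain q where q: "pos k = {p, q}" "p \<in> X" "q \<in> X" using Sv_ends \<open>k \<in> Sv\<close> by metis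
    have "D k \<subseteq> {f \<in> q - p. lev f = lev e} \<union> {f \<in> p - q. lev f = lev e}" unfolding D_def Oe_def by (auto simp: q(1))
    then show ?thesis using fin_D[OF q(2,3)] fin_D[OF q(3,2)] finite_subset by blast
  qed
  define H where "H f = {g \<in> carrier G. ea g f = e}" for f
  have fH: "finite (H f)" if f: "f \<in> E" for f
  proof (cases "H f = {}")
    case False
    then obtain h where h: "h \<in> carrier G" "ea h f = e" unfolding H_def by blast
    have "H f \<subseteq> (\<lambda>k. h \<otimes> k) ` {g \<in> carrier G. ea g f = f}"
    proof
      fix g assume "g \<in> H f"
      then have g: "g \<in> carrier G" "ea g f = e" unfolding H_def by auto
      have "ea (inv h \<otimes> g) f = f" using ea_mult[of "inv h" g f] ea_inv[OF h(1) f] g h f by simp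
      moreover have "g = h \<otimes> (inv h \<otimes> g)" using g h by (simp add: m_assoc[symmetric])
      moreover have "inv h \<otimes> g \<in> carrier G" using g h by simp
      ultimately show "g \<in> (\<lambda>k. h \<otimes> k) ` {g \<in> carrier G. ea g f = f}" by blast
    qed
    then show ?thesis using fin_stab[OF f] finite_subset by blast
  qed simp
  have "Oe e \<subseteq> (\<Union>k \<in> K. \<Union>f \<in> D k. (\<lambda>g. wa g k) ` H f)"
  proof
    fix c assume c: "c \<in> Oe e"
    then have "c \<in> Sv" unfolding Oe_def by blast
    then obtain g k where g: "g \<in> carrier G" "k \<in> K" "c = wa g k" using K(3) by blast
    define f where "f = ea (inv g) e"
    have f: "f \<in> E" "ea g f = e" "lev f = lev e" using g assms ea_cl ea_inv' lev_ea unfolding f_def by auto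
    then have "k \<in> Oe f" using Oe_act[of g k f] g K(2) c by blast
    then have "f \<in> D k" "g \<in> H f" using f g unfolding D_def H_def by auto
    then show "c \<in> (\<Union>k \<in> K. \<Union>f \<in> D k. (\<lambda>g. wa g k) ` H f)" using g by blast
  qed
  moreover have "finite (\<Union>k \<in> K. \<Union>f \<in> D k. (\<lambda>g. wa g k) ` H f)"
    using K(1) fD fH D_def by (intro finite_UN_I finite_imageI) auto
  ultimately show ?thesis using finite_subset by blast
qed

end

section \<open>Finiteness of the cut points\<close>

text \<open>\<open>K\<close> represents the strands, and \<open>M\<close> contains the medians of their ends.\<close>

locale kneser = xgraph +
  fixes K M
  assumes K: "finite K" "K \<subseteq> Sv" "\<And>c. c \<in> Sv \<Longrightarrow> \<exists>g \<in> carrier G. \<exists>k \<in> K. c = wa g k"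
    and M: "finite M" "M \<subseteq> X"
    and med: "\<And>c c' p q x. \<lbrakk>c \<in> K; c' \<in> K; p \<in> pos c; q \<in> pos c; x \<in> pos c'\<rbrakk> \<Longrightarrow> maj p q x \<in> M"
begin

text \<open>Translates of \<open>K\<close> are the regions inside which strands are compared; in the
  application \<open>K\<close> is chosen so large that strands to be identified are connected inside
  one translate.\<close>

definition share_K where "share_K c c' \<longleftrightarrow> (\<exists>g \<in> carrier G. c \<in> wa g ` K \<and> c' \<in> wa g ` K)"

text \<open>All translates of \<open>K\<close> through \<open>c\<close> contribute, since
  \<open>c\<close> may lie in several of them; this makes the marks equivariant.\<close>

definition marks where "marks c = {y \<in> sg c. \<exists>g \<in> carrier G. c \<in> wa g ` K \<and> y \<in> pact g ` M}"

text \<open>The points at which the strand \<open>c\<close> has to be cut in order that strands of a common translate of \<open>K\<close> share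
  the cut points that both contain.\<close>

inductive Pt where
  marks: "\<lbrakk>c \<in> Sv; y \<in> marks c\<rbrakk> \<Longrightarrow> Pt c y"
| tr: "\<lbrakk>Pt c y; share_K c c'; y \<in> sg c'\<rbrakk> \<Longrightarrow> Pt c' y"

lemma share_K_sym: "share_K c c' \<Longrightarrow> share_K c' c" unfolding share_K_def by blast

lemma share_K_Sv: "share_K c c' \<Longrightarrow> c \<in> Sv \<and> c' \<in> Sv" unfolding share_K_def using K(2) Sv_act by blast

lemma share_K_refl: "c \<in> Sv \<Longrightarrow> share_K c c" unfolding share_K_def using K(3) by blast

lemma share_K_act: assumes "share_K c c'" "g \<in> carrier G" shows "share_K (wa g c) (wa g c')"
proof -
  obtain h k k' where h: "h \<in> carrier G" "k \<in> K" "k' \<in> K" "c = wa h k" "c' = wa h k'" using assms unfolding share_K_def by blast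
  have "wa g c = wa (g \<otimes> h) k" "wa g c' = wa (g \<otimes> h) k'" using h wa_mult[OF assms(2) h(1)] K(2) SvD by auto
  then show ?thesis unfolding share_K_def using h assms by blast
qed

text \<open>The medians were put into \<open>M\<close> for this: where a strand of the same
  translate branches off, \<open>c\<close> carries a mark.\<close>

lemma marks_med: assumes "share_K c c'" "p \<in> pos c" "q \<in> pos c" "x \<in> pos c'" shows "maj p q x \<in> marks c"
proof -
  obtain h k k' where h: "h \<in> carrier G" "k \<in> K" "k' \<in> K" "c = wa h k" "c' = wa h k'" using assms unfolding share_K_def by blast
  have W: "k \<in> W" "k' \<in> W" "k \<in> Sv" using h K(2) SvD by auto
  obtain p' q' x' where p: "p = pact h p'" "q = pact h q'" "x = pact h x'" "p' \<in> pos k" "q' \<in> pos k" "x' \<in> pos k'"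
    using assms(2-4) pos_wa[OF h(1) W(1)] pos_wa[OF h(1) W(2)] h by auto
  have X': "p' \<in> X" "q' \<in> X" "x' \<in> X" using p pos_X W by blast+
  have "maj p q x = pact h (maj p' q' x')" using pact_maj[OF h(1) X'] p by simp
  moreover have "maj p' q' x' \<in> M" using med h p by blast
  moreover have "maj p q x \<in> sg c"
  proof -
    have cS: "c \<in> Sv" using share_K_Sv assms by blast
    have X: "p \<in> X" "q \<in> X" "x \<in> X" using p X' pact_X h by auto
    obtain r where r: "pos c = {p, r}" using Sv_ends cS assms by metis
    have "q = p \<or> q = r" using r assms by auto
    then have "\<Inter> (pos c) \<subseteq> maj p q x" unfolding r by (auto simp: maj_def)
    then show ?thesis unfolding sg_def using maj_X X by blast
  qed
  ultimately show ?thesis unfolding marks_def using h by blast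
qed

lemma marks_end: assumes "c \<in> Sv" "p \<in> pos c" shows "p \<in> marks c"
proof -
  have "maj p p p = p" by (auto simp: maj_def)
  then show ?thesis using marks_med[OF share_K_refl[OF assms(1)] assms(2,2,2)] by simp
qed

lemma marks_sg: "y \<in> marks c \<Longrightarrow> y \<in> sg c" "y \<in> marks c \<Longrightarrow> y \<in> X" unfolding marks_def sg_def by auto

lemma Pt_sg: "Pt c y \<Longrightarrow> c \<in> Sv \<and> y \<in> sg c \<and> y \<in> X"
  by (induction rule: Pt.induct) (use marks_sg share_K_Sv in \<open>auto simp: sg_def\<close>)

lemma marks_fin: assumes "c \<in> Sv" shows "finite (marks c)"
proof -
  have "marks c \<subseteq> (\<Union>k \<in> K. \<Union>g \<in> {g \<in> carrier G. wa g k = c}. pact g ` M)" unfolding marks_def by blast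
  moreover have "finite (\<Union>k \<in> K. \<Union>g \<in> {g \<in> carrier G. wa g k = c}. pact g ` M)"
    by (intro finite_UN_I K(1) finite_imageI M(1) fin_move) (use K(2) in blast)
  ultimately show ?thesis using finite_subset by blast
qed

lemma marks_act: assumes "g \<in> carrier G" "c \<in> Sv" "y \<in> marks c" shows "pact g y \<in> marks (wa g c)"
proof -
  obtain h k m where h: "h \<in> carrier G" "k \<in> K" "c = wa h k" "m \<in> M" "y = pact h m" "y \<in> sg c" using assms unfolding marks_def by blast
  have "k \<in> W" "m \<in> X" using h K(2) M(2) SvD by auto
  then have "wa g c = wa (g \<otimes> h) k" "pact g y = pact (g \<otimes> h) m" using h wa_mult[OF assms(1) h(1)] pact_mult[OF assms(1) h(1)] by auto
  moreover have "pact g y \<in> sg (wa g c)" using sg_act assms marks_sg by blast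
  ultimately show ?thesis unfolding marks_def using h assms(1) by blast
qed

lemma Pt_act: assumes "Pt c y" "g \<in> carrier G" shows "Pt (wa g c) (pact g y)"
  using assms(1)
proof (induction rule: Pt.induct)
  case (marks c y)
  then show ?case using Pt.marks marks_act Sv_act assms by blast
next
  case (tr c y c')
  then have "pact g y \<in> sg (wa g c')" using sg_act[OF assms(2)] share_K_Sv Pt_sg by blast
  then show ?case using Pt.tr[OF tr.IH share_K_act[OF tr.hyps(2) assms(2)]] by blast
qed

definition rel where "rel e = {(c, c'). c \<in> Oe e \<and> c' \<in> Oe e \<and> share_K c c'}"

definition Cl where "Cl c e = (rel e)\<^sup>* `` {c}"

text \<open>The arc is the last one before a mark, seen from an end of \<open>c\<close>. Along a
  strand, its class \<open>Cl\<close> can change only at an arc that is singular for some strand of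
  the class.\<close>

definition singular where "singular c e \<longleftrightarrow> (\<exists>p \<in> pos c. \<exists>y \<in> marks c. last_sep p e y)"

definition next_edge where "next_edge e e' \<longleftrightarrow> e \<in> E \<and> e' \<in> E \<and> lev e = lev e' \<and> e \<noteq> e' \<and> beyond e e' \<and>
  (\<forall>f \<in> E. lev f = lev e \<longrightarrow> beyond e f \<longrightarrow> beyond f e' \<longrightarrow> f = e \<or> f = e')"

lemma Cl_self: "c \<in> Cl c e" unfolding Cl_def by blast

lemma rel_sym: "sym ((rel e)\<^sup>*)" by (rule sym_rtrancl) (auto simp: sym_def rel_def share_K_sym)

lemma Cl_eq: "c' \<in> Cl c e \<Longrightarrow> Cl c' e = Cl c e"
  unfolding Cl_def using rel_sym[of e] by (auto dest: symD intro: rtrancl_trans)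

lemma Cl_Oe: assumes "c \<in> Oe e" "c' \<in> Cl c e" shows "c' \<in> Oe e"
proof -
  have "(c, c') \<in> (rel e)\<^sup>*" using assms(2) unfolding Cl_def by blast
  then show ?thesis using assms(1) by (induction rule: rtrancl_induct) (auto simp: rel_def)
qed

lemma Cl_fin: assumes "c \<in> Oe e" "e \<in> E" shows "finite (Cl c e)"
  by (rule finite_subset[OF _ fin_Oe[OF assms(2)]]) (use Cl_Oe[OF assms(1)] in blast)

text \<open>The strand \<open>d\<close> ends or leaves \<open>c\<close> between \<open>e\<close> and
  \<open>e'\<close>. The median of the ends of \<open>c\<close> and the end \<open>x\<close> of
  \<open>d\<close> is a mark of \<open>c\<close>, and \<open>e\<close> is the last arc before
  it.\<close>

lemma branch_sing:
  assumes c: "c \<in> Oe e" "c \<in> Oe e'" and n: "next_edge e e'" and k: "share_K c d" "x \<in> pos d" "e \<in> x" "e' \<notin> x"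
  shows "singular c e"
proof -
  obtain p q where p: "pos c = {p, q}" "p \<in> X" "q \<in> X" "e \<notin> p" "e \<in> q" "c \<in> Sv" using Oe_ends[OF c(1)] .
  have eE: "e \<in> E" "e' \<in> E" "lev e = lev e'" using n unfolding next_edge_def by blast+
  have e'p: "e' \<notin> p" using n p unfolding next_edge_def beyond_def by blast
  then have e'q: "e' \<in> q" using c(2) p unfolding Oe_def by auto
  define y where "y = maj p q x"
  have ym: "y \<in> marks c" unfolding y_def using marks_med k p by auto
  have ey: "e \<in> y" "e' \<notin> y" using p k e'p e'q unfolding y_def maj_def by auto
  have yX: "y \<in> X" using marks_sg ym by blast
  have "beyond f e" if f: "f \<in> E" "lev f = lev e" "f \<notin> p" "f \<in> y" for f
  proof -
    have fq: "f \<in> q" using f unfolding y_def maj_def by blast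
    consider "beyond f e" | "beyond e f" using beyond_total[of e f p q] p f fq eE by blast
    then show ?thesis
    proof cases
      case 2
      have "\<not> beyond e' f" using f(4) ey yX unfolding beyond_def by blast
      then have "beyond f e'" using beyond_total[of e' f p q] p f fq eE e'p e'q by blast
      then have "f = e \<or> f = e'" using n 2 f unfolding next_edge_def by blast
      then show ?thesis using ey f beyond_refl by blast
    qed
  qed
  then have "last_sep p e y" unfolding last_sep_def using p ey eE by blast
  then show ?thesis unfolding singular_def using ym p by blast
qed

lemma Oe_next:
  assumes "c \<in> Oe e" "c \<in> Oe e'" "next_edge e e'" "share_K c d" "\<not> singular c e"
  shows "d \<in> Oe e \<longleftrightarrow> d \<in> Oe e'"
proof
  assume d: "d \<in> Oe e"
  then obtain p q where p: "pos d = {p, q}" "e \<notin> p" "e \<in> q" "d \<in> Sv" "p \<in> X" using Oe_ends by metis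
  have "e' \<in> q" using branch_sing[OF assms(1-4), of q] p assms(5) by blast
  moreover have "e' \<notin> p" using assms(3) p unfolding next_edge_def beyond_def by blast
  ultimately show "d \<in> Oe e'" using Oe_I[OF p(4,1)] by simp
next
  assume d: "d \<in> Oe e'"
  then obtain p q where p: "pos d = {p, q}" "e' \<notin> p" "e' \<in> q" "d \<in> Sv" "q \<in> X" using Oe_ends by metis
  have "e \<notin> p" using branch_sing[OF assms(1-4), of p] p assms(5) by blast
  moreover have "e \<in> q" using assms(3) p unfolding next_edge_def beyond_def by blast
  ultimately show "d \<in> Oe e" using Oe_I[OF p(4,1)] by simp
qed

lemma Cl_next:
  assumes c: "c \<in> Oe e" "c \<in> Oe e'" and n: "next_edge e e'" and ns: "\<And>d. d \<in> Cl c e \<Longrightarrow> \<not> singular d e"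
  shows "Cl c e' = Cl c e"
proof -
  have 1: "d \<in> Oe e' \<and> (c, d) \<in> (rel e')\<^sup>*" if "(c, d) \<in> (rel e)\<^sup>*" for d
    using that
  proof (induction rule: rtrancl_induct)
    case base
    then show ?case using c by blast
  next
    case (step d d')
    then have d: "d \<in> Oe e" "d' \<in> Oe e" "share_K d d'" "\<not> singular d e" using ns unfolding rel_def Cl_def by blast+
    then have "d' \<in> Oe e'" using Oe_next[OF d(1) _ n d(3,4)] step by blast
    then have "(d, d') \<in> rel e'" using step d unfolding rel_def by blast
    then show ?case using step \<open>d' \<in> Oe e'\<close> by (meson rtrancl_into_rtrancl)
  qed
  have 2: "d \<in> Oe e \<and> (c, d) \<in> (rel e)\<^sup>*" if "(c, d) \<in> (rel e')\<^sup>*" for d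
    using that
  proof (induction rule: rtrancl_induct)
    case base
    then show ?case using c by blast
  next
    case (step d d')
    then have d: "d \<in> Oe e'" "d' \<in> Oe e'" "share_K d d'" unfolding rel_def by blast+
    have "\<not> singular d e" using ns step unfolding Cl_def by blast
    then have "d' \<in> Oe e" using Oe_next[OF _ d(1) n d(3)] d step by blast
    then have "(d, d') \<in> rel e" using step d unfolding rel_def by blast
    then show ?case using step \<open>d' \<in> Oe e\<close> by (meson rtrancl_into_rtrancl)
  qed
  show ?thesis unfolding Cl_def using 1 2 by blast
qed

text \<open>Walking along \<open>c\<close> from \<open>e\<close> towards the end \<open>q\<close>,
  the class does not change as long as no strand of it is singular. The walk stops at the last arc
  of the level at the latest, where \<open>c\<close> is singular because its end is a mark.\<close>

lemma Cl_sing: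
  assumes "c \<in> Oe e" "e \<in> E"
  shows "\<exists>e'. e' \<in> E \<and> lev e' = lev e \<and> c \<in> Oe e' \<and> Cl c e' = Cl c e \<and> (\<exists>d \<in> Cl c e. singular d e')"
proof -
  obtain p q where p: "pos c = {p, q}" "p \<in> X" "q \<in> X" "e \<notin> p" "e \<in> q" "c \<in> Sv" using Oe_ends[OF assms(1)] .
  \<comment> \<open>The arcs of the level that lie ahead of \<open>f\<close> on the way to
    \<open>q\<close>; their number is the induction measure.\<close>
  define D where "D f = {h \<in> q - p. lev h = lev e \<and> \<not> beyond h f}" for f
  have fD: "finite (D f)" for f using fin_D[OF p(2,3), of "lev e"] unfolding D_def by (rule_tac finite_subset) auto
  have tot: "beyond f h \<or> beyond h f" if "f \<in> q - p" "h \<in> q - p" for f h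
    using beyond_total[of f h p q] p that X_subD by blast
  have "\<exists>e'. e' \<in> E \<and> lev e' = lev e \<and> c \<in> Oe e' \<and> Cl c e' = Cl c f \<and> (\<exists>d \<in> Cl c f. singular d e')"
    if "f \<in> E" "lev f = lev e" "f \<notin> p" "f \<in> q" for f
    using that
  proof (induction "card (D f)" arbitrary: f rule: less_induct)
    case less
    have cf: "c \<in> Oe f" using Oe_I[OF p(6,1)] less by blast
    show ?case
    proof (cases "\<exists>d \<in> Cl c f. singular d f")
      case True
      then show ?thesis using less cf by blast
    next
      case False
      have "D f \<noteq> {}"
      proof
        assume "D f = {}"
        then have "last_sep p f q" unfolding last_sep_def D_def using less by auto
        then have "singular c f" unfolding singular_def using marks_end p by blast
        then show False using False Cl_self by blast
      qed
      then obtain f' where f': "f' \<in> D f" "\<forall>h \<in> D f. beyond f' h" using beyond_min[OF fD, of f] tot unfolding D_def by blast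
      then have f'q: "f' \<in> q" "f' \<notin> p" "lev f' = lev e" "\<not> beyond f' f" "f' \<in> E" using X_subD p unfolding D_def by blast+
      have n: "next_edge f f'" unfolding next_edge_def
      proof (intro conjI ballI impI)
        show "beyond f f'" using tot[of f f'] f'q less by blast
        fix h assume h: "h \<in> E" "lev h = lev f" "beyond f h" "beyond h f'"
        have hq: "h \<in> q - p" using h f'q less p unfolding beyond_def by blast
        show "h = f \<or> h = f'"
        proof (cases "beyond h f")
          case True
          then show ?thesis using beyond_antisym[of h f] h less by auto
        next
          case False
          then have "beyond f' h" using f' hq h less unfolding D_def by auto
          then show ?thesis using beyond_antisym[of h f'] h less f'q by auto
        qed
      qed (use less f'q beyond_refl in auto)
      have "D f' \<subset> D f"
      proof -
        have "D f' \<subseteq> D f" unfolding D_def using n beyond_trans unfolding next_edge_def by blast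
        moreover have "f' \<notin> D f'" unfolding D_def using beyond_refl by blast
        ultimately show ?thesis using f' by blast
      qed
      then have "card (D f') < card (D f)" using fD psubset_card_mono by blast
      then have IH: "\<exists>e'. e' \<in> E \<and> lev e' = lev e \<and> c \<in> Oe e' \<and> Cl c e' = Cl c f' \<and> (\<exists>d \<in> Cl c f'. singular d e')"
        using less.hyps[of f'] f'q by blast
      have "Cl c f' = Cl c f" by (rule Cl_next[OF cf _ n]) (use Oe_I[OF p(6,1)] f'q False in blast)+
      then show ?thesis using IH by simp
    qed
  qed
  then show ?thesis using p assms by blast
qed

lemma Cl_act: assumes "g \<in> carrier G" "c \<in> Oe e" "e \<in> E" shows "Cl (wa g c) (ea g e) = wa g ` Cl c e"
proof -
  have OW: "d \<in> Sv" "d \<in> W" if "d \<in> Oe f" for d f using that SvD unfolding Oe_def by blast+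
  have r: "(wa g c, wa g d) \<in> (rel (ea g e))\<^sup>*" if "(c, d) \<in> (rel e)\<^sup>*" "g \<in> carrier G" "e \<in> E" for g c d e
    using that(1)
  proof (induction rule: rtrancl_induct)
    case (step d d')
    then have "(wa g d, wa g d') \<in> rel (ea g e)" using Oe_act[OF that(2) _ that(3)] OW share_K_act that unfolding rel_def by blast
    then show ?case using step by (meson rtrancl_into_rtrancl)
  qed blast
  have "d \<in> wa g ` Cl c e" if d: "d \<in> Cl (wa g c) (ea g e)" for d
  proof -
    have c': "wa g c \<in> Oe (ea g e)" using Oe_act assms OW by blast
    then have dW: "d \<in> W" using Cl_Oe[OF c' d] OW by blast
    have "(wa (inv g) (wa g c), wa (inv g) d) \<in> (rel (ea (inv g) (ea g e)))\<^sup>*"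
      by (rule r) (use d assms ea_cl in \<open>auto simp: Cl_def\<close>)
    then have "(c, wa (inv g) d) \<in> (rel e)\<^sup>*" using wa_inv ea_inv OW assms by simp
    moreover have "d = wa g (wa (inv g) d)" using wa_inv' assms dW by simp
    ultimately show ?thesis unfolding Cl_def by blast
  qed
  moreover have "wa g d \<in> Cl (wa g c) (ea g e)" if "d \<in> Cl c e" for d using r[of c d e g] that assms unfolding Cl_def by blast
  ultimately show ?thesis by blast
qed

end

lemma (in protree) last_sep_act:
  assumes g: "g \<in> carrier G" and X: "p \<in> X" "y \<in> X" and l: "last_sep p e y"
  shows "last_sep (pact g p) (ea g e) (pact g y)"
proof -
  have eE: "e \<in> E" using l by (simp add: last_sep_def)
  have "\<forall>f \<in> E. lev f = lev (ea g e) \<longrightarrow> f \<notin> pact g p \<longrightarrow> f \<in> pact g y \<longrightarrow> beyond f (ea g e)"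
    by (subst all_E_act[OF g]) (use l eE in \<open>simp add: last_sep_def mem_pact[OF g] X beyond_pact[OF g] lev_ea[OF g]\<close>)
  then show ?thesis using l eE by (simp add: last_sep_def mem_pact[OF g] X ea_cl[OF g])
qed

context kneser begin

lemma last_sep_Oe: assumes "c \<in> Sv" "p \<in> pos c" "y \<in> sg c" "last_sep p e y" shows "c \<in> Oe e"
proof -
  obtain q where q: "pos c = {p, q}" "p \<noteq> q" "p \<in> X" "q \<in> X" using Sv_ends[OF assms(1,2)] .
  have "y \<in> seg p q" using assms(3) sg_seg q by blast
  then have "e \<in> q" using assms(4) unfolding seg_def last_sep_def by blast
  then show ?thesis using Oe_I[OF assms(1) q(1)] assms(4) unfolding last_sep_def by blast
qed

text \<open>A representative strand, one of its ends and one of its marks. Up to translation every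
  singular arc of every level comes from such a triple, and the number of triples does not depend on
  the level.\<close>

definition Tr where "Tr = (SIGMA k:K. pos k \<times> marks k)"

lemma fin_Tr: "finite Tr"
proof -
  have "finite (pos k \<times> marks k)" if "k \<in> K" for k
  proof -
    have "k \<in> Sv" using that K(2) by blast
    then show ?thesis using marks_fin finite_cartesian_product[of "pos k" "marks k"] card_ge_0_finite[of "pos k"] unfolding Sv_def by simp
  qed
  then show ?thesis unfolding Tr_def using K(1) by blast
qed

lemma singular_tr:
  assumes "singular c e" "c \<in> Sv"
  obtains g k p y e0 where "g \<in> carrier G" "(k, p, y) \<in> Tr" "last_sep p e0 y" "lev e0 = lev e" "c = wa g k" "e = ea g e0" "k \<in> Oe e0" "e0 \<in> E"
proof -
  obtain p y where py: "p \<in> pos c" "y \<in> marks c" "last_sep p e y" using assms unfolding singular_def by blast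
  obtain g k where g: "g \<in> carrier G" "k \<in> K" "c = wa g k" using K(3) assms by blast
  define h where "h = inv g"
  have h: "h \<in> carrier G" using g h_def by simp
  have kS: "k \<in> Sv" "k \<in> W" using g K(2) SvD by auto
  have hc: "wa h c = k" using g kS wa_inv h_def by simp
  have X: "p \<in> X" "y \<in> X" "e \<in> E" using py SvD(2)[OF assms(2)] marks_sg unfolding last_sep_def by auto
  have 1: "last_sep (pact h p) (ea h e) (pact h y)" using last_sep_act[OF h X(1,2) py(3)] .
  have 2: "pact h y \<in> marks k" using marks_act[OF h assms(2) py(2)] hc by simp
  have 3: "pact h p \<in> pos k" using pos_wa[OF h SvD(1)[OF assms(2)]] hc py by blast
  have "e = ea g (ea h e)" using ea_inv' g X h_def by simp
  then show ?thesis using that[OF g(1) _ 1 _ g(3)] 2 3 g(2) lev_ea[OF h X(3)] last_sep_Oe[OF kS(1) 3 marks_sg(1)[OF 2] 1] ea_cl[OF h X(3)]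
    unfolding Tr_def by blast
qed

text \<open>Every class has the size of a singular one, which leaves boundedly many sizes at each level; lifting makes
  \<open>Sz m\<close> increase with \<open>m\<close>, so it is eventually constant.\<close>

definition Sz where "Sz m = {card (Cl c e) | c e. e \<in> E \<and> lev e = m \<and> c \<in> Oe e}"

lemma Cl_W: "c \<in> Oe e \<Longrightarrow> d \<in> Cl c e \<Longrightarrow> d \<in> W"
  using Cl_Oe SvD unfolding Oe_def by blast

text \<open>By \<open>Cl_sing\<close> a class also occurs at an arc that is singular for one of its
  strands, and this strand can be translated to a representative. There the triple and the level
  determine the arc, and hence the size of the class.\<close>

lemma Sz_sub: "Sz m \<subseteq> (\<lambda>(k, p, y). card (Cl k (THE e. last_sep p e y \<and> lev e = m))) ` Tr"
proof
  fix s assume "s \<in> Sz m"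
  then obtain c e where c: "s = card (Cl c e)" "e \<in> E" "lev e = m" "c \<in> Oe e" unfolding Sz_def by blast
  obtain e' d where e': "e' \<in> E" "lev e' = lev e" "c \<in> Oe e'" "Cl c e' = Cl c e" "d \<in> Cl c e" "singular d e'"
    using Cl_sing[OF c(4,2)] by blast
  have dO: "d \<in> Oe e'" using Cl_Oe[OF e'(3)] e'(4,5) by blast
  then have dS: "d \<in> Sv" unfolding Oe_def by blast
  obtain g k p y e0 where g: "g \<in> carrier G" "(k, p, y) \<in> Tr" "last_sep p e0 y" "lev e0 = lev e'" "d = wa g k" "e' = ea g e0" "k \<in> Oe e0" "e0 \<in> E"
    using singular_tr[OF e'(6) dS] .
  have the: "(THE e. last_sep p e y \<and> lev e = m) = e0"
    by (rule the_equality) (use g(3,4) e'(2) c(3) last_sep_unique in auto)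
  have "Cl d e' = Cl c e'" using Cl_eq e'(4,5) by blast
  then have "Cl c e = wa g ` Cl k e0" using Cl_act[OF g(1,7,8)] g(5,6) e'(4) by simp
  moreover have "inj_on (wa g) (Cl k e0)" by (rule inj_on_inverseI[of _ "wa (inv g)"]) (use wa_inv[OF g(1)] Cl_W[OF g(7)] in blast)
  ultimately have "s = card (Cl k e0)" using c(1) card_image by simp
  then show "s \<in> (\<lambda>(k, p, y). card (Cl k (THE e. last_sep p e y \<and> lev e = m))) ` Tr" using the g(2) by force
qed

text \<open>A lift of an arc has the same half-space, so it is crossed by the same strands and has
  the same classes.\<close>

lemma Sz_mono: "Sz m \<subseteq> Sz (Suc m)"
proof
  fix s assume "s \<in> Sz m"
  then obtain c e where c: "s = card (Cl c e)" "e \<in> E" "lev e = m" "c \<in> Oe e" unfolding Sz_def by blast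
  obtain e' where e': "e' \<in> E" "lev e' = Suc m" "\<forall>x \<in> X. e \<in> x \<longleftrightarrow> e' \<in> x" using lift[OF c(2)] c(3) by blast
  have k: "e' \<in> x \<longleftrightarrow> e \<in> x" if "d \<in> Sv" "x \<in> pos d" for d x using e'(3) SvD(2)[OF that(1)] that(2) by blast
  have "Oe e' = Oe e" unfolding Oe_def by (rule Collect_cong) (use k in \<open>simp cong: conj_cong\<close>)
  then have "Cl c e' = Cl c e" "c \<in> Oe e'" using c(4) unfolding Cl_def rel_def by simp_all
  then have "s = card (Cl c e') \<and> e' \<in> E \<and> lev e' = Suc m \<and> c \<in> Oe e'" using c(1) e' by simp
  then show "s \<in> Sz (Suc m)" unfolding Sz_def by blast
qed

lemma Sz_bound: "\<exists>L. \<forall>m. \<forall>s \<in> Sz m. s \<le> L"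
proof -
  have f: "finite (Sz m)" for m using Sz_sub fin_Tr finite_subset by blast
  have b: "card (Sz m) \<le> card Tr" for m
    using card_mono[OF _ Sz_sub, of m] card_image_le[OF fin_Tr] fin_Tr by (meson finite_imageI le_trans)
  obtain m0 where m0: "\<And>m. card (Sz m) \<le> card (Sz m0)"
    using ex_has_greatest_nat[of "\<lambda>_. True" 0 "\<lambda>m. card (Sz m)" "Suc (card Tr)"] b by (auto simp: le_imp_less_Suc)
  have mono: "Sz m \<subseteq> Sz n" if "m \<le> n" for m n using lift_Suc_mono_le[of Sz, OF Sz_mono that] .
  have "Sz m \<subseteq> Sz m0" for m
  proof (cases "m \<le> m0")
    case False
    then have "Sz m0 = Sz m" using card_seteq[OF f mono m0] by simp
    then show ?thesis by simp
  qed (use mono in blast)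
  then have "\<forall>m. \<forall>s \<in> Sz m. s \<le> Max (insert 0 (Sz m0))" using f by (auto intro!: Max_ge)
  then show ?thesis by blast
qed

text \<open>A cut point may have been passed on through many strands. As long as the strand that
  passes it on crosses \<open>e\<close>, the class is the same and the induction hypothesis applies.
  Otherwise that strand lies entirely past \<open>e\<close>, and a median of it with
  \<open>c'\<close> is a mark with \<open>e\<close> as last arc.\<close>

lemma Pt_sing:
  assumes "Pt c y" "p \<in> pos c" "last_sep p e y"
  shows "\<exists>d \<in> Cl c e. singular d e"
  using assms
proof (induction arbitrary: p rule: Pt.induct)
  case (marks c y)
  then show ?case using Cl_self unfolding singular_def by blast
next
  case (tr c y c')
  have S: "c \<in> Sv" "c' \<in> Sv" using share_K_Sv tr by blast+
  have ey: "e \<in> y" "e \<in> E" "e \<notin> p" using tr.prems(2) unfolding last_sep_def by auto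
  obtain q where q: "pos c' = {p, q}" "p \<in> X" "q \<in> X" using Sv_ends[OF S(2) tr.prems(1)] .
  have c'e: "c' \<in> Oe e" using last_sep_Oe[OF S(2) tr.prems(1) tr.hyps(3) tr.prems(2)] .
  have eq: "e \<in> q" using c'e q ey unfolding Oe_def by auto
  have ysg: "y \<in> sg c" "y \<in> X" using Pt_sg tr by blast+
  show ?case
  proof (cases "c \<in> Oe e")
    case True
    then obtain r s where r: "pos c = {r, s}" "r \<in> X" "s \<in> X" "e \<notin> r" "e \<in> s" using Oe_ends by metis
    have ys: "y \<in> seg r s" using ysg sg_seg r by blast
    have "last_sep r e y" unfolding last_sep_def
    proof (intro conjI ballI impI)
      fix f assume f: "f \<in> E" "lev f = lev e" "f \<notin> r" "f \<in> y"
      then have "f \<in> s" using ys unfolding seg_def by blast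
      then consider "beyond f e" | "beyond e f" using beyond_total[of f e r s] f ey r by blast
      then show "beyond f e"
      proof cases
        case 2
        then have "f \<notin> p" using ey q unfolding beyond_def by blast
        then show ?thesis using tr.prems(2) f unfolding last_sep_def by blast
      qed
    qed (use ey r in auto)
    then obtain d where d: "d \<in> Cl c e" "singular d e" using tr.IH r by blast
    have "(c', c) \<in> rel e" unfolding rel_def using True c'e share_K_sym tr by blast
    then have "Cl c e = Cl c' e" using Cl_eq unfolding Cl_def by blast
    then show ?thesis using d by blast
  next
    case False
    obtain r where "r \<in> pos c" using S(1) unfolding Sv_def by (force simp: card_2_iff)
    then obtain s where s: "pos c = {r, s}" "r \<in> X" "s \<in> X" using Sv_ends[OF S(1)] by metis
    have ys: "y \<in> seg r s" using ysg sg_seg s by blast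
    have er: "e \<in> r" "e \<in> s" using False s S(1) ey ys unfolding Oe_def seg_def by auto
    have z: "maj p q r \<in> marks c'" "maj p q s \<in> marks c'" using marks_med[OF share_K_sym[OF tr.hyps(2)]] q s by auto
    \<comment> \<open>If further arcs came between \<open>e\<close> and each of the two medians, the
      earlier of the two would have both \<open>r\<close> and \<open>s\<close> past it, hence also
      \<open>y\<close>, and \<open>e\<close> would not be the last arc before
      \<open>y\<close>.\<close>
    have "last_sep p e (maj p q r) \<or> last_sep p e (maj p q s)"
    proof (rule ccontr)
      assume "\<not> ?thesis"
      then obtain f f' where f: "f \<in> E" "lev f = lev e" "f \<notin> p" "f \<in> maj p q r" "\<not> beyond f e"
        and f': "f' \<in> E" "lev f' = lev e" "f' \<notin> p" "f' \<in> maj p q s" "\<not> beyond f' e"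
        using ey eq er unfolding last_sep_def maj_def by blast
      have i: "f \<in> q" "f \<in> r" "f' \<in> q" "f' \<in> s" using f f' unfolding maj_def by auto
      have y: "r \<inter> s \<subseteq> y" using ys unfolding seg_def by blast
      consider "beyond f f'" | "beyond f' f" using beyond_total[of f f' p q] f f' i q by blast
      then show False
      proof cases
        case 1
        then have "f \<in> y" using i y s(3) unfolding beyond_def by blast
        then show False using tr.prems(2) f unfolding last_sep_def by blast
      next
        case 2
        then have "f' \<in> y" using i y s(2) unfolding beyond_def by blast
        then show False using tr.prems(2) f' unfolding last_sep_def by blast
      qed
    qed
    then have "singular c' e" using z tr.prems(1) unfolding singular_def by blast
    then show ?thesis using Cl_self by blast
  qed
qed

lemma move_card: assumes "c \<in> Sv" "d \<in> W" shows "card {g \<in> carrier G. wa g d = c} \<le> card {g \<in> carrier G. wa g c = c}"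
proof (cases "{g \<in> carrier G. wa g d = c} = {}")
  case False
  then obtain h where h: "h \<in> carrier G" "wa h d = c" by blast
  have "{g \<in> carrier G. wa g d = c} \<subseteq> (\<lambda>k. k \<otimes> h) ` {g \<in> carrier G. wa g c = c}"
  proof
    fix g assume "g \<in> {g \<in> carrier G. wa g d = c}"
    then have g: "g \<in> carrier G" "wa g d = c" by auto
    have "wa (g \<otimes> inv h) c = c" using wa_mult[of g "inv h" c] wa_inv[OF h(1) assms(2)] h g SvD(1)[OF assms(1)] by simp
    moreover have "g = g \<otimes> inv h \<otimes> h" using g h by (simp add: m_assoc)
    moreover have "g \<otimes> inv h \<in> carrier G" using g h by simp
    ultimately show "g \<in> (\<lambda>k. k \<otimes> h) ` {g \<in> carrier G. wa g c = c}" by blast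
  qed
  then show ?thesis using fin_move[OF assms(1)] by (rule surj_card_le[rotated])
next
  case True
  then show ?thesis by (simp only: card.empty)
qed

text \<open>The bound multiplies the number of triples, the largest size of a class, and the number
  of elements that carry one strand to \<open>c\<close>; none of these depends on the level
  \<open>m\<close>.\<close>

lemma singular_count:
  assumes c: "c \<in> Sv" and L: "\<And>m s. s \<in> Sz m \<Longrightarrow> s \<le> L"
  shows "finite {e \<in> E. lev e = m \<and> c \<in> Oe e \<and> (\<exists>d \<in> Cl c e. singular d e)}"
    "card {e \<in> E. lev e = m \<and> c \<in> Oe e \<and> (\<exists>d \<in> Cl c e. singular d e)} \<le> card Tr * (L * card {g \<in> carrier G. wa g c = c})"
proof -
  define N where "N = card {g \<in> carrier G. wa g c = c}"
  define th where "th t = (THE e. t \<in> Tr \<and> last_sep (fst (snd t)) e (snd (snd t)) \<and> lev e = m)" for t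
  define Tm where "Tm = {t \<in> Tr. th t \<in> E \<and> lev (th t) = m \<and> fst t \<in> Oe (th t)}"
  define Z where "Z = {e \<in> E. lev e = m \<and> c \<in> Oe e \<and> (\<exists>d \<in> Cl c e. singular d e)}"
  define B where "B t = (\<Union>d \<in> Cl (fst t) (th t). (\<lambda>g. ea g (th t)) ` {g \<in> carrier G. wa g d = c})" for t
  have fTm: "finite Tm" "card Tm \<le> card Tr" unfolding Tm_def using fin_Tr by (auto intro: card_mono)
  have fB: "finite (B t) \<and> card (B t) \<le> L * N" if t: "t \<in> Tm" for t
  proof -
    have t': "th t \<in> E" "lev (th t) = m" "fst t \<in> Oe (th t)" using t unfolding Tm_def by auto
    have fC: "finite (Cl (fst t) (th t))" using Cl_fin t' by blast
    have dW: "d \<in> W \<and> d \<in> Sv" if "d \<in> Cl (fst t) (th t)" for d using Cl_W[OF t'(3) that] Cl_Oe[OF t'(3) that] unfolding Oe_def by blast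
    have cB: "finite ((\<lambda>g. ea g (th t)) ` {g \<in> carrier G. wa g d = c}) \<and> card ((\<lambda>g. ea g (th t)) ` {g \<in> carrier G. wa g d = c}) \<le> N"
      if d: "d \<in> Cl (fst t) (th t)" for d
    proof
      have f: "finite {g \<in> carrier G. wa g d = c}" using fin_move dW d by blast
      then show "finite ((\<lambda>g. ea g (th t)) ` {g \<in> carrier G. wa g d = c})" by simp
      show "card ((\<lambda>g. ea g (th t)) ` {g \<in> carrier G. wa g d = c}) \<le> N"
        using card_image_le[OF f, of "\<lambda>g. ea g (th t)"] move_card[OF c, of d] dW[OF d] unfolding N_def by simp
    qed
    have "card (Cl (fst t) (th t)) \<in> Sz m" unfolding Sz_def using t' by blast
    then have le: "card (Cl (fst t) (th t)) \<le> L" by (rule L)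
    have "card (B t) \<le> (\<Sum>d \<in> Cl (fst t) (th t). card ((\<lambda>g. ea g (th t)) ` {g \<in> carrier G. wa g d = c}))"
      unfolding B_def by (rule card_UN_le[OF fC])
    also have "\<dots> \<le> (\<Sum>d \<in> Cl (fst t) (th t). N)" by (rule sum_mono) (use cB in blast)
    also have "\<dots> \<le> L * N" using le by simp
    finally show ?thesis using fC cB unfolding B_def by blast
  qed
  have ZB: "Z \<subseteq> (\<Union>t \<in> Tm. B t)"
  proof
    fix e assume "e \<in> Z"
    then obtain d where e: "e \<in> E" "lev e = m" "c \<in> Oe e" "d \<in> Cl c e" "singular d e" unfolding Z_def by blast
    have dS: "d \<in> Sv" using Cl_Oe[OF e(3,4)] unfolding Oe_def by blast
    obtain g k p y e0 where g: "g \<in> carrier G" "(k, p, y) \<in> Tr" "last_sep p e0 y" "lev e0 = lev e" "d = wa g k" "e = ea g e0" "k \<in> Oe e0" "e0 \<in> E"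
      using singular_tr[OF e(5) dS] .
    have the: "th (k, p, y) = e0" unfolding th_def fst_conv snd_conv
      by (rule the_equality) (use g(2,3,4) e(2) last_sep_unique in auto)
    have "c \<in> Cl d e" using Cl_eq[OF e(4)] Cl_self by blast
    then have "c \<in> wa g ` Cl k e0" using Cl_act[OF g(1,7,8)] g(5,6) by simp
    then have "e \<in> B (k, p, y)" unfolding B_def the using g by auto
    moreover have "(k, p, y) \<in> Tm" unfolding Tm_def using the g e by simp
    ultimately show "e \<in> (\<Union>t \<in> Tm. B t)" by blast
  qed
  have fU: "finite (\<Union>t \<in> Tm. B t)" using fTm fB by blast
  then show "finite {e \<in> E. lev e = m \<and> c \<in> Oe e \<and> (\<exists>d \<in> Cl c e. singular d e)}" using ZB finite_subset unfolding Z_def by blast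
  have "card Z \<le> card (\<Union>t \<in> Tm. B t)" using card_mono[OF fU ZB] .
  also have "\<dots> \<le> (\<Sum>t \<in> Tm. card (B t))" by (rule card_UN_le[OF fTm(1)])
  also have "\<dots> \<le> (\<Sum>t \<in> Tm. L * N)" by (rule sum_mono) (use fB in blast)
  also have "\<dots> \<le> card Tr * (L * N)" using fTm(2) by simp
  finally show "card {e \<in> E. lev e = m \<and> c \<in> Oe e \<and> (\<exists>d \<in> Cl c e. singular d e)} \<le> card Tr * (L * card {g \<in> carrier G. wa g c = c})"
    unfolding Z_def N_def .
qed

text \<open>Finitely many cut points are all separated at some level, where each one other than
  \<open>p\<close> has a last arc of its own. By \<open>Pt_sing\<close> these arcs are among those
  counted in \<open>singular_count\<close>, whose bound is the same for all levels.\<close>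

lemma Pt_fin: assumes c: "c \<in> Sv" shows "finite {y. Pt c y}"
proof -
  obtain L where L: "\<And>m s. s \<in> Sz m \<Longrightarrow> s \<le> L" using Sz_bound by blast
  define N where "N = card Tr * (L * card {g \<in> carrier G. wa g c = c})"
  obtain p where p: "p \<in> pos c" using c unfolding Sv_def by (force simp: card_2_iff)
  have pX: "p \<in> X" using p SvD(2)[OF c] by blast
  have "card Y \<le> Suc N" if Y: "finite Y" "Y \<subseteq> {y. Pt c y}" for Y
  proof -
    have YX: "Y \<subseteq> X" using Y Pt_sg by blast
    obtain m where m: "\<forall>x \<in> insert p Y. \<forall>y \<in> insert p Y. x \<noteq> y \<longrightarrow> \<not> lev_eq m x y"
      using sep_all[of "insert p Y"] Y YX pX by blast
    define Z where "Z = {e \<in> E. lev e = m \<and> c \<in> Oe e \<and> (\<exists>d \<in> Cl c e. singular d e)}"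
    have sc: "finite {e \<in> E. lev e = m \<and> c \<in> Oe e \<and> (\<exists>d \<in> Cl c e. singular d e)}"
      "card {e \<in> E. lev e = m \<and> c \<in> Oe e \<and> (\<exists>d \<in> Cl c e. singular d e)} \<le> card Tr * (L * card {g \<in> carrier G. wa g c = c})"
      by (rule singular_count[OF c], erule L)+
    have "\<exists>e. last_sep p e y \<and> lev e = m" if y: "y \<in> Y - {p}" for y
    proof -
      have "y \<in> X" "\<not> lev_eq m p y" using y YX m by auto
      then show ?thesis using last_sep_ex[OF pX] by metis
    qed
    then obtain f where f: "\<And>y. y \<in> Y - {p} \<Longrightarrow> last_sep p (f y) y \<and> lev (f y) = m" by metis
    have "f ` (Y - {p}) \<subseteq> Z"
    proof
      fix e assume "e \<in> f ` (Y - {p})"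
      then obtain y where y: "y \<in> Y" "e = f y" "last_sep p e y" "lev e = m" using f by blast
      have P: "Pt c y" using Y y by blast
      then have "c \<in> Oe e" using last_sep_Oe[OF c p _ y(3)] Pt_sg by blast
      moreover have "e \<in> E" using y(3) unfolding last_sep_def by blast
      ultimately show "e \<in> Z" unfolding Z_def using y(4) Pt_sing[OF P p y(3)] by blast
    qed
    moreover have "inj_on f (Y - {p})"
    proof (rule inj_onI)
      fix y z assume yz: "y \<in> Y - {p}" "z \<in> Y - {p}" "f y = f z"
      then have "lev_eq m y z" using last_sep_nq[OF pX, of y z "f y"] f[OF yz(1)] f[OF yz(2)] YX by auto
      then show "y = z" using m yz by blast
    qed
    ultimately have "card (Y - {p}) \<le> card Z" using sc(1) card_inj_on_le unfolding Z_def by blast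
    then have "card (Y - {p}) \<le> N" using sc(2) unfolding Z_def N_def by linarith
    \<comment> \<open>The end \<open>p\<close> itself has no arc before it, which accounts for the
      additional 1.\<close>
    then show ?thesis using card_Diff1_le[of Y p] Y(1) by (cases "p \<in> Y") auto
  qed
  then show ?thesis using finite_if_finite_subsets_card_bdd[of "{y. Pt c y}" "Suc N"] by blast
qed

lemma Pt_end: "c \<in> Sv \<Longrightarrow> p \<in> pos c \<Longrightarrow> Pt c p" using Pt.marks marks_end by blast

text \<open>The marks \<open>x\<close> and \<open>z\<close> of \<open>c\<close> bound the stretch
  around \<open>e\<close> that \<open>c\<close> has in common with \<open>c'\<close>. As no cut
  point lies strictly between \<open>y\<close> and \<open>y'\<close>, these two belong to that
  stretch, and \<open>c'\<close> inherits them.\<close>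

lemma Pt_share:
  assumes k: "share_K c c'" and o: "c \<in> Oe e" "c' \<in> Oe e"
    and y: "Pt c y" "Pt c y'" "e \<notin> y" "e \<in> y'" and cons: "\<And>x. Pt c x \<Longrightarrow> x \<in> seg y y' \<Longrightarrow> x = y \<or> x = y'"
  shows "Pt c' y" "Pt c' y'"
proof -
  obtain p q where p: "pos c = {p, q}" "p \<in> X" "q \<in> X" "e \<notin> p" "e \<in> q" "c \<in> Sv" using Oe_ends[OF o(1)] .
  obtain p' q' where p': "pos c' = {p', q'}" "p' \<in> X" "q' \<in> X" "e \<notin> p'" "e \<in> q'" "c' \<in> Sv" using Oe_ends[OF o(2)] .
  have yX: "y \<in> X" "y' \<in> X" "y \<in> seg p q" "y' \<in> seg p q" using Pt_sg y sg_seg p by blast+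
  have eE: "e \<in> E" using yX y X_subD by blast
  define z where "z = maj p q q'"
  define x where "x = maj q p p'"
  have Pz: "Pt c z" "Pt c x" using Pt.marks[OF p(6)] marks_med[OF k] p p' unfolding z_def x_def by auto
  have ez: "e \<in> z" "e \<notin> x" using p p' unfolding z_def x_def maj_def by auto
  have zX: "z \<in> X" "x \<in> X" using maj_X p p' unfolding z_def x_def by auto
  have zs: "z \<in> seg p q" "x \<in> seg p q" using Pt_sg Pz sg_seg p by blast+
  have sl: "r \<inter> t \<subseteq> w" "w \<subseteq> r \<union> t" if "w \<in> seg r t" for r t w using that unfolding seg_def by auto
  have m0: "f \<in> p \<and> f \<notin> q \<and> f \<in> z \<or> f \<notin> p \<and> f \<in> q \<and> f \<in> x"
    if f: "f \<in> E" "f \<in> p'" "f \<in> q'" "f \<notin> w" "w \<in> seg p q" for f w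
  proof -
    have "\<not> (f \<in> p \<and> f \<in> q)" using sl[OF f(5)] f(4) by blast
    moreover have "\<not> (f \<notin> p \<and> f \<notin> q)" using quad[of e f p q p' q'] eE f p p' by auto
    ultimately show ?thesis using f unfolding z_def x_def maj_def by blast
  qed
  have hc: "h \<in> p \<and> h \<notin> q \<or> h \<notin> p \<and> h \<in> q" if "h \<in> w" "w \<in> seg p q" "h \<notin> w'" "w' \<in> seg p q" for h w w'
    using sl[OF that(2)] sl[OF that(4)] that by blast
  have "f \<in> y'" if f: "f \<in> p'" "f \<in> q'" for f
  proof (rule ccontr)
    assume n: "f \<notin> y'"
    have fE: "f \<in> E" using f X_subD p' by blast
    consider "f \<in> p" "f \<notin> q" "f \<in> z" | "f \<notin> p" "f \<in> q" "f \<in> x" using m0[OF fE f n yX(4)] by blast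
    then show False
    proof cases
      case 1
      have "h \<in> z" if h: "h \<in> y" "h \<in> y'" for h
      proof (rule ccontr)
        assume hz: "h \<notin> z"
        have hE: "h \<in> E" using h X_subD yX by blast
        consider "h \<in> p" "h \<notin> q" | "h \<notin> p" "h \<in> q" using hc[OF h(1) yX(3) hz zs(1)] by blast
        then show False
        proof cases
          case a: 1
          show False using quad[of h f q y' z p] hE fE p yX zX h hz n 1 a by simp
        next
          case 2
          show False using quad[of h e p y z q] hE eE p yX zX h hz y ez 2 by simp
        qed
      qed
      \<comment> \<open>The mark \<open>z\<close> would be a cut point between the consecutive ones,
        but it differs from both: from \<open>y\<close> at \<open>e\<close>, from \<open>y'\<close>
        at \<open>f\<close>.\<close>
      then have "z \<in> seg y y'" using seg_mem_br[OF yX(1,2) zX(1)] by blast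
      then show False using cons[OF Pz(1)] y ez n 1 by blast
    next
      case 2
      then show False using quad[of e f p y' x q] eE fE p yX zX y ez n by simp
    qed
  qed
  then have y's: "y' \<in> sg c'" using sg_seg[OF p'(1-3)] seg_mem_br[OF p'(2,3) yX(2)] by blast
  have "f \<in> y" if f: "f \<in> p'" "f \<in> q'" for f
  proof (rule ccontr)
    assume n: "f \<notin> y"
    have fE: "f \<in> E" using f X_subD p' by blast
    consider "f \<in> p" "f \<notin> q" "f \<in> z" | "f \<notin> p" "f \<in> q" "f \<in> x" using m0[OF fE f n yX(3)] by blast
    then show False
    proof cases
      case 1
      then show False using quad[of e f y q p z] eE fE p yX zX y ez n by simp
    next
      case 2
      have "h \<in> x" if h: "h \<in> y" "h \<in> y'" for h
      proof (rule ccontr)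
        assume hz: "h \<notin> x"
        have hE: "h \<in> E" using h X_subD yX by blast
        consider "h \<in> p" "h \<notin> q" | "h \<notin> p" "h \<in> q" using hc[OF h(1) yX(3) hz zs(2)] by blast
        then show False
        proof cases
          case a: 1
          show False using quad[of e h x q p y'] hE eE p yX zX h hz y ez a by simp
        next
          case a: 2
          show False using quad[of h f p y x q] hE fE p yX zX h hz n 2 a by simp
        qed
      qed
      then have "x \<in> seg y y'" using seg_mem_br[OF yX(1,2) zX(2)] by blast
      then show False using cons[OF Pz(2)] y ez n 2 by blast
    qed
  qed
  then have ys: "y \<in> sg c'" using sg_seg[OF p'(1-3)] seg_mem_br[OF p'(2,3) yX(1)] by blast
  show "Pt c' y" "Pt c' y'" using Pt.tr[OF _ k] y ys y's by blast+
qed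

end

section \<open>The order of the cut points on a strand\<close>

context protree begin

lemma seg_rev:
  assumes "s \<in> X" "t \<in> X" "y \<in> seg s t" "z \<in> seg s t" "y - s \<subseteq> z - s"
  shows "z - t \<subseteq> y - t"
proof
  fix e assume e: "e \<in> z - t"
  have X: "y \<in> X" "z \<in> X" using assms seg_X by blast+
  have eE: "e \<in> E" using e X_subD X by blast
  show "e \<in> y - t"
  proof (rule ccontr)
    assume "e \<notin> y - t"
    then have "e \<notin> y" using e by blast
    then have "br e \<in> y" "br e \<notin> z" using X_br eE X e by blast+
    then have "br e \<in> s" using assms(5) by blast
    moreover have "br e \<in> t" using X_br[OF assms(2) eE] e by blast
    ultimately show False using assms(4) \<open>br e \<notin> z\<close> unfolding seg_def by blast
  qed
qed

lemma seg_between: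
  assumes "s \<in> X" "t \<in> X" "y \<in> seg s t" "z \<in> seg s t" "x \<in> seg s t" "y - s \<subseteq> z - s"
  shows "x \<in> seg y z \<longleftrightarrow> y - s \<subseteq> x - s \<and> x - s \<subseteq> z - s"
proof -
  have X: "y \<in> X" "z \<in> X" "x \<in> X" using assms seg_X by blast+
  have rev: "z - t \<subseteq> y - t" using seg_rev[OF assms(1-4,6)] .
  show ?thesis
  proof
    assume a: "x \<in> seg y z"
    show "y - s \<subseteq> x - s \<and> x - s \<subseteq> z - s"
      using a assms(6) unfolding seg_def by blast
  next
    assume a: "y - s \<subseteq> x - s \<and> x - s \<subseteq> z - s"
    have "h \<in> x" if h: "h \<in> y" "h \<in> z" for h
    proof (cases "h \<in> s")
      case True
      have hE: "h \<in> E" using h X_subD X by blast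
      show ?thesis
      proof (rule ccontr)
        assume "h \<notin> x"
        then have "br h \<in> x - s" using X_br[OF X(3) hE] X_br[OF assms(1) hE] True by blast
        then have "br h \<in> z" using a by blast
        then show False using X_br[OF X(2) hE] h by blast
      qed
    qed (use a h in blast)
    then show "x \<in> seg y z" using seg_mem_br[OF X] by blast
  qed
qed

end

context kneser begin

definition PT where "PT c = {y. Pt c y}"

definition consec where "consec c Y \<longleftrightarrow> (\<exists>y y'. Y = {y, y'} \<and> y \<noteq> y' \<and> Pt c y \<and> Pt c y' \<and> (\<forall>x. Pt c x \<longrightarrow> x \<in> seg y y' \<longrightarrow> x = y \<or> x = y'))"

definition Ps where "Ps c = {{y} | y. Pt c y} \<union> {Y. consec c Y}"

definition rank where "rank c s y = card {z \<in> PT c. z - s \<subset> y - s}"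

text \<open>Position on the path from \<open>s\<close> that alternates between cut points and consecutive pairs of cut points.\<close>

definition ix where "ix c s Y = (if card Y = 1 then 2 else 1) * (\<Sum>y \<in> Y. rank c s y)"

lemma fin_PT: "c \<in> Sv \<Longrightarrow> finite (PT c)" unfolding PT_def by (rule Pt_fin)

lemma PT_act: assumes "g \<in> carrier G" "c \<in> Sv" shows "PT (wa g c) = pact g ` PT c"
proof -
  have "y \<in> pact g ` PT c" if y: "Pt (wa g c) y" for y
  proof -
    have yX: "y \<in> X" using Pt_sg[OF y] by blast
    have "Pt (wa (inv g) (wa g c)) (pact (inv g) y)" using Pt_act[OF y] assms by simp
    then have "Pt c (pact (inv g) y)" using wa_inv assms SvD by simp
    moreover have "y = pact g (pact (inv g) y)" using pact_inv' assms yX by simp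
    ultimately show ?thesis unfolding PT_def by blast
  qed
  then show ?thesis using Pt_act assms unfolding PT_def by blast
qed

lemma Pt_seg: "c \<in> Sv \<Longrightarrow> pos c = {s, t} \<Longrightarrow> Pt c y \<Longrightarrow> y \<in> seg s t"
  using Pt_sg sg_seg[of c s t] SvD(2)[of c] by auto

lemma rank_less:
  assumes "c \<in> Sv" "s \<in> pos c" "Pt c y" "Pt c z"
  shows "rank c s y < rank c s z \<longleftrightarrow> y - s \<subset> z - s" "rank c s y = rank c s z \<longleftrightarrow> y = z"
proof -
  obtain t where t: "pos c = {s, t}" "s \<noteq> t" "s \<in> X" "t \<in> X" using Sv_ends[OF assms(1,2)] .
  have yz: "y \<in> seg s t" "z \<in> seg s t" using Pt_seg[OF assms(1) t(1)] assms by blast+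
  have X: "y \<in> X" "z \<in> X" using yz seg_X by blast+
  have *: "rank c s y < rank c s z" if "y - s \<subset> z - s" "Pt c y" for y z
    unfolding rank_def by (rule psubset_card_mono) (use fin_PT[OF assms(1)] that in \<open>auto simp: PT_def\<close>)
  have l: "y - s \<subset> z - s \<or> z - s \<subset> y - s \<or> y = z"
    using seg_linear[OF t(3,4) yz] diff_eq[OF t(3) X] by blast
  have p: "y - s \<subset> z - s \<Longrightarrow> rank c s y < rank c s z" "z - s \<subset> y - s \<Longrightarrow> rank c s z < rank c s y" using * assms by blast+
  show "rank c s y < rank c s z \<longleftrightarrow> y - s \<subset> z - s" using l p by (metis less_asym less_irrefl)
  show "rank c s y = rank c s z \<longleftrightarrow> y = z" using l p by (metis less_irrefl)
qed

text \<open>The cut points other than \<open>y\<close> are divided into those before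
  \<open>y\<close> seen from \<open>s\<close> and those before \<open>y\<close> seen from
  \<open>t\<close>.\<close>

lemma rank_sum:
  assumes "c \<in> Sv" "pos c = {s, t}" "Pt c y"
  shows "Suc (rank c s y + rank c t y) = card (PT c)"
proof -
  have X: "s \<in> X" "t \<in> X" using SvD(2)[OF assms(1)] assms(2) by auto
  have f: "finite (PT c)" using fin_PT[OF assms(1)] .
  have sg: "\<And>z. Pt c z \<Longrightarrow> z \<in> seg s t" using Pt_seg[OF assms(1,2)] .
  have yX: "y \<in> X" using sg[OF assms(3)] seg_X by blast
  have sub: "z - t \<subset> y - t \<longleftrightarrow> y - s \<subset> z - s" if z: "Pt c z" for z
  proof -
    have zX: "z \<in> X" using sg[OF z] seg_X by blast
    have s': "z \<in> seg t s" "y \<in> seg t s" using sg[OF z] sg[OF assms(3)] seg_sym by blast+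
    have "z - t \<subseteq> y - t \<longleftrightarrow> y - s \<subseteq> z - s" using seg_rev[OF X sg[OF assms(3)] sg[OF z]] seg_rev[OF X(2,1) s'] by blast
    moreover have "z - t = y - t \<longleftrightarrow> y - s = z - s" using diff_eq[OF X(1) yX zX] diff_eq[OF X(2) zX yX] by blast
    ultimately show ?thesis by blast
  qed
  have t: "z - s \<subset> y - s \<or> y - s \<subset> z - s \<or> z = y" if z: "Pt c z" for z
    using seg_linear[OF X sg[OF z] sg[OF assms(3)]] diff_eq[OF X(1) _ yX] sg[OF z] seg_X by blast
  have "PT c = insert y ({z \<in> PT c. z - s \<subset> y - s} \<union> {z \<in> PT c. z - t \<subset> y - t})"
  proof (intro equalityI subsetI)
    fix z assume "z \<in> PT c"
    then have "Pt c z" by (simp add: PT_def)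
    then show "z \<in> insert y ({z \<in> PT c. z - s \<subset> y - s} \<union> {z \<in> PT c. z - t \<subset> y - t})"
      using t[of z] sub[of z] unfolding PT_def by simp argo
  next
    fix z assume "z \<in> insert y ({z \<in> PT c. z - s \<subset> y - s} \<union> {z \<in> PT c. z - t \<subset> y - t})"
    then show "z \<in> PT c" using assms(3) by (auto simp: PT_def)
  qed
  moreover have "y \<notin> {z \<in> PT c. z - s \<subset> y - s} \<union> {z \<in> PT c. z - t \<subset> y - t}" by blast
  moreover have "{z \<in> PT c. z - s \<subset> y - s} \<inter> {z \<in> PT c. z - t \<subset> y - t} = {}" using sub unfolding PT_def by blast
  ultimately show ?thesis unfolding rank_def using f
    by (metis (no_types, lifting) card_Un_disjoint card_insert_disjoint finite_Un finite_insert)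
qed

lemma rank_cs:
  assumes c: "c \<in> Sv" "s \<in> pos c" and y: "Pt c y" "Pt c y'" "y - s \<subset> y' - s"
    and cons: "\<And>x. Pt c x \<Longrightarrow> x \<in> seg y y' \<Longrightarrow> x = y \<or> x = y'"
  shows "rank c s y' = Suc (rank c s y)"
proof -
  obtain t where t: "pos c = {s, t}" "s \<noteq> t" "s \<in> X" "t \<in> X" using Sv_ends[OF c] .
  have sg: "\<And>z. Pt c z \<Longrightarrow> z \<in> seg s t" using Pt_seg[OF c(1) t(1)] .
  have "{z \<in> PT c. z - s \<subset> y' - s} = insert y {z \<in> PT c. z - s \<subset> y - s}"
  proof -
    have "z = y \<or> z - s \<subset> y - s" if z: "Pt c z" "z - s \<subset> y' - s" for z
    proof (cases "y - s \<subseteq> z - s")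
      case True
      then have "z \<in> seg y y'" using seg_between[OF t(3,4) sg[OF y(1)] sg[OF y(2)] sg[OF z(1)]] y z by blast
      then show ?thesis using cons z by blast
    next
      case False
      then show ?thesis using seg_linear[OF t(3,4) sg[OF z(1)] sg[OF y(1)]] by blast
    qed
    then have 1: "x \<in> insert y {z \<in> PT c. z - s \<subset> y - s}" if "x \<in> {z \<in> PT c. z - s \<subset> y' - s}" for x
      using that unfolding PT_def by simp
    have 2: "x \<in> {z \<in> PT c. z - s \<subset> y' - s}" if "x \<in> insert y {z \<in> PT c. z - s \<subset> y - s}" for x
      using that y(1,3) psubset_trans[of "x - s" "y - s" "y' - s"] unfolding PT_def by auto
    show ?thesis by (intro equalityI subsetI) (erule 1, erule 2)
  qed
  then show ?thesis unfolding rank_def using fin_PT[OF c(1)] by simp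
qed

lemma ix_point: "ix c s {y} = 2 * rank c s y" by (simp add: ix_def)

lemma csE:
  assumes "c \<in> Sv" "s \<in> pos c" "consec c Y"
  obtains y y' where "Y = {y, y'}" "y \<noteq> y'" "Pt c y" "Pt c y'" "y - s \<subset> y' - s" "rank c s y' = Suc (rank c s y)" "ix c s Y = Suc (2 * rank c s y)"
    "\<And>x. Pt c x \<Longrightarrow> x \<in> seg y y' \<Longrightarrow> x = y \<or> x = y'"
proof -
  obtain t where t: "pos c = {s, t}" "s \<noteq> t" "s \<in> X" "t \<in> X" using Sv_ends[OF assms(1,2)] .
  obtain y y' where y: "Y = {y, y'}" "y \<noteq> y'" "Pt c y" "Pt c y'" and co: "\<And>x. Pt c x \<Longrightarrow> x \<in> seg y y' \<Longrightarrow> x = y \<or> x = y'"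
    using assms(3) unfolding consec_def by blast
  note th = that
  have *: thesis if y: "Y = {y, y'}" "y \<noteq> y'" "Pt c y" "Pt c y'" "y - s \<subset> y' - s" and co: "\<And>x. Pt c x \<Longrightarrow> x \<in> seg y y' \<Longrightarrow> x = y \<or> x = y'" for y y'
  proof -
    have r: "rank c s y' = Suc (rank c s y)" using rank_cs[OF assms(1,2) y(3-5) co] .
    have i: "ix c s Y = Suc (2 * rank c s y)" unfolding ix_def using y(1,2) r by simp
    show thesis using th[OF y r i] co by blast
  qed
  have X: "y \<in> X" "y' \<in> X" "y \<in> seg s t" "y' \<in> seg s t" using Pt_seg[OF assms(1) t(1)] y seg_X by blast+
  then have "y - s \<subset> y' - s \<or> y' - s \<subset> y - s"
    using seg_linear[OF t(3,4) X(3,4)] diff_eq[OF t(3) X(1,2)] y(2) by blast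
  then show thesis
  proof
    assume "y - s \<subset> y' - s"
    then show thesis using *[OF y] co by blast
  next
    assume a: "y' - s \<subset> y - s"
    have "Y = {y', y}" using y by blast
    then show thesis using *[OF _ _ y(4,3) a] y(2) co seg_sym by blast
  qed
qed

lemma consec_card: "consec c Y \<Longrightarrow> card Y = 2" unfolding consec_def by (metis card_2_iff)

lemma consec_Pt: "consec c Y \<Longrightarrow> y \<in> Y \<Longrightarrow> Pt c y" unfolding consec_def by auto

lemma ix_inj:
  assumes c: "c \<in> Sv" "s \<in> pos c" and Y: "Y \<in> Ps c" "Z \<in> Ps c" "ix c s Y = ix c s Z"
  shows "Y = Z"
proof -
  have od: "odd (ix c s Y)" if "consec c Y" for Y using csE[OF c that] by (metis even_Suc even_mult_iff even_numeral)
  have ev: "even (ix c s {y})" for y by (simp add: ix_point)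
  show ?thesis
  proof (cases "consec c Y")
    case True
    have "consec c Z"
    proof (rule ccontr)
      assume "\<not> consec c Z"
      then obtain z where "Z = {z}" using Y unfolding Ps_def by auto
      then show False using od[OF True] ev Y(3) by metis
    qed
    obtain y y' where y: "Y = {y, y'}" "Pt c y" "Pt c y'" "rank c s y' = Suc (rank c s y)" "ix c s Y = Suc (2 * rank c s y)" using csE[OF c True] by metis
    obtain z z' where z: "Z = {z, z'}" "Pt c z" "Pt c z'" "rank c s z' = Suc (rank c s z)" "ix c s Z = Suc (2 * rank c s z)" using csE[OF c \<open>consec c Z\<close>] by metis
    have "rank c s y = rank c s z" "rank c s y' = rank c s z'" using y z Y(3) by auto
    then have "y = z" "y' = z'" using rank_less(2)[OF c y(2) z(2)] rank_less(2)[OF c y(3) z(3)] by simp_all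
    then show ?thesis using y z by simp
  next
    case False
    then obtain y where y: "Y = {y}" "Pt c y" using Y unfolding Ps_def by auto
    then have "\<not> consec c Z" using Y od ev by metis
    then obtain z where z: "Z = {z}" "Pt c z" using Y unfolding Ps_def by auto
    then show ?thesis using rank_less(2)[OF c] y z Y(3) by (simp add: ix_point)
  qed
qed

text \<open>Positions run from 0 to \<open>2 * card (PT c) - 2\<close>, so the middle of the strand
  has position \<open>card (PT c) - 1\<close> from either end. This is the origin of the constants
  in \<open>height\<close>.\<close>

lemma ix_sum:
  assumes c: "c \<in> Sv" "pos c = {s, t}" and Y: "Y \<in> Ps c"
  shows "ix c s Y + ix c t Y + 2 = 2 * card (PT c)"
proof -
  have e: "s \<in> pos c" "t \<in> pos c" using c by auto
  show ?thesis
  proof (cases "consec c Y")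
    case True
    obtain y y' where y: "Y = {y, y'}" "y \<noteq> y'" "Pt c y" "Pt c y'" using csE[OF c(1) e(1) True] by metis
    show ?thesis using rank_sum[OF c y(3)] rank_sum[OF c y(4)] y(1,2) unfolding ix_def by simp
  next
    case False
    then obtain y where y: "Y = {y}" "Pt c y" using Y unfolding Ps_def by auto
    then show ?thesis using rank_sum[OF c y(2)] by (simp add: ix_point)
  qed
qed

lemma ix_adj:
  assumes c: "c \<in> Sv" "s \<in> pos c" and Y: "consec c Y" "y \<in> Y"
  shows "ix c s Y = Suc (ix c s {y}) \<or> ix c s {y} = Suc (ix c s Y)"
  using csE[OF c Y(1)] Y(2) by (metis ix_point insertE singletonD mult_Suc_right add_2_eq_Suc)

lemma consec_act: assumes "g \<in> carrier G" "c \<in> Sv" "consec c Y" shows "consec (wa g c) (pact g ` Y)"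
proof -
  obtain y y' where y: "Y = {y, y'}" "y \<noteq> y'" "Pt c y" "Pt c y'" and co: "\<And>x. Pt c x \<Longrightarrow> x \<in> seg y y' \<Longrightarrow> x = y \<or> x = y'"
    using assms(3) unfolding consec_def by blast
  have X: "y \<in> X" "y' \<in> X" using y Pt_sg by blast+
  have "pact g ` Y = {pact g y, pact g y'}" "pact g y \<noteq> pact g y'" using y X pact_eq[OF assms(1)] by auto
  moreover have "Pt (wa g c) (pact g y)" "Pt (wa g c) (pact g y')" using Pt_act y assms by blast+
  moreover have "z = pact g y \<or> z = pact g y'" if z: "Pt (wa g c) z" "z \<in> seg (pact g y) (pact g y')" for z
  proof -
    obtain x where x: "Pt c x" "z = pact g x" using z(1) PT_act[OF assms(1,2)] unfolding PT_def by blast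
    then have "x \<in> seg y y'" using z(2) seg_pact[OF assms(1) X] Pt_sg by blast
    then show ?thesis using co x by blast
  qed
  ultimately show ?thesis unfolding consec_def by blast
qed

lemma rank_act: assumes "g \<in> carrier G" "c \<in> Sv" "s \<in> pos c" "Pt c y" shows "rank (wa g c) (pact g s) (pact g y) = rank c s y"
proof -
  have sX: "s \<in> X" "y \<in> X" using SvD(2)[OF assms(2)] assms Pt_sg by blast+
  have sub: "pact g z - pact g s \<subset> pact g y - pact g s \<longleftrightarrow> z - s \<subset> y - s" if "z \<in> X" for z
  proof -
    have "inj_on (ea g) E" using ea_inj[OF assms(1)] by (auto simp: inj_on_def)
    then have d: "pact g z - pact g s = ea g ` (z - s)" if "z \<in> X" for z
      unfolding pact_def using inj_on_image_set_diff[of "ea g" E z s] X_sub that sX by (metis Diff_subset order_trans)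
    have "z - s \<subseteq> E" "y - s \<subseteq> E" using X_sub that sX by blast+
    then have i: "inj_on (ea g) ((z - s) \<union> (y - s))" by (intro inj_on_subset[OF \<open>inj_on (ea g) E\<close>]) blast
    have "A \<subset> B" if AB: "ea g ` A \<subset> ea g ` B" "inj_on (ea g) (A \<union> B)" for A B
    proof -
      have "A \<subseteq> B"
      proof
        fix x assume x: "x \<in> A"
        then obtain b where "b \<in> B" "ea g x = ea g b" using AB(1) by blast
        then show "x \<in> B" using inj_onD[OF AB(2), of x b] x by auto
      qed
      then show ?thesis using AB(1) by blast
    qed
    then show ?thesis unfolding d[OF that] d[OF sX(2)] using i image_strict_mono[of "ea g" "y - s" "z - s"] inj_on_subset[OF i]
      by (metis Un_upper2)
  qed
  have "{z \<in> PT (wa g c). z - pact g s \<subset> pact g y - pact g s} = pact g ` {z \<in> PT c. z - s \<subset> y - s}"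
  proof (intro equalityI subsetI)
    fix z assume "z \<in> {z \<in> PT (wa g c). z - pact g s \<subset> pact g y - pact g s}"
    then obtain x where x: "Pt c x" "z = pact g x" "pact g x - pact g s \<subset> pact g y - pact g s"
      unfolding PT_act[OF assms(1,2)] by (auto simp: PT_def)
    moreover have "x \<in> X" using Pt_sg x by blast
    ultimately show "z \<in> pact g ` {z \<in> PT c. z - s \<subset> y - s}" using sub by (auto simp: PT_def)
  next
    fix z assume "z \<in> pact g ` {z \<in> PT c. z - s \<subset> y - s}"
    then obtain x where x: "Pt c x" "z = pact g x" "x - s \<subset> y - s" by (auto simp: PT_def)
    moreover have "x \<in> X" using Pt_sg x by blast
    ultimately show "z \<in> {z \<in> PT (wa g c). z - pact g s \<subset> pact g y - pact g s}"
      unfolding PT_act[OF assms(1,2)] using sub[of x] by (auto simp: PT_def)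
  qed
  moreover have "inj_on (pact g) {z \<in> PT c. z - s \<subset> y - s}" using pact_eq[OF assms(1)] Pt_sg unfolding PT_def inj_on_def by blast
  ultimately show ?thesis unfolding rank_def by (simp add: card_image)
qed

lemma Ps_sub: "Y \<in> Ps c \<Longrightarrow> y \<in> Y \<Longrightarrow> Pt c y" unfolding Ps_def using consec_Pt by blast

lemma Ps_X: "Y \<in> Ps c \<Longrightarrow> Y \<subseteq> X" using Ps_sub Pt_sg by blast

lemma ix_act: assumes "g \<in> carrier G" "c \<in> Sv" "s \<in> pos c" "Y \<in> Ps c" shows "ix (wa g c) (pact g s) (pact g ` Y) = ix c s Y"
proof -
  have "inj_on (pact g) Y" using pact_eq[OF assms(1)] Ps_X[OF assms(4)] by (auto simp: inj_on_def)
  then have "(\<Sum>y \<in> pact g ` Y. rank (wa g c) (pact g s) y) = (\<Sum>y \<in> Y. rank c s y)"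
    using rank_act[OF assms(1-3)] Ps_sub[OF assms(4)] by (simp add: sum.reindex)
  then show ?thesis unfolding ix_def using card_pact[OF assms(1) Ps_X[OF assms(4)]] by simp
qed

lemma Ps_act: "g \<in> carrier G \<Longrightarrow> c \<in> Sv \<Longrightarrow> Y \<in> Ps c \<Longrightarrow> pact g ` Y \<in> Ps (wa g c)"
  unfolding Ps_def using consec_act Pt_act by auto

lemma pred_ex:
  assumes c: "c \<in> Sv" "s \<in> pos c" and y: "Pt c y" "y \<noteq> s"
  obtains y' where "Pt c y'" "consec c {y', y}" "rank c s y = Suc (rank c s y')"
proof -
  obtain t where t: "pos c = {s, t}" "s \<noteq> t" "s \<in> X" "t \<in> X" using Sv_ends[OF c] .
  have sg: "\<And>z. Pt c z \<Longrightarrow> z \<in> seg s t" using Pt_seg[OF c(1) t(1)] .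
  define D where "D = {z \<in> PT c. z - s \<subset> y - s}"
  have fD: "finite D" unfolding D_def using fin_PT[OF c(1)] by simp
  have yX: "y \<in> X" using sg y seg_X by blast
  have "s \<in> D" unfolding D_def PT_def using Pt_end[OF c] diff_eq[OF t(3) yX t(3)] y by auto
  then obtain y' where y': "y' \<in> D" "\<forall>z \<in> D. rank c s z \<le> rank c s y'"
  proof -
    have "Max (rank c s ` D) \<in> rank c s ` D" using fD \<open>s \<in> D\<close> by (intro Max_in) auto
    then obtain y' where "y' \<in> D" "Max (rank c s ` D) = rank c s y'" by blast
    moreover have "rank c s z \<le> Max (rank c s ` D)" if "z \<in> D" for z using fD that by simp
    ultimately show ?thesis using that by simp
  qed
  have P: "Pt c y'" "y' - s \<subset> y - s" using y' unfolding D_def PT_def by auto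
  have co: "x = y' \<or> x = y" if x: "Pt c x" "x \<in> seg y' y" for x
  proof (rule ccontr)
    assume n: "\<not> (x = y' \<or> x = y)"
    have xX: "x \<in> X" "y' \<in> X" using sg x P seg_X by blast+
    have "y' - s \<subseteq> x - s" "x - s \<subseteq> y - s" using seg_between[OF t(3,4) sg[OF P(1)] sg[OF y(1)] sg[OF x(1)]] P x by blast+
    then have "y' - s \<subset> x - s" "x - s \<subset> y - s" using diff_eq[OF t(3)] n xX yX by blast+
    then have "x \<in> D" "rank c s y' < rank c s x" using rank_less(1)[OF c] P x unfolding D_def PT_def by auto
    then show False using y' by auto
  qed
  have "y' \<noteq> y" using P by blast
  then have "consec c {y', y}" unfolding consec_def using P y co by blast
  then show ?thesis using that P rank_cs[OF c P(1) y(1) P(2)] co by blast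
qed

end

section \<open>Subdivision\<close>

locale subdiv = kneser +
  fixes p
  assumes par: "par (Id_on W) p" and im: "immersed (Id_on W)"
begin

text \<open>Well defined because the graph is immersed: a strand has only one neighbour over each of
  its ends.\<close>

definition end_vx where "end_vx c y = (THE a. (c, a) \<in> ad \<and> pos a = {y})"

text \<open>At its two ends the subdivided strand is glued to the old vertices, which several
  strands may share. Interior cut points and consecutive pairs keep the strand as first component,
  so that different strands stay apart.\<close>

definition vx where "vx c Z = (if consec c Z then (c, Z) else if Z \<subseteq> pos c then (end_vx c (the_elem Z), Z) else (c, Z))"

definition Wt where "Wt = {(a, pos a) | a. a \<in> W \<and> card (pos a) = 1} \<union> {vx c Z | c Z. c \<in> Sv \<and> Z \<in> Ps c}"

definition act where "act g v = (wa g (fst v), pact g ` snd v)"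

definition adt where "adt = {(vx c {y}, vx c Y) | c y Y. c \<in> Sv \<and> consec c Y \<and> y \<in> Y} \<union> {(vx c Y, vx c {y}) | c y Y. c \<in> Sv \<and> consec c Y \<and> y \<in> Y}"

definition se where "se c = (if p c = c then (SOME s. s \<in> pos c) else (SOME s. s \<in> pos c \<and> p c = end_vx c s))"

text \<open>Parents in the subdivided strand decrease the height: towards the middle if \<open>c\<close> is its own parent, and
  otherwise towards the end of \<open>c\<close> that is its parent.\<close>

definition height where "height c Y = (if p c = c then nat \<bar>int (ix c (se c) Y) + 1 - int (card (PT c))\<bar> else ix c (se c) Y)"

definition na where "na c Y Z \<longleftrightarrow> (consec c Y \<and> (\<exists>y \<in> Y. Z = {y})) \<or> (consec c Z \<and> (\<exists>y \<in> Z. Y = {y}))"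

definition lo where "lo c Y Z \<longleftrightarrow> na c Y Z \<and> height c Z < height c Y"

text \<open>Along a strand the heights are monotone or V-shaped, so a position has at most one lower
  neighbour and the first \<open>THE\<close> is unambiguous. An old vertex whose parent was a strand
  moves to the first pair on that strand.\<close>

definition pt where "pt v = (if fst v \<in> Sv then (if \<exists>Z. lo (fst v) (snd v) Z then vx (fst v) (THE Z. lo (fst v) (snd v) Z) else v)
   else (if p (fst v) = fst v then v else vx (p (fst v)) (THE Z. consec (p (fst v)) Z \<and> snd v \<subseteq> Z)))"

lemma end_vx: assumes "c \<in> Sv" "y \<in> pos c" shows "(c, end_vx c y) \<in> ad" "pos (end_vx c y) = {y}" "end_vx c y \<in> W" "end_vx c y \<notin> Sv"
proof -
  obtain a where a: "(c, a) \<in> ad" "pos a = {y}" using S_nb assms unfolding Sv_def by blast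
  have "b = a" if "(c, b) \<in> ad" "pos b = {y}" for b
  proof -
    have "(b, a) \<in> Id_on W" by (rule immD[OF im that(1) a(1)]) (use that a SvD(1)[OF assms(1)] in auto)
    then show ?thesis by auto
  qed
  then have n: "end_vx c y = a" unfolding end_vx_def by (intro the_equality) (use a in blast)+
  show "(c, end_vx c y) \<in> ad" "pos (end_vx c y) = {y}" using a n by simp_all
  show "end_vx c y \<in> W" using ad_W[OF a(1)] n by simp
  show "end_vx c y \<notin> Sv" using a(2) n unfolding Sv_def by simp
qed

lemma end_vx_unique: assumes "c \<in> Sv" "(c, a) \<in> ad" shows "\<exists>y \<in> pos c. pos a = {y} \<and> a = end_vx c y"
proof -
  have aW: "a \<in> W" "c \<in> W" using ad_W assms by blast+
  have "card (pos a) = 1" using ad_col[OF assms(2)] pos_card[OF aW(1)] assms(1) unfolding Sv_def by auto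
  then obtain y where y: "pos a = {y}" by (auto simp: card_1_singleton_iff)
  have "y \<in> pos c"
  proof (rule ccontr)
    assume "y \<notin> pos c"
    then have "pos c \<subseteq> {y}" using ad_pos[OF assms(2)] y by auto
    then have "card (pos c) \<le> 1" using card_mono[of "{y}" "pos c"] by simp
    then show False using assms(1) unfolding Sv_def by simp
  qed
  moreover have "a = end_vx c y" using immD[OF im assms(2) end_vx(1)[OF assms(1) \<open>y \<in> pos c\<close>]] y end_vx(2)[OF assms(1) \<open>y \<in> pos c\<close>] aW by auto
  ultimately show ?thesis using y by blast
qed

lemma end_vx_act: assumes "g \<in> carrier G" "c \<in> Sv" "y \<in> pos c" shows "end_vx (wa g c) (pact g y) = wa g (end_vx c y)"
proof -
  have "(wa g c, wa g (end_vx c y)) \<in> ad" using ad_act[OF assms(1)] end_vx(1) assms by blast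
  then obtain z where "pos (wa g (end_vx c y)) = {z}" "wa g (end_vx c y) = end_vx (wa g c) z" using end_vx_unique[OF Sv_act[OF assms(1,2)]] by blast
  then show ?thesis using pos_wa[OF assms(1) end_vx(3)[OF assms(2,3)]] end_vx(2)[OF assms(2,3)] by simp
qed

lemma vx_snd: "snd (vx c Z) = Z" by (simp add: vx_def)

lemma vx_cs: "consec c Z \<Longrightarrow> vx c Z = (c, Z)" by (simp add: vx_def)

lemma not_cs1: "\<not> consec c {y}" using consec_card by fastforce

lemma vx_end: "y \<in> pos c \<Longrightarrow> vx c {y} = (end_vx c y, {y})" by (simp add: vx_def not_cs1)

lemma vx_int: "y \<notin> pos c \<Longrightarrow> vx c {y} = (c, {y})" by (simp add: vx_def not_cs1)

lemma PsE: assumes "Z \<in> Ps c" obtains "consec c Z" | y where "Z = {y}" "Pt c y"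
  using assms unfolding Ps_def by blast

lemma consec_act_iff: assumes "g \<in> carrier G" "c \<in> Sv" "Z \<subseteq> X" shows "consec (wa g c) (pact g ` Z) \<longleftrightarrow> consec c Z"
proof
  assume "consec (wa g c) (pact g ` Z)"
  then have "consec (wa (inv g) (wa g c)) (pact (inv g) ` pact g ` Z)" using consec_act[of "inv g" "wa g c"] Sv_act assms by simp
  moreover have "pact (inv g) ` pact g ` Z = Z" using pact_inv[OF assms(1)] assms(3) by force
  ultimately show "consec c Z" using wa_inv[OF assms(1) SvD(1)[OF assms(2)]] by simp
qed (use consec_act assms in blast)

lemma pos_act_iff: assumes "g \<in> carrier G" "c \<in> Sv" "y \<in> X" shows "pact g y \<in> pos (wa g c) \<longleftrightarrow> y \<in> pos c"
  using pos_wa[OF assms(1) SvD(1)[OF assms(2)]] pact_eq[OF assms(1)] assms(3) SvD(2)[OF assms(2)] by blast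

lemma vx_act: assumes "g \<in> carrier G" "c \<in> Sv" "Z \<in> Ps c" shows "act g (vx c Z) = vx (wa g c) (pact g ` Z)"
  using assms(3)
proof (cases rule: PsE)
  case 1
  then show ?thesis using vx_cs consec_act assms by (simp add: act_def)
next
  case (2 y)
  have yX: "y \<in> X" using Pt_sg 2 by blast
  show ?thesis
  proof (cases "y \<in> pos c")
    case True
    then show ?thesis using 2 vx_end pos_act_iff[OF assms(1,2) yX] end_vx_act[OF assms(1,2)] by (simp add: act_def)
  next
    case False
    then show ?thesis using 2 vx_int pos_act_iff[OF assms(1,2) yX] by (simp add: act_def)
  qed
qed

lemma Ps1: "Pt c y \<Longrightarrow> {y} \<in> Ps c" unfolding Ps_def by blast
lemma Ps2: "consec c Y \<Longrightarrow> Y \<in> Ps c" unfolding Ps_def by blast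

lemma WtE:
  assumes "v \<in> Wt"
  obtains a where "v = (a, pos a)" "a \<in> W" "card (pos a) = 1" | c y where "c \<in> Sv" "Pt c y" "y \<notin> pos c" "v = (c, {y})" | c Y where "c \<in> Sv" "consec c Y" "v = (c, Y)"
proof -
  consider a where "v = (a, pos a)" "a \<in> W" "card (pos a) = 1" | c Z where "v = vx c Z" "c \<in> Sv" "Z \<in> Ps c"
    using assms unfolding Wt_def by blast
  then show ?thesis
  proof cases
    case 1
    then show ?thesis using that by blast
  next
    case (2 c Z)
    from 2(3) show ?thesis
    proof (cases rule: PsE)
      case 1
      then show ?thesis using that(3) 2 vx_cs by simp
    next
      case (2 y)
      then show ?thesis using that(1)[of "end_vx c y"] that(2)[of c y] \<open>v = vx c Z\<close> \<open>c \<in> Sv\<close> end_vx[of c y] vx_end vx_int by (cases "y \<in> pos c") auto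
    qed
  qed
qed

lemma vx_Wt: "c \<in> Sv \<Longrightarrow> Z \<in> Ps c \<Longrightarrow> vx c Z \<in> Wt" unfolding Wt_def by blast

lemma Wt_D: assumes "v \<in> Wt" shows "fst v \<in> W" "snd v \<subseteq> X" "card (snd v) = 1 \<or> card (snd v) = 2"
proof -
  have "fst v \<in> W \<and> snd v \<subseteq> X \<and> (card (snd v) = 1 \<or> card (snd v) = 2)"
    using assms
  proof (cases rule: WtE)
    case (1 a)
    then show ?thesis using pos_X by simp
  next
    case (2 c y)
    then show ?thesis using SvD(1) Pt_sg by simp
  next
    case (3 c Y)
    then show ?thesis using SvD(1) Ps_X[OF Ps2] consec_card by simp
  qed
  then show "fst v \<in> W" "snd v \<subseteq> X" "card (snd v) = 1 \<or> card (snd v) = 2" by blast+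
qed

lemma act_Wt: assumes "g \<in> carrier G" "v \<in> Wt" shows "act g v \<in> Wt"
proof -
  consider a where "v = (a, pos a)" "a \<in> W" "card (pos a) = 1" | c Z where "v = vx c Z" "c \<in> Sv" "Z \<in> Ps c"
    using assms unfolding Wt_def by blast
  then show ?thesis
  proof cases
    case 1
    then have "act g v = (wa g a, pos (wa g a))" "wa g a \<in> W" "card (pos (wa g a)) = 1"
      using pos_wa[OF assms(1)] wa_cl[OF assms(1)] card_pact[OF assms(1) pos_X] by (auto simp: act_def)
    then show ?thesis unfolding Wt_def by blast
  next
    case 2
    then show ?thesis using vx_act[OF assms(1) 2(2,3)] vx_Wt Sv_act Ps_act assms by simp
  qed
qed

lemma adt_sym: "(v, w) \<in> adt \<Longrightarrow> (w, v) \<in> adt" unfolding adt_def by blast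

lemma adt_I: "c \<in> Sv \<Longrightarrow> consec c Y \<Longrightarrow> y \<in> Y \<Longrightarrow> (vx c {y}, vx c Y) \<in> adt" unfolding adt_def by blast

lemma adt_act1: assumes "g \<in> carrier G" "c \<in> Sv" "consec c Y" "y \<in> Y" shows "(act g (vx c {y}), act g (vx c Y)) \<in> adt"
proof -
  have "act g (vx c {y}) = vx (wa g c) {pact g y}" "act g (vx c Y) = vx (wa g c) (pact g ` Y)"
    using vx_act[OF assms(1,2)] Ps1 Ps2 consec_Pt assms by fastforce+
  then show ?thesis using adt_I[OF Sv_act consec_act] assms by simp
qed

lemma adt_act: "g \<in> carrier G \<Longrightarrow> (v, w) \<in> adt \<Longrightarrow> (act g v, act g w) \<in> adt"
  using adt_act1 adt_sym unfolding adt_def by blast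

lemma path_end: assumes "c \<in> Sv" "s \<in> pos c" "Pt c y" shows "(vx c {y}, vx c {s}) \<in> adt\<^sup>*"
  using assms(3)
proof (induction "rank c s y" arbitrary: y rule: less_induct)
  case less
  show ?case
  proof (cases "y = s")
    case False
    obtain y' where y': "Pt c y'" "consec c {y', y}" "rank c s y = Suc (rank c s y')" using pred_ex[OF assms(1,2) less(2) False] .
    then have "(vx c {y'}, vx c {s}) \<in> adt\<^sup>*" using less by simp
    moreover have "(vx c {y}, vx c {y', y}) \<in> adt" "(vx c {y', y}, vx c {y'}) \<in> adt"
      using adt_I[OF assms(1) y'(2)] adt_sym by blast+
    ultimately show ?thesis by (meson converse_rtrancl_into_rtrancl)
  qed simp
qed

lemma sym_adt: "(v, w) \<in> adt\<^sup>* \<Longrightarrow> (w, v) \<in> adt\<^sup>*"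
  using sym_rtrancl[of adt] adt_sym unfolding sym_def by blast

lemma adt_conn: assumes "v \<in> Wt" "w \<in> Wt" shows "(v, w) \<in> adt\<^sup>*"
proof -
  define rp where "rp x = (if x \<in> Sv then vx x {SOME s. s \<in> pos x} else (x, pos x))" for x
  have so: "(SOME s. s \<in> pos c) \<in> pos c" if "c \<in> Sv" for c
    by (rule someI_ex) (use that in \<open>auto simp: Sv_def card_2_iff\<close>)
  have 0: "(vx c Z, rp c) \<in> adt\<^sup>*" if c: "c \<in> Sv" "Z \<in> Ps c" for c Z
    using c(2)
  proof (cases rule: PsE)
    case 1
    then obtain y where "y \<in> Z" "Pt c y" using consec_Pt unfolding consec_def by blast
    then have "(vx c Z, vx c {y}) \<in> adt" "(vx c {y}, rp c) \<in> adt\<^sup>*" using adt_I adt_sym path_end[OF c(1) so[OF c(1)]] c 1 unfolding rp_def by auto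
    then show ?thesis by (meson converse_rtrancl_into_rtrancl)
  next
    case (2 y)
    then show ?thesis using path_end[OF c(1) so[OF c(1)]] c unfolding rp_def by simp
  qed
  have 1: "(v, rp (fst v)) \<in> adt\<^sup>*" if "v \<in> Wt" for v
    using that
  proof (cases rule: WtE)
    case (1 a)
    then show ?thesis unfolding rp_def Sv_def by simp
  next
    case (2 c y)
    then show ?thesis using 0[of c "{y}"] Ps1 vx_int by simp
  next
    case (3 c Y)
    then show ?thesis using 0[of c Y] Ps2 vx_cs by simp
  qed
  have 2: "(rp x, rp y) \<in> adt\<^sup>*" if a: "(x, y) \<in> ad" for x y
  proof -
    have *: "(rp c, rp a) \<in> adt\<^sup>*" if "(c, a) \<in> ad" "c \<in> Sv" for c a
    proof -
      note th = that
      obtain z where z: "z \<in> pos c" "pos a = {z}" "a = end_vx c z" using end_vx_unique[OF th(2,1)] by blast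
      have "rp a = vx c {z}" using z vx_end end_vx(4)[OF th(2) z(1)] unfolding rp_def by simp
      then show ?thesis using 0[OF th(2), of "{z}"] sym_adt Ps1 Pt_end[OF th(2) z(1)] by simp
    qed
    have W: "x \<in> W" "y \<in> W" using ad_W a by blast+
    have "x \<in> Sv \<or> y \<in> Sv" using ad_col[OF a] pos_card W unfolding Sv_def by blast
    then show ?thesis using *[OF a] *[OF ad_sym[OF a]] sym_adt by blast
  qed
  have "(rp x, rp y) \<in> adt\<^sup>*" if "(x, y) \<in> ad\<^sup>*" for x y
    using that by (induction rule: rtrancl_induct) (use 2 in \<open>auto intro: rtrancl_trans\<close>)
  then have "(rp (fst v), rp (fst w)) \<in> adt\<^sup>*" using conn Wt_D(1) assms by blast
  then show ?thesis using 1[OF assms(1)] sym_adt[OF 1[OF assms(2)]] by (meson rtrancl_trans)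
qed

lemma xt: "xgraph G E lev ea br X tip Wt act adt snd"
proof (rule xgraphI)
  show "act g w \<in> Wt" if "g \<in> carrier G" "w \<in> Wt" for g w using act_Wt that .
  show "act \<one> w = w" if "w \<in> Wt" for w
  proof -
    have "pact \<one> ` snd w = snd w" using Wt_D(2)[OF that] pact_one by force
    then show ?thesis unfolding act_def using wa_one[OF Wt_D(1)[OF that]] by simp
  qed
  show "act (g \<otimes> h) w = act g (act h w)" if "g \<in> carrier G" "h \<in> carrier G" "w \<in> Wt" for g h w
  proof -
    have "pact (g \<otimes> h) ` snd w = pact g ` pact h ` snd w" unfolding image_image
      by (rule image_cong) (use Wt_D(2)[OF that(3)] pact_mult that in auto)
    then show ?thesis unfolding act_def using wa_mult[OF that(1,2) Wt_D(1)[OF that(3)]] by simp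
  qed
  show "x \<in> Wt \<and> y \<in> Wt" if "(x, y) \<in> adt" for x y using that vx_Wt Ps1 Ps2 consec_Pt unfolding adt_def by blast
  show "(y, x) \<in> adt" if "(x, y) \<in> adt" for x y using adt_sym that .
  show "(act g x, act g y) \<in> adt" if "g \<in> carrier G" "(x, y) \<in> adt" for g x y using adt_act that .
  show "snd (act g w) = pact g ` snd w" for g w by (simp add: act_def)
  show "(card (snd x) = 1) \<noteq> (card (snd y) = 1)" if "(x, y) \<in> adt" for x y
  proof -
    have "card (snd (vx c {y})) = 1 \<and> card (snd (vx c Y)) = 2" if "consec c Y" for c y Y using consec_card[OF that] by (simp add: vx_snd)
    then show ?thesis using that unfolding adt_def by fastforce
  qed
  show "\<exists>F. finite F \<and> F \<subseteq> adt \<and> (\<forall>(x, y) \<in> adt. \<exists>g \<in> carrier G. \<exists>(x', y') \<in> F. x = act g x' \<and> y = act g y')"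
  proof -
    define F0 where "F0 = (\<Union>k \<in> K. (\<lambda>(y, Y). (vx k {y}, vx k Y)) ` {(y, Y). consec k Y \<and> y \<in> Y})"
    have KS: "k \<in> K \<Longrightarrow> k \<in> Sv" for k using K(2) by blast
    have "finite {(y, Y). consec k Y \<and> y \<in> Y}" if "k \<in> K" for k
    proof (rule finite_subset)
      show "{(y, Y). consec k Y \<and> y \<in> Y} \<subseteq> PT k \<times> Pow (PT k)" using consec_Pt unfolding PT_def by blast
      show "finite (PT k \<times> Pow (PT k))" using fin_PT[OF KS[OF that]] by simp
    qed
    then have fF: "finite F0" unfolding F0_def using K(1) by simp
    have F0a: "F0 \<subseteq> adt" unfolding F0_def using adt_I KS by auto
    have k: "\<exists>g \<in> carrier G. \<exists>(x', y') \<in> F0. vx c {y} = act g x' \<and> vx c Y = act g y'" if c: "c \<in> Sv" "consec c Y" "y \<in> Y" for c y Y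
    proof -
      obtain g k where g: "g \<in> carrier G" "k \<in> K" "c = wa g k" using K(3) c by blast
      have YX: "Y \<subseteq> X" "y \<in> X" using Ps_X[OF Ps2[OF c(2)]] c(3) by blast+
      define Y' where "Y' = pact (inv g) ` Y"
      have Y: "pact g ` Y' = Y" unfolding Y'_def using pact_inv'[OF g(1)] YX by force
      have Y'X: "Y' \<subseteq> X" unfolding Y'_def using pact_X g YX by auto
      have cs': "consec k Y'" using consec_act_iff[OF g(1) KS[OF g(2)] Y'X] Y c g by simp
      have y': "pact (inv g) y \<in> Y'" "pact g (pact (inv g) y) = y" unfolding Y'_def using c pact_inv' g YX by auto
      have "vx c {y} = act g (vx k {pact (inv g) y})" using vx_act[OF g(1) KS[OF g(2)] Ps1[OF consec_Pt[OF cs' y'(1)]]] y' g by simp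
      moreover have "vx c Y = act g (vx k Y')" using vx_act[OF g(1) KS[OF g(2)] Ps2[OF cs']] Y g by simp
      moreover have "(vx k {pact (inv g) y}, vx k Y') \<in> F0" unfolding F0_def using g cs' y' by force
      ultimately show ?thesis using g(1) by blast
    qed
    have "\<forall>(x, y) \<in> adt. \<exists>g \<in> carrier G. \<exists>(x', y') \<in> F0 \<union> prod.swap ` F0. x = act g x' \<and> y = act g y'"
    proof clarify
      fix v w v' w' assume "((v, w), (v', w')) \<in> adt"
      then consider c y Y where "c \<in> Sv" "consec c Y" "y \<in> Y" "(v, w) = vx c {y}" "(v', w') = vx c Y"
        | c y Y where "c \<in> Sv" "consec c Y" "y \<in> Y" "(v', w') = vx c {y}" "(v, w) = vx c Y" unfolding adt_def by blast
      then show "\<exists>g \<in> carrier G. \<exists>(x', y') \<in> F0 \<union> prod.swap ` F0. (v, w) = act g x' \<and> (v', w') = act g y'"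
      proof cases
        case 1
        then show ?thesis using k[OF 1(1-3)] by auto
      next
        case 2
        obtain g x' y' where "g \<in> carrier G" "(x', y') \<in> F0" "(v', w') = act g x'" "(v, w) = act g y'" using k[OF 2(1-3)] 2 by auto
        moreover then have "(y', x') \<in> prod.swap ` F0" by force
        ultimately show ?thesis by blast
      qed
    qed
    moreover have "F0 \<union> prod.swap ` F0 \<subseteq> adt" using F0a adt_sym by auto
    ultimately show ?thesis using fF by (intro exI[of _ "F0 \<union> prod.swap ` F0"]) blast
  qed
  show "snd w \<subseteq> X" "card (snd w) = 1 \<or> card (snd w) = 2" if "w \<in> Wt" for w using Wt_D that by blast+
  show "snd x \<subseteq> snd y \<or> snd y \<subseteq> snd x" if "(x, y) \<in> adt" for x y using that vx_snd unfolding adt_def by auto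
  show "\<exists>a. (c, a) \<in> adt \<and> snd a = {y}" if c: "c \<in> Wt" "card (snd c) = 2" "y \<in> snd c" for c y
    using c(1)
  proof (cases rule: WtE)
    case (3 d Y)
    then have "(c, vx d {y}) \<in> adt" using adt_sym[OF adt_I[OF 3(1,2), of y]] c(3) vx_cs by simp
    moreover have "snd (vx d {y}) = {y}" by (rule vx_snd)
    ultimately show ?thesis by blast
  qed (use c in auto)
  show "(x, y) \<in> adt\<^sup>*" if "x \<in> Wt" "y \<in> Wt" for x y using adt_conn that .
  obtain w where w: "w \<in> W" using W_ne by blast
  show "Wt \<noteq> {}"
  proof (cases "w \<in> Sv")
    case True
    then obtain s where "s \<in> pos w" unfolding Sv_def by (force simp: card_2_iff)
    then show ?thesis using vx_Wt[OF True Ps1[OF Pt_end[OF True]]] by blast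
  next
    case False
    then show ?thesis using w pos_card[OF w] unfolding Wt_def Sv_def by blast
  qed
qed

interpretation u: xgraph G E lev ea br X tip Wt act adt snd by (rule xt)

lemma p_ad: assumes "w \<in> W" "p w \<noteq> w" shows "(w, p w) \<in> ad"
proof -
  have "(p w, w) \<in> adR (Id_on W)" using parD(4)[OF par assms(1)] assms(2) by (auto simp: Id_on_iff)
  then show ?thesis unfolding adR_def using ad_sym by (auto simp: Id_on_iff)
qed

lemma p_act: assumes "g \<in> carrier G" "w \<in> W" shows "p (wa g w) = wa g (p w)"
  using parD(3)[OF par assms] by (simp add: Id_on_iff)

lemma p_fix_act: assumes "g \<in> carrier G" "w \<in> W" shows "p (wa g w) = wa g w \<longleftrightarrow> p w = w"
proof
  assume "p (wa g w) = wa g w"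
  then have "wa (inv g) (wa g (p w)) = wa (inv g) (wa g w)" using p_act[OF assms] by simp
  then show "p w = w" using wa_inv[OF assms(1)] parD(1)[OF par assms(2)] assms(2) by simp
qed (use p_act[OF assms] in simp)

lemma end_vx_inj: assumes "c \<in> Sv" "s \<in> pos c" "t \<in> pos c" "end_vx c s = end_vx c t" shows "s = t"
proof -
  have "{s} = pos (end_vx c s)" by (rule end_vx(2)[OF assms(1,2), symmetric])
  also have "\<dots> = pos (end_vx c t)" by (rule arg_cong[OF assms(4)])
  also have "\<dots> = {t}" by (rule end_vx(2)[OF assms(1,3)])
  finally show ?thesis by (rule singleton_inject)
qed

lemma se: assumes "c \<in> Sv" shows "se c \<in> pos c" "p c \<noteq> c \<Longrightarrow> p c = end_vx c (se c)"
proof -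
  have 1: "se c \<in> pos c \<and> p c = end_vx c (se c)" if n: "p c \<noteq> c"
  proof -
    obtain y where "y \<in> pos c" "p c = end_vx c y" using end_vx_unique[OF assms p_ad[OF SvD(1)[OF assms] n]] by blast
    then show ?thesis unfolding se_def using n someI[of "\<lambda>s. s \<in> pos c \<and> p c = end_vx c s" y] by simp
  qed
  have "\<exists>s. s \<in> pos c" using assms unfolding Sv_def by (force simp: card_2_iff)
  then have "(SOME s. s \<in> pos c) \<in> pos c" by (rule someI_ex)
  then have "se c \<in> pos c" if "p c = c" unfolding se_def using that by simp
  then show "se c \<in> pos c" using 1 by blast
  show "p c \<noteq> c \<Longrightarrow> p c = end_vx c (se c)" using 1 by blast
qed

lemma ix_na: assumes "c \<in> Sv" "s \<in> pos c" "na c Y Z" shows "ix c s Z = Suc (ix c s Y) \<or> ix c s Y = Suc (ix c s Z)"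
  using assms(3) ix_adj[OF assms(1,2)] unfolding na_def by blast

lemma na_Ps: "na c Y Z \<Longrightarrow> Y \<in> Ps c \<and> Z \<in> Ps c" unfolding na_def using Ps1 Ps2 consec_Pt by blast

lemma height_adj: assumes "c \<in> Sv" "na c Y Z" shows "height c Y \<noteq> height c Z"
proof -
  have "ix c (se c) Z = Suc (ix c (se c) Y) \<or> ix c (se c) Y = Suc (ix c (se c) Z)"
    by (rule ix_na[OF assms(1) se(1)[OF assms(1)] assms(2)])
  then show ?thesis unfolding height_def by (cases "p c = c") auto
qed

lemma lo_unique: assumes "c \<in> Sv" "lo c Y Z" "lo c Y Z'" shows "Z = Z'"
proof -
  have n: "na c Y Z" "na c Y Z'" using assms unfolding lo_def by blast+
  have i: "ix c (se c) Z = Suc (ix c (se c) Y) \<or> ix c (se c) Y = Suc (ix c (se c) Z)"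
    "ix c (se c) Z' = Suc (ix c (se c) Y) \<or> ix c (se c) Y = Suc (ix c (se c) Z')"
    using ix_na[OF assms(1) se(1)[OF assms(1)]] n by blast+
  have h: "height c Z < height c Y" "height c Z' < height c Y" using assms unfolding lo_def by blast+
  have "ix c (se c) Z = ix c (se c) Z'"
  proof (cases "p c = c")
    case True
    then have "\<bar>int (ix c (se c) Z) + 1 - int (card (PT c))\<bar> < \<bar>int (ix c (se c) Y) + 1 - int (card (PT c))\<bar>"
      "\<bar>int (ix c (se c) Z') + 1 - int (card (PT c))\<bar> < \<bar>int (ix c (se c) Y) + 1 - int (card (PT c))\<bar>"
      using h unfolding height_def by simp_all
    then show ?thesis using i by (elim disjE) simp_all
  next
    case False
    then show ?thesis using i h unfolding height_def by auto
  qed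
  then show ?thesis using ix_inj[OF assms(1) se(1)[OF assms(1)]] na_Ps n by blast
qed

text \<open>The distance from the middle can be measured from either end. So heights are equivariant
  although \<open>se\<close> picks an arbitrary end of a strand that is its own parent.\<close>

lemma height_root: assumes "c \<in> Sv" "p c = c" "s \<in> pos c" "Y \<in> Ps c" shows "height c Y = nat \<bar>int (ix c s Y) + 1 - int (card (PT c))\<bar>"
proof (cases "s = se c")
  case False
  obtain t where "pos c = {se c, t}" "se c \<noteq> t" using Sv_ends[OF assms(1) se(1)[OF assms(1)]] by metis
  then have "pos c = {s, se c}" using False assms(3) by auto
  then have "ix c s Y + ix c (se c) Y + 2 = 2 * card (PT c)" using ix_sum[OF assms(1) _ assms(4)] by blast
  then show ?thesis unfolding height_def using assms(2) by simp
qed (simp add: height_def assms)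

lemma height_act: assumes "g \<in> carrier G" "c \<in> Sv" "Y \<in> Ps c" shows "height (wa g c) (pact g ` Y) = height c Y"
proof -
  have cW: "c \<in> W" using SvD assms by blast
  have gs: "pact g (se c) \<in> pos (wa g c)" using pos_wa[OF assms(1) cW] se(1)[OF assms(2)] by simp
  have seX: "se c \<in> X" using se(1) SvD(2) assms by blast
  note i = ix_act[OF assms(1,2) se(1)[OF assms(2)] assms(3)]
  have cd: "card (PT (wa g c)) = card (PT c)"
    unfolding PT_act[OF assms(1,2)] by (rule card_pact[OF assms(1)]) (use Pt_sg in \<open>auto simp: PT_def\<close>)
  show ?thesis
  proof (cases "p c = c")
    case True
    then have "p (wa g c) = wa g c" using p_fix_act assms(1) cW by blast
    then show ?thesis using height_root[OF Sv_act[OF assms(1,2)] _ gs Ps_act[OF assms]] i cd True unfolding height_def by simp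
  next
    case False
    then have n: "p (wa g c) \<noteq> wa g c" using p_fix_act assms(1) cW by blast
    have "p (wa g c) = end_vx (wa g c) (pact g (se c))" using p_act[OF assms(1) cW] se[OF assms(2)] False end_vx_act[OF assms(1,2)] by simp
    then have "se (wa g c) = pact g (se c)" using se[OF Sv_act[OF assms(1,2)]] n end_vx_inj[OF Sv_act[OF assms(1,2)] _ gs] by simp
    then show ?thesis using i False n unfolding height_def by simp
  qed
qed

lemma lo_act: assumes "g \<in> carrier G" "c \<in> Sv" "lo c Y Z" shows "lo (wa g c) (pact g ` Y) (pact g ` Z)"
proof -
  have n: "na c Y Z" "height c Z < height c Y" using assms unfolding lo_def by blast+
  have "na (wa g c) (pact g ` Y) (pact g ` Z)" using n(1) consec_act[OF assms(1,2)] unfolding na_def by auto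
  then show ?thesis unfolding lo_def using n height_act[OF assms(1,2)] na_Ps by simp
qed

lemma lo_act': assumes "g \<in> carrier G" "c \<in> Sv" "Y \<in> Ps c" "lo (wa g c) (pact g ` Y) Z" shows "\<exists>Z'. lo c Y Z'"
proof -
  have "lo (wa (inv g) (wa g c)) (pact (inv g) ` pact g ` Y) (pact (inv g) ` Z)"
    using lo_act[OF _ Sv_act[OF assms(1,2)] assms(4)] assms(1) by simp
  moreover have "pact (inv g) ` pact g ` Y = Y" using pact_inv[OF assms(1)] Ps_X[OF assms(3)] by force
  ultimately show ?thesis using wa_inv[OF assms(1) SvD(1)[OF assms(2)]] by auto
qed

lemma rk0: "rank c s s = 0" unfolding rank_def by (simp add: psubset_eq)

text \<open>A pair containing the end \<open>s\<close> begins at rank 0, so its position is 1, and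
  positions determine pairs. Existence is the predecessor of the other end when no cut point lies
  closer; in general it comes from viewing \<open>s\<close> from \<open>t\<close>.\<close>

lemma first_pair: assumes "c \<in> Sv" "s \<in> pos c" shows "\<exists>!Z. consec c Z \<and> s \<in> Z"
proof -
  obtain t where t: "pos c = {s, t}" "s \<noteq> t" using Sv_ends[OF assms] by metis
  have "t \<in> pos c" using t by blast
  then obtain y where "consec c {y, s}" using pred_ex[OF assms(1) \<open>t \<in> pos c\<close> Pt_end[OF assms] t(2)] by metis
  moreover have "ix c s Z = 1" if Z: "consec c Z" "s \<in> Z" for Z
  proof -
    obtain y y' where y: "Z = {y, y'}" "rank c s y' = Suc (rank c s y)" "ix c s Z = Suc (2 * rank c s y)" using csE[OF assms Z(1)] by metis
    then have "s = y" using Z(2) rk0[of c s] by auto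
    then show ?thesis using y rk0 by simp
  qed
  ultimately show ?thesis using ix_inj[OF assms] Ps2 by (metis insertCI)
qed

definition fp where "fp c s = (THE Z. consec c Z \<and> s \<in> Z)"

lemma fp: assumes "c \<in> Sv" "s \<in> pos c" shows "consec c (fp c s)" "s \<in> fp c s" "consec c Z \<Longrightarrow> s \<in> Z \<Longrightarrow> Z = fp c s"
  using theI'[OF first_pair[OF assms]] first_pair[OF assms] unfolding fp_def by blast+

lemma fp_act: assumes "g \<in> carrier G" "c \<in> Sv" "s \<in> pos c" shows "fp (wa g c) (pact g s) = pact g ` fp c s"
proof -
  have "pact g s \<in> pos (wa g c)" using pos_wa[OF assms(1) SvD(1)[OF assms(2)]] assms by simp
  moreover have "consec (wa g c) (pact g ` fp c s)" "pact g s \<in> pact g ` fp c s" using consec_act[OF assms(1,2)] fp[OF assms(2,3)] by blast+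
  ultimately show ?thesis using fp(3)[OF Sv_act[OF assms(1,2)]] by simp
qed

lemma pt_lo: assumes "c \<in> Sv" "lo c Y Z" shows "pt (c, Y) = vx c Z"
proof -
  have "(THE Z. lo c Y Z) = Z" using lo_unique[OF assms(1)] assms(2) by (intro the_equality) blast+
  then show ?thesis unfolding pt_def using assms by auto
qed

lemma pt_root: assumes "c \<in> Sv" "\<nexists>Z. lo c Y Z" shows "pt (c, Y) = (c, Y)"
  unfolding pt_def fst_conv snd_conv if_not_P[OF assms(2)] using assms(1) by simp

lemma pt_P: assumes "a \<in> W" "card (pos a) = 1"
  shows "p a = a \<Longrightarrow> pt (a, pos a) = (a, pos a)"
    "p a \<noteq> a \<Longrightarrow> \<exists>y \<in> pos (p a). p a \<in> Sv \<and> pos a = {y} \<and> a = end_vx (p a) y \<and> pt (a, pos a) = vx (p a) (fp (p a) y)"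
proof -
  have aS: "a \<notin> Sv" using assms unfolding Sv_def by simp
  show "p a = a \<Longrightarrow> pt (a, pos a) = (a, pos a)" unfolding pt_def using aS by simp
  assume n: "p a \<noteq> a"
  have ad: "(a, p a) \<in> ad" using p_ad assms n by blast
  have pS: "p a \<in> Sv" using ad_col[OF ad] pos_card assms ad_W[OF ad] unfolding Sv_def by auto
  then obtain y where y: "y \<in> pos (p a)" "pos a = {y}" "a = end_vx (p a) y" using end_vx_unique[OF pS ad_sym[OF ad]] by blast
  have "pt (a, pos a) = vx (p a) (fp (p a) y)" unfolding pt_def fp_def using aS n y(2) by simp
  then show "\<exists>y \<in> pos (p a). p a \<in> Sv \<and> pos a = {y} \<and> a = end_vx (p a) y \<and> pt (a, pos a) = vx (p a) (fp (p a) y)" using y pS by blast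
qed

lemma na_adt: assumes "c \<in> Sv" "na c Y Z" shows "(vx c Y, vx c Z) \<in> adt"
  using assms adt_I adt_sym unfolding na_def by blast

lemma Wt_cases:
  assumes "v \<in> Wt"
  obtains a where "v = (a, pos a)" "a \<in> W" "card (pos a) = 1" | c Y where "c \<in> Sv" "Y \<in> Ps c" "v = (c, Y)" "v = vx c Y"
  using assms
proof (cases rule: WtE)
  case (1 a)
  then show ?thesis using that by blast
next
  case (2 c y)
  then show ?thesis using that(2)[of c "{y}"] Ps1 vx_int by simp
next
  case (3 c Y)
  then show ?thesis using that(2)[of c Y] Ps2 vx_cs by simp
qed

lemma par_t: "u.par (Id_on Wt) pt"
proof -
  have st: "pt v = v \<or> (v, pt v) \<in> adt" if "v \<in> Wt" for v
    using that
  proof (cases rule: Wt_cases)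
    case (1 a)
    show ?thesis
    proof (cases "p a = a")
      case False
      then obtain y where y: "y \<in> pos (p a)" "p a \<in> Sv" "pos a = {y}" "a = end_vx (p a) y" "pt v = vx (p a) (fp (p a) y)" using pt_P(2)[OF 1(2,3)] 1(1) by blast
      then have "v = vx (p a) {y}" using vx_end 1 by simp
      then show ?thesis using adt_I[OF y(2) fp(1,2)[OF y(2,1)]] y(5) by simp
    qed (use pt_P(1)[OF 1(2,3)] 1 in simp)
  next
    case (2 c Y)
    show ?thesis
    proof (cases "\<exists>Z. lo c Y Z")
      case True
      then obtain Z where Z: "lo c Y Z" by blast
      then show ?thesis using pt_lo[OF 2(1) Z] na_adt[OF 2(1), of Y Z] 2 unfolding lo_def by simp
    qed (use pt_root 2 in simp)
  qed
  have eq: "pt (act g v) = act g (pt v)" if g: "g \<in> carrier G" and v: "v \<in> Wt" for g v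
    using v
  proof (cases rule: Wt_cases)
    case (1 a)
    have ga: "act g v = (wa g a, pos (wa g a))" "wa g a \<in> W" "card (pos (wa g a)) = 1"
      using 1 pos_wa[OF g] wa_cl[OF g] card_pact[OF g pos_X] by (auto simp: act_def)
    show ?thesis
    proof (cases "p a = a")
      case True
      then show ?thesis using pt_P(1)[OF 1(2,3)] pt_P(1)[OF ga(2,3)] p_fix_act[OF g 1(2)] 1 ga by simp
    next
      case False
      then obtain y where y: "y \<in> pos (p a)" "p a \<in> Sv" "pos a = {y}" "pt v = vx (p a) (fp (p a) y)" using pt_P(2)[OF 1(2,3)] 1(1) by blast
      obtain y' where y': "pos (wa g a) = {y'}" "pt (act g v) = vx (p (wa g a)) (fp (p (wa g a)) y')"
        using pt_P(2)[OF ga(2,3)] p_fix_act[OF g 1(2)] False ga(1) by auto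
      have "y' = pact g y" using y' y(3) pos_wa[OF g 1(2)] by simp
      then have "pt (act g v) = vx (wa g (p a)) (pact g ` fp (p a) y)" using y' p_act[OF g 1(2)] fp_act[OF g y(2,1)] by simp
      then show ?thesis using vx_act[OF g y(2) Ps2[OF fp(1)[OF y(2,1)]]] y(4) by simp
    qed
  next
    case (2 c Y)
    have gv: "act g v = (wa g c, pact g ` Y)" using 2 by (simp add: act_def)
    show ?thesis
    proof (cases "\<exists>Z. lo c Y Z")
      case True
      then obtain Z where Z: "lo c Y Z" by blast
      then have "Z \<in> Ps c" using na_Ps unfolding lo_def by blast
      then show ?thesis using pt_lo[OF 2(1) Z] pt_lo[OF Sv_act[OF g 2(1)] lo_act[OF g 2(1) Z]] vx_act[OF g 2(1)] gv 2(3) by simp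
    next
      case False
      then have "\<nexists>Z. lo (wa g c) (pact g ` Y) Z" using lo_act'[OF g 2(1,2)] by blast
      then show ?thesis using pt_root[OF Sv_act[OF g 2(1)]] pt_root[OF 2(1)] False gv 2 by simp
    qed
  qed
  show ?thesis unfolding u.par_def
  proof (intro conjI ballI)
    show W: "pt v \<in> Wt" if "v \<in> Wt" for v using st[OF that] u.ad_W that by metis
    then show "\<And>vw. vw \<in> Id_on Wt \<Longrightarrow> case vw of (v, w) \<Rightarrow> (pt v, pt w) \<in> Id_on Wt" by auto
    show "(pt (act g v), act g (pt v)) \<in> Id_on Wt" if "g \<in> carrier G" "v \<in> Wt" for g v
      using eq[OF that] act_Wt[OF that(1) W[OF that(2)]] by (metis Id_onI)
    show "(pt v, v) \<in> Id_on Wt \<or> (pt v, v) \<in> u.adR (Id_on Wt)" if "v \<in> Wt" for v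
      using st[OF that] u.ad_adR[OF u.req_Id] adt_sym that by (metis Id_onI)
  qed
qed

text \<open>Adjacent positions on a strand differ in height, and the higher one has the lower one as
  parent unless it is an end of the strand. At an end the parent is prescribed by the old vertex,
  and a free flag there comes from a free flag of the old graph.\<close>

lemma npt:
  assumes "t \<in> u.fflags True (Id_on Wt) pt"
  obtains c y where "c \<in> Sv" "y \<in> pos c" "t = ((end_vx c y, {y}), (c, fp c y))" "(end_vx c y, c) \<in> fflags True (Id_on W) p"
proof -
  obtain v w where vw: "t = (v, w)" "(v, w) \<in> adt" "card (snd v) = 1" "(pt v, w) \<notin> Id_on Wt" "(pt w, v) \<notin> Id_on Wt"
    using assms unfolding u.fflags_def by auto
  have VW: "v \<in> Wt" "w \<in> Wt" using u.ad_W vw by blast+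
  have ne: "pt v \<noteq> w" "pt w \<noteq> v" using vw VW by auto
  obtain c y Y where c: "c \<in> Sv" "consec c Y" "y \<in> Y" "v = vx c {y}" "w = vx c Y"
  proof -
    have "\<exists>c y Y. c \<in> Sv \<and> consec c Y \<and> y \<in> Y \<and> v = vx c {y} \<and> w = vx c Y \<or> c \<in> Sv \<and> consec c Y \<and> v = vx c Y" using vw(2) unfolding adt_def by blast
    moreover have "v \<noteq> vx c Y" if "consec c Y" for c Y using vw(3) consec_card[OF that] vx_snd[of c Y] by auto
    ultimately show ?thesis using that by blast
  qed
  have w: "w = (c, Y)" using c vx_cs by simp
  have na: "na c {y} Y" "na c Y {y}" unfolding na_def using c by blast+
  have "\<not> lo c Y {y}" using pt_lo[OF c(1), of Y "{y}"] ne w c(4) by auto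
  then have lt: "height c Y < height c {y}" using height_adj[OF c(1) na(1)] na unfolding lo_def by auto
  then have lo: "lo c {y} Y" unfolding lo_def using na by blast
  have yp: "y \<in> pos c"
  proof (rule ccontr)
    assume "y \<notin> pos c"
    then show False using vx_int pt_lo[OF c(1) lo] ne c by simp
  qed
  have v: "v = (end_vx c y, {y})" using c vx_end yp by simp
  have Y: "Y = fp c y" using fp(3)[OF c(1) yp] c by blast
  have a: "(c, end_vx c y) \<in> ad" "pos (end_vx c y) = {y}" "end_vx c y \<in> W" using end_vx[OF c(1) yp] by blast+
  have "p (end_vx c y) \<noteq> c"
  proof
    assume pc: "p (end_vx c y) = c"
    then have "p (end_vx c y) \<noteq> end_vx c y" using end_vx(4)[OF c(1) yp] c(1) by auto
    then obtain z where "pos (end_vx c y) = {z}" "pt (end_vx c y, pos (end_vx c y)) = vx c (fp c z)" using pt_P(2)[of "end_vx c y"] a pc by auto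
    then show False using ne v w Y a c by simp
  qed
  moreover have "p c \<noteq> end_vx c y"
  proof
    assume pc: "p c = end_vx c y"
    then have pn: "p c \<noteq> c" using end_vx(4)[OF c(1) yp] c(1) by auto
    then have "se c = y" using se[OF c(1)] pc end_vx_inj[OF c(1) _ yp] by simp
    then have "height c {y} = 0" unfolding height_def using pn rk0 by (simp add: ix_point)
    then show False using lt by simp
  qed
  ultimately have "(end_vx c y, c) \<in> fflags True (Id_on W) p" unfolding fflags_def using a ad_sym by auto
  then show ?thesis using that[OF c(1) yp] vw(1) v w Y by simp
qed

text \<open>A flag of the subdivided graph goes to the old edge on which it starts. The stabilisers
  agree, because an element that fixes a strand and the vertex at one of its ends also fixes the
  first pair.\<close>

lemma flag_mset_sub: "mset_le stab_less (u.flag_mset True (Id_on Wt) pt) (flag_mset True (Id_on W) p)"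
  unfolding flag_mset_def u.flag_mset_def
proof (rule qmset_dom[OF u.fflags_equiv[OF u.req_Id] u.fin_quot[OF u.req_Id u.fflags_ad] fflags_equiv[OF req_Id] fin_quot[OF req_Id fflags_ad],
      where f = "\<lambda>t. (fst (fst t), fst (snd t))"])
  show "lab (Id_on W) b = lab (Id_on W) b'" if "(b, b') \<in> flag_rel (Id_on W)" for b b' using lab_TH[OF req_Id that] .
  show "(fst (fst t), fst (snd t)) \<in> fflags True (Id_on W) p" if t: "t \<in> u.fflags True (Id_on Wt) pt" for t
  proof -
    from npt[OF t] obtain c y where "t = ((end_vx c y, {y}), (c, fp c y))" "(end_vx c y, c) \<in> fflags True (Id_on W) p" by metis
    then show ?thesis by simp
  qed
  show "u.lab (Id_on Wt) t = lab (Id_on W) (fst (fst t), fst (snd t)) \<or> (u.lab (Id_on Wt) t, lab (Id_on W) (fst (fst t), fst (snd t))) \<in> stab_less"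
    if t: "t \<in> u.fflags True (Id_on Wt) pt" for t
  proof -
    obtain c y where c: "c \<in> Sv" "y \<in> pos c" "t = ((end_vx c y, {y}), (c, fp c y))" "(end_vx c y, c) \<in> fflags True (Id_on W) p" by (rule npt[OF t])
    have cW: "c \<in> W" "end_vx c y \<in> W" using SvD(1)[OF c(1)] end_vx(3)[OF c(1,2)] .
    have tW: "(end_vx c y, {y}) \<in> Wt" "(c, fp c y) \<in> Wt" using t c(3) u.fflags_ad u.ad_W by blast+
    have "u.flag_stab (Id_on Wt) t = flag_stab (Id_on W) (end_vx c y, c)"
    proof (intro equalityI subsetI)
      fix g assume "g \<in> u.flag_stab (Id_on Wt) t"
      then show "g \<in> flag_stab (Id_on W) (end_vx c y, c)" unfolding u.flag_stab_def u.st_def flag_stab_def st_def c(3) act_def using cW by (simp add: Id_on_iff)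
    next
      fix g assume "g \<in> flag_stab (Id_on W) (end_vx c y, c)"
      then have g: "g \<in> carrier G" "wa g (end_vx c y) = end_vx c y" "wa g c = c" unfolding flag_stab_def st_def by auto
      have "{pact g y} = {y}" using pos_wa[OF g(1) cW(2)] g(2) end_vx(2)[OF c(1,2)] by simp
      then have gy: "pact g y = y" by simp
      then have "pact g ` fp c y = fp c y" using fp_act[OF g(1) c(1,2)] g(3) by simp
      then show "g \<in> u.flag_stab (Id_on Wt) t" unfolding u.flag_stab_def u.st_def c(3) act_def using g gy tW by (simp add: Id_on_iff)
    qed
    then show ?thesis unfolding u.lab_def lab_def c(3) by simp
  qed
  show "(u.lab (Id_on Wt) t, lab (Id_on W) (fst (fst t), fst (snd t))) \<in> stab_less"
    if t: "t \<in> u.fflags True (Id_on Wt) pt" "s \<in> u.fflags True (Id_on Wt) pt" and n: "(t, s) \<notin> u.flag_rel (Id_on Wt)"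
      and f: "((fst (fst t), fst (snd t)), (fst (fst s), fst (snd s))) \<in> flag_rel (Id_on W)" for t s
  proof -
    obtain c y where c: "c \<in> Sv" "y \<in> pos c" "t = ((end_vx c y, {y}), (c, fp c y))" by (rule npt[OF t(1)])
    obtain d z where d: "d \<in> Sv" "z \<in> pos d" "s = ((end_vx d z, {z}), (d, fp d z))" by (rule npt[OF t(2)])
    obtain g where g: "g \<in> carrier G" "wa g (end_vx c y) = end_vx d z" "wa g c = d" using f c d unfolding flag_rel_def by auto
    have "{pact g y} = {z}" using pos_wa[OF g(1) end_vx(3)[OF c(1,2)]] g(2) end_vx(2)[OF c(1,2)] end_vx(2)[OF d(1,2)] by simp
    then have gy: "pact g y = z" by simp
    then have "pact g ` fp c y = fp d z" using fp_act[OF g(1) c(1,2)] g(3) by simp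
    then have a: "act g (end_vx c y, {y}) = (end_vx d z, {z})" "act g (c, fp c y) = (d, fp d z)" unfolding act_def using g gy by simp_all
    have W: "(end_vx c y, {y}) \<in> Wt" "(c, fp c y) \<in> Wt" "(end_vx d z, {z}) \<in> Wt" "(d, fp d z) \<in> Wt"
      using t c(3) d(3) u.fflags_ad u.ad_W by blast+
    have "(t, s) \<in> u.flag_rel (Id_on Wt)" unfolding c(3) d(3)
      by (rule u.THI[OF u.req_Id W(1,2) g(1)]) (use a W in \<open>simp_all add: Id_on_iff\<close>)
    then show ?thesis using n by blast
  qed
qed

end

section \<open>Tips of arcs, and strands across every arc\<close>

context protree begin

lemma tip_br: assumes "e \<in> E" shows "e \<notin> tip (br e)" "br e \<notin> tip e"
proof -
  show "e \<notin> tip (br e)" using X_br[OF tip_X[OF br_cl[OF assms]] assms] tip_in[OF br_cl[OF assms]] by blast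
  show "br e \<notin> tip e" using X_br[OF tip_X[OF assms] assms] tip_in[OF assms] by blast
qed

text \<open>Suppose an arc points to \<open>p\<close> and \<open>q\<close> but not to
  \<open>tip e\<close>. If it points to the other tip, its reverse has the half-space of
  \<open>e\<close>, against its value at \<open>q\<close>; if not, it crosses
  \<open>e\<close>.\<close>

lemma tip_seg: assumes "e \<in> E" "p \<in> X" "q \<in> X" "e \<notin> p" "e \<in> q" shows "tip e \<in> seg p q"
proof -
  note t = tip_X[OF assms(1)] tip_X[OF br_cl[OF assms(1)]]
  have "f \<in> tip e" if f: "f \<in> p" "f \<in> q" for f
  proof (rule ccontr)
    assume n: "f \<notin> tip e"
    have fE: "f \<in> E" using f X_subD assms by blast
    show False
    proof (cases "f \<in> tip (br e)")
      case True
      then have b: "br f \<in> tip e" "br f \<notin> tip (br e)" using X_br[OF t(1) fE] X_br[OF t(2) fE] n by blast+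
      have "br f \<in> q" using tip_half[OF assms(1) b assms(3)] assms(5) by blast
      then show False using X_br[OF assms(3) fE] f by blast
    next
      case False
      then show False using quad[of e f "tip (br e)" "tip e" p q] assms t fE f n tip_in tip_br by simp
    qed
  qed
  then show ?thesis using seg_mem_br[OF assms(2,3) t(1)] by blast
qed

lemma tip_between1: assumes "e \<in> E" "x \<in> seg (tip (br e)) (tip e)" "e \<in> x" shows "x = tip e"
proof -
  have "f \<in> x" if f: "f \<in> tip e" for f
  proof (cases "f \<in> tip (br e)")
    case True
    then show ?thesis using assms(2) f unfolding seg_def by blast
  next
    case False
    then show ?thesis using tip_half[OF assms(1) f False seg_X[OF assms(2)]] assms(3) by blast
  qed
  then show ?thesis using X_eqI[OF tip_X[OF assms(1)] seg_X[OF assms(2)]] by blast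
qed

text \<open>All arcs that separate the two tips have the half-space of \<open>e\<close> or its
  complement, so the value at \<open>e\<close> determines a point between the tips.\<close>

lemma tip_between: assumes "e \<in> E" "x \<in> seg (tip (br e)) (tip e)" shows "x = tip (br e) \<or> x = tip e"
proof (cases "e \<in> x")
  case False
  then have "br e \<in> x" using X_br[OF seg_X[OF assms(2)] assms(1)] by blast
  moreover have "x \<in> seg (tip (br (br e))) (tip (br e))" using assms seg_sym br_br by simp
  ultimately show ?thesis using tip_between1[OF br_cl[OF assms(1)]] by blast
qed (use tip_between1 assms in blast)

lemma tip_other: assumes "e \<in> E" "f \<in> E" "lev f = lev e" "f \<noteq> e" "f \<noteq> br e" shows "f \<in> tip e \<longleftrightarrow> f \<in> tip (br e)"
proof
  assume "f \<in> tip e"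
  then show "f \<in> tip (br e)" using tip_lev[OF assms(1) _ _ assms(3)] assms(4) by blast
next
  assume "f \<in> tip (br e)"
  then show "f \<in> tip e" using tip_lev[OF br_cl[OF assms(1)], of f] br_br[OF assms(1)] lev_br[OF assms(1)] assms(3,5) by auto
qed

text \<open>If no translate of \<open>e\<close> points towards \<open>y\<close>, then \<open>e\<close> would be compressible.\<close>

lemma not_avoid:
  assumes e: "e \<in> E" and y: "y \<in> X" and av: "\<And>g. g \<in> carrier G \<Longrightarrow> ea g e \<notin> y"
  shows False
proof -
  define D where "D = {f. (\<exists>g \<in> carrier G. f = ea g e) \<and> f \<in> tip e}"
  have DE: "f \<in> E \<and> lev f = lev e \<and> f \<notin> y \<and> f \<in> tip e" if "f \<in> D" for f
    using that ea_cl lev_ea e av unfolding D_def by auto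
  have "D \<subseteq> {f \<in> tip e - y. lev f = lev e}" using DE by blast
  then have fin: "finite D" using fin_D[OF y tip_X[OF e]] finite_subset by blast
  have "e = ea \<one> e" using ea_one[OF e] by simp
  then have "e \<in> D" using tip_in[OF e] unfolding D_def by blast
  moreover have tot: "beyond f h \<or> beyond h f" if "f \<in> D" "h \<in> D" for f h
    using beyond_total[of f h y "tip e"] DE that y tip_X e by blast
  \<comment> \<open>The translate that is passed first on the way from \<open>y\<close> to
    \<open>tip e\<close>.\<close>
  ultimately obtain f where f: "f \<in> D" "\<And>h. h \<in> D \<Longrightarrow> beyond f h" using beyond_min[OF fin] by blast
  note fE = DE[OF f(1)]
  have tf: "tip f \<in> X" "tip (br f) \<in> X" "f \<in> tip f" "f \<notin> tip (br f)" using tip_X tip_in tip_br br_cl fE by blast+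
  have avf: "ea g f \<notin> y" if "g \<in> carrier G" for g
    using that f(1) av e unfolding D_def by (auto simp: ea_mult[symmetric])
  obtain k where k: "k \<in> carrier G" "f = ea k e" using f(1) unfolding D_def by blast
  \<comment> \<open>An element that fixes the head of \<open>f\<close> in the tree of this level
    fixes \<open>f\<close>. Otherwise \<open>f\<close> and its image point to each other's heads and
    tails, which prevents nesting; but both avoid \<open>y\<close>, so they are nested.\<close>
  have fixg: "ea g f = f" if g: "g \<in> carrier G" and s: "\<forall>h \<in> E. lev h = lev f \<longrightarrow> (h \<in> ea g ` tip f \<longleftrightarrow> h \<in> tip f)" for g
  proof (rule ccontr)
    assume ne: "ea g f \<noteq> f"
    define f' where "f' = ea g f"
    have f': "f' \<in> E" "lev f' = lev f" "f' \<notin> y" "f' \<noteq> f" using ea_cl lev_ea g fE avf ne unfolding f'_def by auto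
    have t': "tip f' = ea g ` tip f" using tip_act[OF g] fE unfolding f'_def by blast
    have i: "f' \<in> tip f" "f \<in> tip f'" using s f' fE tf tip_in[OF f'(1)] t' by auto
    have i2: "f' \<in> tip (br f)" using tip_lev[of f f'] f' fE i by blast
    have i3: "f \<in> tip (br f')" using tip_lev[of f' f] f' fE i by metis
    have "beyond f f' \<or> beyond f' f" using beyond_total[of f f' y "tip f"] f' fE tf i y by blast
    then show False
    proof
      assume "beyond f f'"
      then show False using i2 tf unfolding beyond_def by blast
    next
      assume "beyond f' f"
      then show False using i3 tip_br[OF f'(1)] tip_X[OF br_cl[OF f'(1)]] unfolding beyond_def by blast
    qed
  qed
  \<comment> \<open>By reducedness the head and the tail of \<open>f\<close> are in one orbit at
    this level. The translate of \<open>f\<close> whose head is at the tail of \<open>f\<close> then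
    comes before \<open>f\<close>.\<close>
  obtain g where g: "g \<in> carrier G" "\<forall>h \<in> E. lev h = lev f \<longrightarrow> (h \<in> ea g ` tip f \<longleftrightarrow> h \<in> tip (br f))"
    using reduced[of f] fixg fE by blast
  define f' where "f' = ea g f"
  have f': "f' \<in> E" "lev f' = lev f" "f' \<notin> y" using ea_cl lev_ea g fE avf unfolding f'_def by auto
  have "f' \<in> ea g ` tip f" unfolding f'_def using tf by blast
  then have i: "f' \<in> tip (br f)" using g f' by blast
  then have ne: "f' \<noteq> f" using tf by blast
  have "f' \<noteq> br f" using no_inv g fE unfolding f'_def by blast
  then have i2: "f' \<in> tip f" using tip_other[of f f'] f' fE ne i by blast
  have nle: "\<not> beyond f f'" using i tf unfolding beyond_def by blast
  then have le: "beyond f' f" using beyond_total[of f f' y "tip f"] f' fE tf i2 y by blast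
  have "f' \<in> tip e" using le fE tip_X e unfolding beyond_def by blast
  moreover have "f' = ea (g \<otimes> k) e" unfolding f'_def using ea_mult g k e by simp
  ultimately have "f' \<in> D" unfolding D_def using g k by blast
  then show False using f(2) nle by blast
qed

end

context xgraph begin

text \<open>If no strand crossed a translate of \<open>e\<close>, the connected graph would lie on
  one side of each translate, and by equivariance on corresponding sides. Then no translate of
  \<open>e\<close>, or none of \<open>br e\<close>, points towards the graph, against
  \<open>not_avoid\<close>.\<close>

lemma crossed: assumes "e \<in> E" shows "Oe e \<noteq> {}"
proof
  assume n: "Oe e = {}"
  have n': "Oe (ea g e) = {}" if g: "g \<in> carrier G" for g
  proof (rule ccontr)
    assume "Oe (ea g e) \<noteq> {}"
    then obtain c where c: "c \<in> Oe (ea g e)" by blast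
    then have "c \<in> Sv" unfolding Oe_def by blast
    then have "wa (inv g) c \<in> Oe (ea (inv g) (ea g e))" using Oe_act[of "inv g" c "ea g e"] g assms ea_cl c by simp
    then show False using n ea_inv[OF g assms] by simp
  qed
  obtain w where w: "w \<in> W" using W_ne by blast
  obtain y where y: "y \<in> pos w" using pos_card[OF w] by (metis card.empty ex_in_conv zero_neq_numeral zero_neq_one)
  have con: "f \<in> x \<longleftrightarrow> f \<in> y" if f: "Oe f = {}" and v: "v \<in> W" "x \<in> pos v" for f v x
  proof -
    have one: "f \<in> x \<longleftrightarrow> f \<in> z" if "x \<in> pos v" "z \<in> pos v" "v \<in> W" for v x z
    proof (cases "card (pos v) = 1")
      case True
      then show ?thesis using that by (auto simp: card_1_singleton_iff)
    next
      case False
      then have "v \<in> Sv" using pos_card[OF that(3)] that unfolding Sv_def by blast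
      then show ?thesis using f that unfolding Oe_def by blast
    qed
    have "(w, v) \<in> ad\<^sup>*" using conn w v by blast
    then show ?thesis using v(2)
    proof (induction arbitrary: x rule: rtrancl_induct)
      case base
      then show ?case using one y w by blast
    next
      case (step u v)
      have W: "u \<in> W" "v \<in> W" using ad_W step by blast+
      have "pos u \<noteq> {}" "pos v \<noteq> {}" using pos_card W by (metis card.empty zero_neq_numeral zero_neq_one)+
      then obtain z where "z \<in> pos u" "z \<in> pos v" using ad_pos[OF step(2)] by blast
      then show ?case using step one[of x v z] W by blast
    qed
  qed
  have yX: "y \<in> X" using y w pos_X by blast
  have tr: "ea g f \<in> y \<longleftrightarrow> f \<in> y" if g: "g \<in> carrier G" and f: "f \<in> E" "Oe (ea g f) = {}" for g f
  proof -
    have "pact g y \<in> pos (wa g w)" using pos_wa[OF g w] y by blast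
    then have "ea g f \<in> pact g y \<longleftrightarrow> ea g f \<in> y" using con[OF f(2)] wa_cl g w by blast
    then show ?thesis using mem_pact[OF g yX f(1)] by blast
  qed
  have trb: "Oe (br f) = Oe f" if "f \<in> E" for f
  proof -
    have "br f \<in> x \<longleftrightarrow> f \<notin> x" if "x \<in> pos c" "c \<in> Sv" for x c using X_br[OF _ \<open>f \<in> E\<close>] SvD(2)[OF that(2)] that(1) by blast
    then show ?thesis unfolding Oe_def by blast
  qed
  show False
  proof (cases "e \<in> y")
    case False
    then show False using not_avoid[OF assms yX] tr[OF _ assms n'] by blast
  next
    case True
    then have "br e \<notin> y" using X_br[OF yX assms] by blast
    moreover have "ea g (br e) \<in> y \<longleftrightarrow> br e \<in> y" if "g \<in> carrier G" for g
      by (rule tr[OF that br_cl[OF assms]]) (use ea_br[OF that assms] trb[OF ea_cl[OF that assms]] n'[OF that] in simp)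
    ultimately show False using not_avoid[OF br_cl[OF assms] yX] by blast
  qed
qed

end

context kneser begin

text \<open>By \<open>Pt_share\<close> the members of both pairs are cut points of both strands, and
  consecutive pairs on either side of the same arc leave no room for a difference.\<close>

lemma same_pair:
  assumes k: "share_K c c'" and Y: "consec c Y" "consec c' Z" and y: "y0 \<in> Y" "y1 \<in> Y" "e \<notin> y0" "e \<in> y1"
    and z: "z0 \<in> Z" "z1 \<in> Z" "e \<notin> z0" "e \<in> z1"
  shows "y0 = z0" "y1 = z1"
proof -
  have S: "c \<in> Sv" "c' \<in> Sv" using share_K_Sv k by blast+
  have O: "d \<in> Oe e" if d: "d \<in> Sv" "Pt d u" "Pt d v" "e \<notin> u" "e \<in> v" for d u v
  proof -
    obtain r where "r \<in> pos d" using d(1) unfolding Sv_def by (force simp: card_2_iff)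
    then obtain t where t: "pos d = {r, t}" "r \<in> X" "t \<in> X" using Sv_ends[OF d(1)] by metis
    have "u \<in> seg r t" "v \<in> seg r t" using Pt_seg[OF d(1) t(1)] d by blast+
    then have "(e \<notin> r \<or> e \<notin> t) \<and> (e \<in> r \<or> e \<in> t)" using d unfolding seg_def by blast
    then show ?thesis unfolding Oe_def using d(1) by (auto simp: t(1))
  qed
  have Y': "Y = {y0, y1}" using Y(1) y unfolding consec_def by auto
  have Z': "Z = {z0, z1}" using Y(2) z unfolding consec_def by auto
  have coY: "x = y0 \<or> x = y1" if "Pt c x" "x \<in> seg y0 y1" for x
    using Y(1) that seg_sym[of y0 y1] unfolding consec_def Y' by (auto simp: doubleton_eq_iff)
  have coZ: "x = z0 \<or> x = z1" if "Pt c' x" "x \<in> seg z0 z1" for x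
    using Y(2) that seg_sym[of z0 z1] unfolding consec_def Z' by (auto simp: doubleton_eq_iff)
  have PY: "Pt c y0" "Pt c y1" "Pt c' z0" "Pt c' z1" using consec_Pt Y y z by blast+
  have Oc: "c \<in> Oe e" "c' \<in> Oe e" using O S PY y z by blast+
  have PZ: "Pt c z0" "Pt c z1" using Pt_share[OF share_K_sym[OF k] Oc(2,1) PY(3,4) z(3,4) coZ] by blast+
  have PY': "Pt c' y0" "Pt c' y1" using Pt_share[OF k Oc PY(1,2) y(3,4) coY] by blast+
  obtain s t where s: "pos c = {s, t}" "s \<in> X" "t \<in> X" "e \<notin> s" "e \<in> t" using Oe_ends[OF Oc(1)] by metis
  note sg = Pt_seg[OF S(1) s(1)]
  have lin: "u - s \<subseteq> v - s" if "Pt c u" "Pt c v" "e \<notin> u" "e \<in> v" for u v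
    using seg_linear[OF s(2,3) sg[OF that(1)] sg[OF that(2)]] that s(4) by blast
  have bet: "x \<in> seg u v" if "Pt c u" "Pt c v" "Pt c x" "u - s \<subseteq> x - s" "x - s \<subseteq> v - s" for u v x
    using seg_between[OF s(2,3) sg[OF that(1)] sg[OF that(2)] sg[OF that(3)]] that by blast
  have lin2: "u - s \<subseteq> v - s \<or> v - s \<subseteq> u - s" if "Pt c u" "Pt c v" for u v
    using seg_linear[OF s(2,3) sg[OF that(1)] sg[OF that(2)]] .
  show "y0 = z0"
  proof (cases "y0 - s \<subseteq> z0 - s")
    case True
    then have "z0 \<in> seg y0 y1" using bet PY PZ lin y z by blast
    then show ?thesis using coY PZ y z by blast
  next
    case False
    then have "y0 \<in> seg z0 z1" using bet PY PZ lin lin2 y z by blast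
    then show ?thesis using coZ PY' y z by blast
  qed
  show "y1 = z1"
  proof (cases "y1 - s \<subseteq> z1 - s")
    case True
    then have "y1 \<in> seg z0 z1" using bet PY PZ lin y z by blast
    then show ?thesis using coZ PY' y z by blast
  next
    case False
    then have "z1 \<in> seg y0 y1" using bet PY PZ lin lin2 y z by blast
    then show ?thesis using coY PZ y z by blast
  qed
qed

end

section \<open>Walks along a finite set of strands\<close>

context subdiv begin

interpretation u: xgraph G E lev ea br X tip Wt act adt snd by (rule xt)

text \<open>Steps are confined to strands of \<open>K\<close>: any two of these share the translate
  \<open>K\<close> itself, which is what \<open>same_pair\<close> asks for.\<close>

definition kstep where "kstep v c Y v' \<longleftrightarrow> c \<in> K \<and> (\<exists>y y'. consec c Y \<and> Y = {y, y'} \<and> y \<noteq> y' \<and> v = vx c {y} \<and> v' = vx c {y'})"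

inductive kw where
  kw0: "v \<in> Wt \<Longrightarrow> kw v 0 v"
| kwS: "kstep v c Y w \<Longrightarrow> kw w n v' \<Longrightarrow> kw v (Suc n) v'"

lemma K_S: "c \<in> K \<Longrightarrow> c \<in> Sv" using K(2) by blast

lemma kstep_D: assumes "kstep v c Y w" shows "v \<in> Wt" "w \<in> Wt" "kstep w c Y v"
  using assms vx_Wt K_S Ps1 consec_Pt unfolding kstep_def by blast+

lemma kw_app: "kw v m w \<Longrightarrow> kw w n x \<Longrightarrow> kw v (m + n) x"
  by (induction rule: kw.induct) (auto intro: kw.intros)

lemma kw_rev: "kw v n w \<Longrightarrow> kw w n v"
proof (induction rule: kw.induct)
  case (kwS v c Y w n v')
  have "kw w (Suc 0) v" using kw.kwS[OF kstep_D(3)[OF kwS(1)] kw0] kstep_D(1)[OF kwS(1)] .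
  then show ?case using kw_app[OF kwS.IH] by fastforce
qed (auto intro: kw.intros)

text \<open>A discrete intermediate value argument that finds the first step leaving the half-space
  of \<open>e\<close>.\<close>

lemma kw_cross:
  assumes "kw v n x" "snd v = {y}" "snd x = {z}" "e \<in> y" "e \<notin> z"
  shows "\<exists>n1 n2 w c Y w' a b. kw v n1 w \<and> kstep w c Y w' \<and> kw w' n2 x \<and> n = Suc (n1 + n2) \<and> snd w = {a} \<and> snd w' = {b} \<and> e \<in> a \<and> e \<notin> b"
  using assms
proof (induction arbitrary: y rule: kw.induct)
  case (kwS v c Y w n x)
  obtain a b where ab: "snd v = {a}" "snd w = {b}" using kwS(1) vx_snd unfolding kstep_def by metis
  show ?case
  proof (cases "e \<in> b")
    case True
    then obtain n1 n2 w1 c1 Y1 w1' a1 b1 where *: "kw w n1 w1" "kstep w1 c1 Y1 w1'" "kw w1' n2 x" "n = Suc (n1 + n2)"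
      "snd w1 = {a1}" "snd w1' = {b1}" "e \<in> a1" "e \<notin> b1" using kwS.IH[OF ab(2) kwS.prems(2) True kwS.prems(4)] by (elim exE conjE) (rule that; assumption)
    have "kw v (Suc n1) w1" using kw.kwS[OF kwS(1) *(1)] .
    then show ?thesis using * by (metis add_Suc)
  next
    case False
    have "kw v 0 v" using kw0 kstep_D(1)[OF kwS(1)] .
    then show ?thesis using kwS ab False by (metis add_0 singleton_inject)
  qed
qed simp

text \<open>An arc \<open>e\<close> that separates the first two positions has to be crossed back
  later, and by \<open>same_pair\<close> this happens over the same two points as the first step.
  The parts between and after these steps are shorter walks that return to their position. Immersion
  carries the first equivalence across the common pair.\<close>

lemma kwalk:
  assumes R: "u.req R" and im: "u.immersed R" and w: "kw v n v'" "snd v = snd v'"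
  shows "(v, v') \<in> R"
  using w
proof (induction n arbitrary: v v' rule: less_induct)
  case (less n)
  from less.prems(1) show ?case
  proof (cases rule: kw.cases)
    case kw0
    then show ?thesis using u.reqD(1)[OF R] by simp
  next
    case (kwS c Y v1 m)
    obtain y0 y1 where y: "c \<in> K" "consec c Y" "Y = {y0, y1}" "y0 \<noteq> y1" "v = vx c {y0}" "v1 = vx c {y1}" using kwS(2) unfolding kstep_def by blast
    have Xy: "y0 \<in> X" "y1 \<in> X" using consec_Pt[OF y(2)] y(3) Pt_sg by blast+
    obtain e where e: "e \<in> y1" "e \<notin> y0" using X_diff[OF Xy y(4)] by metis
    have s1: "snd v1 = {y1}" "snd v' = {y0}" using y vx_snd less.prems(2) by auto
    obtain n1 n2 w c' Z w' a b where k: "kw v1 n1 w" "kstep w c' Z w'" "kw w' n2 v'" "m = Suc (n1 + n2)" "snd w = {a}" "snd w' = {b}" "e \<in> a" "e \<notin> b"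
      using kw_cross[OF kwS(3) s1 e] by (elim exE conjE) (rule that; assumption)
    obtain z1 z0 where z: "c' \<in> K" "consec c' Z" "Z = {z1, z0}" "w = vx c' {z1}" "w' = vx c' {z0}" using k(2) unfolding kstep_def by blast
    have ab: "a = z1" "b = z0" using k(5,6) z vx_snd by auto
    have "share_K c c'" unfolding share_K_def using y(1) z(1) wa_one K_S SvD(1) by (metis imageI one_closed)
    then have eq: "y0 = z0" "y1 = z1" using same_pair[OF _ y(2) z(2), of y0 y1 e z0 z1] y(3) z(3) e k(7,8) ab by auto
    have YZ: "Z = Y" using eq y z by blast
    have 1: "(v1, w) \<in> R" by (rule less.IH[OF _ k(1)]) (use k kwS s1 ab eq in auto)
    have a1: "(v1, vx c Y) \<in> adt" "(w, vx c' Z) \<in> adt" "(vx c Y, v) \<in> adt" "(vx c' Z, w') \<in> adt"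
      using adt_I[OF K_S[OF y(1)] y(2)] adt_I[OF K_S[OF z(1)] z(2)] adt_sym y z by auto
    have "(vx c Y, vx c' Z) \<in> R" by (rule u.immD[OF im a1(1,2) 1]) (use YZ vx_snd in simp)
    then have 2: "(v, w') \<in> R" by (rule u.immD[OF im a1(3,4)]) (use y z eq vx_snd in simp)
    have "(w', v') \<in> R" by (rule less.IH[OF _ k(3)]) (use k kwS s1 ab eq in auto)
    then show ?thesis using 2 u.reqD(3)[OF R] by metis
  qed
qed

lemma kw_c: assumes "c \<in> K" "Pt c y" "Pt c z" shows "\<exists>n. kw (vx c {y}) n (vx c {z})"
proof -
  note cS = K_S[OF assms(1)]
  obtain s where s: "s \<in> pos c" using cS unfolding Sv_def by (force simp: card_2_iff)
  have *: "\<exists>n. kw (vx c {y}) n (vx c {s})" if "Pt c y" for y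
    using that
  proof (induction "rank c s y" arbitrary: y rule: less_induct)
    case less
    show ?case
    proof (cases "y = s")
      case True
      then show ?thesis using kw0 vx_Wt[OF cS Ps1[OF less(2)]] by blast
    next
      case False
      obtain y' where y': "Pt c y'" "consec c {y', y}" "rank c s y = Suc (rank c s y')" using pred_ex[OF cS s less(2) False] .
      then obtain n where "kw (vx c {y'}) n (vx c {s})" using less by force
      moreover have "y \<noteq> y'" using y'(3) by auto
      then have "kstep (vx c {y}) c {y', y} (vx c {y'})" unfolding kstep_def using assms(1) y' by blast
      ultimately show ?thesis using kwS by blast
    qed
  qed
  then show ?thesis using assms kw_rev kw_app by metis
qed

lemma kw_conn:
  assumes V: "\<And>c. c \<in> V \<Longrightarrow> c \<in> Sv \<Longrightarrow> c \<in> K" and w: "(c, c') \<in> (ad \<inter> V \<times> V)\<^sup>*" and c: "c \<in> K" "c' \<in> Sv" "Pt c y" "Pt c' y'"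
  shows "\<exists>n. kw (vx c {y}) n (vx c' {y'})"
proof -
  have "(x \<in> Sv \<longrightarrow> (\<forall>z. Pt x z \<longrightarrow> (\<exists>n. kw (vx c {y}) n (vx x {z})))) \<and> (x \<in> W \<longrightarrow> x \<notin> Sv \<longrightarrow> (\<exists>n. kw (vx c {y}) n (x, pos x)))"
    if "(c, x) \<in> (ad \<inter> V \<times> V)\<^sup>*" for x
    using that
  proof (induction rule: rtrancl_induct)
    case base
    then show ?case using kw_c[OF c(1,3)] K_S[OF c(1)] by blast
  next
    case (step a b)
    have ab: "(a, b) \<in> ad" "a \<in> W" "b \<in> W" using step(2) ad_W by blast+
    show ?case
    proof (cases "a \<in> Sv")
      case True
      then obtain z where z: "z \<in> pos a" "pos b = {z}" "b = end_vx a z" using end_vx_unique[OF True ab(1)] by blast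
      then have "b \<notin> Sv" "vx a {z} = (b, pos b)" using end_vx(4)[OF True z(1)] vx_end by auto
      then show ?thesis using step(3) True Pt_end[OF True z(1)] by metis
    next
      case False
      have bS: "b \<in> Sv" using ad_col[OF ab(1)] pos_card ab False unfolding Sv_def by blast
      obtain z where z: "z \<in> pos b" "pos a = {z}" "a = end_vx b z" using end_vx_unique[OF bS ad_sym[OF ab(1)]] by blast
      have "vx b {z} = (a, pos a)" using z vx_end by simp
      then obtain n where "kw (vx c {y}) n (vx b {z})" using step(3) False ab by auto
      moreover have "b \<in> K" using V[OF _ bS] step(2) by blast
      ultimately show ?thesis using kw_c[OF _ Pt_end[OF bS z(1)]] bS kw_app by metis
    qed
  qed
  then show ?thesis using w c by blast
qed

end

definition (in protree) mini where
  "mini M0 \<longleftrightarrow> (\<forall>M' (W' :: (nat \<times> 'g set) set) wa' ad' pos' p'. net W' wa' ad' pos' p' M' \<longrightarrow> (M', M0) \<notin> mult stab_less)"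

lemma (in protree) miniD:
  fixes W' :: "(nat \<times> 'g set) set"
  shows "mini M0 \<Longrightarrow> net W' wa' ad' pos' p' M' \<Longrightarrow> (M', M0) \<notin> mult stab_less"
  unfolding mini_def by (elim allE impE) assumption+

context xgraph begin

text \<open>Folding keeps or lowers the multiset, and minimality excludes lowering, so the immersed
  quotient has the multiset \<open>M0\<close> again.\<close>

lemma immersed_transfer:
  assumes R0: "req R0" "par R0 p0" and le: "flag_mset True R0 p0 = M0 \<or> (flag_mset True R0 p0, M0) \<in> mult stab_less"
    and min: "mini M0"
  shows "\<exists>R. req R \<and> immersed R \<and> (\<exists>(W' :: (nat \<times> 'g set) set) wa' ad' pos' p'. net W' wa' ad' pos' p' M0 \<and>
    ggraph.immersed ad' pos' (Id_on W') \<and>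
    (\<exists>j. W' = j ` W \<and> (\<forall>x \<in> W. \<forall>y \<in> W. j x = j y \<longleftrightarrow> (x, y) \<in> R) \<and> (\<forall>w \<in> W. pos' (j w) = pos w)))"
proof -
  obtain R q where q: "req R" "par R q" "immersed R" "flag_mset True R q = flag_mset True R0 p0 \<or> (flag_mset True R q, flag_mset True R0 p0) \<in> mult stab_less"
    using immerse[OF R0] by metis
  have le': "flag_mset True R q = M0 \<or> (flag_mset True R q, M0) \<in> mult stab_less"
    using q(4) le trancl_trans[of "flag_mset True R q" "flag_mset True R0 p0" "mult1 stab_less" M0] unfolding mult_def by auto
  from transfer[OF q(1,2)] show ?thesis
  proof (elim exE conjE)
    fix W' :: "(nat \<times> 'g set) set" and wa' ad' pos' p' j
    assume a: "net W' wa' ad' pos' p' (flag_mset True R q)" "immersed R \<longrightarrow> ggraph.immersed ad' pos' (Id_on W')"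
      "W' = j ` W" "\<forall>x \<in> W. \<forall>y \<in> W. j x = j y \<longleftrightarrow> (x, y) \<in> R" "\<forall>w \<in> W. pos' (j w) = pos w"
    have "flag_mset True R q = M0" using le' miniD[OF min a(1)] by blast
    then have "net W' wa' ad' pos' p' M0" using a(1) by simp
    then have "\<exists>(W' :: (nat \<times> 'g set) set) wa' ad' pos' p'. net W' wa' ad' pos' p' M0 \<and> ggraph.immersed ad' pos' (Id_on W') \<and>
      (\<exists>j. W' = j ` W \<and> (\<forall>x \<in> W. \<forall>y \<in> W. j x = j y \<longleftrightarrow> (x, y) \<in> R) \<and> (\<forall>w \<in> W. pos' (j w) = pos w))"
      using a(2-5) q(3) by (intro exI conjI) (assumption | blast)+
    then show ?thesis using q by blast
  qed
qed

lemma walk_fin: "(x, y) \<in> ad\<^sup>* \<Longrightarrow> \<exists>V. finite V \<and> (x, y) \<in> (ad \<inter> V \<times> V)\<^sup>*"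
proof (induction rule: rtrancl_induct)
  case base
  then show ?case by blast
next
  case (step y z)
  then obtain V where V: "finite V" "(x, y) \<in> (ad \<inter> V \<times> V)\<^sup>*" by blast
  have "(x, y) \<in> (ad \<inter> (insert y (insert z V)) \<times> (insert y (insert z V)))\<^sup>*" using V(2) by (rule rtrancl_mono[THEN subsetD, rotated]) blast
  moreover have "(y, z) \<in> ad \<inter> (insert y (insert z V)) \<times> (insert y (insert z V))" using step by blast
  ultimately show ?case using V(1) by (meson finite_insert rtrancl_into_rtrancl)
qed

lemma Oe_br: assumes "e \<in> E" shows "Oe (br e) = Oe e"
proof -
  have "br e \<in> x \<longleftrightarrow> e \<notin> x" if "x \<in> pos c" "c \<in> Sv" for x c using X_br[OF _ assms] SvD(2)[OF that(2)] that(1) by blast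
  then show ?thesis unfolding Oe_def by blast
qed

end

context subdiv begin

interpretation u: xgraph G E lev ea br X tip Wt act adt snd by (rule xt)

definition TT where "TT e \<longleftrightarrow> (\<forall>k \<in> K. \<forall>f \<in> E. lev f = lev e \<longrightarrow> k \<in> Oe f \<longrightarrow> tip f \<in> M)"

text \<open>The tips belong to \<open>M\<close> up to translation, so they are cut points, and by
  \<open>tip_between\<close> nothing lies between them.\<close>

lemma tips_cs:
  assumes c: "c \<in> Oe e" and e: "e \<in> E" and T: "TT e"
  shows "consec c {tip (br e), tip e}"
proof -
  have cS: "c \<in> Sv" using c unfolding Oe_def by blast
  have *: "Pt c (tip f)" if f: "f \<in> E" "lev f = lev e" "c \<in> Oe f" for f
  proof -
    obtain g k where g: "g \<in> carrier G" "k \<in> K" "c = wa g k" using K(3)[OF cS] by blast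
    define f' where "f' = ea (inv g) f"
    have f': "f' \<in> E" "lev f' = lev e" "ea g f' = f" using f g ea_cl lev_ea ea_inv' unfolding f'_def by auto
    have "k \<in> Oe f'" using Oe_act[OF g(1) K_S[OF g(2)] f'(1)] f f' g by simp
    then have "tip f' \<in> M" using T g f' unfolding TT_def by blast
    moreover have "tip f = pact g (tip f')" using tip_act[OF g(1) f'(1)] f' unfolding pact_def by simp
    moreover have "tip f \<in> sg c"
    proof -
      obtain r t where r: "pos c = {r, t}" "r \<in> X" "t \<in> X" "f \<notin> r" "f \<in> t" using Oe_ends[OF f(3)] by metis
      show ?thesis unfolding sg_seg[OF r(1-3)] by (rule tip_seg[OF f(1) r(2-5)])
    qed
    ultimately have "tip f \<in> marks c" unfolding marks_def using g by blast
    then show ?thesis using Pt.marks cS by blast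
  qed
  have P: "Pt c (tip e)" "Pt c (tip (br e))" using *[OF e] *[OF br_cl[OF e]] c Oe_br[OF e] lev_br[OF e] by auto
  have "tip (br e) \<noteq> tip e" using tip_br[OF e] tip_in[OF e] by blast
  then show ?thesis unfolding consec_def using P tip_between[OF e] by blast
qed

lemma consec_tips:
  assumes c: "consec c Y" "c \<in> Sv" and e: "e \<in> E" "y \<in> Y" "y' \<in> Y" "e \<notin> y" "e \<in> y'" and T: "TT e"
  shows "c \<in> Oe e" "Y = {tip (br e), tip e}"
proof -
  obtain r where "r \<in> pos c" using c(2) unfolding Sv_def by (force simp: card_2_iff)
  then obtain t where t: "pos c = {r, t}" "r \<in> X" "t \<in> X" using Sv_ends[OF c(2)] by metis
  have "y \<in> seg r t" "y' \<in> seg r t" using Pt_seg[OF c(2) t(1)] consec_Pt[OF c(1)] e by blast+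
  then have "(e \<notin> r \<or> e \<notin> t) \<and> (e \<in> r \<or> e \<in> t)" using e unfolding seg_def by blast
  then show O: "c \<in> Oe e" unfolding Oe_def using c(2) by (auto simp: t(1))
  have "y = tip (br e)" "y' = tip e"
    using same_pair[OF share_K_refl[OF c(2)] c(1) tips_cs[OF O e(1) T] e(2-5), of "tip (br e)" "tip e"] tip_br[OF e(1)] tip_in[OF e(1)] by auto
  moreover have "Y = {y, y'}" using c(1) e unfolding consec_def by auto
  ultimately show "Y = {tip (br e), tip e}" by simp
qed

text \<open>A path from \<open>c\<close> to \<open>c'\<close> along strands of \<open>K\<close>
  gives a walk from position \<open>tip e\<close> back to \<open>tip e\<close>, whose ends are
  identified by \<open>kwalk\<close>. Immersion then identifies the adjacent pairs across
  \<open>e\<close>.\<close>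

lemma cross_R:
  assumes R: "u.req R" "u.immersed R" and e: "e \<in> E" and c: "c \<in> K" "c' \<in> K" "c \<in> Oe e" "c' \<in> Oe e"
    and T: "TT e"
    and V: "V \<inter> Sv \<subseteq> K" "(c, c') \<in> (ad \<inter> V \<times> V)\<^sup>*"
  shows "((c, {tip (br e), tip e}), (c', {tip (br e), tip e})) \<in> R"
proof -
  have consec: "consec c {tip (br e), tip e}" "consec c' {tip (br e), tip e}" using tips_cs[OF c(3) e T] tips_cs[OF c(4) e T] .
  have P: "Pt c (tip e)" "Pt c' (tip e)" using consec_Pt consec by blast+
  obtain n where "kw (vx c {tip e}) n (vx c' {tip e})" using kw_conn[OF _ V(2) c(1) K_S[OF c(2)] P] V(1) by blast
  then have r: "(vx c {tip e}, vx c' {tip e}) \<in> R" using kwalk[OF R] vx_snd by simp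
  have a: "(vx c {tip e}, vx c {tip (br e), tip e}) \<in> adt" "(vx c' {tip e}, vx c' {tip (br e), tip e}) \<in> adt"
    using adt_I[OF K_S[OF c(1)] consec(1)] adt_I[OF K_S[OF c(2)] consec(2)] by blast+
  have "(vx c {tip (br e), tip e}, vx c' {tip (br e), tip e}) \<in> R"
    by (rule u.immD[OF R(2) a r]) (simp add: vx_snd)
  then show ?thesis using vx_cs consec by simp
qed

end

section \<open>Graphs that cross each arc of one level once\<close>

context protree begin

definition crosses where "crosses e Y \<longleftrightarrow> card Y = 2 \<and> (\<exists>y \<in> Y. e \<notin> y) \<and> (\<exists>y \<in> Y. e \<in> y)"

text \<open>Besides orbit representatives, \<open>K\<close> contains all strands that cross a
  representative arc of level \<open>n\<close>, and the strands on chosen paths between them;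
  \<open>M\<close> contains the tips of the arcs of this level crossed by \<open>K\<close>. After
  subdivision, an immersed quotient identifies all crossings of the same arc, and
  \<open>crossed\<close> shows that there is one.\<close>

lemma level_net:
  fixes W0 :: "(nat \<times> 'g set) set"
  assumes g0: "net W0 wa0 ad0 pos0 p0 M0"
    and min: "mini M0"
  obtains W :: "(nat \<times> 'g set) set" and wa ad pos p where "net W wa ad pos p M0" "ggraph.immersed ad pos (Id_on W)"
    "\<And>e. e \<in> E \<Longrightarrow> lev e = n \<Longrightarrow> \<exists>!s. s \<in> W \<and> crosses e (pos s)"
    "\<And>e s. e \<in> E \<Longrightarrow> lev e = n \<Longrightarrow> s \<in> W \<Longrightarrow> crosses e (pos s) \<Longrightarrow> pos s = {tip (br e), tip e}"
proof -
  interpret a: xgraph G E lev ea br X tip W0 wa0 ad0 pos0 using g0 unfolding net_def by blast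
  have a: "a.par (Id_on W0) p0" "a.flag_mset True (Id_on W0) p0 = M0 \<or> (a.flag_mset True (Id_on W0) p0, M0) \<in> mult stab_less" using g0 unfolding net_def by auto
  obtain W :: "(nat \<times> 'g set) set" and wa ad pos p where W: "net W wa ad pos p M0" "ggraph.immersed ad pos (Id_on W)"
  proof -
    from a.immersed_transfer[OF a.req_Id a min] show thesis
      by (elim exE conjE) (rule that, assumption+)
  qed
  interpret b: xgraph G E lev ea br X tip W wa ad pos using W unfolding net_def by blast
  have pr': "b.par (Id_on W) p \<and> M0 = b.flag_mset True (Id_on W) p" using W(1) unfolding net_def by (elim conjE) (rule conjI)
  have pr: "b.par (Id_on W) p" "b.flag_mset True (Id_on W) p = M0" using conjunct1[OF pr'] conjunct2[OF pr', symmetric] .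
  obtain F where F: "finite F" "F \<subseteq> E" "\<forall>e \<in> E. lev e = n \<longrightarrow> (\<exists>g \<in> carrier G. \<exists>f \<in> F. e = ea g f)"
    using fin_orb[of n] by (elim exE conjE) (rule that)
  obtain K0 where K0: "finite K0" "K0 \<subseteq> b.Sv" "\<forall>c \<in> b.Sv. \<exists>g \<in> carrier G. \<exists>k \<in> K0. c = wa g k" using b.Sv_orbits by blast
  define C where "C = (\<Union>e \<in> F. b.Oe e)"
  have fC: "finite C" unfolding C_def using F(1,2) b.fin_Oe by blast
  have CS: "C \<subseteq> b.Sv" unfolding C_def b.Oe_def by blast
  have "\<exists>V. finite V \<and> (x, y) \<in> (ad \<inter> V \<times> V)\<^sup>*" if "x \<in> W" "y \<in> W" for x y using b.walk_fin[OF b.conn[OF that]] .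
  then obtain V where V: "\<And>x y. x \<in> W \<Longrightarrow> y \<in> W \<Longrightarrow> finite (V x y) \<and> (x, y) \<in> (ad \<inter> V x y \<times> V x y)\<^sup>*" by metis
  define VV where "VV = (\<Union>c \<in> C. \<Union>c' \<in> C. V c c')"
  have CW: "C \<subseteq> W" using CS b.SvD(1) by blast
  have fVV: "finite VV" unfolding VV_def using fC V CW by blast
  define K where "K = K0 \<union> C \<union> (VV \<inter> b.Sv)"
  have fK: "finite K" "K \<subseteq> b.Sv" unfolding K_def using K0 fC CS fVV by auto
  have fpos: "finite (pos k)" if k: "k \<in> K" for k
  proof -
    have "card (pos k) = 2" using fK(2) k unfolding b.Sv_def by blast
    then show ?thesis using card_ge_0_finite[of "pos k"] by simp
  qed
  define D where "D k = {f \<in> E. lev f = n \<and> k \<in> b.Oe f}" for k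
  have fD: "finite (D k)" if k: "k \<in> K" for k
  proof -
    have kS: "k \<in> b.Sv" using k fK by blast
    then obtain r where "r \<in> pos k" unfolding b.Sv_def by (force simp: card_2_iff)
    then obtain t where t: "pos k = {r, t}" "r \<in> X" "t \<in> X" using b.Sv_ends[OF kS] by metis
    have "D k \<subseteq> {f \<in> t - r. lev f = n} \<union> {f \<in> r - t. lev f = n}" unfolding D_def b.Oe_def by (auto simp: t(1))
    then show ?thesis using fin_D[OF t(2,3)] fin_D[OF t(3,2)] finite_subset by blast
  qed
  define M where "M = (\<Union>k \<in> K. \<Union>k' \<in> K. (\<lambda>(r, s, x). maj r s x) ` (pos k \<times> pos k \<times> pos k')) \<union> (\<Union>k \<in> K. tip ` D k)"
  have fM: "finite M" unfolding M_def using fK(1) fpos fD by blast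
  have MX: "M \<subseteq> X"
  proof -
    have pX: "r \<in> X" if "k \<in> K" "r \<in> pos k" for k r using fK(2) that b.SvD(2) by blast
    have "maj r s x \<in> X" if "k \<in> K" "k' \<in> K" "r \<in> pos k" "s \<in> pos k" "x \<in> pos k'" for k k' r s x
      using maj_X pX that by metis
    moreover have "tip f \<in> X" if "f \<in> D k" for f k using that tip_X unfolding D_def by blast
    ultimately show ?thesis unfolding M_def by (intro Un_least UN_least image_subsetI) auto
  qed
  interpret s: subdiv G E lev ea br X tip W wa ad pos K M p
  proof unfold_locales
    show "finite K" "K \<subseteq> b.Sv" "finite M" "M \<subseteq> X" "b.par (Id_on W) p" "b.immersed (Id_on W)" by (fact fK fM MX pr(1) W(2))+
    show "\<exists>g \<in> carrier G. \<exists>k \<in> K. c = wa g k" if "c \<in> b.Sv" for c using K0(3) that unfolding K_def by blast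
    show "maj r t x \<in> M" if "c \<in> K" "c' \<in> K" "r \<in> pos c" "t \<in> pos c" "x \<in> pos c'" for c c' r t x
      unfolding M_def using that by force
  qed
  interpret u: xgraph G E lev ea br X tip s.Wt s.act s.adt snd by (rule s.xt)
  have T: "s.TT e" if "lev e = n" for e unfolding s.TT_def using that unfolding M_def D_def by blast
  have le: "u.flag_mset True (Id_on s.Wt) s.pt = M0 \<or> (u.flag_mset True (Id_on s.Wt) s.pt, M0) \<in> mult stab_less"
    using mset_le_mult[OF s.flag_mset_sub] pr(2) by simp
  obtain R where R: "u.req R" "u.immersed R" and ex: "\<exists>(W' :: (nat \<times> 'g set) set) wa' ad' pos' p'. net W' wa' ad' pos' p' M0 \<and>
    ggraph.immersed ad' pos' (Id_on W') \<and>
    (\<exists>j. W' = j ` s.Wt \<and> (\<forall>x \<in> s.Wt. \<forall>y \<in> s.Wt. j x = j y \<longleftrightarrow> (x, y) \<in> R) \<and> (\<forall>w \<in> s.Wt. pos' (j w) = snd w))"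
    using u.immersed_transfer[OF u.req_Id s.par_t le min] by blast
  from ex obtain W' :: "(nat \<times> 'g set) set" and wa' ad' pos' p' j where W': "net W' wa' ad' pos' p' M0"
    "ggraph.immersed ad' pos' (Id_on W')" "W' = j ` s.Wt" "\<And>x y. x \<in> s.Wt \<Longrightarrow> y \<in> s.Wt \<Longrightarrow> j x = j y \<longleftrightarrow> (x, y) \<in> R" "\<And>w. w \<in> s.Wt \<Longrightarrow> pos' (j w) = snd w" by blast
  have crossing: "\<exists>c. v = (c, {tip (br e), tip e}) \<and> c \<in> b.Oe e" if v: "v \<in> s.Wt" "crosses e (snd v)" and e: "e \<in> E" "lev e = n" for v e
    using v(1)
  proof (cases rule: s.WtE)
    case (3 c Y)
    then obtain y y' where "y \<in> Y" "y' \<in> Y" "e \<notin> y" "e \<in> y'" using v(2) unfolding crosses_def by auto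
    then have "c \<in> b.Oe e" "Y = {tip (br e), tip e}" using s.consec_tips[OF 3(2,1) e(1) _ _ _ _ T[OF e(2)]] by blast+
    then show ?thesis using 3 by simp
  qed (use v(2) in \<open>auto simp: crosses_def\<close>)
  have cw: "(c, {tip (br e), tip e}) \<in> s.Wt \<and> crosses e {tip (br e), tip e}" if c: "c \<in> b.Oe e" and e: "e \<in> E" "lev e = n" for c e
  proof -
    have consec: "s.consec c {tip (br e), tip e}" using s.tips_cs[OF c e(1) T[OF e(2)]] .
    have "c \<in> b.Sv" using c unfolding b.Oe_def by blast
    then have "(c, {tip (br e), tip e}) \<in> s.Wt" using s.vx_Wt[OF _ s.Ps2[OF consec]] s.vx_cs[OF consec] by simp
    then show ?thesis unfolding crosses_def using s.consec_card[OF consec] tip_in[OF e(1)] tip_br[OF e(1)] by blast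
  qed
  have un: "((c, {tip (br e), tip e}), (c', {tip (br e), tip e})) \<in> R" if c: "c \<in> b.Oe e" "c' \<in> b.Oe e" and e: "e \<in> E" "lev e = n" for c c' e
  proof -
    \<comment> \<open>It suffices to compare crossings of a representative arc, where both strands
      and a path between them are available in \<open>K\<close>.\<close>
    obtain g f where g: "g \<in> carrier G" "f \<in> F" "e = ea g f" using F(3) e by blast
    have f: "f \<in> E" "lev f = n" using g F(2) e lev_ea by auto
    define h where "h = inv g"
    have h: "h \<in> carrier G" "ea h e = f" using g ea_inv f unfolding h_def by auto
    have S: "c \<in> b.Sv" "c' \<in> b.Sv" using c unfolding b.Oe_def by blast+
    have hc: "wa h c \<in> b.Oe f" "wa h c' \<in> b.Oe f" using b.Oe_act[OF h(1) _ e(1)] S c h(2) by auto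
    then have hC: "wa h c \<in> C" "wa h c' \<in> C" unfolding C_def using g(2) by blast+
    then have hK: "wa h c \<in> K" "wa h c' \<in> K" unfolding K_def by blast+
    have hW: "wa h c \<in> W" "wa h c' \<in> W" using hC CW by blast+
    have VK: "V (wa h c) (wa h c') \<inter> b.Sv \<subseteq> K" unfolding K_def VV_def using hC by blast
    have "((wa h c, {tip (br f), tip f}), (wa h c', {tip (br f), tip f})) \<in> R"
      using s.cross_R[OF R f(1) hK hc T[OF f(2)] VK] V[OF hW] by blast
    then have r: "(s.act g (wa h c, {tip (br f), tip f}), s.act g (wa h c', {tip (br f), tip f})) \<in> R" by (rule u.reqD(6)[OF R(1) g(1)])
    have cW: "wa g (wa h c) = c" "wa g (wa h c') = c'" using b.wa_inv'[OF g(1)] b.SvD(1) S unfolding h_def by auto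
    have "pact g ` {tip (br f), tip f} = {tip (br e), tip e}"
      using tip_act[OF g(1) f(1)] tip_act[OF g(1) br_cl[OF f(1)]] ea_br[OF g(1) f(1)] g(3) unfolding pact_def by simp
    then show ?thesis using r cW unfolding s.act_def by simp
  qed
  show thesis
  proof (rule that[OF W'(1,2)])
    show "\<exists>!s. s \<in> W' \<and> crosses e (pos' s)" if e: "e \<in> E" "lev e = n" for e
    proof -
      obtain c where c: "c \<in> b.Oe e" using b.crossed[OF e(1)] by blast
      note c' = cw[OF c e]
      show ?thesis
      proof (rule ex1I)
        show "j (c, {tip (br e), tip e}) \<in> W' \<and> crosses e (pos' (j (c, {tip (br e), tip e})))" using c' W'(3,5) by simp
        fix t assume t: "t \<in> W' \<and> crosses e (pos' t)"
        then obtain v where v: "v \<in> s.Wt" "t = j v" "crosses e (snd v)" using W'(3,5) by auto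
        obtain d where d: "v = (d, {tip (br e), tip e})" "d \<in> b.Oe e" using crossing[OF v(1,3) e] by blast
        show "t = j (c, {tip (br e), tip e})" using un[OF d(2) c e] W'(4) c' v d by simp
      qed
    qed
    show "pos' t = {tip (br e), tip e}" if e: "e \<in> E" "lev e = n" and t: "t \<in> W'" "crosses e (pos' t)" for e t
    proof -
      obtain v where v: "v \<in> s.Wt" "t = j v" "crosses e (snd v)" using t W'(3,5) by auto
      then show ?thesis using crossing[OF v(1,3) e] W'(5) by auto
    qed
  qed
qed

end

text \<open>Each vertex other than \<open>v0\<close> chooses the last edge of a shortest path from
  \<open>v0\<close>. The distance from \<open>v0\<close> grows along this edge, so its two ends
  cannot both choose it.\<close>

lemma conn_card:
  assumes E: "finite F" and c: "\<And>v. v \<in> V \<Longrightarrow> (v0, v) \<in> (F \<union> F\<inverse>)\<^sup>*"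
  shows "finite V" "card V \<le> Suc (card F)"
proof -
  define r where "r = F \<union> F\<inverse>"
  define d where "d v = (LEAST k. (v0, v) \<in> r ^^ k)" for v
  have ex: "\<exists>f u. f \<in> F \<and> (f = (u, v) \<or> f = (v, u)) \<and> d v = Suc (d u)" if v: "v \<in> V - {v0}" for v
  proof -
    have "\<exists>k. (v0, v) \<in> r ^^ k" using c v unfolding r_def by (meson DiffD1 rtrancl_imp_relpow)
    then have dv: "(v0, v) \<in> r ^^ d v" unfolding d_def by (rule LeastI_ex)
    have "d v \<noteq> 0"
    proof
      assume "d v = 0"
      then show False using dv v by simp
    qed
    then obtain k where k: "d v = Suc k" by (metis not0_implies_Suc)
    then obtain u where u: "(v0, u) \<in> r ^^ k" "(u, v) \<in> r" using dv by auto
    have du: "d u \<le> k" "(v0, u) \<in> r ^^ d u" using u(1) unfolding d_def by (rule Least_le, rule LeastI)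
    have "(v0, v) \<in> r ^^ Suc (d u)" using du(2) u(2) by auto
    then have "d v \<le> Suc (d u)" unfolding d_def[of v] by (rule Least_le)
    then have "d v = Suc (d u)" using k du(1) by simp
    then show ?thesis using u(2) unfolding r_def by auto
  qed
  then obtain f u where fu: "\<And>v. v \<in> V - {v0} \<Longrightarrow> f v \<in> F \<and> (f v = (u v, v) \<or> f v = (v, u v)) \<and> d v = Suc (d (u v))"
    by metis
  have inj: "inj_on f (V - {v0})"
  proof (rule inj_onI)
    fix v w assume a: "v \<in> V - {v0}" "w \<in> V - {v0}" "f v = f w"
    show "v = w"
    proof (rule ccontr)
      assume "v \<noteq> w"
      then have "u v = w \<and> u w = v" using fu[OF a(1)] fu[OF a(2)] a(3) by auto
      then have "d v = Suc (d w)" "d w = Suc (d v)" using fu[OF a(1)] fu[OF a(2)] by auto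
      then show False by simp
    qed
  qed
  have sub: "f ` (V - {v0}) \<subseteq> F" using fu by blast
  have fin: "finite (V - {v0})" using inj sub E by (meson finite_imageD finite_subset)
  then show "finite V" by simp
  have "card (V - {v0}) \<le> card F" using card_inj_on_le[OF inj sub E] .
  then show "card V \<le> Suc (card F)" using fin by (metis card_Diff_singleton_if diff_le_self Suc_le_mono card_Suc_Diff1 insert_Diff_single le_SucI finite_Diff2 finite.emptyI finite.insertI Diff_empty Diff_insert0)
qed

context protree begin

text \<open>An arc of this level that points to \<open>x\<close> but not to \<open>tip e\<close>
  would either cross \<open>e\<close> or come after \<open>e\<close> on the way from
  \<open>y\<close> to \<open>x\<close>.\<close>

lemma last_sep_tip: assumes "y \<in> X" "x \<in> X" "last_sep y e x" shows "lev_eq (lev e) x (tip e)"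
proof -
  have e: "e \<in> E" "e \<notin> y" "e \<in> x" using assms unfolding last_sep_def by blast+
  note t = tip_X[OF e(1)] tip_X[OF br_cl[OF e(1)]] tip_in[OF e(1)] tip_br(1)[OF e(1)]
  have *: "h \<in> tip e" if h: "h \<in> E" "lev h = lev e" "h \<in> x" for h
  proof (rule ccontr)
    assume n: "h \<notin> tip e"
    have "h \<noteq> e" "h \<noteq> br e" using n t X_br[OF assms(2) e(1)] e h by auto
    then have n2: "h \<notin> tip (br e)" using tip_other[OF e(1) h(1,2)] n by blast
    show False
    proof (cases "h \<in> y")
      case True
      then show False using quad[of e h "tip (br e)" "tip e" y x] e h n n2 t assms by simp
    next
      case False
      then have "beyond h e" using assms(3) h unfolding last_sep_def by blast
      then show False using t n unfolding beyond_def by blast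
    qed
  qed
  show ?thesis unfolding lev_eq_def
  proof (intro ballI impI iffI)
    fix f assume f: "f \<in> E" "lev f = lev e"
    show "f \<in> tip e" if "f \<in> x" using * f that .
    show "f \<in> x" if "f \<in> tip e"
    proof (rule ccontr)
      assume "f \<notin> x"
      then have "br f \<in> x" using X_br[OF assms(2) f(1)] by blast
      then have "br f \<in> tip e" using *[OF br_cl[OF f(1)]] lev_br[OF f(1)] f by simp
      then show False using X_br[OF t(1) f(1)] that by blast
    qed
  qed
qed

end

section \<open>Counting vertices of one level\<close>

locale level = xgraph +
  fixes p n
  assumes par: "par (Id_on W) p" and im: "immersed (Id_on W)"
    and cx1: "\<And>e. e \<in> E \<Longrightarrow> lev e = n \<Longrightarrow> \<exists>!s. s \<in> W \<and> crosses e (pos s)"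
    and cx2: "\<And>e s. e \<in> E \<Longrightarrow> lev e = n \<Longrightarrow> s \<in> W \<Longrightarrow> crosses e (pos s) \<Longrightarrow> pos s = {tip (br e), tip e}"
begin

text \<open>Strands are included if both ends have the same image at level \<open>n\<close>; only
  the crossing strands lie over no single vertex of the \<open>n\<close>-th tree.\<close>

definition over_pt where "over_pt x w \<longleftrightarrow> w \<in> W \<and> (\<forall>z \<in> pos w. lev_eq n x z)"

definition crossing where "crossing s \<longleftrightarrow> s \<in> W \<and> (\<exists>e \<in> E. lev e = n \<and> crosses e (pos s))"

lemma pos_ne: "w \<in> W \<Longrightarrow> \<exists>z. z \<in> pos w \<and> z \<in> X"
  using pos_card[of w] pos_X[of w] by (metis card.empty ex_in_conv subsetD zero_neq_numeral zero_neq_one)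

lemma over_pt_W: "over_pt x w \<Longrightarrow> w \<in> W" unfolding over_pt_def by blast

lemma over_pt_ncr: "over_pt x w \<Longrightarrow> \<not> crossing w"
  unfolding over_pt_def crossing_def crosses_def lev_eq_def by blast

lemma ncr_nq: assumes "w \<in> W" "\<not> crossing w" "y \<in> pos w" "z \<in> pos w" shows "lev_eq n y z"
proof (rule ccontr)
  assume a: "\<not> lev_eq n y z"
  have X: "y \<in> X" "z \<in> X" using assms pos_X by blast+
  obtain e where e: "e \<in> E" "lev e = n" "e \<in> z" "e \<notin> y" using lev_eq_diff[OF X a] .
  have "y \<noteq> z" using a lev_eq_refl by blast
  then have "card (pos w) = 2" using pos_card[OF assms(1)] assms(3,4) by (auto simp: card_1_singleton_iff)
  then show False using assms e unfolding crossing_def crosses_def by blast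
qed

lemma ncr_cl: "w \<in> W \<Longrightarrow> \<not> crossing w \<Longrightarrow> z \<in> pos w \<Longrightarrow> lev_eq n x z \<Longrightarrow> over_pt x w"
  unfolding over_pt_def using ncr_nq lev_eq_trans by blast

lemma crossing_ends: assumes "crossing s" "z \<in> pos s" obtains e where "e \<in> E" "lev e = n" "crosses e (pos s)" "z = tip e" "pos s = {tip (br e), tip e}"
proof -
  obtain e where e: "e \<in> E" "lev e = n" "crosses e (pos s)" "s \<in> W" using assms unfolding crossing_def by blast
  have ps: "pos s = {tip (br e), tip e}" using cx2 e by blast
  have "crosses (br e) (pos s)" using e(3) X_br[OF _ e(1)] pos_X[OF e(4)] unfolding crosses_def by blast
  moreover have "pos s = {tip (br (br e)), tip (br e)}" using ps br_br[OF e(1)] by auto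
  ultimately show ?thesis using that[of e] that[of "br e"] ps e assms(2) br_cl[OF e(1)] lev_br[OF e(1)] by auto
qed

lemma crossing_unique: "s \<in> W \<Longrightarrow> t \<in> W \<Longrightarrow> e \<in> E \<Longrightarrow> lev e = n \<Longrightarrow> crosses e (pos s) \<Longrightarrow> crosses e (pos t) \<Longrightarrow> s = t"
  using cx1[of e] by blast

lemma adP: assumes "(x, y) \<in> ad" "card (pos x) = 1" shows "pos x \<subseteq> pos y" "card (pos y) = 2"
proof -
  have W: "x \<in> W" "y \<in> W" using ad_W assms by blast+
  show c2: "card (pos y) = 2" using ad_col[OF assms(1)] assms(2) pos_card[OF W(2)] by blast
  show "pos x \<subseteq> pos y"
  proof (rule ccontr)
    assume "\<not> pos x \<subseteq> pos y"
    then have "pos y \<subseteq> pos x" using ad_pos[OF assms(1)] by blast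
    then have "card (pos y) \<le> card (pos x)" using assms(2) by (intro card_mono) (auto intro: card_ge_0_finite)
    then show False using assms(2) c2 by simp
  qed
qed

lemma ad_typ: "(x, y) \<in> ad \<Longrightarrow> card (pos x) = 1 \<or> card (pos y) = 1"
  using ad_col[of x y] by blast

lemma im_unique: "(u, a) \<in> ad \<Longrightarrow> (u, b) \<in> ad \<Longrightarrow> pos a = pos b \<Longrightarrow> a = b"
  using immD[OF im, of u a u b] ad_W[of u a] by (auto simp: Id_on_iff)

lemma ad_inter: "(x, y) \<in> ad \<Longrightarrow> \<exists>z. z \<in> pos x \<and> z \<in> pos y"
  using ad_pos[of x y] ad_W[of x y] pos_ne by blast

text \<open>The strand that crosses the last arc before \<open>x\<close> has a neighbour over the
  tip of this arc, which agrees with \<open>x\<close> at level \<open>n\<close>.\<close>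

lemma W_class: assumes "x \<in> X" "y \<in> X" "\<not> lev_eq n y x" shows "\<exists>w. over_pt x w \<and> card (pos w) = 1"
proof -
  obtain e where e: "last_sep y e x" "lev e = n" using last_sep_ex[OF assms(2,1,3)] .
  have eE: "e \<in> E" using e unfolding last_sep_def by blast
  have nx: "lev_eq n x (tip e)" using last_sep_tip[OF assms(2,1) e(1)] e(2) by simp
  obtain s where s: "s \<in> W" "crosses e (pos s)" using cx1[OF eE e(2)] by blast
  then obtain a where a: "(s, a) \<in> ad" "pos a = {tip e}" using S_nb[of s "tip e"] cx2[OF eE e(2)] unfolding crosses_def by auto
  then have "over_pt x a" unfolding over_pt_def using ad_W nx by auto
  then show ?thesis using a by auto
qed

text \<open>Only \<open>s\<close> crosses \<open>e\<close>, and \<open>a\<close> is its only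
  neighbour on the far side. So a walk that ends on the far side passes through \<open>a\<close>,
  and the rest of it is strictly shorter.\<close>

lemma cross_back:
  assumes "(u, w) \<in> ad ^^ m" "u \<in> W" "\<forall>z \<in> pos u. e \<notin> z" "\<forall>z \<in> pos w. e \<in> z"
    and e: "e \<in> E" "lev e = n" and s: "s \<in> W" "crosses e (pos s)" and a: "(s, a) \<in> ad" "pos a = {tip e}"
  shows "\<exists>k < m. (a, w) \<in> ad ^^ k"
  using assms(1-4)
proof (induction m arbitrary: u rule: less_induct)
  case (less m)
  have pw: "pos s = {tip (br e), tip e}" using cx2 e s by blast
  have "m \<noteq> 0"
  proof
    assume "m = 0"
    then have "u = w" using less.prems by simp
    then show False using less.prems pos_ne by blast
  qed
  then obtain k where k: "m = Suc k" by (metis not0_implies_Suc)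
  then obtain u1 where u1: "(u, u1) \<in> ad" "(u1, w) \<in> ad ^^ k" using less.prems(1) relpow_Suc_D2 by metis
  have W1: "u1 \<in> W" using ad_W u1 by blast
  show ?case
  proof (cases "\<forall>z \<in> pos u1. e \<notin> z")
    case True
    then obtain k' where "k' < k" "(a, w) \<in> ad ^^ k'" using less.IH[of k u1] k u1 W1 less.prems by auto
    then show ?thesis using k less_SucI by blast
  next
    case False
    obtain z where "z \<in> pos u1" "e \<notin> z" using ad_inter[OF u1(1)] less.prems by blast
    then have "card (pos u1) \<noteq> 1" using False by (auto simp: card_1_singleton_iff)
    then have "crosses e (pos u1)" unfolding crosses_def using False \<open>z \<in> pos u1\<close> \<open>e \<notin> z\<close> pos_card[OF W1] by blast
    then have us: "u1 = s" using crossing_unique e s W1 by blast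
    have "k \<noteq> 0"
    proof
      assume "k = 0"
      then have "u1 = w" using u1 by simp
      then show False using less.prems \<open>z \<in> pos u1\<close> \<open>e \<notin> z\<close> by blast
    qed
    then obtain k' where k': "k = Suc k'" by (metis not0_implies_Suc)
    then obtain u2 where u2: "(s, u2) \<in> ad" "(u2, w) \<in> ad ^^ k'" using u1(2) relpow_Suc_D2 us by metis
    have c2: "card (pos u2) = 1" using ad_typ[OF u2(1)] s(2) unfolding crosses_def by auto
    have sub: "pos u2 \<subseteq> pos s" using adP(1)[OF ad_sym[OF u2(1)] c2] .
    then consider "pos u2 = {tip e}" | "pos u2 = {tip (br e)}" using c2 pw by (auto simp: card_1_singleton_iff)
    then show ?thesis
    proof cases
      case 1
      then have "u2 = a" using im_unique[OF u2(1) a(1)] a(2) by simp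
      then show ?thesis using u2 k k' by (metis less_Suc_eq)
    next
      case 2
      then have "\<forall>z \<in> pos u2. e \<notin> z" using tip_br[OF e(1)] by simp
      then obtain j where "j < k'" "(a, w) \<in> ad ^^ j" using less.IH[of k' u2] k k' u2 less.prems ad_W[OF u2(1)] by auto
      then show ?thesis using k k' less_SucI by metis
    qed
  qed
qed

text \<open>A walk that leaves the vertices over \<open>x\<close> does so along a crossing strand.
  By immersion or \<open>cross_back\<close> it returns through the vertex \<open>w\<close> it has
  left, so the excursion can be cut out and the walk becomes shorter.\<close>

lemma over_pt_conn: assumes "over_pt x w" "over_pt x w'" shows "(w, w') \<in> (ad \<inter> {v. over_pt x v} \<times> {v. over_pt x v})\<^sup>*"
proof -
  have "(w, w') \<in> ad\<^sup>*" using conn assms over_pt_W by blast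
  then obtain m where "(w, w') \<in> ad ^^ m" using rtrancl_imp_relpow by metis
  then show ?thesis using assms(1)
  proof (induction m arbitrary: w rule: less_induct)
    case (less m)
    show ?case
    proof (cases m)
      case 0
      then show ?thesis using less by simp
    next
      case (Suc k)
      then obtain u where u: "(w, u) \<in> ad" "(u, w') \<in> ad ^^ k" using less.prems(1) relpow_Suc_D2 by metis
      have W: "w \<in> W" "u \<in> W" using ad_W u by blast+
      show ?thesis
      proof (cases "over_pt x u")
        case True
        then have "(u, w') \<in> (ad \<inter> {v. over_pt x v} \<times> {v. over_pt x v})\<^sup>*" using less.IH[of k u] Suc u by simp
        moreover have "(w, u) \<in> ad \<inter> {v. over_pt x v} \<times> {v. over_pt x v}" using u True less.prems by blast
        ultimately show ?thesis by (meson converse_rtrancl_into_rtrancl)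
      next
        case False
        obtain z where z: "z \<in> pos w" "z \<in> pos u" using ad_inter[OF u(1)] by blast
        have nz: "lev_eq n x z" using less.prems(2) z unfolding over_pt_def by blast
        have cu: "crossing u" using ncr_cl[OF W(2) _ z(2) nz] False by blast
        obtain e where e: "e \<in> E" "lev e = n" "crosses e (pos u)" "z = tip e" "pos u = {tip (br e), tip e}" using crossing_ends[OF cu z(2)] .
        have "card (pos w) = 1" using ad_typ[OF u(1)] e(3) unfolding crosses_def by auto
        then have pw: "pos w = {tip e}" using z e by (auto simp: card_1_singleton_iff)
        have "e \<in> z" using tip_in e by blast
        then have ew': "\<forall>y \<in> pos w'. e \<in> y" using nz assms(2) e unfolding over_pt_def lev_eq_def by blast
        have "k \<noteq> 0"
        proof
          assume "k = 0"
          then have "u = w'" using u by simp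
          then show False using over_pt_ncr[OF assms(2)] cu by blast
        qed
        then obtain k' where k': "k = Suc k'" by (metis not0_implies_Suc)
        then obtain u2 where u2: "(u, u2) \<in> ad" "(u2, w') \<in> ad ^^ k'" using u(2) relpow_Suc_D2 by metis
        have c2: "card (pos u2) = 1" using ad_typ[OF u2(1)] e(3) unfolding crosses_def by auto
        then consider "pos u2 = {tip e}" | "pos u2 = {tip (br e)}" using adP(1)[OF ad_sym[OF u2(1)] c2] e(5) by (auto simp: card_1_singleton_iff)
        then have "\<exists>j < m. (w, w') \<in> ad ^^ j"
        proof cases
          case 1
          then have "u2 = w" using im_unique[OF u2(1) ad_sym[OF u(1)]] pw by simp
          then show ?thesis using u2 Suc k' by (metis less_Suc_eq)
        next
          case 2
          then have "\<forall>y \<in> pos u2. e \<notin> y" using tip_br[OF e(1)] by simp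
          then obtain j where "j < k'" "(w, w') \<in> ad ^^ j"
            using cross_back[OF u2(2) _ _ ew' e(1,2) W(2) e(3) ad_sym[OF u(1)] pw] ad_W[OF u2(1)] by blast
          then show ?thesis using Suc k' less_SucI by metis
        qed
        then show ?thesis using less.IH less.prems(2) by blast
      qed
    qed
  qed
qed

lemma p_W: "w \<in> W \<Longrightarrow> p w \<in> W" using parD(1)[OF par] .

lemma p_act: assumes "g \<in> carrier G" "w \<in> W" shows "p (wa g w) = wa g (p w)"
  using parD(3)[OF par assms] by (simp add: Id_on_iff)

lemma p_ad: assumes "w \<in> W" "p w \<noteq> w" shows "(w, p w) \<in> ad"
proof -
  have "(p w, w) \<in> adR (Id_on W)" using parD(4)[OF par assms(1)] assms(2) by (auto simp: Id_on_iff)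
  then show ?thesis unfolding adR_def using ad_sym by (auto simp: Id_on_iff)
qed

lemma over_pt_act: assumes "g \<in> carrier G" "x \<in> X" "over_pt x w" shows "over_pt (pact g x) (wa g w)"
proof -
  have w: "w \<in> W" "\<And>z. z \<in> pos w \<Longrightarrow> lev_eq n x z" "\<And>z. z \<in> pos w \<Longrightarrow> z \<in> X" using assms(3) pos_X unfolding over_pt_def by blast+
  then show ?thesis using pos_wa[OF assms(1) w(1)] lev_eq_pact[OF assms(1,2)] wa_cl[OF assms(1)] unfolding over_pt_def by auto
qed

lemma over_pt_nq: assumes "lev_eq n x y" "over_pt x w" shows "over_pt y w"
  using assms lev_eq_sym lev_eq_trans unfolding over_pt_def by blast

lemma crossing_act: assumes "g \<in> carrier G" "crossing s" shows "crossing (wa g s)"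
proof -
  obtain e where e: "e \<in> E" "lev e = n" "crosses e (pos s)" "s \<in> W" using assms unfolding crossing_def by blast
  have sX: "pos s \<subseteq> X" using pos_X e by blast
  have ps: "pos (wa g s) = pact g ` pos s" using pos_wa assms e by blast
  have m: "ea g e \<in> pact g z \<longleftrightarrow> e \<in> z" if "z \<in> pos s" for z using mem_pact[OF assms(1) _ e(1)] sX that by blast
  have "card (pos (wa g s)) = 2" using ps card_pact[OF assms(1) sX] e(3) unfolding crosses_def by simp
  moreover obtain z z' where "z \<in> pos s" "z' \<in> pos s" "e \<notin> z" "e \<in> z'" using e(3) unfolding crosses_def by blast
  ultimately have "crosses (ea g e) (pos (wa g s))" unfolding crosses_def using ps m by blast
  then show ?thesis unfolding crossing_def using wa_cl ea_cl lev_ea assms e by metis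
qed

text \<open>No free flag starts over \<open>x\<close>. Such classes are counted by common ancestors,
  the others by a flag.\<close>

definition good where "good x \<longleftrightarrow> (\<forall>a c. over_pt x a \<longrightarrow> card (pos a) = 1 \<longrightarrow> (a, c) \<in> ad \<longrightarrow> p a = c \<or> p c = a)"

lemma good_ad: assumes "good x" "over_pt x v" "over_pt x w" "(v, w) \<in> ad" shows "p v = w \<or> p w = v"
  using ad_typ[OF assms(4)] assms ad_sym[OF assms(4)] unfolding good_def by blast

lemma good_act: assumes "g \<in> carrier G" "x \<in> X" "good x" shows "good (pact g x)"
  unfolding good_def
proof (intro allI impI)
  fix a c assume a: "over_pt (pact g x) a" "card (pos a) = 1" "(a, c) \<in> ad"
  define h where "h = inv g"
  have h: "h \<in> carrier G" using assms h_def by simp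
  have W: "a \<in> W" "c \<in> W" using ad_W a by blast+
  have "over_pt (pact h (pact g x)) (wa h a)" using over_pt_act[OF h pact_X a(1)] assms by blast
  then have "over_pt x (wa h a)" using pact_inv[OF assms(1,2)] h_def by simp
  moreover have "card (pos (wa h a)) = 1" using pos_wa[OF h W(1)] card_pact[OF h pos_X[OF W(1)]] a by simp
  moreover have "(wa h a, wa h c) \<in> ad" using ad_act[OF h a(3)] .
  ultimately have "p (wa h a) = wa h c \<or> p (wa h c) = wa h a" using assms(3) unfolding good_def by blast
  then have "wa h (p a) = wa h c \<or> wa h (p c) = wa h a" using p_act h W by simp
  then show "p a = c \<or> p c = a" using wa_inv[OF h] p_W W by metis
qed

text \<open>The vertices over \<open>x\<close> are connected, and by goodness every edge between
  them is a parent edge. Hence iterating \<open>p\<close> from any of them reaches \<open>t\<close>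
  without leaving. From \<open>t'\<close> this must take no step, as its parent is outside.\<close>

lemma exit_unique:
  assumes "good x" "over_pt x t" "over_pt x t'" "\<not> over_pt x (p t)" "\<not> over_pt x (p t')"
  shows "t = t'"
proof -
  have "\<exists>i. (p ^^ i) w = t \<and> (\<forall>j \<le> i. over_pt x ((p ^^ j) w))" if "(t, w) \<in> (ad \<inter> {v. over_pt x v} \<times> {v. over_pt x v})\<^sup>*" for w
    using that
  proof (induction rule: rtrancl_induct)
    case base
    then show ?case using assms(2) by (intro exI[of _ 0]) simp
  next
    case (step v w)
    then obtain i where i: "(p ^^ i) v = t" "\<forall>j \<le> i. over_pt x ((p ^^ j) v)" by blast
    have vw: "over_pt x v" "over_pt x w" "(v, w) \<in> ad" using step by blast+
    consider "p w = v" | "p v = w" using good_ad[OF assms(1) vw] by blast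
    then show ?case
    proof cases
      case 1
      have "(p ^^ Suc i) w = t" using i 1 by (simp add: funpow_swap1)
      moreover have "over_pt x ((p ^^ j) w)" if "j \<le> Suc i" for j
        using that i 1 vw by (cases j) (auto simp: funpow_swap1)
      ultimately show ?thesis by blast
    next
      case 2
      show ?thesis
      proof (cases i)
        case 0
        then show ?thesis using i 2 vw assms(4) by auto
      next
        case (Suc k)
        have "(p ^^ k) w = t" using i 2 Suc by (simp add: funpow_swap1)
        moreover have "over_pt x ((p ^^ j) w)" if "j \<le> k" for j
          using i(2)[rule_format, of "Suc j"] that 2 Suc by (simp add: funpow_swap1)
        ultimately show ?thesis by blast
      qed
    qed
  qed
  then obtain i where i: "(p ^^ i) t' = t" "\<forall>j \<le> i. over_pt x ((p ^^ j) t')" using over_pt_conn[OF assms(2,3)] by blast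
  show ?thesis
  proof (cases i)
    case (Suc k)
    then have "over_pt x ((p ^^ 1) t')" using i(2)[rule_format, of 1] by simp
    then show ?thesis using assms(5) by simp
  qed (use i in simp)
qed

definition Z where "Z x = {wa g v | g v. g \<in> carrier G \<and> over_pt x v}"

text \<open>Chosen to be closed under \<open>p\<close>: a parent may be a crossing strand, but the
  parent of that strand lies over a translate of \<open>x\<close> again.\<close>

definition Q where "Q x = Z x \<union> {s. crossing s \<and> p s \<in> Z x}"

text \<open>Let the parent of \<open>v\<close> be a strand \<open>s\<close> that crosses
  \<open>e\<close>. As the exit is unique, the stabiliser of the vertex of the \<open>n\<close>-th
  tree below \<open>v\<close> fixes \<open>s\<close> and \<open>e\<close>; so reducedness puts the
  other end of \<open>e\<close> into the same orbit. Over that end \<open>s\<close> is not the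
  parent, since this would invert \<open>e\<close>; by goodness the parent of \<open>s\<close> lies
  there.\<close>

lemma exit_step: assumes x: "x \<in> X" "good x" and v: "over_pt x v" shows "p v \<in> Q x"
proof (cases "over_pt x (p v)")
  case True
  then have "p v = wa \<one> (p v)" using wa_one over_pt_W by simp
  then show ?thesis unfolding Q_def Z_def using True by blast
next
  case False
  have vW: "v \<in> W" using v over_pt_W by blast
  have "p v \<noteq> v" using False v by auto
  then have a: "(v, p v) \<in> ad" using p_ad vW by blast
  define s where "s = p v"
  have sW: "s \<in> W" using p_W vW s_def by blast
  obtain z where z: "z \<in> pos v" "z \<in> pos s" using ad_inter[OF a] s_def by blast
  have nz: "lev_eq n x z" using v z unfolding over_pt_def by blast
  have consec: "crossing s" using ncr_cl[OF sW _ z(2) nz] False s_def by blast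
  obtain e where e: "e \<in> E" "lev e = n" "crosses e (pos s)" "z = tip e" "pos s = {tip (br e), tip e}" using crossing_ends[OF consec z(2)] .
  have "card (pos v) = 1" using ad_typ[OF a] e(3) unfolding s_def crosses_def by auto
  then have pv: "pos v = {tip e}" using z e by (auto simp: card_1_singleton_iff)
  note t = tip_X[OF e(1)] tip_X[OF br_cl[OF e(1)]] tip_in[OF e(1)] tip_br(1)[OF e(1)]
  have fx: "ea g e = e" if g: "g \<in> carrier G" and lev_eq: "lev_eq n (pact g (tip e)) (tip e)" for g
  proof -
    have "over_pt (pact g x) (wa g v)" using over_pt_act[OF g x(1) v] .
    moreover have "lev_eq n (pact g x) x"
    proof -
      have "lev_eq n (pact g x) (pact g (tip e))" using lev_eq_pact[OF g x(1) t(1)] nz e by simp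
      then show ?thesis using lev_eq_trans[OF lev_eq_trans[OF _ lev_eq] lev_eq_sym[OF nz[unfolded e(4)]]] by simp
    qed
    ultimately have c: "over_pt x (wa g v)" using over_pt_nq by blast
    have "crossing (wa g s)" using crossing_act[OF g consec] .
    moreover have ps: "p (wa g v) = wa g s" using p_act[OF g vW] s_def by simp
    ultimately have "\<not> over_pt x (p (wa g v))" using over_pt_ncr by auto
    then have gv: "wa g v = v" using exit_unique[OF x(2) c v _ False] by blast
    then have "wa g s = s" using ps s_def by simp
    then have 1: "pact g ` pos s = pos s" using pos_wa[OF g sW] by simp
    have "pact g ` pos v = pos v" using pos_wa[OF g vW] gv by simp
    then have 2: "pact g (tip e) = tip e" using pv by simp
    have "tip (br e) \<noteq> tip e" using t by auto
    moreover have "pact g (tip (br e)) \<noteq> pact g (tip e)" using pact_eq[OF g t(2,1)] t by auto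
    ultimately have "pact g (tip (br e)) = tip (br e)" using 1 2 e(5) by auto
    then have "ea g e \<notin> tip (br e)" using mem_pact[OF g t(2) e(1)] t(4) by simp
    moreover have "ea g e \<in> tip e" using mem_pact[OF g t(1) e(1)] t(3) 2 by simp
    ultimately show ?thesis using tip_lev[OF e(1)] lev_ea[OF g e(1)] by blast
  qed
  have "\<exists>g \<in> carrier G. \<forall>f \<in> E. lev f = lev e \<longrightarrow> (f \<in> ea g ` tip e \<longleftrightarrow> f \<in> tip (br e))"
    by (rule reduced[OF e(1)]) (use fx e(2) in \<open>auto simp: lev_eq_def pact_def\<close>)
  then obtain g where g: "g \<in> carrier G" "lev_eq n (pact g (tip e)) (tip (br e))" unfolding lev_eq_def pact_def using e(2) by blast
  obtain a' where a': "(s, a') \<in> ad" "pos a' = {tip (br e)}" using S_nb[OF sW, of "tip (br e)"] e unfolding crosses_def by auto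
  have a'W: "a' \<in> W" using ad_W a' by blast
  have "lev_eq n (pact g x) (pact g (tip e))" using lev_eq_pact[OF g(1) x(1) t(1)] nz e by simp
  then have ca': "over_pt (pact g x) a'" unfolding over_pt_def using a'(2) a'W lev_eq_trans[OF _ g(2)] by simp
  define h where "h = inv g"
  have h: "h \<in> carrier G" using g h_def by simp
  have cha: "over_pt x (wa h a')" using over_pt_act[OF h pact_X[OF g(1) x(1)] ca'] pact_inv[OF g(1) x(1)] h_def by simp
  have ga: "wa g (wa h a') = a'" using wa_inv' g a'W h_def by simp
  have "p a' = s \<or> p s = a'" using good_act[OF g(1) x] ca' a' ad_sym unfolding good_def by simp
  \<comment> \<open>Otherwise \<open>a'\<close> would be the unique exit over its class, hence equal
    to \<open>wa g v\<close>. Then \<open>g\<close> would fix \<open>s\<close> and exchange the tips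
    of \<open>e\<close>, carrying \<open>e\<close> to \<open>br e\<close>.\<close>
  moreover have "p a' \<noteq> s"
  proof
    assume pa: "p a' = s"
    have "p (wa h a') = wa h s" using p_act[OF h a'W] pa by simp
    then have "\<not> over_pt x (p (wa h a'))" using crossing_act[OF h consec] over_pt_ncr by auto
    then have "wa h a' = v" using exit_unique[OF x(2) cha v _ False] by blast
    then have av: "a' = wa g v" using ga by simp
    have gt: "pact g (tip e) = tip (br e)" using pos_wa[OF g(1) vW] av a'(2) pv by simp
    have "wa g s = s" using p_act[OF g(1) vW] av pa s_def by simp
    then have "pact g ` pos s = pos s" using pos_wa[OF g(1) sW] by simp
    moreover have "pact g (tip (br e)) \<noteq> pact g (tip e)" using pact_eq[OF g(1) t(2,1)] t by auto
    ultimately have "pact g (tip (br e)) = tip e" using gt e(5) by auto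
    then have "ea g e \<notin> tip e" using mem_pact[OF g(1) t(2) e(1)] t(4) by simp
    moreover have "ea g e \<in> tip (br e)" using mem_pact[OF g(1) t(1) e(1)] t(3) gt by simp
    ultimately have "ea g e = br e" using tip_lev[OF br_cl[OF e(1)]] br_br[OF e(1)] lev_br[OF e(1)] lev_ea[OF g(1) e(1)] by simp
    then show False using no_inv g e by blast
  qed
  ultimately have "p s = wa g (wa h a')" using ga by simp
  then have "p s \<in> Z x" unfolding Z_def using g(1) cha by blast
  then show ?thesis unfolding Q_def using consec s_def by blast
qed

lemma Z_act: "g \<in> carrier G \<Longrightarrow> w \<in> Z x \<Longrightarrow> wa g w \<in> Z x"
  unfolding Z_def using wa_mult[symmetric] over_pt_W by blast

lemma Z_ncr: assumes "w \<in> Z x" shows "\<not> crossing w"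
proof
  assume c: "crossing w"
  obtain g v where g: "g \<in> carrier G" "over_pt x v" "w = wa g v" using assms unfolding Z_def by blast
  have "crossing (wa (inv g) w)" using crossing_act c g by simp
  then show False using g over_pt_ncr over_pt_W wa_inv by metis
qed

lemma Q_act: "g \<in> carrier G \<Longrightarrow> w \<in> Q x \<Longrightarrow> wa g w \<in> Q x"
proof -
  assume a: "g \<in> carrier G" "w \<in> Q x"
  show ?thesis
  proof (cases "w \<in> Z x")
    case True
    then show ?thesis using Z_act[OF a(1)] unfolding Q_def by blast
  next
    case False
    then have w: "crossing w" "p w \<in> Z x" using a(2) unfolding Q_def by blast+
    then have "p (wa g w) = wa g (p w)" using p_act[OF a(1)] unfolding crossing_def by blast
    then show ?thesis using crossing_act[OF a(1) w(1)] Z_act[OF a(1) w(2)] unfolding Q_def by simp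
  qed
qed

lemma Q_step: assumes "x \<in> X" "good x" "w \<in> Q x" shows "p w \<in> Q x"
proof (cases "w \<in> Z x")
  case True
  then obtain g v where g: "g \<in> carrier G" "over_pt x v" "w = wa g v" unfolding Z_def by blast
  then have "p w = wa g (p v)" using p_act over_pt_W by simp
  then show ?thesis using Q_act[OF g(1) exit_step[OF assms(1,2) g(2)]] by simp
qed (use assms(3) in \<open>auto simp: Q_def\<close>)

lemma Z_disj: assumes "x \<in> X" "y \<in> X" "w \<in> Z x" "w \<in> Z y" shows "\<exists>g \<in> carrier G. lev_eq n (pact g x) y"
proof -
  obtain g v where g: "g \<in> carrier G" "over_pt x v" "w = wa g v" using assms unfolding Z_def by blast
  obtain h u where h: "h \<in> carrier G" "over_pt y u" "w = wa h u" using assms unfolding Z_def by blast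
  define k where "k = inv h \<otimes> g"
  have k: "k \<in> carrier G" using g h k_def by simp
  have "wa k v = wa (inv h) w" unfolding k_def using wa_mult[of "inv h" g v] g h over_pt_W by simp
  also have "\<dots> = u" using wa_inv h over_pt_W by simp
  finally have "over_pt (pact k x) u" using over_pt_act[OF k assms(1) g(2)] by simp
  moreover obtain z where "z \<in> pos u" using pos_ne over_pt_W h by blast
  ultimately have "lev_eq n (pact k x) y" using h(2) lev_eq_trans lev_eq_sym unfolding over_pt_def by blast
  then show ?thesis using k by blast
qed

lemma Q_disj: assumes "x \<in> X" "y \<in> X" "w \<in> Q x" "w \<in> Q y" shows "\<exists>g \<in> carrier G. lev_eq n (pact g x) y"
  using assms Z_disj[OF assms(1,2), of w] Z_disj[OF assms(1,2), of "p w"] Z_ncr[of w] unfolding Q_def by blast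

text \<open>Classes of vertices with a common ancestor up to \<open>G\<close>. A good vertex class is determined by such a class.\<close>

definition same_root where "same_root = {(w, w'). w \<in> W \<and> w' \<in> W \<and> (\<exists>i j. \<exists>g \<in> carrier G. (p ^^ i) w = wa g ((p ^^ j) w'))}"

lemma pi_W: "w \<in> W \<Longrightarrow> (p ^^ i) w \<in> W" by (induction i) (auto simp: p_W)

lemma pi_act: "g \<in> carrier G \<Longrightarrow> w \<in> W \<Longrightarrow> (p ^^ i) (wa g w) = wa g ((p ^^ i) w)"
  by (induction i) (auto simp: p_act pi_W)

lemma same_root_equiv: "equiv W same_root"
proof (rule equivI)
  show "same_root \<subseteq> W \<times> W" unfolding same_root_def by blast
  show "refl_on W same_root"
  proof (rule refl_onI)
    fix w assume w: "w \<in> W"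
    then have "(p ^^ 0) w = wa \<one> ((p ^^ 0) w)" using wa_one by simp
    then show "(w, w) \<in> same_root" unfolding same_root_def using w by blast
  qed
  show "sym same_root"
  proof (rule symI)
    fix v w assume "(v, w) \<in> same_root"
    then obtain i j g where g: "v \<in> W" "w \<in> W" "g \<in> carrier G" "(p ^^ i) v = wa g ((p ^^ j) w)" unfolding same_root_def by blast
    then have "(p ^^ j) w = wa (inv g) ((p ^^ i) v)" using wa_inv pi_W by simp
    then show "(w, v) \<in> same_root" unfolding same_root_def using g inv_closed by blast
  qed
  show "trans same_root"
  proof (rule transI)
    fix u v w assume "(u, v) \<in> same_root" "(v, w) \<in> same_root"
    then obtain i j g k l h where g: "u \<in> W" "v \<in> W" "g \<in> carrier G" "(p ^^ i) u = wa g ((p ^^ j) v)"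
      and h: "w \<in> W" "h \<in> carrier G" "(p ^^ k) v = wa h ((p ^^ l) w)" unfolding same_root_def by blast
    have "(p ^^ (k + i)) u = (p ^^ k) (wa g ((p ^^ j) v))" using g by (simp add: funpow_add)
    also have "\<dots> = wa g ((p ^^ (k + j)) v)" using pi_act g pi_W by (simp add: funpow_add)
    also have "\<dots> = wa g ((p ^^ j) ((p ^^ k) v))" by (metis add.commute comp_apply funpow_add)
    also have "\<dots> = wa g (wa h ((p ^^ (j + l)) w))" using h pi_act pi_W by (simp add: funpow_add)
    also have "\<dots> = wa (g \<otimes> h) ((p ^^ (j + l)) w)" using wa_mult g h pi_W by simp
    finally show "(u, w) \<in> same_root" unfolding same_root_def using g h by blast
  qed
qed

lemma same_root_p: assumes "w \<in> W" shows "(w, p w) \<in> same_root"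
proof -
  have "(p ^^ 1) w = wa \<one> ((p ^^ 0) (p w))" using wa_one p_W assms by simp
  then show ?thesis unfolding same_root_def using assms p_W by blast
qed

lemma same_root_act: assumes "w \<in> W" "g \<in> carrier G" shows "(wa g w, w) \<in> same_root"
proof -
  have "(p ^^ 0) (wa g w) = wa g ((p ^^ 0) w)" by simp
  then show ?thesis unfolding same_root_def using assms wa_cl by blast
qed

text \<open>The iterated parents of \<open>v\<close> stay in \<open>Q x\<close>, those of
  \<open>w\<close> in \<open>Q y\<close>, so a common ancestor up to translation lies in both
  sets.\<close>

lemma same_root_good: assumes "x \<in> X" "y \<in> X" "good x" "good y" "over_pt x v" "over_pt y w" "(v, w) \<in> same_root" shows "\<exists>g \<in> carrier G. lev_eq n (pact g x) y"
proof -
  have i: "(p ^^ i) v \<in> Q x" if "x \<in> X" "good x" "over_pt x v" for x v i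
  proof (induction i)
    case 0
    have "v = wa \<one> v" using wa_one over_pt_W that by simp
    then have "v \<in> Q x" unfolding Q_def Z_def using that by blast
    then show ?case by simp
  next
    case (Suc i)
    then show ?case using Q_step that by simp
  qed
  obtain i j g where g: "g \<in> carrier G" "(p ^^ i) v = wa g ((p ^^ j) w)" using assms(7) unfolding same_root_def by blast
  show ?thesis using Q_disj[OF assms(1,2)] i[OF assms(1,3,5)] Q_act[OF g(1) i[OF assms(2,4,6)]] g(2) by metis
qed

definition NPQ where "NPQ = fflags True (Id_on W) p // (flag_rel (Id_on W) \<inter> fflags True (Id_on W) p \<times> fflags True (Id_on W) p)"

lemma fin_NPQ: "finite NPQ" unfolding NPQ_def by (rule fin_quot[OF req_Id fflags_ad])

lemma size_NPQ: "size (flag_mset True (Id_on W) p) = card NPQ"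
  unfolding flag_mset_def qmset_def NPQ_def by simp

text \<open>Contracting the parent edges and dividing by \<open>G\<close> leaves a connected graph
  whose vertices are the classes of \<open>same_root\<close> and whose edges come from orbits of
  flags.\<close>

lemma W_comp: "finite (W // same_root)" "card (W // same_root) \<le> Suc (card NPQ)"
proof -
  define F where "F = (\<lambda>q. (same_root `` {fst (SOME t. t \<in> q)}, same_root `` {snd (SOME t. t \<in> q)})) ` NPQ"
  have fF: "finite F" "card F \<le> card NPQ" unfolding F_def using fin_NPQ card_image_le by blast+
  obtain w0 where w0: "w0 \<in> W" using W_ne by blast
  have fflags: "(same_root `` {x}, same_root `` {y}) \<in> F" if xy: "(x, y) \<in> fflags True (Id_on W) p" for x y
  proof -
    define q where "q = (flag_rel (Id_on W) \<inter> fflags True (Id_on W) p \<times> fflags True (Id_on W) p) `` {(x, y)}"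
    have qN: "q \<in> NPQ" unfolding q_def NPQ_def using xy by (rule quotientI)
    have "(SOME t. t \<in> q) \<in> q" using equiv_class_self[OF fflags_equiv[OF req_Id] xy] unfolding q_def by (rule someI)
    then have "((x, y), (SOME t. t \<in> q)) \<in> flag_rel (Id_on W)" unfolding q_def by blast
    then obtain g x' y' where g: "(SOME t. t \<in> q) = (x', y')" "g \<in> carrier G" "x' = wa g x" "y' = wa g y" "x \<in> W" "y \<in> W" unfolding flag_rel_def by auto
    have "same_root `` {x'} = same_root `` {x}" "same_root `` {y'} = same_root `` {y}" using equiv_class_eq[OF same_root_equiv] same_root_act g by auto
    then have "(same_root `` {x}, same_root `` {y}) = (same_root `` {fst (SOME t. t \<in> q)}, same_root `` {snd (SOME t. t \<in> q)})" using g(1) by simp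
    then show ?thesis unfolding F_def using qN by blast
  qed
  have st: "same_root `` {x} = same_root `` {y} \<or> (same_root `` {x}, same_root `` {y}) \<in> F \<union> F\<inverse>" if xy: "(x, y) \<in> ad" for x y
  proof -
    have W: "x \<in> W" "y \<in> W" using ad_W xy by blast+
    have *: "same_root `` {x} = same_root `` {y} \<or> (same_root `` {x}, same_root `` {y}) \<in> F" if xy: "(x, y) \<in> ad" "card (pos x) = 1" "x \<in> W" "y \<in> W" for x y
    proof (cases "p x = y \<or> p y = x")
      case True
      then have "(x, y) \<in> same_root \<or> (y, x) \<in> same_root" using same_root_p xy by blast
      then show ?thesis using equiv_class_eq[OF same_root_equiv] by blast
    next
      case False
      then have "(x, y) \<in> fflags True (Id_on W) p" unfolding fflags_def using xy by auto
      then show ?thesis using fflags by blast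
    qed
    show ?thesis using ad_typ[OF xy] *[OF xy _ W] *[OF ad_sym[OF xy] _ W(2,1)] by blast
  qed
  have "(same_root `` {w0}, v) \<in> (F \<union> F\<inverse>)\<^sup>*" if v: "v \<in> W // same_root" for v
  proof -
    obtain w where w: "w \<in> W" "v = same_root `` {w}" using v by (rule quotientE)
    have "(w0, w) \<in> ad\<^sup>*" using conn w0 w by blast
    then have "(same_root `` {w0}, same_root `` {w}) \<in> (F \<union> F\<inverse>)\<^sup>*"
    proof (induction rule: rtrancl_induct)
      case (step y z)
      then show ?case using st[OF step(2)] by (metis rtrancl_into_rtrancl)
    qed simp
    then show ?thesis using w by simp
  qed
  note cc = conn_card[of F "W // same_root" "same_root `` {w0}", OF fF(1) this]
  show "finite (W // same_root)" by (rule cc(1))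
  show "card (W // same_root) \<le> Suc (card NPQ)" using cc(2) fF(2) by linarith
qed

text \<open>A class that is not good is sent to the orbit of a flag starting over it, a good one to
  the ancestor class of any vertex over it. Both maps are injective, which gives at most
  \<open>card NPQ\<close> and \<open>card NPQ + 1\<close> classes.\<close>

lemma count:
  assumes Y: "finite Y" "Y \<subseteq> X" and ineq: "\<And>x y g. x \<in> Y \<Longrightarrow> y \<in> Y \<Longrightarrow> x \<noteq> y \<Longrightarrow> g \<in> carrier G \<Longrightarrow> \<not> lev_eq n (pact g x) y"
  shows "card Y \<le> 2 * size (flag_mset True (Id_on W) p) + 1"
\<comment> \<open>\<open>W_class\<close> finds a vertex over a point only in the presence of a
  second, inequivalent point.\<close>
proof (cases "card Y \<le> 1")
  case False
  have ne: "\<exists>w. over_pt x w" if x: "x \<in> Y" for x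
  proof -
    have "\<exists>y \<in> Y. y \<noteq> x"
    proof (rule ccontr)
      assume "\<not> ?thesis"
      then have "Y = {x}" using x by blast
      then show False using False by simp
    qed
    then obtain y where y: "y \<in> Y" "y \<noteq> x" by blast
    then have "\<not> lev_eq n y x" using ineq[OF y(1) x y(2), of \<one>] pact_one Y by auto
    then show ?thesis using W_class[of x y] x y Y by blast
  qed
  define Yg where "Yg = {x \<in> Y. good x}"
  define Yb where "Yb = {x \<in> Y. \<not> good x}"
  have cY: "card Y = card Yg + card Yb"
  proof -
    have "Y = Yg \<union> Yb" "Yg \<inter> Yb = {}" unfolding Yg_def Yb_def by blast+
    then show ?thesis using Y(1) by (metis card_Un_disjoint finite_Un)
  qed
  have "\<exists>t. t \<in> fflags True (Id_on W) p \<and> over_pt x (fst t)" if x: "x \<in> Yb" for x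
  proof -
    obtain a c where "over_pt x a" "card (pos a) = 1" "(a, c) \<in> ad" "p a \<noteq> c" "p c \<noteq> a" using x unfolding Yb_def good_def by blast
    then have "(a, c) \<in> fflags True (Id_on W) p" "over_pt x (fst (a, c))" unfolding fflags_def by auto
    then show ?thesis by blast
  qed
  then obtain t where t: "\<And>x. x \<in> Yb \<Longrightarrow> t x \<in> fflags True (Id_on W) p \<and> over_pt x (fst (t x))" by metis
  define f where "f x = (flag_rel (Id_on W) \<inter> fflags True (Id_on W) p \<times> fflags True (Id_on W) p) `` {t x}" for x
  have Z1: "w \<in> Z x" if "over_pt x w" "(wa g w) = w'" "g \<in> carrier G" for x w w' g
  proof -
    have "w = wa \<one> w" using wa_one over_pt_W that by simp
    then show ?thesis unfolding Z_def using that by blast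
  qed
  have "inj_on f Yb"
  proof (rule inj_onI)
    fix x y assume a: "x \<in> Yb" "y \<in> Yb" "f x = f y"
    have "(t x, t y) \<in> flag_rel (Id_on W)"
      using eq_equiv_class[OF a(3)[unfolded f_def] fflags_equiv[OF req_Id]] t[OF a(2)] by blast
    then obtain g where g: "g \<in> carrier G" "wa g (fst (t x)) = fst (t y)" unfolding flag_rel_def by auto
    have "fst (t y) = wa g (fst (t x)) \<and> g \<in> carrier G \<and> over_pt x (fst (t x))" using g t[OF a(1)] by simp
    then have "fst (t y) \<in> Z x" unfolding Z_def by blast
    moreover have "fst (t y) \<in> Z y" using Z1[of y "fst (t y)" \<one>] t[OF a(2)] by blast
    ultimately show "x = y" using Z_disj[of x y] a ineq Y(2) unfolding Yb_def by blast
  qed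
  moreover have "f ` Yb \<subseteq> NPQ" unfolding f_def NPQ_def using t by (auto intro: quotientI)
  ultimately have b: "card Yb \<le> card NPQ" using card_inj_on_le fin_NPQ by blast
  obtain w where w: "\<And>x. x \<in> Y \<Longrightarrow> over_pt x (w x)" using ne by metis
  have "inj_on (\<lambda>x. same_root `` {w x}) Yg"
  proof (rule inj_onI)
    fix x y assume a: "x \<in> Yg" "y \<in> Yg" "same_root `` {w x} = same_root `` {w y}"
    have "x \<in> Y" "y \<in> Y" "good x" "good y" using a unfolding Yg_def by auto
    moreover have "(w x, w y) \<in> same_root" using eq_equiv_class[OF a(3) same_root_equiv] w over_pt_W calculation by blast
    ultimately show "x = y" using same_root_good[of x y "w x" "w y"] w ineq Y(2) by blast
  qed
  moreover have "(\<lambda>x. same_root `` {w x}) ` Yg \<subseteq> W // same_root" using w over_pt_W unfolding Yg_def by (auto intro: quotientI)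
  ultimately have "card Yg \<le> card (W // same_root)" using card_inj_on_le W_comp(1) by blast
  then show ?thesis using cY b W_comp(2) size_NPQ by simp
qed simp

end

theorem (in protree) bounded_orbits:
  assumes S: "finite S" "S \<subseteq> carrier G" "generate G S = carrier G"
    and ch: "\<nexists>H. \<forall>i::nat. subgroup (H i) G \<and> finite (H i) \<and> H i \<subset> H (Suc i)"
  shows "\<exists>B. \<forall>n Y. finite Y \<longrightarrow> Y \<subseteq> X \<longrightarrow>
    (\<forall>x \<in> Y. \<forall>y \<in> Y. \<forall>g \<in> carrier G. x \<noteq> y \<longrightarrow> \<not> lev_eq n (pact g x) y) \<longrightarrow> card Y \<le> B"
proof (rule minimal[OF S wf_ltr[OF ch]])
  fix M0 and W0 :: "(nat \<times> 'g set) set" and wa0 ad0 pos0 p0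
  assume g0: "net W0 wa0 ad0 pos0 p0 M0"
    and m: "\<And>M' (W' :: (nat \<times> 'g set) set) wa' ad' pos' p'. net W' wa' ad' pos' p' M' \<Longrightarrow> (M', M0) \<notin> mult stab_less"
  have mini: "mini M0" unfolding mini_def by (intro allI impI) (rule m)
  have "card Y \<le> 2 * size M0 + 1" if Y: "finite Y" "Y \<subseteq> X"
    and ne: "\<And>x y g. x \<in> Y \<Longrightarrow> y \<in> Y \<Longrightarrow> x \<noteq> y \<Longrightarrow> g \<in> carrier G \<Longrightarrow> \<not> lev_eq n (pact g x) y" for n Y
  proof (rule level_net[OF g0 mini, where n = n])
    fix W :: "(nat \<times> 'g set) set" and wa ad pos p
    assume W: "net W wa ad pos p M0" "ggraph.immersed ad pos (Id_on W)"
      "\<And>e. e \<in> E \<Longrightarrow> lev e = n \<Longrightarrow> \<exists>!s. s \<in> W \<and> crosses e (pos s)"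
      "\<And>e s. e \<in> E \<Longrightarrow> lev e = n \<Longrightarrow> s \<in> W \<Longrightarrow> crosses e (pos s) \<Longrightarrow> pos s = {tip (br e), tip e}"
    interpret b: xgraph G E lev ea br X tip W wa ad pos using W(1) unfolding net_def by blast
    have pr: "b.par (Id_on W) p \<and> M0 = b.flag_mset True (Id_on W) p" using W(1) unfolding net_def by (elim conjE) (rule conjI)
    interpret l: level G E lev ea br X tip W wa ad pos p n
    proof (rule level.intro[OF b.xgraph_axioms level_axioms.intro])
      show "b.par (Id_on W) p" by (rule conjunct1[OF pr])
      show "b.immersed (Id_on W)" by (rule W(2))
      show "\<exists>!s. s \<in> W \<and> crosses e (pos s)" if "e \<in> E" "lev e = n" for e by (rule W(3)[OF that])
      show "pos s = {tip (br e), tip e}" if "e \<in> E" "lev e = n" "s \<in> W" "crosses e (pos s)" for e s by (rule W(4)[OF that])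
    qed
    have c: "card Y \<le> 2 * size (b.flag_mset True (Id_on W) p) + 1" by (rule l.count[OF Y]) (rule ne)
    have "size M0 = size (b.flag_mset True (Id_on W) p)" by (rule arg_cong[OF conjunct2[OF pr]])
    then show ?thesis using c by linarith
  qed
  note key = this
  show ?thesis
  proof (intro exI allI impI)
    fix n Y assume "finite Y" "Y \<subseteq> X" "\<forall>x \<in> Y. \<forall>y \<in> Y. \<forall>g \<in> carrier G. x \<noteq> y \<longrightarrow> \<not> lev_eq n (pact g x) y"
    then show "card Y \<le> 2 * size M0 + 1" by (intro key) auto
  qed
qed

section \<open>Group actions on half-trees\<close>

lemma gpath_act:
  assumes "G_tree G T av ae" "g \<in> carrier G" "gpath T u es v"
  shows "gpath T (av g u) (map (ae g) es) (av g v)"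
  using assms(3)
proof (induction es arbitrary: u)
  case Nil
  then show ?case using assms(1,2) group_action.element_image unfolding G_tree_def by fastforce
next
  case (Cons e es)
  have e: "e \<in> garcs T" "gsrc T e = u" "gpath T (gtgt T e) es v" using Cons.prems by auto
  have "ae g e \<in> garcs T" using assms(1,2) group_action.element_image e unfolding G_tree_def by fastforce
  moreover have "gsrc T (ae g e) = av g (gsrc T e)" "gtgt T (ae g e) = av g (gtgt T e)" using assms(1,2) e unfolding G_tree_def by blast+
  ultimately show ?case using Cons.IH e by simp
qed

lemma reduced_act:
  assumes "G_tree G T av ae" "g \<in> carrier G" "set es \<subseteq> garcs T" "reduced_path T es"
  shows "reduced_path T (map (ae g) es)"
  using assms(3,4)
proof (induction es)
  case (Cons e es)
  have ga: "group_action G (garcs T) ae" using assms(1) unfolding G_tree_def by (elim conjE)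
  have inj: "inj_on (ae g) (garcs T)" by (rule group_action.inj_prop[OF ga assms(2)])
  have sg: "serre_graph T" using assms(1) unfolding G_tree_def is_tree_def by blast
  have e: "e \<in> garcs T" using Cons.prems by simp
  have b: "gbar T (ae g e) = ae g (gbar T e)" using assms(1,2) e unfolding G_tree_def by blast
  have b': "gbar T e \<in> garcs T" by (rule serreD(3)[OF sg e])
  note prems = Cons.prems and IH = Cons.IH
  show ?case
  proof (cases es)
    case (Cons e2 es')
    then have "e2 \<in> garcs T" "e2 \<noteq> gbar T e" using prems by auto
    then have "ae g e2 \<noteq> ae g (gbar T e)" using inj_onD[OF inj _ _ b'] by blast
    then show ?thesis using IH prems Cons b by (simp add: reduced_path_Cons)
  qed simp
qed simp

lemma tow_act1:
  assumes "G_tree G T av ae" "g \<in> carrier G" "e \<in> tow T v"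
  shows "ae g e \<in> tow T (av g v)"
proof -
  obtain es where es: "e \<in> garcs T" "gpath T (gsrc T e) (e # es) v" "reduced_path T (e # es)" using assms(3) unfolding tow_def by blast
  have sg: "serre_graph T" using assms(1) unfolding G_tree_def is_tree_def by blast
  have 1: "gpath T (av g (gsrc T e)) (ae g e # map (ae g) es) (av g v)" using gpath_act[OF assms(1,2) es(2)] by simp
  have 2: "reduced_path T (ae g e # map (ae g) es)" using reduced_act[OF assms(1,2) gpath_verts(3)[OF sg es(2)] es(3)] by simp
  have "ae g e \<in> garcs T" "gsrc T (ae g e) = av g (gsrc T e)" using 1 by auto
  then show ?thesis unfolding tow_def using 1 2 by auto
qed

section \<open>The limit of a sequence of trees\<close>

locale tseq = group G for G :: "('g, 'm) monoid_scheme" (structure) +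
  fixes T :: "nat \<Rightarrow> ('v, 'e) sgraph" and av :: "nat \<Rightarrow> 'g \<Rightarrow> 'v \<Rightarrow> 'v" and ae :: "nat \<Rightarrow> 'g \<Rightarrow> 'e \<Rightarrow> 'e"
    and f :: "nat \<Rightarrow> 'v \<Rightarrow> 'v" and fe :: "nat \<Rightarrow> 'e \<Rightarrow> 'e" and C :: "nat \<Rightarrow> 'e set"
  assumes tr: "G_tree G (T n) (av n) (ae n)"
    and rt: "reduced_tree G (T n) (av n) (ae n)"
    and fo: "finite (orbits G (garcs (T n)) (ae n))"
    and fs: "e \<in> garcs (T n) \<Longrightarrow> finite (stabilizer G (ae n) e)"
    and cm: "contraction_map G (T (Suc n)) (av (Suc n)) (ae (Suc n)) (T n) (av n) (ae n) (f n) (fe n) (C n)"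
begin

abbreviation "V n \<equiv> gverts (T n)"
abbreviation "A n \<equiv> garcs (T n)"

lemma gt: "gtree (T n)" using tr unfolding G_tree_def gtree_def by blast

lemma sgr: "serre_graph (T n)" using gtree.sg[OF gt] .

lemmas ar = serreD[OF sgr]

lemma aV: "group_action G (V n) (av n)" and aA: "group_action G (A n) (ae n)"
  using tr unfolding G_tree_def by blast+

lemma av_cl: "g \<in> carrier G \<Longrightarrow> v \<in> V n \<Longrightarrow> av n g v \<in> V n" using group_action.element_image[OF aV] by blast
lemma ae_cl: "g \<in> carrier G \<Longrightarrow> e \<in> A n \<Longrightarrow> ae n g e \<in> A n" using group_action.element_image[OF aA] by blast
lemma av_one: "v \<in> V n \<Longrightarrow> av n \<one> v = v" using group_action.id_eq_one[OF aV] by (metis restrict_apply')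
lemma ae_one: "e \<in> A n \<Longrightarrow> ae n \<one> e = e" using group_action.id_eq_one[OF aA] by (metis restrict_apply')
lemma av_mult: "g \<in> carrier G \<Longrightarrow> h \<in> carrier G \<Longrightarrow> v \<in> V n \<Longrightarrow> av n (g \<otimes> h) v = av n g (av n h v)"
  using group_action.composition_rule[OF aV] by blast
lemma ae_mult: "g \<in> carrier G \<Longrightarrow> h \<in> carrier G \<Longrightarrow> v \<in> A n \<Longrightarrow> ae n (g \<otimes> h) v = ae n g (ae n h v)"
  using group_action.composition_rule[OF aA] by blast

lemma ae_ends: "g \<in> carrier G \<Longrightarrow> e \<in> A n \<Longrightarrow> gsrc (T n) (ae n g e) = av n g (gsrc (T n) e)"
  "g \<in> carrier G \<Longrightarrow> e \<in> A n \<Longrightarrow> gtgt (T n) (ae n g e) = av n g (gtgt (T n) e)"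
  "g \<in> carrier G \<Longrightarrow> e \<in> A n \<Longrightarrow> gbar (T n) (ae n g e) = ae n g (gbar (T n) e)"
  "g \<in> carrier G \<Longrightarrow> e \<in> A n \<Longrightarrow> ae n g e \<noteq> gbar (T n) e"
  using tr unfolding G_tree_def by blast+

lemma tow_act: assumes "g \<in> carrier G" "v \<in> V n" "e \<in> A n" shows "ae n g e \<in> tow (T n) (av n g v) \<longleftrightarrow> e \<in> tow (T n) v"
proof
  assume "ae n g e \<in> tow (T n) (av n g v)"
  then have "ae n (inv g) (ae n g e) \<in> tow (T n) (av n (inv g) (av n g v))" using tow_act1[OF tr] assms by blast
  then show "e \<in> tow (T n) v" using ae_mult[symmetric] av_mult[symmetric] ae_one av_one assms by simp
qed (use tow_act1[OF tr] assms in blast)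

lemma cmD:
  shows "C n \<subseteq> A (Suc n)" "e \<in> C n \<Longrightarrow> gbar (T (Suc n)) e \<in> C n" "g \<in> carrier G \<Longrightarrow> e \<in> C n \<Longrightarrow> ae (Suc n) g e \<in> C n"
    "f n ` V (Suc n) = V n" "g \<in> carrier G \<Longrightarrow> v \<in> V (Suc n) \<Longrightarrow> f n (av (Suc n) g v) = av n g (f n v)"
    "u \<in> V (Suc n) \<Longrightarrow> v \<in> V (Suc n) \<Longrightarrow> f n u = f n v \<longleftrightarrow> C_connected (T (Suc n)) (C n) u v"
    "bij_betw (fe n) (A (Suc n) - C n) (A n)"
    "e \<in> A (Suc n) - C n \<Longrightarrow> gsrc (T n) (fe n e) = f n (gsrc (T (Suc n)) e)"
    "e \<in> A (Suc n) - C n \<Longrightarrow> gtgt (T n) (fe n e) = f n (gtgt (T (Suc n)) e)"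
    "e \<in> A (Suc n) - C n \<Longrightarrow> gbar (T n) (fe n e) = fe n (gbar (T (Suc n)) e)"
    "g \<in> carrier G \<Longrightarrow> e \<in> A (Suc n) - C n \<Longrightarrow> fe n (ae (Suc n) g e) = ae n g (fe n e)"
  using cm[of n] unfolding contraction_map_def by (elim conjE, blast)+

lemma f_V: "v \<in> V (Suc n) \<Longrightarrow> f n v \<in> V n" using cmD(4) by blast

lemma fe_A: "e \<in> A (Suc n) - C n \<Longrightarrow> fe n e \<in> A n" using cmD(7) bij_betwE by blast

lemma fe_inj: "e \<in> A (Suc n) - C n \<Longrightarrow> e' \<in> A (Suc n) - C n \<Longrightarrow> fe n e = fe n e' \<Longrightarrow> e = e'"
  using cmD(7) unfolding bij_betw_def inj_on_def by blast

lemma nC_bar: "e \<in> A (Suc n) - C n \<Longrightarrow> gbar (T (Suc n)) e \<in> A (Suc n) - C n"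
  using cmD(2)[of "gbar (T (Suc n)) e" n] ar(3,5)[of e "Suc n"] by auto

lemma f_C: assumes "e \<in> C n" shows "f n (gsrc (T (Suc n)) e) = f n (gtgt (T (Suc n)) e)"
proof -
  have e: "e \<in> A (Suc n)" using cmD(1) assms by blast
  have "gpath (T (Suc n)) (gsrc (T (Suc n)) e) [e] (gtgt (T (Suc n)) e)" using e ar(2) by simp
  then have "C_connected (T (Suc n)) (C n) (gsrc (T (Suc n)) e) (gtgt (T (Suc n)) e)" unfolding C_connected_def using assms
    by (metis empty_set list.simps(15) singletonD subsetI)
  then show ?thesis using cmD(6) ar(1,2) e by blast
qed

text \<open>Along a path from the head of \<open>e\<close>, the left side changes only when
  \<open>e\<close> or its reverse is traversed, and the right side changes at the same time.
  Contracted arcs affect neither.\<close>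

lemma tow_f: assumes e: "e \<in> A (Suc n) - C n" and v: "v \<in> V (Suc n)"
  shows "e \<in> tow (T (Suc n)) v \<longleftrightarrow> fe n e \<in> tow (T n) (f n v)"
proof -
  interpret t: gtree "T (Suc n)" by (rule gt)
  interpret b: gtree "T n" by (rule gt)
  have eA: "e \<in> A (Suc n)" "fe n e \<in> A n" using e fe_A by blast+
  have "gtgt (T (Suc n)) e \<in> V (Suc n)" using ar(2) eA by blast
  then show ?thesis using v
  proof (induction rule: t.path_induct)
    case base
    then show ?case using t.tow_tgt[OF eA(1)] b.tow_tgt[OF eA(2)] cmD(9)[OF e] by simp
  next
    case (step a)
    show ?case
    proof (cases "a \<in> C n")
      case True
      have "e \<noteq> a" "e \<noteq> gbar (T (Suc n)) a" using e True cmD(2) by blast+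
      then have "e \<in> tow (T (Suc n)) (gtgt (T (Suc n)) a) \<longleftrightarrow> e \<in> tow (T (Suc n)) (gsrc (T (Suc n)) a)"
        using t.tow_adj[OF step(1) eA(1)] by blast
      then show ?thesis using step(2) f_C[OF True] by simp
    next
      case False
      have a: "a \<in> A (Suc n) - C n" using step False by blast
      have fa: "fe n a \<in> A n" "gsrc (T n) (fe n a) = f n (gsrc (T (Suc n)) a)" "gtgt (T n) (fe n a) = f n (gtgt (T (Suc n)) a)"
        using fe_A[OF a] cmD(8,9)[OF a] by auto
      consider "a = e" | "a = gbar (T (Suc n)) e" | "e \<noteq> a" "e \<noteq> gbar (T (Suc n)) a" using ar(5)[OF step(1)] by metis
      then show ?thesis
      proof cases
        case 1
        then show ?thesis using t.tow_tgt[OF eA(1)] b.tow_tgt[OF eA(2)] fa by simp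
      next
        case 2
        have "gtgt (T (Suc n)) a = gsrc (T (Suc n)) e" using 2 ar(7)[OF eA(1)] by simp
        moreover have "e \<notin> tow (T (Suc n)) (gsrc (T (Suc n)) e)" using t.tow_src[OF eA(1)] t.tow_bar[OF eA(1)] ar(1)[OF eA(1)] by blast
        moreover have "fe n e \<notin> tow (T n) (gsrc (T n) (fe n e))" using b.tow_src[OF eA(2)] b.tow_bar[OF eA(2)] ar(1)[OF eA(2)] by blast
        ultimately show ?thesis using cmD(8)[OF e] by simp
      next
        case 3
        have "fe n e \<noteq> fe n a" using fe_inj[OF e a] 3 by blast
        moreover have "fe n e \<noteq> gbar (T n) (fe n a)" using fe_inj[OF e nC_bar[OF a]] cmD(10)[OF a] 3 by metis
        ultimately have "fe n e \<in> tow (T n) (gtgt (T n) (fe n a)) \<longleftrightarrow> fe n e \<in> tow (T n) (gsrc (T n) (fe n a))"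
          using b.tow_adj[OF fa(1) eA(2)] by blast
        moreover have "e \<in> tow (T (Suc n)) (gtgt (T (Suc n)) a) \<longleftrightarrow> e \<in> tow (T (Suc n)) (gsrc (T (Suc n)) a)"
          using t.tow_adj[OF step(1) eA(1)] 3 by blast
        ultimately show ?thesis using step(2) fa by simp
      qed
    qed
  qed
qed

definition threads where "threads = {x. \<forall>n. x n \<in> V n \<and> f n (x (Suc n)) = x n}"

definition pt where "pt x = {(n, e). e \<in> tow (T n) (x n)}"

definition E where "E = {(n, e). e \<in> A n}"

definition eact where "eact g a = (fst a, ae (fst a) g (snd a))"

definition ebr where "ebr a = (fst a, gbar (T (fst a)) (snd a))"

text \<open>Completes a thread that is given from level \<open>n\<close> upwards: each step of the
  recursion pushes the first entry down by one level and shifts the others.\<close>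

primrec dn :: "nat \<Rightarrow> (nat \<Rightarrow> 'v) \<Rightarrow> nat \<Rightarrow> 'v" where
  "dn 0 u = u"
| "dn (Suc n) u = dn n (\<lambda>k. if k = 0 then f n (u 0) else u (k - 1))"

lemma dn_LS:
  assumes "\<And>k. u k \<in> V (n + k)" "\<And>k. f (n + k) (u (Suc k)) = u k"
  shows "dn n u \<in> threads \<and> (\<forall>k. dn n u (n + k) = u k)"
  using assms
proof (induction n arbitrary: u)
  case 0
  then show ?case by (simp add: threads_def)
next
  case (Suc n)
  define u' where "u' k = (if k = 0 then f n (u 0) else u (k - 1))" for k
  have 1: "u' k \<in> V (n + k)" for k using Suc.prems(1)[of "k - 1"] Suc.prems(1)[of 0] f_V by (cases k) (auto simp: u'_def)
  have 2: "f (n + k) (u' (Suc k)) = u' k" for k using Suc.prems(2)[of "k - 1"] by (cases k) (auto simp: u'_def)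
  have "dn (Suc n) u = dn n u'" by (simp add: u'_def[abs_def])
  moreover have "dn n u' (Suc n + k) = u k" for k using Suc.IH[OF 1 2, THEN conjunct2, rule_format, of "Suc k"] by (simp add: u'_def)
  ultimately show ?case using Suc.IH[OF 1 2] by simp
qed

text \<open>As \<open>fe\<close> is a bijection from the uncontracted arcs, an arc has exactly one
  lift to each higher level.\<close>

primrec lifts :: "nat \<Rightarrow> 'e \<Rightarrow> nat \<Rightarrow> 'e" where
  "lifts n e 0 = e"
| "lifts n e (Suc k) = inv_into (A (Suc (n + k)) - C (n + k)) (fe (n + k)) (lifts n e k)"

lemma lifts: assumes "e \<in> A n" shows "lifts n e k \<in> A (n + k)" "lifts n e (Suc k) \<in> A (Suc (n + k)) - C (n + k)" "fe (n + k) (lifts n e (Suc k)) = lifts n e k"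
proof -
  have *: "inv_into (A (Suc m) - C m) (fe m) a \<in> A (Suc m) - C m \<and> fe m (inv_into (A (Suc m) - C m) (fe m) a) = a" if "a \<in> A m" for a m
    using cmD(7)[of m] that inv_into_into[of a "fe m" "A (Suc m) - C m"] f_inv_into_f[of a "fe m" "A (Suc m) - C m"] unfolding bij_betw_def by auto
  show l: "lifts n e k \<in> A (n + k)" for k
  proof (induction k)
    case (Suc k)
    then show ?case using *[of "lifts n e k" "n + k"] by simp
  qed (use assms in simp)
  show "lifts n e (Suc k) \<in> A (Suc (n + k)) - C (n + k)" "fe (n + k) (lifts n e (Suc k)) = lifts n e k" using *[OF l] by auto
qed

lemma lifts_I: assumes "\<And>k. a k \<in> A (n + k)" "\<And>k. a (Suc k) \<notin> C (n + k)" "\<And>k. fe (n + k) (a (Suc k)) = a k" shows "lifts n (a 0) k = a k"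
proof (induction k)
  case (Suc k)
  have "a (Suc k) \<in> A (Suc (n + k)) - C (n + k)" using assms(1)[of "Suc k"] assms(2)[of k] by simp
  moreover have "inj_on (fe (n + k)) (A (Suc (n + k)) - C (n + k))" using cmD(7) unfolding bij_betw_def by blast
  ultimately show ?case using inv_into_f_f[of "fe (n + k)" "A (Suc (n + k)) - C (n + k)" "a (Suc k)"] Suc assms(3)[of k] by simp
qed simp

definition ts where "ts n e = dn n (\<lambda>k. gtgt (T (n + k)) (lifts n e k))"

definition tip where "tip a = pt (ts (fst a) (snd a))"

lemma ts: assumes "e \<in> A n" shows "ts n e \<in> threads" "ts n e (n + k) = gtgt (T (n + k)) (lifts n e k)"
proof -
  have 1: "gtgt (T (n + k)) (lifts n e k) \<in> V (n + k)" for k using lifts(1)[OF assms] ar(2) by blast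
  have 2: "f (n + k) (gtgt (T (n + Suc k)) (lifts n e (Suc k))) = gtgt (T (n + k)) (lifts n e k)" for k
    using cmD(9)[OF lifts(2)[OF assms, of k]] lifts(3)[OF assms, of k] by simp
  show "ts n e \<in> threads" "ts n e (n + k) = gtgt (T (n + k)) (lifts n e k)"
    using dn_LS[of "\<lambda>k. gtgt (T (n + k)) (lifts n e k)" n] 1 2 unfolding ts_def by blast+
qed

lemma threads_D: "x \<in> threads \<Longrightarrow> x n \<in> V n" "x \<in> threads \<Longrightarrow> f n (x (Suc n)) = x n" unfolding threads_def by blast+

lemma threads_eq: assumes "x \<in> threads" "y \<in> threads" "\<And>k. x (n + k) = y (n + k)" shows "x = y"
proof
  fix m
  have "x (m + n - j) = y (m + n - j)" if "j \<le> n" for j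
    using that
  proof (induction j)
    case 0
    then show ?case using assms(3)[of m] by (simp add: add.commute)
  next
    case (Suc j)
    then have "m + n - j = Suc (m + n - Suc j)" by simp
    then show ?case using Suc threads_D(2)[OF assms(1), of "m + n - Suc j"] threads_D(2)[OF assms(2), of "m + n - Suc j"] by simp
  qed
  from this[of n] show "x m = y m" by simp
qed

lemma lifts_half: assumes "e \<in> A n" "x \<in> threads" shows "lifts n e k \<in> tow (T (n + k)) (x (n + k)) \<longleftrightarrow> e \<in> tow (T n) (x n)"
proof (induction k)
  case (Suc k)
  have "lifts n e (Suc k) \<in> tow (T (Suc (n + k))) (x (Suc (n + k))) \<longleftrightarrow> fe (n + k) (lifts n e (Suc k)) \<in> tow (T (n + k)) (f (n + k) (x (Suc (n + k))))"
    by (rule tow_f[OF lifts(2)[OF assms(1)] threads_D(1)[OF assms(2)]])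
  then show ?case using Suc lifts(3)[OF assms(1)] threads_D(2)[OF assms(2)] by simp
qed simp

lemma lifts_bar: assumes "e \<in> A n" shows "lifts n (gbar (T n) e) k = gbar (T (n + k)) (lifts n e k)"
proof -
  have "lifts n ((\<lambda>k. gbar (T (n + k)) (lifts n e k)) 0) k = (\<lambda>k. gbar (T (n + k)) (lifts n e k)) k"
  proof (rule lifts_I)
    fix k
    show "gbar (T (n + k)) (lifts n e k) \<in> A (n + k)" using lifts(1)[OF assms] ar(3) by blast
    show "gbar (T (n + Suc k)) (lifts n e (Suc k)) \<notin> C (n + k)" using nC_bar[OF lifts(2)[OF assms]] by simp
    show "fe (n + k) (gbar (T (n + Suc k)) (lifts n e (Suc k))) = gbar (T (n + k)) (lifts n e k)"
      using cmD(10)[OF lifts(2)[OF assms, of k]] lifts(3)[OF assms, of k] by simp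
  qed
  then show ?thesis by simp
qed

lemma lifts_act: assumes "e \<in> A n" "g \<in> carrier G" shows "lifts n (ae n g e) k = ae (n + k) g (lifts n e k)"
proof -
  have "lifts n ((\<lambda>k. ae (n + k) g (lifts n e k)) 0) k = (\<lambda>k. ae (n + k) g (lifts n e k)) k"
  proof (rule lifts_I)
    fix k
    show "ae (n + k) g (lifts n e k) \<in> A (n + k)" using lifts(1)[OF assms(1)] ae_cl[OF assms(2)] by blast
    show "ae (n + Suc k) g (lifts n e (Suc k)) \<notin> C (n + k)"
    proof
      assume "ae (n + Suc k) g (lifts n e (Suc k)) \<in> C (n + k)"
      then have "ae (Suc (n + k)) (inv g) (ae (Suc (n + k)) g (lifts n e (Suc k))) \<in> C (n + k)" using cmD(3) assms(2) by simp
      then show False using ae_mult[of "inv g" g] ae_one assms lifts(2)[OF assms(1), of k] by (metis DiffD1 DiffD2 inv_closed l_inv)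
    qed
    show "fe (n + k) (ae (n + Suc k) g (lifts n e (Suc k))) = ae (n + k) g (lifts n e k)"
      using cmD(11)[OF assms(2) lifts(2)[OF assms(1), of k]] lifts(3)[OF assms(1), of k] by simp
  qed
  then show ?thesis by simp
qed

lemma threads_act: assumes "x \<in> threads" "g \<in> carrier G" shows "(\<lambda>n. av n g (x n)) \<in> threads"
  unfolding threads_def using threads_D[OF assms(1)] av_cl[OF assms(2)] cmD(5)[OF assms(2)] by simp

lemma pt_act: assumes "x \<in> threads" "g \<in> carrier G" shows "eact g ` pt x = pt (\<lambda>n. av n g (x n))"
proof (intro equalityI subsetI)
  fix a assume "a \<in> eact g ` pt x"
  then obtain n e where e: "e \<in> tow (T n) (x n)" "a = (n, ae n g e)" unfolding pt_def eact_def by auto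
  moreover have "e \<in> A n" using gtree.tow_sub[OF gt] e by blast
  ultimately show "a \<in> pt (\<lambda>n. av n g (x n))" using tow_act[OF assms(2) threads_D(1)[OF assms(1)]] unfolding pt_def by simp
next
  fix a assume "a \<in> pt (\<lambda>n. av n g (x n))"
  then obtain n e where e: "e \<in> tow (T n) (av n g (x n))" "a = (n, e)" unfolding pt_def by auto
  have eA: "e \<in> A n" using gtree.tow_sub[OF gt] e by blast
  define e' where "e' = ae n (inv g) e"
  have e': "e' \<in> A n" "ae n g e' = e" using ae_cl ae_mult[symmetric] ae_one eA assms(2) unfolding e'_def by auto
  then have "e' \<in> tow (T n) (x n)" using tow_act[OF assms(2) threads_D(1)[OF assms(1)] e'(1)] e by simp
  then have "(n, e') \<in> pt x" unfolding pt_def by simp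
  moreover have "a = eact g (n, e')" unfolding eact_def using e e' by simp
  ultimately show "a \<in> eact g ` pt x" by blast
qed

lemma ts_act: assumes "e \<in> A n" "g \<in> carrier G" shows "ts n (ae n g e) = (\<lambda>m. av m g (ts n e m))"
  by (rule threads_eq[OF ts(1)[OF ae_cl[OF assms(2,1)]] threads_act[OF ts(1)[OF assms(1)] assms(2)], of n])
    (use ts(2) lifts_act lifts(1) assms ae_cl ae_ends in simp)

lemma ts_fe: assumes "e \<in> A (Suc n) - C n" shows "ts (Suc n) e = ts n (fe n e)"
proof (rule threads_eq[of _ _ "Suc n"])
  show "ts (Suc n) e \<in> threads" "ts n (fe n e) \<in> threads" using ts(1) assms fe_A by blast+
  fix k
  define a where "a j = (if j = 0 then fe n e else lifts (Suc n) e (j - 1))" for j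
  have eA: "e \<in> A (Suc n)" using assms by blast
  have "lifts n (a 0) (Suc k) = a (Suc k)"
  proof (rule lifts_I)
    fix j
    show "a j \<in> A (n + j)" using fe_A[OF assms] lifts(1)[OF eA, of "j - 1"] by (cases j) (auto simp: a_def)
    show "a (Suc j) \<notin> C (n + j)" using assms lifts(2)[OF eA, of "j - 1"] by (cases j) (auto simp: a_def)
    show "fe (n + j) (a (Suc j)) = a j" using lifts(3)[OF eA, of "j - 1"] by (cases j) (auto simp: a_def)
  qed
  then have "lifts n (fe n e) (Suc k) = lifts (Suc n) e k" by (simp add: a_def)
  then show "ts (Suc n) e (Suc n + k) = ts n (fe n e) (Suc n + k)" using ts(2)[OF eA, of k] ts(2)[OF fe_A[OF assms], of "Suc k"] by simp
qed

lemma ts_C: assumes "e \<in> A (Suc n)" "e \<in> C n" "m \<le> n" shows "ts (Suc n) e m = ts (Suc n) (gbar (T (Suc n)) e) m"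
  using assms(3)
proof (induction m rule: inc_induct)
  case base
  note b = ar(3)[OF assms(1)]
  have "ts (Suc n) e n = f n (ts (Suc n) e (Suc n))" "ts (Suc n) (gbar (T (Suc n)) e) n = f n (ts (Suc n) (gbar (T (Suc n)) e) (Suc n))"
    using threads_D(2)[OF ts(1)[OF assms(1)]] threads_D(2)[OF ts(1)[OF b]] by simp_all
  moreover have "ts (Suc n) e (Suc n) = gtgt (T (Suc n)) e" "ts (Suc n) (gbar (T (Suc n)) e) (Suc n) = gsrc (T (Suc n)) e"
    using ts(2)[OF assms(1), of 0] ts(2)[OF b, of 0] ar(7)[OF assms(1)] by simp_all
  ultimately show ?case using f_C[OF assms(2)] by simp
next
  case (step m)
  then show ?case using threads_D(2)[OF ts(1)[OF assms(1)], of m] threads_D(2)[OF ts(1)[OF ar(3)[OF assms(1)]], of m] by simp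
qed

lemma tow_ends: assumes "e \<in> A n" "a \<in> tow (T n) (gtgt (T n) e)" "a \<notin> tow (T n) (gtgt (T n) (gbar (T n) e))" shows "a = e"
  using gtree.tow_tgt_eq[OF gt assms(1)] assms(2,3) ar(7)[OF assms(1)] by auto

text \<open>If the level \<open>m\<close> of \<open>a\<close> is at least \<open>n\<close>, then
  \<open>a\<close> is the lift of \<open>e\<close>. Otherwise the tips of \<open>e\<close> still
  differ below level \<open>n\<close>, so \<open>e\<close> is not contracted and can be replaced by
  its image one level lower.\<close>

lemma half: assumes "e \<in> A n" "a \<in> tow (T m) (ts n e m)" "a \<notin> tow (T m) (ts n (gbar (T n) e) m)" "x \<in> threads"
  shows "a \<in> tow (T m) (x m) \<longleftrightarrow> e \<in> tow (T n) (x n)"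
  using assms(1-3)
proof (induction n arbitrary: e)
  case 0
  have b: "gbar (T 0) e \<in> A 0" using ar(3) 0 by blast
  have "a = lifts 0 e m"
    by (rule tow_ends[OF lifts(1)[OF 0(1), of m, simplified]]) (use 0 ts(2)[OF 0(1), of m] ts(2)[OF b, of m] lifts_bar[OF 0(1), of m] in simp_all)
  then show ?case using lifts_half[OF 0(1) assms(4), of m] by simp
next
  case (Suc n)
  have b: "gbar (T (Suc n)) e \<in> A (Suc n)" using ar(3) Suc by blast
  show ?case
  proof (cases "Suc n \<le> m")
    case True
    then obtain k where k: "m = Suc n + k" using le_Suc_ex by blast
    have "a = lifts (Suc n) e k"
      by (rule tow_ends[OF lifts(1)[OF Suc(2), of k]]) (use Suc ts(2)[OF Suc(2), of k] ts(2)[OF b, of k] lifts_bar[OF Suc(2), of k] k in simp_all)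
    then show ?thesis using lifts_half[OF Suc(2) assms(4), of k] k by simp
  next
    case False
    have nC: "e \<notin> C n" using ts_C[OF Suc(2), of m] False Suc(3,4) by auto
    then have e: "e \<in> A (Suc n) - C n" using Suc by blast
    have "a \<in> tow (T m) (x m) \<longleftrightarrow> fe n e \<in> tow (T n) (x n)"
      by (rule Suc.IH[OF fe_A[OF e]]) (use Suc ts_fe[OF e] ts_fe[OF nC_bar[OF e]] cmD(10)[OF e] in simp_all)
    then show ?thesis using tow_f[OF e threads_D(1)[OF assms(4)]] threads_D(2)[OF assms(4)] by simp
  qed
qed

text \<open>Contractions are surjective on vertices, so preimages can be chosen level by level, and
  the lower entries are images.\<close>

lemma vertex_LS: assumes "v \<in> V n" shows "\<exists>x \<in> threads. x n = v"
proof -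
  have ex: "\<exists>w. w \<in> V (Suc m) \<and> f m w = u" if "u \<in> V m" for u m using cmD(4)[of m] that by force
  define up where "up = rec_nat v (\<lambda>k u. SOME w. w \<in> V (Suc (n + k)) \<and> f (n + k) w = u)"
  have u0: "up 0 = v" and uS: "up (Suc k) = (SOME w. w \<in> V (Suc (n + k)) \<and> f (n + k) w = up k)" for k unfolding up_def by simp_all
  have V: "up k \<in> V (n + k)" for k
  proof (induction k)
    case (Suc k)
    then show ?case using someI_ex[OF ex[OF Suc]] uS by simp
  qed (use assms u0 in simp)
  have "f (n + k) (up (Suc k)) = up k" for k using someI_ex[OF ex[OF V]] uS by simp
  from dn_LS[of up n, OF V this] show ?thesis using u0 by (metis add.right_neutral)
qed

definition X where "X = pt ` threads"

lemma mem_pt: "(n, e) \<in> pt x \<longleftrightarrow> e \<in> tow (T n) (x n)" by (simp add: pt_def)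

lemma tip_pt: "a \<in> E \<Longrightarrow> ts (fst a) (snd a) \<in> threads" using ts(1) unfolding E_def by auto

lemma tip_mem: assumes "(n, e) \<in> E" shows "(n, a) \<in> tip (n, e) \<longleftrightarrow> a \<in> tow (T n) (gtgt (T n) e)"
  using ts(2)[of e n 0] assms unfolding tip_def E_def by (simp add: mem_pt)

lemma tip_mem_br: assumes "(n, e) \<in> E" shows "(n, a) \<in> tip (ebr (n, e)) \<longleftrightarrow> a \<in> tow (T n) (gsrc (T n) e)"
proof -
  have e: "e \<in> A n" using assms E_def by simp
  have "(n, gbar (T n) e) \<in> E" using ar(3)[OF e] E_def by simp
  then show ?thesis using tip_mem[of n "gbar (T n) e" a] ar(7)[OF e] by (simp add: ebr_def)
qed

lemma towb: "x \<in> threads \<Longrightarrow> e \<in> A n \<Longrightarrow> gbar (T n) e \<in> tow (T n) (x n) \<longleftrightarrow> e \<notin> tow (T n) (x n)"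
  using gtree.tow_bar[OF gt] threads_D(1) by blast

lemma pt_sub: "pt x \<subseteq> E" unfolding pt_def E_def using gtree.tow_sub[OF gt] by auto

lemma eact_pt: "x \<in> threads \<Longrightarrow> g \<in> carrier G \<Longrightarrow> eact g ` pt x \<in> X"
  unfolding X_def using pt_act threads_act by blast

text \<open>The medians at the single levels form a thread, since contraction respects the direction
  of uncontracted arcs and a vertex is determined by the arcs towards it.\<close>

lemma maj_LS:
  assumes "x \<in> threads" "y \<in> threads" "z \<in> threads"
  shows "(pt x \<inter> pt y) \<union> (pt x \<inter> pt z) \<union> (pt y \<inter> pt z) \<in> X"
proof -
  have "\<exists>m. m \<in> V n \<and> tow (T n) m = (tow (T n) (x n) \<inter> tow (T n) (y n)) \<union> (tow (T n) (x n) \<inter> tow (T n) (z n)) \<union> (tow (T n) (y n) \<inter> tow (T n) (z n))" for n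
    using gtree.tow_maj[OF gt threads_D(1) threads_D(1) threads_D(1), OF assms] by blast
  then obtain m where m: "\<And>n. m n \<in> V n"
    "\<And>n. tow (T n) (m n) = (tow (T n) (x n) \<inter> tow (T n) (y n)) \<union> (tow (T n) (x n) \<inter> tow (T n) (z n)) \<union> (tow (T n) (y n) \<inter> tow (T n) (z n))" by metis
  have "f n (m (Suc n)) = m n" for n
  proof (rule gtree.tow_inj[OF gt f_V[OF m(1)] m(1)])
    have "a \<in> tow (T n) (f n (m (Suc n))) \<longleftrightarrow> a \<in> tow (T n) (m n)" if a: "a \<in> A n" for a
    proof -
      obtain e where e: "e \<in> A (Suc n) - C n" "a = fe n e" using cmD(7)[of n] a unfolding bij_betw_def by blast
      have "a \<in> tow (T n) (w n) \<longleftrightarrow> e \<in> tow (T (Suc n)) (w (Suc n))" if "w \<in> threads" for w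
        using tow_f[OF e(1) threads_D(1)[OF that]] threads_D(2)[OF that] e(2) by simp
      then show ?thesis using tow_f[OF e(1) m(1)] e(2) m(2) assms by simp
    qed
    then show "tow (T n) (f n (m (Suc n))) = tow (T n) (m n)" using gtree.tow_sub[OF gt] by blast
  qed
  then have "m \<in> threads" unfolding threads_def using m(1) by blast
  moreover have "pt m = (pt x \<inter> pt y) \<union> (pt x \<inter> pt z) \<union> (pt y \<inter> pt z)" unfolding pt_def using m(2) by auto
  ultimately show ?thesis unfolding X_def by (metis imageI)
qed

lemma threads_ne: "\<exists>x. x \<in> threads"
proof -
  have "V 0 \<noteq> {}" using tr[of 0] unfolding G_tree_def is_tree_def by blast
  then show ?thesis using vertex_LS by blast
qed

lemma pt_nq:
  assumes "x \<in> threads" "y \<in> threads" "\<And>a. a \<in> E \<Longrightarrow> fst a = n \<Longrightarrow> a \<in> pt x \<longleftrightarrow> a \<in> pt y"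
  shows "x n = y n"
proof (rule gtree.tow_inj[OF gt threads_D(1)[OF assms(1)] threads_D(1)[OF assms(2)]])
  have "e \<in> tow (T n) (x n) \<longleftrightarrow> e \<in> tow (T n) (y n)" if "e \<in> A n" for e
    using assms(3)[of "(n, e)"] that by (simp add: E_def mem_pt)
  then show "tow (T n) (x n) = tow (T n) (y n)" using gtree.tow_sub[OF gt] by blast
qed

lemma ptree: "protree G E fst eact ebr X tip"
proof unfold_locales
  show "eact g e \<in> E" if "g \<in> carrier G" "e \<in> E" for g e
    using that ae_cl unfolding E_def eact_def by auto
  show "eact \<one> e = e" if "e \<in> E" for e using that ae_one unfolding E_def eact_def by auto
  show "eact (g \<otimes> h) e = eact g (eact h e)" if "g \<in> carrier G" "h \<in> carrier G" "e \<in> E" for g h e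
    using that ae_mult unfolding E_def eact_def by auto
  show "ebr e \<in> E" "ebr (ebr e) = e" "ebr e \<noteq> e" "fst (ebr e) = fst e" if "e \<in> E" for e
    using that ar(3,4,5) unfolding E_def ebr_def by (auto simp: prod_eq_iff)
  show "eact g (ebr e) = ebr (eact g e)" "fst (eact g e) = fst e" "eact g e \<noteq> ebr e" if "g \<in> carrier G" "e \<in> E" for g e
    using that ae_ends unfolding E_def eact_def ebr_def by auto
  show "finite {g \<in> carrier G. eact g e = e}" if "e \<in> E" for e
  proof -
    obtain n a where e: "e = (n, a)" "a \<in> A n" using \<open>e \<in> E\<close> unfolding E_def by blast
    have "{g \<in> carrier G. eact g e = e} = stabilizer G (ae n) a" unfolding stabilizer_def eact_def e by auto
    then show ?thesis using fs[OF e(2)] by simp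
  qed
  show "\<exists>F. finite F \<and> F \<subseteq> E \<and> (\<forall>e \<in> E. fst e = n \<longrightarrow> (\<exists>g \<in> carrier G. \<exists>f \<in> F. e = eact g f))" for n
  proof -
    define F where "F = (\<lambda>q. (n, SOME a. a \<in> q)) ` orbits G (A n) (ae n)"
    have q: "(SOME a. a \<in> q) \<in> q" if q: "q \<in> orbits G (A n) (ae n)" for q
    proof -
      obtain b where b: "b \<in> A n" "q = orbit G (ae n) b" using q unfolding orbits_def by blast
      have "b \<in> q" unfolding b(2) orbit_def using ae_one[OF b(1)] by force
      then show ?thesis by (rule someI)
    qed
    have sub: "q \<subseteq> A n" if "q \<in> orbits G (A n) (ae n)" for q using that ae_cl unfolding orbits_def orbit_def by blast
    have "\<exists>g \<in> carrier G. \<exists>f \<in> F. e = eact g f" if e: "e \<in> E" "fst e = n" for e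
    proof -
      obtain a where a: "e = (n, a)" "a \<in> A n" using e unfolding E_def by auto
      define q where "q = orbit G (ae n) a"
      have qo: "q \<in> orbits G (A n) (ae n)" unfolding q_def orbits_def using a by blast
      obtain g where g: "g \<in> carrier G" "(SOME a. a \<in> q) = ae n g a" using q[OF qo] unfolding q_def orbit_def by blast
      then have "e = eact (inv g) (n, SOME a. a \<in> q)" unfolding eact_def a using ae_mult[of "inv g" g a] ae_one a by simp
      then show ?thesis unfolding F_def using g(1) qo by blast
    qed
    moreover have "finite F" unfolding F_def using fo by blast
    moreover have "F \<subseteq> E" unfolding F_def E_def using q sub by blast
    ultimately show ?thesis by blast
  qed
  show "X \<noteq> {}" unfolding X_def using threads_ne by blast
  show "x \<subseteq> E" if "x \<in> X" for x using that pt_sub unfolding X_def by blast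
  show "ebr e \<in> x \<longleftrightarrow> e \<notin> x" if "x \<in> X" "e \<in> E" for x e
    using that towb unfolding X_def E_def ebr_def by (auto simp: mem_pt)
  show "eact g ` x \<in> X" if "g \<in> carrier G" "x \<in> X" for g x using that eact_pt unfolding X_def by blast
  show "finite {e \<in> y - x. fst e = n}" if "x \<in> X" "y \<in> X" for x y n
  proof -
    obtain u v where uv: "u \<in> threads" "v \<in> threads" "x = pt u" "y = pt v" using \<open>x \<in> X\<close> \<open>y \<in> X\<close> unfolding X_def by blast
    have "{e \<in> y - x. fst e = n} \<subseteq> Pair n ` (tow (T n) (v n) - tow (T n) (u n))" unfolding uv pt_def by auto
    moreover have "finite (tow (T n) (v n) - tow (T n) (u n))" using gtree.tow_diff_finite[OF gt] threads_D(1) uv by blast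
    ultimately show ?thesis using finite_subset by blast
  qed
  show "x \<inter> y \<union> x \<inter> z \<union> y \<inter> z \<in> X" if "x \<in> X" "y \<in> X" "z \<in> X" for x y z
    using that maj_LS unfolding X_def by blast
  show False if "e \<in> E" "f \<in> E" "fst e = fst f" "a \<in> X" "b \<in> X" "c \<in> X" "d \<in> X"
    "e \<notin> a" "f \<notin> a" "e \<in> b" "f \<notin> b" "e \<notin> c" "f \<in> c" "e \<in> d" "f \<in> d" for e f a b c d
  proof -
    note h = that
    obtain n e' f' where e: "e = (n, e')" "f = (n, f')" "e' \<in> A n" "f' \<in> A n" using h(1-3) unfolding E_def by auto
    obtain a' b' c' d' where a: "a = pt a'" "b = pt b'" "c = pt c'" "d = pt d'" "a' \<in> threads" "b' \<in> threads" "c' \<in> threads" "d' \<in> threads"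
      using h(4-7) unfolding X_def by blast
    show False by (rule gtree.tow_nested[OF gt e(3,4) threads_D(1)[OF a(5)] threads_D(1)[OF a(8)], of "b' n" "c' n"])
      (use h(8-15) a threads_D(1) in \<open>auto simp: e mem_pt\<close>)
  qed
  show "tip e \<in> X" if "e \<in> E" for e using tip_pt[OF that] unfolding tip_def X_def by blast
  show "e \<in> tip e" if "e \<in> E" for e
  proof -
    obtain n a where e: "e = (n, a)" "a \<in> A n" using \<open>e \<in> E\<close> unfolding E_def by blast
    show ?thesis using tip_mem[of n a a] \<open>e \<in> E\<close> gtree.tow_tgt[OF gt e(2)] e by simp
  qed
  show "tip (eact g e) = eact g ` tip e" if "g \<in> carrier G" "e \<in> E" for g e
  proof -
    obtain n a where e: "e = (n, a)" "a \<in> A n" using \<open>e \<in> E\<close> unfolding E_def by blast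
    have ge: "eact g e = (n, ae n g a)" unfolding e eact_def by simp
    have "tip (eact g e) = pt (\<lambda>m. av m g (ts n a m))"
      unfolding tip_def ge fst_conv snd_conv ts_act[OF e(2) \<open>g \<in> carrier G\<close>] by (rule refl)
    moreover have "tip e = pt (ts n a)" unfolding tip_def e fst_conv snd_conv by (rule refl)
    ultimately show ?thesis using pt_act[OF ts(1)[OF e(2)] \<open>g \<in> carrier G\<close>] by simp
  qed
  show "f = e" if "e \<in> E" "f \<in> tip e" "f \<notin> tip (ebr e)" "fst f = fst e" for e f
  proof -
    obtain n a where e0: "e = (n, a)" "a \<in> A n" using \<open>e \<in> E\<close> unfolding E_def by blast
    define b where "b = snd f"
    have "f = (n, b)" using \<open>fst f = fst e\<close> e0 b_def by (simp add: prod_eq_iff)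
    note e = e0 this
    have "b \<in> tow (T n) (gtgt (T n) a)" "b \<notin> tow (T n) (gsrc (T n) a)" using tip_mem[of n a b] tip_mem_br[of n a b] that e by auto
    then show ?thesis using gtree.tow_tgt_eq[OF gt e(2)] e by blast
  qed
  show "f \<in> x \<longleftrightarrow> e \<in> x" if "e \<in> E" "f \<in> tip e" "f \<notin> tip (ebr e)" "x \<in> X" for e f x
  proof -
    obtain n a where e0: "e = (n, a)" "a \<in> A n" using \<open>e \<in> E\<close> unfolding E_def by blast
    obtain m b where "f = (m, b)" by (cases f) (rule that)
    note e = e0 this
    obtain y where y: "y \<in> threads" "x = pt y" using \<open>x \<in> X\<close> unfolding X_def by blast
    have "f \<in> pt (ts n a)" "f \<notin> pt (ts n (gbar (T n) a))"
      using \<open>f \<in> tip e\<close> \<open>f \<notin> tip (ebr e)\<close> unfolding tip_def ebr_def e(1) by simp_all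
    then show ?thesis using half[OF e(2) _ _ y(1), of b m] unfolding e y by (simp add: mem_pt)
  qed
  show "\<exists>e' \<in> E. fst e' = Suc (fst e) \<and> (\<forall>x \<in> X. e \<in> x \<longleftrightarrow> e' \<in> x)" if "e \<in> E" for e
  proof -
    obtain n a where e: "e = (n, a)" "a \<in> A n" using \<open>e \<in> E\<close> unfolding E_def by blast
    have "(Suc n, lifts n a 1) \<in> E" using lifts(1)[OF e(2), of 1] unfolding E_def by simp
    moreover have "\<forall>x \<in> X. e \<in> x \<longleftrightarrow> (Suc n, lifts n a 1) \<in> x" using lifts_half[OF e(2), of _ 1] unfolding X_def e by (auto simp: mem_pt)
    ultimately show ?thesis unfolding e(1) by (intro bexI[of _ "(Suc n, lifts n a 1)"]) auto
  qed
  show "\<exists>g \<in> carrier G. \<forall>f \<in> E. fst f = fst e \<longrightarrow> (f \<in> eact g ` tip e \<longleftrightarrow> f \<in> tip (ebr e))"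
    if "e \<in> E" and fx: "\<forall>g \<in> carrier G. (\<forall>f \<in> E. fst f = fst e \<longrightarrow> (f \<in> eact g ` tip e \<longleftrightarrow> f \<in> tip e)) \<longrightarrow> eact g e = e" for e
  proof -
    obtain n a where e: "e = (n, a)" "a \<in> A n" using \<open>e \<in> E\<close> unfolding E_def by blast
    note b = ar(3)[OF e(2)]
    define v where "v = gtgt (T n) a"
    have vV: "v \<in> V n" using ar(2)[OF e(2)] v_def by simp
    have tg: "(n, f') \<in> eact g ` tip e \<longleftrightarrow> f' \<in> tow (T n) (av n g v)" if "g \<in> carrier G" for g f'
      using pt_act[OF ts(1)[OF e(2)] that] ts(2)[OF e(2), of 0] unfolding tip_def e v_def by (simp add: mem_pt)
    have t0: "(n, f') \<in> tip e \<longleftrightarrow> f' \<in> tow (T n) v" for f' using tip_mem[of n a f'] \<open>e \<in> E\<close> e v_def by simp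
    \<comment> \<open>Compressibility refers to the source of an arc, whereas \<open>tip\<close>
      follows the head; so the reversed arc is used, whose source is \<open>v\<close>.\<close>
    have "stabilizer G (ae n) (gbar (T n) a) = stabilizer G (av n) v"
    proof (intro equalityI subsetI)
      fix g assume "g \<in> stabilizer G (ae n) (gbar (T n) a)"
      then have g: "g \<in> carrier G" "ae n g (gbar (T n) a) = gbar (T n) a" unfolding stabilizer_def by auto
      have "av n g v = v" using ae_ends(1)[OF g(1) b] g(2) ar(6)[OF e(2)] v_def by simp
      then show "g \<in> stabilizer G (av n) v" unfolding stabilizer_def using g by simp
    next
      fix g assume "g \<in> stabilizer G (av n) v"
      then have g: "g \<in> carrier G" "av n g v = v" unfolding stabilizer_def by auto
      have "eact g e = e" using fx g tg[OF g(1)] t0 e by (auto simp: E_def)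
      then have "ae n g a = a" unfolding e eact_def by simp
      then show "g \<in> stabilizer G (ae n) (gbar (T n) a)" unfolding stabilizer_def using g ae_ends(3)[OF g(1) e(2)] by simp
    qed
    moreover have "\<not> compressible G (T n) (av n) (ae n) (gbar (T n) a)" using rt[of n] b unfolding reduced_tree_def by blast
    ultimately have "orbit G (av n) v = orbit G (av n) (gsrc (T n) a)"
      unfolding compressible_def using ar(6,7)[OF e(2)] v_def by simp
    moreover have "gsrc (T n) a \<in> orbit G (av n) (gsrc (T n) a)" by (rule group_action.orbit_refl[OF aV ar(1)[OF e(2)]])
    ultimately have "gsrc (T n) a \<in> orbit G (av n) v" by simp
    then have "\<exists>g. gsrc (T n) a = av n g v \<and> g \<in> carrier G" unfolding orbit_def by (rule CollectD)
    then obtain g where g: "g \<in> carrier G" "av n g v = gsrc (T n) a" by metis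
    have "(n, f') \<in> eact g ` tip e \<longleftrightarrow> (n, f') \<in> tip (ebr e)" for f'
      using tg[OF g(1)] tip_mem_br[of n a f'] \<open>e \<in> E\<close> e g(2) by simp
    then show ?thesis unfolding e by (intro bexI[OF _ g(1)] ballI impI) (simp add: prod_eq_iff split_paired_all)
  qed
qed

text \<open>One thread through each orbit of vertices gives points of \<open>X\<close> that are
  inequivalent at level \<open>n\<close>. For infinitely many orbits \<open>card\<close> is
  0.\<close>

lemma no_bound:
  assumes B: "\<And>n Y. finite Y \<Longrightarrow> Y \<subseteq> X \<Longrightarrow> (\<forall>x \<in> Y. \<forall>y \<in> Y. \<forall>g \<in> carrier G. x \<noteq> y \<longrightarrow> \<not> protree.lev_eq E fst n (protree.pact eact g x) y) \<Longrightarrow> card Y \<le> B"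
  shows "card (orbits G (V n) (av n)) \<le> B"
proof (cases "finite (orbits G (V n) (av n))")
  case True
  interpret p: protree G E fst eact ebr X tip by (rule ptree)
  have "\<exists>x. x \<in> threads \<and> q = orbit G (av n) (x n)" if "q \<in> orbits G (V n) (av n)" for q
    using that vertex_LS[of _ n] unfolding orbits_def by blast
  then obtain x where x: "\<And>q. q \<in> orbits G (V n) (av n) \<Longrightarrow> x q \<in> threads \<and> q = orbit G (av n) (x q n)" by metis
  define Y where "Y = (\<lambda>q. pt (x q)) ` orbits G (V n) (av n)"
  have key: "q = r" if q: "q \<in> orbits G (V n) (av n)" "r \<in> orbits G (V n) (av n)" and g: "g \<in> carrier G" and lev_eq: "p.lev_eq n (p.pact g (pt (x q))) (pt (x r))" for q r g
  proof -
    have L: "x q \<in> threads" "x r \<in> threads" using x q by blast+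
    have "av n g (x q n) = x r n"
      by (rule pt_nq[OF threads_act[OF L(1) g] L(2)]) (use lev_eq pt_act[OF L(1) g] in \<open>auto simp: p.lev_eq_def p.pact_def\<close>)
    then have "orbit G (av n) (x r n) = orbit G (av n) (x q n)"
    proof -
      have v: "x q n \<in> V n" using L threads_D(1) by blast
      have v': "x r n \<in> V n" using L threads_D(1) by blast
      have 1: "x r n \<in> orbit G (av n) (x q n)" unfolding orbit_def using g \<open>av n g (x q n) = x r n\<close> by (intro CollectI exI[of _ g]) simp
      have 2: "x q n \<in> orbit G (av n) (x r n)" by (rule group_action.orbit_sym[OF aV v v' 1])
      have sb: "orbit G (av n) u \<subseteq> V n" if "u \<in> V n" for u using that av_cl unfolding orbit_def by blast
      show ?thesis
      proof (intro equalityI subsetI)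
        fix u assume u: "u \<in> orbit G (av n) (x r n)"
        then have "u \<in> V n" using sb[OF v'] by blast
        then show "u \<in> orbit G (av n) (x q n)" by (rule group_action.orbit_trans[OF aV v v' _ 1 u])
      next
        fix u assume u: "u \<in> orbit G (av n) (x q n)"
        then have "u \<in> V n" using sb[OF v] by blast
        then show "u \<in> orbit G (av n) (x r n)" by (rule group_action.orbit_trans[OF aV v' v _ 2 u])
      qed
    qed
    then show ?thesis using x q by metis
  qed
  have "inj_on (\<lambda>q. pt (x q)) (orbits G (V n) (av n))"
  proof (rule inj_onI)
    fix q r assume a: "q \<in> orbits G (V n) (av n)" "r \<in> orbits G (V n) (av n)" "pt (x q) = pt (x r)"
    have "pt (x q) \<in> X" using x a unfolding X_def by blast
    then have "p.lev_eq n (p.pact \<one> (pt (x q))) (pt (x r))" using p.pact_one p.lev_eq_refl a(3) by simp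
    then show "q = r" using key[OF a(1,2) one_closed] by blast
  qed
  then have "card (orbits G (V n) (av n)) = card Y" unfolding Y_def by (simp add: card_image)
  also have "\<dots> \<le> B"
  proof (rule B)
    show "finite Y" unfolding Y_def using True by simp
    show "Y \<subseteq> X" unfolding Y_def X_def using x by blast
    show "\<forall>y \<in> Y. \<forall>z \<in> Y. \<forall>g \<in> carrier G. y \<noteq> z \<longrightarrow> \<not> p.lev_eq n (p.pact g y) z" unfolding Y_def using key by blast
  qed
  finally show ?thesis .
qed simp

end

section \<open>From chains of finite subgroups to the theorem\<close>

lemma chain_union:
  assumes "group G" and H: "\<And>i::nat. subgroup (H i) G \<and> finite (H i) \<and> H i \<subset> H (Suc i)"
  shows "locally_finite_subgroup (\<Union>i. H i) G \<and> infinite (\<Union>i. H i)"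
proof -
  interpret group G by fact
  have mono: "H i \<subseteq> H j" if "i \<le> j" for i j using lift_Suc_mono_le[of H i j] H that by blast
  have card: "i \<le> card (H i)" for i
  proof (induction i)
    case (Suc i)
    have "card (H i) < card (H (Suc i))" by (rule psubset_card_mono) (use H in blast)+
    then show ?case using Suc by simp
  qed simp
  have sub: "\<exists>i. S \<subseteq> H i" if "finite S" "S \<subseteq> (\<Union>i. H i)" for S
    using that
  proof (induction rule: finite_induct)
    case (insert s S)
    then obtain i j where "S \<subseteq> H i" "s \<in> H j" by auto
    then have "insert s S \<subseteq> H (max i j)" using mono[of i "max i j"] mono[of j "max i j"] by auto
    then show ?case by blast
  qed simp
  have "infinite (\<Union>i. H i)"
  proof
    assume f: "finite (\<Union>i. H i)"
    then have "card (H (Suc (card (\<Union>i. H i)))) \<le> card (\<Union>i. H i)" by (intro card_mono) auto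
    then show False using card[of "Suc (card (\<Union>i. H i))"] by simp
  qed
  moreover have "subgroup (\<Union>i. H i) G"
  proof (rule subgroupI)
    show "(\<Union>i. H i) \<subseteq> carrier G" using H subgroup.subset by blast
    show "(\<Union>i. H i) \<noteq> {}" using H subgroup.one_closed by blast
    show "inv\<^bsub>G\<^esub> a \<in> (\<Union>i. H i)" if a: "a \<in> (\<Union>i. H i)" for a
    proof -
      obtain i where "a \<in> H i" using a by blast
      then have "inv\<^bsub>G\<^esub> a \<in> H i" using subgroup.m_inv_closed[of "H i" G] H[of i] by simp
      then show ?thesis by blast
    qed
    show "a \<otimes>\<^bsub>G\<^esub> b \<in> (\<Union>i. H i)" if a: "a \<in> (\<Union>i. H i)" "b \<in> (\<Union>i. H i)" for a b
    proof -
      obtain i where "{a, b} \<subseteq> H i" using sub[of "{a, b}"] a by auto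
      then have "a \<otimes>\<^bsub>G\<^esub> b \<in> H i" using subgroup.m_closed[of "H i" G] H[of i] by simp
      then show ?thesis by blast
    qed
  qed
  moreover have "finite (generate G S)" if S: "finite S" "S \<subseteq> (\<Union>i. H i)" for S
  proof -
    obtain i where i: "S \<subseteq> H i" using sub[OF S] by blast
    then have "generate G S \<subseteq> H i" using generate_subgroup_incl H by blast
    then show ?thesis using H finite_subset by blast
  qed
  ultimately show ?thesis unfolding locally_finite_subgroup_def by blast
qed

theorem theorem3p5:
  fixes G :: "('g, 'm) monoid_scheme"
    and T :: "nat \<Rightarrow> ('v, 'e) sgraph"
    and av :: "nat \<Rightarrow> 'g \<Rightarrow> 'v \<Rightarrow> 'v"
    and ae :: "nat \<Rightarrow> 'g \<Rightarrow> 'e \<Rightarrow> 'e"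
  assumes "group G"
    and "finitely_generated_group G"
    and "inaccessible_sequence G T av ae"
  shows "\<exists>H. locally_finite_subgroup H G \<and> infinite H"
proof (rule ccontr)
  assume no: "\<not> ?thesis"
  interpret group G by fact
  \<comment> \<open>The union of a strictly increasing chain of finite subgroups would be an
    infinite locally finite subgroup.\<close>
  have ch: "\<nexists>H. \<forall>i::nat. subgroup (H i) G \<and> finite (H i) \<and> H i \<subset> H (Suc i)"
    using chain_union[OF assms(1)] no by blast
  obtain S where S: "finite S" "S \<subseteq> carrier G" "generate G S = carrier G" using assms(2) unfolding finitely_generated_group_def by blast
  note ia = assms(3)[unfolded inaccessible_sequence_def]
  have "\<forall>n. \<exists>z. case z of (f, fe, C) \<Rightarrow> contraction_map G (T (Suc n)) (av (Suc n)) (ae (Suc n)) (T n) (av n) (ae n) f fe C"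
    using ia by simp
  then obtain z where z: "\<And>n. case z n of (f, fe, C) \<Rightarrow> contraction_map G (T (Suc n)) (av (Suc n)) (ae (Suc n)) (T n) (av n) (ae n) f fe C" by metis
  interpret t: tseq G T av ae "\<lambda>n. fst (z n)" "\<lambda>n. fst (snd (z n))" "\<lambda>n. snd (snd (z n))"
    by unfold_locales (use ia z in \<open>auto simp: case_prod_unfold\<close>)
  interpret p: protree G t.E fst t.eact t.ebr t.X t.tip by (rule t.ptree)
  obtain B where B: "\<forall>n Y. finite Y \<longrightarrow> Y \<subseteq> t.X \<longrightarrow>
    (\<forall>x \<in> Y. \<forall>y \<in> Y. \<forall>g \<in> carrier G. x \<noteq> y \<longrightarrow> \<not> p.lev_eq n (p.pact g x) y) \<longrightarrow> card Y \<le> B"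
    using p.bounded_orbits[OF S ch] by blast
  have "card (orbits G (gverts (T n)) (av n)) \<le> B" for n by (rule t.no_bound) (use B in blast)
  moreover have "filterlim (\<lambda>n. card (orbits G (gverts (T n)) (av n))) at_top sequentially" using ia by blast
  then have "\<forall>\<^sub>F n in sequentially. Suc B \<le> card (orbits G (gverts (T n)) (av n))" unfolding filterlim_at_top by blast
  then obtain n where "Suc B \<le> card (orbits G (gverts (T n)) (av n))" unfolding eventually_sequentially by blast
  ultimately show False by (metis Suc_n_not_le_n le_trans)
qed

end
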